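(* Let $(M,h)$ be a compact Hermitian manifold of complex dimension $m$ with fundamental form $\omega_h$ satisfying $\partial\bar\partial\omega_h^{m-2}=0$, and let $(N,g)$ be a Riemannian manifold. Let $f:(M,h)\to(N,g)$ be a Hermitian harmonic map. If $(N,g)$ has strongly Hermitian-negative curvature, then $\operatorname{rank}_{\mathbb R}df\le 2$ (at every point of $M$). In particular, if $\dim_{\mathbb C}M>1$, there is no Hermitian harmonic immersion of $M$ into a Riemannian manifold of constant negative curvature.
   Context: Manifolds are connected and maps are smooth. For a Hermitian metric $h=(h_{\alpha\bar\beta})$ in local holomorphic coordinates $z^\alpha$ on $M$, the fundamental form is $\omega_h=\frac{\sqrt{-1}}{2}h_{\alpha\bar\beta}\,dz^\alpha\wedge d\bar z^\beta$. For $m=1$ the condition $\partial\bar\partial\omega_h^{m-2}=0$ is regarded as void. A smooth map $f:(M,h)\to(N,g)$ from a Hermitian manifold to a Riemannian manifold is Hermitian harmonic if, in local holomorphic coordinates $z^\alpha$ on $M$ and local coordinates on $N$, for every $i$, $$h^{\alpha\bar\beta}\left(\frac{\partial^2 f^i}{\partial z^\alpha\partial\bar z^\beta}+\Gamma^i_{jk}(f)\frac{\partial f^j}{\partial\bar z^\beta}\frac{\partial f^k}{\partial z^\alpha}\right)=0,$$ where $\Gamma^i_{jk}$ are the Christoffel symbols of the Levi-Civita connection of $g$. Curvature convention: $R(X,Y,Z,W)=g(\nabla_X\nabla_YZ-\nabla_Y\nabla_XZ-\nabla_{[X,Y]}Z,W)$ with components $R_{ijk\ell}$ (so constant sectional curvature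 $\kappa$ means $R_{ijk\ell}=\kappa(g_{i\ell}g_{jk}-g_{ik}g_{j\ell})$). The curvature of $(N,g)$ is strongly Hermitian-negative if at every point $R_{ijk\ell}A^{i\bar\ell}A^{j\bar k}\le 0$ for every Hermitian positive semi-definite complex matrix $A=(A^{i\bar\ell})$, with equality only if $A$ has complex rank $\le 1$. *)

theory Defs
  imports "HOL-Analysis.Analysis"
begin

section \<open>Smooth and holomorphic maps between open subsets of vector spaces\<close>

primrec continuously_differentiable_on ::
  "nat \<Rightarrow> 'a::real_normed_vector set \<Rightarrow> ('a \<Rightarrow> 'b::real_normed_vector) \<Rightarrow> bool" where
  "continuously_differentiable_on 0 S u \<longleftrightarrow> continuous_on S u"
| "continuously_differentiable_on (Suc k) S u \<longleftrightarrow>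
     (\<forall>x\<in>S. u differentiable (at x)) \<and>
     (\<forall>v. continuously_differentiable_on k S (\<lambda>x. frechet_derivative u (at x) v))"

definition smooth_on :: "'a::real_normed_vector set \<Rightarrow> ('a \<Rightarrow> 'b::real_normed_vector) \<Rightarrow> bool" where
  "smooth_on S u \<longleftrightarrow> (\<forall>k. continuously_differentiable_on k S u)"

definition holomorphic_map_on :: "(complex^'m) set \<Rightarrow> (complex^'m \<Rightarrow> complex^'k) \<Rightarrow> bool" where
  "holomorphic_map_on S F \<longleftrightarrow>
     (\<forall>x\<in>S. \<exists>D. (F has_derivative D) (at x) \<and> (\<forall>c v. D (c *s v) = c *s D v))"

definition partial_deriv :: "'n \<Rightarrow> (real^'n \<Rightarrow> real) \<Rightarrow> real^'n \<Rightarrow> real" where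
  "partial_deriv i u y = frechet_derivative u (at y) (axis i 1)"

text \<open>The Wirtinger derivatives; \<open>axis \<alpha> 1\<close> and \<open>axis \<alpha> \<i>\<close> are the real coordinate directions
  of \<open>Re z\<^sup>\<alpha>\<close> and \<open>Im z\<^sup>\<alpha>\<close>.\<close>

definition d_dz :: "'m::finite \<Rightarrow> (complex^'m \<Rightarrow> complex) \<Rightarrow> complex^'m \<Rightarrow> complex" where
  "d_dz \<alpha> u x =
     (frechet_derivative u (at x) (axis \<alpha> 1) - \<i> * frechet_derivative u (at x) (axis \<alpha> \<i>)) / 2"

definition d_dzbar :: "'m::finite \<Rightarrow> (complex^'m \<Rightarrow> complex) \<Rightarrow> complex^'m \<Rightarrow> complex" where
  "d_dzbar \<alpha> u x =
     (frechet_derivative u (at x) (axis \<alpha> 1) + \<i> * frechet_derivative u (at x) (axis \<alpha> \<i>)) / 2"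


section \<open>Manifolds\<close>

text \<open>A chart is a pair of its domain and its coordinate map; values of the coordinate map
  outside the domain are irrelevant.\<close>

type_synonym ('a, 'e) chart = "'a set \<times> ('a \<Rightarrow> 'e)"

definition chart_image :: "('a, 'e) chart \<Rightarrow> 'e set" where
  "chart_image c = snd c ` fst c"

definition chart_inv :: "('a, 'e) chart \<Rightarrow> 'e \<Rightarrow> 'a" where
  "chart_inv c = inv_into (fst c) (snd c)"

definition transition :: "('a, 'e) chart \<Rightarrow> ('a, 'e) chart \<Rightarrow> 'e \<Rightarrow> 'e" where
  "transition c c' = snd c' \<circ> chart_inv c"

definition topological_manifold :: "'a topology \<Rightarrow> ('a, 'e::euclidean_space) chart set \<Rightarrow> bool" where
  "topological_manifold X A \<longleftrightarrow>
     topspace X \<noteq> {} \<and> connected_space X \<and> Hausdorff_space X \<and> second_countable X \<and>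
     topspace X = (\<Union>c\<in>A. fst c) \<and>
     (\<forall>c\<in>A. openin X (fst c) \<and> open (chart_image c) \<and>
        homeomorphic_map (subtopology X (fst c)) (top_of_set (chart_image c)) (snd c))"

definition smooth_manifold :: "'a topology \<Rightarrow> ('a, real^'n) chart set \<Rightarrow> bool" where
  "smooth_manifold X A \<longleftrightarrow> topological_manifold X A \<and>
     (\<forall>c\<in>A. \<forall>c'\<in>A. smooth_on (snd c ` (fst c \<inter> fst c')) (transition c c'))"

definition complex_manifold :: "'a topology \<Rightarrow> ('a, complex^'m) chart set \<Rightarrow> bool" where
  "complex_manifold X A \<longleftrightarrow> topological_manifold X A \<and>
     (\<forall>c\<in>A. \<forall>c'\<in>A. holomorphic_map_on (snd c ` (fst c \<inter> fst c')) (transition c c'))"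

definition local_rep :: "('a, 'd) chart \<Rightarrow> ('b, 'e) chart \<Rightarrow> ('a \<Rightarrow> 'b) \<Rightarrow> 'd \<Rightarrow> 'e" where
  "local_rep c d f = snd d \<circ> f \<circ> chart_inv c"

definition local_dom :: "('a, 'd) chart \<Rightarrow> ('b, 'e) chart \<Rightarrow> ('a \<Rightarrow> 'b) \<Rightarrow> 'd set" where
  "local_dom c d f = snd c ` {p \<in> fst c. f p \<in> fst d}"

definition smooth_map ::
  "'a topology \<Rightarrow> ('a, 'd::euclidean_space) chart set \<Rightarrow>
   'b topology \<Rightarrow> ('b, 'e::euclidean_space) chart set \<Rightarrow> ('a \<Rightarrow> 'b) \<Rightarrow> bool" where
  "smooth_map X A Y B f \<longleftrightarrow> continuous_map X Y f \<and>
     (\<forall>c\<in>A. \<forall>d\<in>B. smooth_on (local_dom c d f) (local_rep c d f))"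

text \<open>The differential of \<open>f\<close> in the charts \<open>c\<close>, \<open>d\<close> around \<open>p\<close> and \<open>f p\<close>.\<close>

definition differential ::
  "('a, 'd::euclidean_space) chart \<Rightarrow> ('b, 'e::euclidean_space) chart \<Rightarrow> ('a \<Rightarrow> 'b) \<Rightarrow> 'a \<Rightarrow> 'd \<Rightarrow> 'e" where
  "differential c d f p = frechet_derivative (local_rep c d f) (at (snd c p))"

definition real_rank ::
  "('a, 'd::euclidean_space) chart \<Rightarrow> ('b, 'e::euclidean_space) chart \<Rightarrow> ('a \<Rightarrow> 'b) \<Rightarrow> 'a \<Rightarrow> nat" where
  "real_rank c d f p = dim (range (differential c d f p))"

definition immersion ::
  "'a topology \<Rightarrow> ('a, 'd::euclidean_space) chart set \<Rightarrow>
   'b topology \<Rightarrow> ('b, 'e::euclidean_space) chart set \<Rightarrow> ('a \<Rightarrow> 'b) \<Rightarrow> bool" where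
  "immersion X A Y B f \<longleftrightarrow> smooth_map X A Y B f \<and>
     (\<forall>c\<in>A. \<forall>d\<in>B. \<forall>p\<in>fst c. f p \<in> fst d \<longrightarrow> inj (differential c d f p))"


section \<open>Metrics\<close>

text \<open>A metric is given by its component matrix in each chart of the atlas, as a function of the
  coordinates, subject to the tensorial transformation law. For a Hermitian metric the entry
  \<open>h c x $ \<alpha> $ \<beta>\<close> is the component with unbarred index \<open>\<alpha>\<close> and barred index \<open>\<beta>\<close>.\<close>

type_synonym ('a, 'm) hermitian_components =
  "('a, complex^'m) chart \<Rightarrow> complex^'m \<Rightarrow> complex^'m^'m"

type_synonym ('a, 'n) riemannian_components =
  "('a, real^'n) chart \<Rightarrow> real^'n \<Rightarrow> real^'n^'n"

definition hermitian_matrix :: "complex^'m^'m \<Rightarrow> bool" where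
  "hermitian_matrix H \<longleftrightarrow> (\<forall>\<alpha> \<beta>. H $ \<beta> $ \<alpha> = cnj (H $ \<alpha> $ \<beta>))"

definition hermitian_form :: "complex^'m^'m \<Rightarrow> complex^'m \<Rightarrow> complex" where
  "hermitian_form H v = (\<Sum>\<alpha>\<in>UNIV. \<Sum>\<beta>\<in>UNIV. H $ \<alpha> $ \<beta> * v $ \<alpha> * cnj (v $ \<beta>))"

definition hermitian_positive_definite :: "complex^'m^'m \<Rightarrow> bool" where
  "hermitian_positive_definite H \<longleftrightarrow> hermitian_matrix H \<and> (\<forall>v. v \<noteq> 0 \<longrightarrow> Re (hermitian_form H v) > 0)"

definition hermitian_positive_semidefinite :: "complex^'m^'m \<Rightarrow> bool" where
  "hermitian_positive_semidefinite H \<longleftrightarrow> hermitian_matrix H \<and> (\<forall>v. Re (hermitian_form H v) \<ge> 0)"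

definition hermitian_metric ::
  "('a, complex^'m) chart set \<Rightarrow> ('a, 'm) hermitian_components \<Rightarrow> bool" where
  "hermitian_metric A h \<longleftrightarrow>
     (\<forall>c\<in>A. smooth_on (chart_image c) (h c) \<and>
        (\<forall>x\<in>chart_image c. hermitian_positive_definite (h c x))) \<and>
     (\<forall>c\<in>A. \<forall>c'\<in>A. \<forall>p\<in>fst c \<inter> fst c'. \<forall>\<alpha> \<beta>.
        h c (snd c p) $ \<alpha> $ \<beta> =
          (\<Sum>\<gamma>\<in>UNIV. \<Sum>\<delta>\<in>UNIV. h c' (snd c' p) $ \<gamma> $ \<delta>
             * d_dz \<alpha> (\<lambda>x. transition c c' x $ \<gamma>) (snd c p)
             * cnj (d_dz \<beta> (\<lambda>x. transition c c' x $ \<delta>) (snd c p))))"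

definition riemannian_metric ::
  "('a, real^'n) chart set \<Rightarrow> ('a, 'n) riemannian_components \<Rightarrow> bool" where
  "riemannian_metric A g \<longleftrightarrow>
     (\<forall>c\<in>A. smooth_on (chart_image c) (g c) \<and>
        (\<forall>y\<in>chart_image c. transpose (g c y) = g c y \<and> (\<forall>v. v \<noteq> 0 \<longrightarrow> v \<bullet> (g c y *v v) > 0))) \<and>
     (\<forall>c\<in>A. \<forall>c'\<in>A. \<forall>p\<in>fst c \<inter> fst c'. \<forall>i j.
        g c (snd c p) $ i $ j =
          (\<Sum>k\<in>UNIV. \<Sum>l\<in>UNIV. g c' (snd c' p) $ k $ l
             * partial_deriv i (\<lambda>y. transition c c' y $ k) (snd c p)
             * partial_deriv j (\<lambda>y. transition c c' y $ l) (snd c p)))"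

definition hermitian_manifold ::
  "'a topology \<Rightarrow> ('a, complex^'m) chart set \<Rightarrow> ('a, 'm) hermitian_components \<Rightarrow> bool" where
  "hermitian_manifold X A h \<longleftrightarrow> complex_manifold X A \<and> hermitian_metric A h"

definition riemannian_manifold ::
  "'a topology \<Rightarrow> ('a, real^'n) chart set \<Rightarrow> ('a, 'n) riemannian_components \<Rightarrow> bool" where
  "riemannian_manifold X A g \<longleftrightarrow> smooth_manifold X A \<and> riemannian_metric A g"


section \<open>Complex differential forms in coordinates\<close>

text \<open>A complex-valued \<open>k\<close>-form on an open subset of \<open>complex^'m\<close> is evaluated at a point on a list
  of \<open>k\<close> real tangent vectors; values on lists of other lengths are irrelevant.\<close>

type_synonym 'm form = "complex^'m \<Rightarrow> (complex^'m) list \<Rightarrow> complex"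

definition wedge :: "nat \<Rightarrow> nat \<Rightarrow> 'm form \<Rightarrow> 'm form \<Rightarrow> 'm form" where
  "wedge k l a b x vs =
     (\<Sum>\<sigma> | \<sigma> permutes {..<k + l}. of_int (sign \<sigma>)
        * a x (take k (permute_list \<sigma> vs)) * b x (drop k (permute_list \<sigma> vs)))
     / (fact k * fact l)"

primrec wedge_power :: "'m form \<Rightarrow> nat \<Rightarrow> 'm form" where  \<comment> \<open>powers of a 2-form\<close>
  "wedge_power a 0 = (\<lambda>x vs. 1)"
| "wedge_power a (Suc r) = wedge 2 (2 * r) a (wedge_power a r)"

definition dz :: "'m::finite \<Rightarrow> 'm form" where
  "dz \<alpha> x vs = hd vs $ \<alpha>"

definition dzbar :: "'m::finite \<Rightarrow> 'm form" where
  "dzbar \<alpha> x vs = cnj (hd vs $ \<alpha>)"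

text \<open>The Dolbeault operators on \<open>k\<close>-forms: \<open>\<partial>a = \<Sum> dz\<^sup>\<alpha> \<and> \<partial>a/\<partial>z\<^sup>\<alpha>\<close> and its conjugate
  analogue. Differentiating \<open>a\<close> with its vector arguments held constant differentiates
  the coefficients of \<open>a\<close> with respect to \<open>dz\<^sup>I \<and> dzbar\<^sup>J\<close>.\<close>

definition del :: "nat \<Rightarrow> 'm::finite form \<Rightarrow> 'm form" where
  "del k a x vs = (\<Sum>\<alpha>\<in>UNIV. wedge 1 k (dz \<alpha>) (\<lambda>y ws. d_dz \<alpha> (\<lambda>z. a z ws) y) x vs)"

definition delbar :: "nat \<Rightarrow> 'm::finite form \<Rightarrow> 'm form" where
  "delbar k a x vs = (\<Sum>\<alpha>\<in>UNIV. wedge 1 k (dzbar \<alpha>) (\<lambda>y ws. d_dzbar \<alpha> (\<lambda>z. a z ws) y) x vs)"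

definition fundamental_form :: "(complex^'m \<Rightarrow> complex^'m^'m) \<Rightarrow> 'm::finite form" where
  "fundamental_form H x vs =
     \<i> / 2 * (\<Sum>\<alpha>\<in>UNIV. \<Sum>\<beta>\<in>UNIV. H x $ \<alpha> $ \<beta> * wedge 1 1 (dz \<alpha>) (dzbar \<beta>) x vs)"

text \<open>The condition \<open>\<partial>\<partial>bar \<omega>\<^sup>m\<^sup>-\<^sup>2 = 0\<close>, void for \<open>m = 1\<close>; here \<open>\<omega>\<^sup>m\<^sup>-\<^sup>2\<close> has degree \<open>2 * (m - 2)\<close>.\<close>

definition del_delbar_omega_condition ::
  "('a, complex^'m) chart set \<Rightarrow> ('a, 'm::finite) hermitian_components \<Rightarrow> bool" where
  "del_delbar_omega_condition A h \<longleftrightarrow>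
     (CARD('m) \<ge> 2 \<longrightarrow>
       (\<forall>c\<in>A. \<forall>x\<in>chart_image c. \<forall>vs. length vs = 2 * (CARD('m) - 2) + 2 \<longrightarrow>
          del (2 * (CARD('m) - 2) + 1) (delbar (2 * (CARD('m) - 2))
            (wedge_power (fundamental_form (h c)) (CARD('m) - 2))) x vs = 0))"


section \<open>Christoffel symbols and curvature\<close>

text \<open>Throughout, \<open>G\<close> is the component matrix of a Riemannian metric in one chart.\<close>

definition christoffel :: "(real^'n \<Rightarrow> real^'n^'n) \<Rightarrow> 'n \<Rightarrow> 'n \<Rightarrow> 'n \<Rightarrow> real^'n \<Rightarrow> real" where
  "christoffel G i j k y =
     (\<Sum>l\<in>UNIV. matrix_inv (G y) $ i $ l *
        (partial_deriv j (\<lambda>y. G y $ k $ l) y + partial_deriv k (\<lambda>y. G y $ j $ l) y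
          - partial_deriv l (\<lambda>y. G y $ j $ k) y)) / 2"

text \<open>\<open>R\<^sub>i\<^sub>j\<^sub>k\<^sub>l = g(\<nabla>\<^sub>i \<nabla>\<^sub>j \<partial>\<^sub>k - \<nabla>\<^sub>j \<nabla>\<^sub>i \<partial>\<^sub>k, \<partial>\<^sub>l)\<close>, expanded with
  \<open>\<nabla>\<^sub>j \<partial>\<^sub>k = \<Gamma>\<^sup>a\<^sub>j\<^sub>k \<partial>\<^sub>a\<close>.\<close>

definition curvature ::
  "(real^'n \<Rightarrow> real^'n^'n) \<Rightarrow> 'n \<Rightarrow> 'n \<Rightarrow> 'n \<Rightarrow> 'n \<Rightarrow> real^'n \<Rightarrow> real" where
  "curvature G i j k l y =
     (\<Sum>a\<in>UNIV. G y $ a $ l *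
        (partial_deriv i (christoffel G a j k) y - partial_deriv j (christoffel G a i k) y
          + (\<Sum>b\<in>UNIV. christoffel G b j k y * christoffel G a i b y
                     - christoffel G b i k y * christoffel G a j b y)))"

text \<open>The contraction below is automatically real by the symmetries of the curvature tensor,
  so taking its real part in the inequality loses nothing.\<close>

definition curvature_contraction ::
  "(real^'n \<Rightarrow> real^'n^'n) \<Rightarrow> real^'n \<Rightarrow> complex^'n^'n \<Rightarrow> complex" where
  "curvature_contraction G y Q =
     (\<Sum>i\<in>UNIV. \<Sum>j\<in>UNIV. \<Sum>k\<in>UNIV. \<Sum>l\<in>UNIV.
        complex_of_real (curvature G i j k l y) * Q $ i $ l * Q $ j $ k)"

definition strongly_hermitian_negative ::
  "('b, real^'n) chart set \<Rightarrow> ('b, 'n) riemannian_components \<Rightarrow> bool" where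
  "strongly_hermitian_negative B g \<longleftrightarrow>
     (\<forall>d\<in>B. \<forall>y\<in>chart_image d. \<forall>Q. hermitian_positive_semidefinite Q \<longrightarrow>
        Re (curvature_contraction (g d) y Q) \<le> 0 \<and>
        (curvature_contraction (g d) y Q = 0 \<longrightarrow> rank Q \<le> 1))"

definition constant_sectional_curvature ::
  "('b, real^'n) chart set \<Rightarrow> ('b, 'n) riemannian_components \<Rightarrow> real \<Rightarrow> bool" where
  "constant_sectional_curvature B g \<kappa> \<longleftrightarrow>
     (\<forall>d\<in>B. \<forall>y\<in>chart_image d. \<forall>i j k l.
        curvature (g d) i j k l y =
          \<kappa> * (g d y $ i $ l * g d y $ j $ k - g d y $ i $ k * g d y $ j $ l))"


section \<open>Hermitian harmonic maps\<close>

text \<open>The inverse metric components \<open>h\<^sup>\<alpha>\<^sup>\<beta>\<close> (second index barred) satisfy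
  \<open>\<Sum>\<^sub>\<beta> h\<^sup>\<alpha>\<^sup>\<beta> h\<^sub>\<gamma>\<^sub>\<beta> = \<delta>\<^sup>\<alpha>\<^sub>\<gamma>\<close>, so they form the transpose of the matrix inverse.\<close>

definition inverse_metric :: "complex^'m^'m \<Rightarrow> 'm \<Rightarrow> 'm \<Rightarrow> complex" where
  "inverse_metric H \<alpha> \<beta> = matrix_inv H $ \<beta> $ \<alpha>"

definition hermitian_harmonic ::
  "'a topology \<Rightarrow> ('a, complex^'m) chart set \<Rightarrow> ('a, 'm) hermitian_components \<Rightarrow>
   'b topology \<Rightarrow> ('b, real^'n) chart set \<Rightarrow> ('b, 'n) riemannian_components \<Rightarrow> ('a \<Rightarrow> 'b) \<Rightarrow> bool" where
  "hermitian_harmonic X A h Y B g f \<longleftrightarrow> smooth_map X A Y B f \<and>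
     (\<forall>c\<in>A. \<forall>d\<in>B. \<forall>x\<in>local_dom c d f. \<forall>i.
        (let F = local_rep c d f; Fc = (\<lambda>j z. complex_of_real (F z $ j)) in
          (\<Sum>\<alpha>\<in>UNIV. \<Sum>\<beta>\<in>UNIV. inverse_metric (h c x) \<alpha> \<beta> *
             (d_dz \<alpha> (d_dzbar \<beta> (Fc i)) x +
              (\<Sum>j\<in>UNIV. \<Sum>k\<in>UNIV. complex_of_real (christoffel (g d) i j k (F x))
                 * d_dzbar \<beta> (Fc j) x * d_dz \<alpha> (Fc k) x))) = 0))"

end

theory Submission
  imports Defs "HOL-Complex_Analysis.Cauchy_Integral_Formula"
begin

text \<open>Let \<open>\<phi> = g\<^sub>i\<^sub>j \<partial>f\<^sup>i \<and> \<partial>bar f\<^sup>j\<close>. Since \<open>\<partial>\<partial>bar \<omega>\<^sup>m\<^sup>-\<^sup>2 = 0\<close>, integrating by parts twice shows that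
  \<open>\<integral> \<partial>\<partial>bar(\<rho> \<phi>) \<and> \<omega>\<^sup>m\<^sup>-\<^sup>2 = 0\<close> for every function \<open>\<rho>\<close> supported in one chart, hence, by a partition of unity,
  \<open>\<integral> \<partial>\<partial>bar \<phi> \<and> \<omega>\<^sup>m\<^sup>-\<^sup>2 = 0\<close>. For a Hermitian harmonic map the integrand is, up to a positive constant, the square
  norm of the complex Hessian of \<open>f\<close> minus the curvature of the target contracted with the matrix
  \<open>h\<^sup>\<alpha>\<^sup>\<beta> \<partial>\<^sub>\<alpha>f\<^sup>i \<partial>bar\<^sub>\<beta>f\<^sup>j\<close>, which is positive semidefinite. Both terms are nonnegative, so both vanish,
  and equality in the curvature condition makes the vectors \<open>\<partial>\<^sub>\<alpha>f\<close> proportional to a single complex vector,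
  whose real and imaginary parts span the range of \<open>df\<close>. Constant negative curvature forces the same
  equality case by the Cauchy--Schwarz inequality.

  In coordinates, wedging with \<open>\<omega>\<^sup>m\<^sup>-\<^sup>2\<close> is contraction with
  \<open>det h (h\<^sup>\<alpha>\<^sup>\<beta> h\<^sup>\<gamma>\<^sup>\<delta> - h\<^sup>\<alpha>\<^sup>\<delta> h\<^sup>\<gamma>\<^sup>\<beta>)\<close>.\<close>

section \<open>Functions of class \<open>C\<^sup>k\<close>\<close>

text \<open>Both signs come from one pairing of matrices, tr A tr B - tr AB. Harmonicity says that
  the covariant complex Hessian is trace-free, so for it only the second term is left, and that is a
  square norm; on products of gradients the same pairing gives the antisymmetrized products that the
  curvature contracts.

  Forms are never integrated globally. Instead a scalar integrand is shown to agree in all charts,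
  although the second derivatives of the coefficients of \<phi> are no tensors: the offending terms
  cancel by antisymmetry. Transition maps are only given as complex differentiable at each point, so
  their smoothness has to be proved. A localized integrand has integral zero but no sign, because
  its weight is differentiated; the sum of all of them has a sign. Using the weights a second time,
  undifferentiated, connects the two facts.

  No normal coordinates are chosen on the target: completing a square in arbitrary coordinates
  absorbs the first derivatives of the metric. For m = 1 the domain has real dimension two and the
  rank bound is immediate.\<close>

abbreviation "ck \<equiv> continuously_differentiable_on"

text \<open>Functions that agree near a point have the same derivatives there, so the choice behind
  \<open>frechet_derivative\<close> returns the same map for both, even where no derivative exists.
  Expressions may therefore be rewritten under derivatives before any regularity is known.\<close>

lemma frechet_derivative_cong:
  assumes "open S" "x \<in> S" "\<And>y. y \<in> S \<Longrightarrow> u y = v y"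
  shows "frechet_derivative u (at x) = frechet_derivative v (at x)"
proof -
  have "(u has_derivative D) (at x) \<longleftrightarrow> (v has_derivative D) (at x)" for D
    using assms by (metis has_derivative_transform_within_open)
  then show ?thesis by (simp add: frechet_derivative_def)
qed

lemma differentiable_has_frechet:
  "u differentiable at x \<Longrightarrow> (u has_derivative frechet_derivative u (at x)) (at x)"
  by (simp add: frechet_derivative_works)

lemma frechet_derivative_eqI:
  "(u has_derivative D) (at x) \<Longrightarrow> frechet_derivative u (at x) = D"
  by (rule frechet_derivative_at[symmetric])

lemma ck_subset: "ck k S u \<Longrightarrow> T \<subseteq> S \<Longrightarrow> ck k T u"
proof (induction k arbitrary: u)
  case 0 then show ?case by (auto intro: continuous_on_subset)
qed auto

lemma ck_cong:
  assumes "open S" "ck k S u" "\<And>x. x \<in> S \<Longrightarrow> u x = v x"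
  shows "ck k S v"
  using assms(2,3)
proof (induction k arbitrary: u v)
  case 0
  then show ?case by (auto cong: continuous_on_cong)
next
  case (Suc k)
  have eq: "frechet_derivative u (at x) = frechet_derivative v (at x)" if "x \<in> S" for x
    using frechet_derivative_cong[OF assms(1) that] Suc.prems(2) by blast
  have "v differentiable at x" if "x \<in> S" for x
    using Suc.prems that assms(1) unfolding differentiable_def
    by (metis has_derivative_transform_within_open continuously_differentiable_on.simps(2) differentiable_def)
  moreover have "ck k S (\<lambda>x. frechet_derivative v (at x) w)" for w
    by (rule Suc.IH[of "\<lambda>x. frechet_derivative u (at x) w"]) (use Suc.prems eq in auto)
  ultimately show ?case by simp
qed

text \<open>The class is phrased with \<open>frechet_derivative\<close>; this rule lets a closure
  proof present an explicit formula for the derivative and recurse on that formula.\<close>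

lemma ck_SucI:
  assumes "open S" "\<And>x. x \<in> S \<Longrightarrow> (u has_derivative u' x) (at x)" "\<And>v. ck k S (\<lambda>x. u' x v)"
  shows "ck (Suc k) S u"
proof -
  have "ck k S (\<lambda>x. frechet_derivative u (at x) v)" for v
    by (rule ck_cong[OF assms(1) assms(3)[of v]]) (simp add: frechet_derivative_eqI[OF assms(2)])
  then show ?thesis using assms(2) by (auto simp: differentiable_def)
qed

lemma ck_has_derivative:
  "ck (Suc k) S u \<Longrightarrow> x \<in> S \<Longrightarrow> (u has_derivative frechet_derivative u (at x)) (at x)"
  by (simp add: frechet_derivative_works[symmetric])

lemma ck_continuous_on: "ck k S u \<Longrightarrow> continuous_on S u"
  by (cases k) (auto simp: continuous_on_eq_continuous_within
      intro: differentiable_imp_continuous_within differentiable_at_withinI)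

lemma ck_SucD: "ck (Suc k) S u \<Longrightarrow> ck k S u"
proof (induction k arbitrary: u)
  case 0 then show ?case by (metis ck_continuous_on continuously_differentiable_on.simps(1))
next
  case (Suc k) then show ?case by (metis continuously_differentiable_on.simps(2))
qed

lemma ck_le: "ck k S u \<Longrightarrow> l \<le> k \<Longrightarrow> ck l S u"
  by (induction k) (auto simp del: continuously_differentiable_on.simps simp: le_Suc_eq dest: ck_SucD)

lemma ck_local:
  assumes "\<And>x. x \<in> S \<Longrightarrow> \<exists>T. open T \<and> x \<in> T \<and> ck k T u"
  shows "ck k S u"
  using assms
proof (induction k arbitrary: u)
  case 0
  show ?case unfolding continuously_differentiable_on.simps continuous_on_eq_continuous_within
  proof
    fix x assume "x \<in> S"
    from 0[OF this] obtain T where T: "open T" "x \<in> T" "continuous_on T u" by auto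
    then have "continuous (at x) u" by (simp add: continuous_on_eq_continuous_at)
    then show "continuous (at x within S) u" by (simp add: continuous_at_imp_continuous_within)
  qed
next
  case (Suc k)
  have "u differentiable at x" if "x \<in> S" for x
    using Suc.prems[OF that] by auto
  moreover have "ck k S (\<lambda>x. frechet_derivative u (at x) v)" for v
    by (rule Suc.IH) (use Suc.prems in \<open>auto dest!: meta_spec\<close>)
  ultimately show ?case by simp
qed

lemma ck_const: "ck k S (\<lambda>x. c)"
  by (induction k arbitrary: c) simp_all

lemma ck_bounded_linear:
  assumes "bounded_linear L" shows "ck k S L"
proof (cases k)
  case 0
  with assms show ?thesis by (simp add: linear_continuous_on)
next
  case (Suc l)
  have "frechet_derivative L (at x) = L" for x
    by (rule frechet_derivative_eqI) (rule bounded_linear_imp_has_derivative[OF assms])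
  then show ?thesis using Suc assms by (auto intro: bounded_linear_imp_differentiable ck_const)
qed

lemma ck_id: "ck k S (\<lambda>x. x)"
  by (rule ck_bounded_linear) (rule bounded_linear_ident)

lemma ck_add:
  assumes "open S" "ck k S u" "ck k S v"
  shows "ck k S (\<lambda>x. u x + v x)"
  using assms(2,3)
proof (induction k arbitrary: u v)
  case 0 then show ?case by (auto intro: continuous_intros)
next
  case (Suc k)
  show ?case
    by (rule ck_SucI[OF assms(1) has_derivative_add[OF ck_has_derivative[OF Suc.prems(1)] ck_has_derivative[OF Suc.prems(2)]]])
       (use Suc in auto)
qed

lemma ck_sum:
  assumes "open S" "\<And>i. i \<in> I \<Longrightarrow> ck k S (u i)"
  shows "ck k S (\<lambda>x. \<Sum>i\<in>I. u i x)"
  using assms(2)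
  by (induction I rule: infinite_finite_induct) (auto intro: ck_const ck_add[OF assms(1)])

lemma ck_linear_compose:
  assumes "open S" "bounded_linear L" "ck k S u"
  shows "ck k S (\<lambda>x. L (u x))"
  using assms(3)
proof (induction k arbitrary: u)
  case 0 then show ?case
    using bounded_linear.continuous_on[OF assms(2)] by auto
next
  case (Suc k)
  show ?case
    by (rule ck_SucI[OF assms(1) bounded_linear.has_derivative[OF assms(2) ck_has_derivative[OF Suc.prems]]])
       (use Suc in auto)
qed

lemma ck_bilinear:
  assumes "open S" "bounded_bilinear p" "ck k S u" "ck k S v"
  shows "ck k S (\<lambda>x. p (u x) (v x))"
  using assms(3,4)
proof (induction k arbitrary: u v)
  case 0 then show ?case
    using bounded_bilinear.continuous_on[OF assms(2)] by auto
next
  case (Suc k)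
  have *: "ck k S u" "ck k S v" using Suc.prems by (auto dest: ck_SucD simp del: continuously_differentiable_on.simps)
  show ?case
    by (rule ck_SucI[OF assms(1) bounded_bilinear.FDERIV[OF assms(2) ck_has_derivative[OF Suc.prems(1)] ck_has_derivative[OF Suc.prems(2)]]])
       (use Suc * in \<open>auto intro!: ck_add[OF assms(1)]\<close>)
qed

lemmas ck_mult = ck_bilinear[OF _ bounded_bilinear_mult]
lemmas ck_scaleR = ck_bilinear[OF _ bounded_bilinear_scaleR]
lemmas ck_cnj = ck_linear_compose[OF _ bounded_linear_cnj]
lemmas ck_Re = ck_linear_compose[OF _ bounded_linear_Re]
lemmas ck_of_real = ck_linear_compose[OF _ bounded_linear_of_real]

lemma ck_vec_nth: "open S \<Longrightarrow> ck k S u \<Longrightarrow> ck k S (\<lambda>x. u x $ i)"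
  by (rule ck_linear_compose[OF _ bounded_linear_vec_nth])

lemma ck_prod:
  fixes u :: "'i \<Rightarrow> 'a::real_normed_vector \<Rightarrow> 'b::{real_normed_algebra_1,comm_ring_1}"
  assumes "open S" "\<And>i. i \<in> I \<Longrightarrow> ck k S (u i)"
  shows "ck k S (\<lambda>x. \<Prod>i\<in>I. u i x)"
  using assms(2)
  by (induction I rule: infinite_finite_induct) (auto intro: ck_const ck_mult[OF assms(1)])

lemma ck_minus: "open S \<Longrightarrow> ck k S u \<Longrightarrow> ck k S (\<lambda>x. - u x)"
  by (rule ck_linear_compose[OF _ bounded_linear_minus[OF bounded_linear_ident]])

lemma ck_diff: "open S \<Longrightarrow> ck k S u \<Longrightarrow> ck k S v \<Longrightarrow> ck k S (\<lambda>x. u x - v x)"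
  using ck_add[of S k u "\<lambda>x. - v x"] ck_minus[of S k v] by simp

text \<open>The class speaks of derivatives along fixed vectors, whereas the chain rule
  differentiates g along df v, which moves with x. Expanding df v in the basis of the middle space
  leaves fixed directions with C^k coefficients, to which the induction applies.\<close>

lemma ck_compose:
  fixes f :: "'a::real_normed_vector \<Rightarrow> 'b::euclidean_space" and g :: "'b \<Rightarrow> 'c::real_normed_vector"
  assumes "open S" "open T" "f ` S \<subseteq> T" "ck k S f" "ck k T g"
  shows "ck k S (\<lambda>x. g (f x))"
  using assms(4,5)
proof (induction k arbitrary: g)
  case 0 then show ?case
    using assms(3) by (auto intro: continuous_on_compose2)
next
  case (Suc k)
  have f: "ck k S f" using Suc.prems(1) by (rule ck_SucD)
  have d: "((\<lambda>x. g (f x)) has_derivative (\<lambda>v. \<Sum>b\<in>Basis. (frechet_derivative f (at x) v \<bullet> b) *\<^sub>R frechet_derivative g (at (f x)) b)) (at x)"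
    if x: "x \<in> S" for x
  proof -
    have g: "(g has_derivative frechet_derivative g (at (f x))) (at (f x))"
      using Suc.prems(2) x assms(3) by (auto intro!: ck_has_derivative simp del: continuously_differentiable_on.simps)
    have lin: "linear (frechet_derivative g (at (f x)))" using g by (rule has_derivative_linear)
    have rep: "frechet_derivative g (at (f x)) w = (\<Sum>b\<in>Basis. (w \<bullet> b) *\<^sub>R frechet_derivative g (at (f x)) b)" for w
    proof -
      have "frechet_derivative g (at (f x)) w = frechet_derivative g (at (f x)) (\<Sum>b\<in>Basis. (w \<bullet> b) *\<^sub>R b)"
        by (simp only: euclidean_representation)
      also have "\<dots> = (\<Sum>b\<in>Basis. (w \<bullet> b) *\<^sub>R frechet_derivative g (at (f x)) b)"
        by (simp only: linear_sum[OF lin] linear_cmul[OF lin])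
      finally show ?thesis .
    qed
    show ?thesis
      by (rule has_derivative_eq_rhs[OF has_derivative_compose[OF ck_has_derivative[OF Suc.prems(1) x] g]])
         (simp only: rep[symmetric])
  qed
  show ?case
  proof (rule ck_SucI[OF assms(1) d])
    fix v
    show "ck k S (\<lambda>x. \<Sum>b\<in>Basis. (frechet_derivative f (at x) v \<bullet> b) *\<^sub>R frechet_derivative g (at (f x)) b)"
      using Suc.prems f
      by (intro ck_sum ck_scaleR assms(1) ck_linear_compose[OF assms(1) bounded_linear_inner_left] Suc.IH) auto
  qed auto
qed

lemma ck_inverse:
  fixes u :: "'a::real_normed_vector \<Rightarrow> 'b::real_normed_field"
  assumes "open S" "ck k S u" "\<And>x. x \<in> S \<Longrightarrow> u x \<noteq> 0"
  shows "ck k S (\<lambda>x. inverse (u x))"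
  using assms(2)
proof (induction k)
  case 0 then show ?case using assms(3) by (auto intro!: continuous_on_inverse)
next
  case (Suc k)
  have IH: "ck k S (\<lambda>x. inverse (u x))" using Suc by (simp del: continuously_differentiable_on.simps add: ck_SucD)
  show ?case
  proof (rule ck_SucI[OF assms(1)])
    fix x assume "x \<in> S"
    show "((\<lambda>x. inverse (u x)) has_derivative
        (\<lambda>v. - (inverse (u x) * frechet_derivative u (at x) v * inverse (u x)))) (at x)"
      by (rule Deriv.has_derivative_inverse) (use \<open>x \<in> S\<close> assms(3) ck_has_derivative[OF Suc.prems] in auto)
  qed (use IH Suc.prems in \<open>auto intro!: ck_minus ck_mult assms(1)\<close>)
qed

text \<open>The second difference over a parallelogram is symmetric in v and w. Two uses of the mean
  value theorem express it by the derivative along v followed by w; exchanging the roles of v and w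
  gives the other order, and letting the parallelogram shrink compares the two.\<close>

lemma second_difference_real:
  fixes u :: "'a::real_normed_vector \<Rightarrow> real"
  assumes "open S" "ck 2 S u" "s > 0"
    and sub: "\<And>a b. a \<in> {0..s} \<Longrightarrow> b \<in> {0..s} \<Longrightarrow> x + a *\<^sub>R v + b *\<^sub>R w \<in> S"
  shows "\<exists>a b. a \<in> {0..s} \<and> b \<in> {0..s} \<and>
     u (x + s *\<^sub>R v + s *\<^sub>R w) - u (x + s *\<^sub>R v) - u (x + s *\<^sub>R w) + u x
       = s\<^sup>2 * frechet_derivative (\<lambda>y. frechet_derivative u (at y) v) (at (x + a *\<^sub>R v + b *\<^sub>R w)) w"
proof -
  define D where "D y = frechet_derivative u (at y) v" for y
  have u1: "ck (Suc 1) S u" using assms(2) by (simp add: numeral_2_eq_2)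
  have D1: "ck (Suc 0) S D" using u1 unfolding D_def by simp
  define \<phi> where "\<phi> a = u (x + a *\<^sub>R v + s *\<^sub>R w) - u (x + a *\<^sub>R v)" for a
  have d\<phi>: "(\<phi> has_real_derivative D (x + a *\<^sub>R v + s *\<^sub>R w) - D (x + a *\<^sub>R v)) (at a)"
    if "a \<in> {0..s}" for a
  proof -
    have 1: "(u has_derivative frechet_derivative u (at (x + a *\<^sub>R v + s *\<^sub>R w))) (at (x + a *\<^sub>R v + s *\<^sub>R w))"
      by (rule ck_has_derivative[OF u1]) (use sub that assms(3) in auto)
    have 2: "(u has_derivative frechet_derivative u (at (x + a *\<^sub>R v))) (at (x + a *\<^sub>R v))"
      by (rule ck_has_derivative[OF u1]) (use sub[of a 0] that assms(3) in auto)
    have l: "linear (frechet_derivative u (at (x + a *\<^sub>R v + s *\<^sub>R w)))" "linear (frechet_derivative u (at (x + a *\<^sub>R v)))"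
      using 1 2 has_derivative_linear by auto
    have "(\<phi> has_derivative (\<lambda>t. frechet_derivative u (at (x + a *\<^sub>R v + s *\<^sub>R w)) (t *\<^sub>R v)
        - frechet_derivative u (at (x + a *\<^sub>R v)) (t *\<^sub>R v))) (at a)"
      unfolding \<phi>_def
      by (intro has_derivative_diff has_derivative_compose[where g=u and f="\<lambda>a. x + a *\<^sub>R v + s *\<^sub>R w", OF _ 1] has_derivative_compose[where g=u and f="\<lambda>a. x + a *\<^sub>R v", OF _ 2])
         (auto intro!: derivative_eq_intros)
    then show ?thesis
      unfolding has_field_derivative_def D_def
      by (rule has_derivative_eq_rhs) (auto simp: linear_cmul[OF l(1)] linear_cmul[OF l(2)] left_diff_distrib fun_eq_iff)
  qed
  have "\<exists>a. 0 < a \<and> a < s \<and> \<phi> s - \<phi> 0 = (s - 0) * (D (x + a *\<^sub>R v + s *\<^sub>R w) - D (x + a *\<^sub>R v))"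
    by (rule MVT2) (use assms(3) d\<phi> in auto)
  then obtain a where a: "0 < a" "a < s" "\<phi> s - \<phi> 0 = s * (D (x + a *\<^sub>R v + s *\<^sub>R w) - D (x + a *\<^sub>R v))" by auto
  define \<psi> where "\<psi> b = D (x + a *\<^sub>R v + b *\<^sub>R w)" for b
  have d\<psi>: "(\<psi> has_real_derivative frechet_derivative D (at (x + a *\<^sub>R v + b *\<^sub>R w)) w) (at b)"
    if "b \<in> {0..s}" for b
  proof -
    have 1: "(D has_derivative frechet_derivative D (at (x + a *\<^sub>R v + b *\<^sub>R w))) (at (x + a *\<^sub>R v + b *\<^sub>R w))"
      by (rule ck_has_derivative[OF D1]) (use sub that a in auto)
    have l: "linear (frechet_derivative D (at (x + a *\<^sub>R v + b *\<^sub>R w)))"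
      using 1 has_derivative_linear by auto
    have "(\<psi> has_derivative (\<lambda>t. frechet_derivative D (at (x + a *\<^sub>R v + b *\<^sub>R w)) (t *\<^sub>R w))) (at b)"
      unfolding \<psi>_def
      by (intro has_derivative_compose[where g=D and f="\<lambda>b. x + a *\<^sub>R v + b *\<^sub>R w", OF _ 1]) (auto intro!: derivative_eq_intros)
    then show ?thesis
      unfolding has_field_derivative_def
      by (rule has_derivative_eq_rhs) (auto simp: linear_cmul[OF l] fun_eq_iff)
  qed
  have "\<exists>b. 0 < b \<and> b < s \<and> \<psi> s - \<psi> 0 = (s - 0) * frechet_derivative D (at (x + a *\<^sub>R v + b *\<^sub>R w)) w"
    by (rule MVT2) (use assms(3) d\<psi> in auto)
  then obtain b where b: "0 < b" "b < s" "\<psi> s - \<psi> 0 = s * frechet_derivative D (at (x + a *\<^sub>R v + b *\<^sub>R w)) w" by auto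
  have "u (x + s *\<^sub>R v + s *\<^sub>R w) - u (x + s *\<^sub>R v) - u (x + s *\<^sub>R w) + u x = \<phi> s - \<phi> 0"
    by (simp add: \<phi>_def)
  also have "\<dots> = s\<^sup>2 * frechet_derivative D (at (x + a *\<^sub>R v + b *\<^sub>R w)) w"
    using a(3) b(3) by (simp add: \<psi>_def power2_eq_square)
  finally show ?thesis using a b unfolding D_def
    by (intro exI[of _ a] exI[of _ b]) auto
qed

lemma second_derivative_symmetric_real:
  fixes u :: "'a::real_normed_vector \<Rightarrow> real"
  assumes "open S" "ck 2 S u" "x \<in> S"
  shows "frechet_derivative (\<lambda>y. frechet_derivative u (at y) v) (at x) w
       = frechet_derivative (\<lambda>y. frechet_derivative u (at y) w) (at x) v"
proof (rule ccontr)
  define A where "A y = frechet_derivative (\<lambda>y. frechet_derivative u (at y) v) (at y) w" for y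
  define B where "B y = frechet_derivative (\<lambda>y. frechet_derivative u (at y) w) (at y) v" for y
  assume "\<not> ?thesis"
  then have ne: "A x \<noteq> B x" by (simp add: A_def B_def)
  define e where "e = \<bar>A x - B x\<bar> / 2"
  have e: "e > 0" using ne by (simp add: e_def)
  have "ck 0 S A" "ck 0 S B" using assms(2) unfolding A_def B_def by (simp_all add: numeral_2_eq_2)
  then have "continuous (at x) A" "continuous (at x) B"
    using assms(1,3) by (auto simp: continuous_on_eq_continuous_at)
  then obtain d1 d2 where d: "d1 > 0" "\<And>y. dist y x < d1 \<Longrightarrow> dist (A y) (A x) < e"
    "d2 > 0" "\<And>y. dist y x < d2 \<Longrightarrow> dist (B y) (B x) < e"
    using e unfolding continuous_at_eps_delta by metis
  obtain d3 where d3: "d3 > 0" "ball x d3 \<subseteq> S" using assms(1,3) openE by blast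
  define d where "d = min d1 (min d2 d3)"
  \<comment> \<open>Small enough that the whole parallelogram stays within distance d of x; the
    summand 1 keeps the denominator positive when v = w = 0.\<close>
  define s where "s = d / (2 * (norm v + norm w + 1))"
  have dpos: "d > 0" using d d3 by (simp add: d_def)
  have npos: "norm v + norm w + 1 > 0" using norm_ge_zero[of v] norm_ge_zero[of w] by linarith
  then have s: "s > 0" using dpos by (simp add: s_def)
  have near: "dist (x + a *\<^sub>R v + b *\<^sub>R w) x < d" if "a \<in> {0..s}" "b \<in> {0..s}" for a b
  proof -
    have "dist (x + a *\<^sub>R v + b *\<^sub>R w) x = norm (a *\<^sub>R v + b *\<^sub>R w)" by (simp add: dist_norm algebra_simps)
    also have "\<dots> \<le> a * norm v + b * norm w" using norm_triangle_ineq[of "a *\<^sub>R v" "b *\<^sub>R w"] that by simp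
    also have "\<dots> \<le> s * norm v + s * norm w" using that by (intro add_mono mult_right_mono) auto
    also have "\<dots> < s * (2 * (norm v + norm w + 1))"
      using s norm_ge_zero[of v] norm_ge_zero[of w] by (simp add: algebra_simps add_nonneg_pos)
    also have "\<dots> = d" using npos by (simp add: s_def)
    finally show ?thesis .
  qed
  have inS: "x + a *\<^sub>R v + b *\<^sub>R w \<in> S" if "a \<in> {0..s}" "b \<in> {0..s}" for a b
    using near[OF that] d3(2) by (auto simp: d_def dist_commute)
  have inS': "x + a *\<^sub>R w + b *\<^sub>R v \<in> S" if "a \<in> {0..s}" "b \<in> {0..s}" for a b
    using inS[OF that(2,1)] by (simp add: algebra_simps)
  obtain a b where ab: "a \<in> {0..s}" "b \<in> {0..s}"
    "u (x + s *\<^sub>R v + s *\<^sub>R w) - u (x + s *\<^sub>R v) - u (x + s *\<^sub>R w) + u x = s\<^sup>2 * A (x + a *\<^sub>R v + b *\<^sub>R w)"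
    using second_difference_real[OF assms(1,2) s inS] unfolding A_def by metis
  obtain a' b' where ab': "a' \<in> {0..s}" "b' \<in> {0..s}"
    "u (x + s *\<^sub>R w + s *\<^sub>R v) - u (x + s *\<^sub>R w) - u (x + s *\<^sub>R v) + u x = s\<^sup>2 * B (x + a' *\<^sub>R w + b' *\<^sub>R v)"
    using second_difference_real[OF assms(1,2) s inS'] unfolding B_def by metis
  have xs: "x + s *\<^sub>R w + s *\<^sub>R v = x + s *\<^sub>R v + s *\<^sub>R w" by simp
  from ab(3) ab'(3)[unfolded xs] have "s\<^sup>2 * A (x + a *\<^sub>R v + b *\<^sub>R w) = s\<^sup>2 * B (x + a' *\<^sub>R w + b' *\<^sub>R v)" by linarith
  then have eq: "A (x + a *\<^sub>R v + b *\<^sub>R w) = B (x + a' *\<^sub>R w + b' *\<^sub>R v)" using s by simp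
  have 1: "dist (A (x + a *\<^sub>R v + b *\<^sub>R w)) (A x) < e"
    by (rule d(2)) (use near[OF ab(1,2)] in \<open>auto simp: d_def\<close>)
  have xs': "x + a' *\<^sub>R w + b' *\<^sub>R v = x + b' *\<^sub>R v + a' *\<^sub>R w" by simp
  have 2: "dist (B (x + a' *\<^sub>R w + b' *\<^sub>R v)) (B x) < e"
    unfolding xs' by (rule d(4)) (use near[OF ab'(2,1)] in \<open>auto simp: d_def\<close>)
  have "dist (A x) (B x) < e + e"
    using dist_triangle_less_add[OF 1[unfolded eq dist_commute[of _ "A x"]] 2[unfolded dist_commute[of _ "B x"]]] .
  then show False by (simp add: e_def dist_real_def)
qed

lemma second_derivative_symmetric:
  fixes u :: "'a::real_normed_vector \<Rightarrow> 'b::euclidean_space"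
  assumes "open S" "ck 2 S u" "x \<in> S"
  shows "frechet_derivative (\<lambda>y. frechet_derivative u (at y) v) (at x) w
       = frechet_derivative (\<lambda>y. frechet_derivative u (at y) w) (at x) v"
proof (rule euclidean_eqI)
  fix b :: 'b assume "b \<in> Basis"
  have u1: "ck (Suc 1) S u" using assms(2) by (simp add: numeral_2_eq_2)
  have inner: "frechet_derivative (\<lambda>y. r y \<bullet> b) (at y) z = frechet_derivative r (at y) z \<bullet> b"
    if "ck (Suc k) S r" "y \<in> S" for r :: "'a \<Rightarrow> 'b" and y z k
    by (subst frechet_derivative_eqI[OF bounded_linear.has_derivative[OF bounded_linear_inner_left ck_has_derivative[OF that]]]) simp
  have ck: "ck 2 S (\<lambda>y. u y \<bullet> b)"
    by (rule ck_linear_compose[OF assms(1) bounded_linear_inner_left assms(2)])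
  have twice: "frechet_derivative (\<lambda>y. frechet_derivative (\<lambda>y. u y \<bullet> b) (at y) z) (at x) z'
     = frechet_derivative (\<lambda>y. frechet_derivative u (at y) z) (at x) z' \<bullet> b" for z z'
  proof -
    have "frechet_derivative (\<lambda>y. frechet_derivative (\<lambda>y. u y \<bullet> b) (at y) z) (at x) z'
      = frechet_derivative (\<lambda>y. frechet_derivative u (at y) z \<bullet> b) (at x) z'"
      by (rule fun_cong[OF frechet_derivative_cong[OF assms(1,3)]]) (rule inner[OF u1])
    also have "\<dots> = frechet_derivative (\<lambda>y. frechet_derivative u (at y) z) (at x) z' \<bullet> b"
      by (rule inner[of 0]) (use u1 assms(3) in auto)
    finally show ?thesis .
  qed
  show "frechet_derivative (\<lambda>y. frechet_derivative u (at y) v) (at x) w \<bullet> b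
       = frechet_derivative (\<lambda>y. frechet_derivative u (at y) w) (at x) v \<bullet> b"
    using second_derivative_symmetric_real[OF assms(1) ck assms(3), of v w] by (simp only: twice)
qed

section \<open>Holomorphic maps of several variables\<close>

lemma bounded_linear_smult_left: "bounded_linear (\<lambda>\<zeta>::complex. \<zeta> *s (v::complex^'m::finite))"
  by (simp add: linear_conv_bounded_linear[symmetric] linear_iff vec_eq_iff algebra_simps)

lemma continuous_on_smult [continuous_intros]:
  fixes v :: "complex^'m::finite"
  shows "continuous_on S c \<Longrightarrow> continuous_on S (\<lambda>x. c x *s v)"
  by (rule bounded_linear.continuous_on[OF bounded_linear_smult_left])

definition complex_differentiable_on :: "(complex^'m::finite) set \<Rightarrow> (complex^'m \<Rightarrow> complex) \<Rightarrow> bool" where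
  "complex_differentiable_on S f \<longleftrightarrow>
     (\<forall>x\<in>S. \<exists>D. (f has_derivative D) (at x) \<and> (\<forall>c v. D (c *s v) = c * D v))"

lemma complex_differentiable_onD:
  assumes "complex_differentiable_on S f" "x \<in> S"
  shows "(f has_derivative frechet_derivative f (at x)) (at x)"
    and "frechet_derivative f (at x) (c *s v) = c * frechet_derivative f (at x) v"
  using assms frechet_derivative_at unfolding complex_differentiable_on_def by metis+

lemma complex_differentiable_on_continuous: "complex_differentiable_on S f \<Longrightarrow> continuous_on S f"
  by (meson complex_differentiable_onD(1) continuous_at_imp_continuous_on has_derivative_continuous)

lemma complex_line_derivative:
  fixes v :: "complex^'m::finite"
  assumes f: "complex_differentiable_on S f" and x: "x + \<zeta> *s v \<in> S"
  shows "((\<lambda>\<zeta>. f (x + \<zeta> *s v)) has_field_derivative frechet_derivative f (at (x + \<zeta> *s v)) v) (at \<zeta>)"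
proof -
  have "((\<lambda>\<zeta>. x + \<zeta> *s v) has_derivative (\<lambda>\<zeta>. \<zeta> *s v)) (at \<zeta>)"
    using has_derivative_add[OF has_derivative_const bounded_linear_imp_has_derivative[OF bounded_linear_smult_left]]
    by simp
  from has_derivative_compose[OF this complex_differentiable_onD(1)[OF f x]]
  show ?thesis unfolding has_field_derivative_def
    by (rule has_derivative_eq_rhs) (simp add: complex_differentiable_onD(2)[OF f x] fun_eq_iff mult.commute)
qed

lemma smult_norm: "norm (\<zeta> *s (v::complex^'m::finite)) = cmod \<zeta> * norm v"
  by (simp add: norm_vec_def L2_set_def norm_mult power_mult_distrib sum_distrib_left[symmetric] real_sqrt_mult)

lemma exists_smult_radius:
  fixes v :: "complex^'m::finite"
  assumes "r > 0"
  obtains R where "R > 0" "\<And>\<zeta>. cmod \<zeta> \<le> R \<Longrightarrow> norm (\<zeta> *s v) < r"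
proof
  have p: "norm v + 1 > 0" using norm_ge_zero[of v] by linarith
  show "r / (norm v + 1) > 0" using assms p by simp
  fix \<zeta> :: complex assume "cmod \<zeta> \<le> r / (norm v + 1)"
  then have "cmod \<zeta> * norm v \<le> r / (norm v + 1) * norm v" by (rule mult_right_mono) simp
  also have "\<dots> < r" using p assms by (simp add: field_simps)
  finally show "norm (\<zeta> *s v) < r" by (simp add: smult_norm)
qed

text \<open>Cauchy's estimate on a complex line through the point controls the derivative by the values.\<close>

lemma complex_differentiable_derivative_continuous:
  fixes f :: "complex^'m::finite \<Rightarrow> complex"
  assumes "open S" and f: "complex_differentiable_on S f"
  shows "continuous_on S (\<lambda>x. frechet_derivative f (at x) v)"
proof -
  have "continuous (at x0) (\<lambda>x. frechet_derivative f (at x) v)" if x0: "x0 \<in> S" for x0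
  proof -
    obtain r where r: "r > 0" "cball x0 (2*r) \<subseteq> S"
      using open_contains_cball[of S] assms(1) x0 by (metis mult.commute field_sum_of_halves half_gt_zero mult_2)
    obtain R where R: "R > 0" "\<And>\<zeta>. cmod \<zeta> \<le> R \<Longrightarrow> norm (\<zeta> *s v) < r"
      using exists_smult_radius[OF r(1)] by blast
    have "uniformly_continuous_on (cball x0 (2*r)) f"
      by (intro compact_uniformly_continuous continuous_on_subset[OF complex_differentiable_on_continuous[OF f]] r) auto
    have inS: "x + \<zeta> *s v \<in> cball x0 (2*r)" if "dist x x0 < r" "cmod \<zeta> \<le> R" for x \<zeta>
    proof -
      have "dist (x + \<zeta> *s v) x0 \<le> dist x x0 + norm (\<zeta> *s v)"
        by (metis add.commute dist_norm dist_triangle2 dist_commute add_diff_cancel_left')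
      then show ?thesis using that R(2)[of \<zeta>] by (auto simp: dist_commute)
    qed
    show ?thesis unfolding continuous_at_eps_delta
    proof (intro allI impI)
      fix e :: real assume e: "e > 0"
      \<comment> \<open>Cauchy's inequality will divide by R; the factor 1/2 makes the final
        estimate strict.\<close>
      then have "e * R / 2 > 0" using R by simp
      with \<open>uniformly_continuous_on _ f\<close> obtain d where d: "d > 0"
        "\<And>x x'. x \<in> cball x0 (2*r) \<Longrightarrow> x' \<in> cball x0 (2*r) \<Longrightarrow> dist x' x < d \<Longrightarrow> dist (f x') (f x) < e * R / 2"
        unfolding uniformly_continuous_on_def by metis
      show "\<exists>d>0. \<forall>x'. dist x' x0 < d \<longrightarrow> dist (frechet_derivative f (at x') v) (frechet_derivative f (at x0) v) < e"
      proof (intro exI[of _ "min d r"] conjI allI impI)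
        show "0 < min d r" using d r by simp
        fix x assume x: "dist x x0 < min d r"
        \<comment> \<open>The derivatives at x and x0 are compared through one function of a single
          variable, the difference of the restrictions of f to two parallel complex lines.\<close>
        define q where "q \<zeta> = f (x + \<zeta> *s v) - f (x0 + \<zeta> *s v)" for \<zeta>
        have q': "(q has_field_derivative (frechet_derivative f (at (x + \<zeta> *s v)) v
             - frechet_derivative f (at (x0 + \<zeta> *s v)) v)) (at \<zeta>)" if "cmod \<zeta> \<le> R" for \<zeta>
          unfolding q_def
          by (intro DERIV_diff complex_line_derivative[OF f] subsetD[OF r(2)] inS) (use that x r in auto)
        have "norm ((deriv ^^ 1) q 0) \<le> fact 1 * (e * R / 2) / R^1"
        proof (rule Cauchy_inequality)
          show "q holomorphic_on ball 0 R" unfolding holomorphic_on_def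
          proof
            fix \<zeta> assume "\<zeta> \<in> ball (0::complex) R"
            then have "q field_differentiable (at \<zeta>)" using q'[of \<zeta>] by (auto simp: field_differentiable_def)
            then show "q field_differentiable at \<zeta> within ball 0 R" by (rule field_differentiable_at_within)
          qed
          show "continuous_on (cball 0 R) q"
            by (rule continuous_at_imp_continuous_on) (auto intro!: DERIV_isCont[OF q'] simp: dist_norm)
          fix \<zeta> :: complex assume "norm (0 - \<zeta>) = R"
          then have "dist (f (x + \<zeta> *s v)) (f (x0 + \<zeta> *s v)) < e * R / 2"
            by (intro d(2) inS) (use x r in \<open>auto simp: dist_norm\<close>)
          then show "cmod (q \<zeta>) \<le> e * R / 2" by (simp add: q_def dist_norm)
        qed (use R in auto)
        moreover have "deriv q 0 = frechet_derivative f (at x) v - frechet_derivative f (at x0) v"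
          using DERIV_imp_deriv[OF q'[of 0]] R by simp
        ultimately show "dist (frechet_derivative f (at x) v) (frechet_derivative f (at x0) v) < e"
          using R e by (simp add: dist_norm)
      qed
    qed
  qed
  then show ?thesis by (simp add: continuous_at_imp_continuous_on)
qed

text \<open>Cauchy's formula on the complex lines x + \<zeta> v writes the directional derivative as
  an integral of f itself against a kernel independent of x. Differentiating under the integral is
  allowed because the derivatives of f along fixed vectors are continuous by the preceding lemma,
  and complex linearity passes through the integral.\<close>

lemma complex_differentiable_derivative:
  fixes f :: "complex^'m::finite \<Rightarrow> complex"
  assumes "open S" and f: "complex_differentiable_on S f"
  shows "complex_differentiable_on S (\<lambda>x. frechet_derivative f (at x) v)"
  unfolding complex_differentiable_on_def
proof
  fix x0 assume x0: "x0 \<in> S"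
  obtain r where r: "r > 0" "cball x0 (2*r) \<subseteq> S"
    using open_contains_cball[of S] assms(1) x0 by (metis mult.commute field_sum_of_halves half_gt_zero mult_2)
  obtain R where R: "R > 0" "\<And>\<zeta>. cmod \<zeta> \<le> R \<Longrightarrow> norm (\<zeta> *s v) < r"
    using exists_smult_radius[OF r(1)] by blast
  define U where "U = ball x0 r"
  have inS: "x + \<zeta> *s v \<in> S" if "x \<in> U" "cmod \<zeta> \<le> R" for x \<zeta>
  proof -
    have "dist (x + \<zeta> *s v) x0 \<le> dist x x0 + norm (\<zeta> *s v)"
      by (metis add.commute dist_norm dist_triangle2 dist_commute add_diff_cancel_left')
    then have "x + \<zeta> *s v \<in> cball x0 (2*r)"
      using that R(2)[of \<zeta>] by (auto simp: dist_commute U_def)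
    then show ?thesis using r by auto
  qed
  define p where "p = circlepath 0 R"
  \<comment> \<open>Kernel of Cauchy's formula for a first derivative on the circle p: the velocity
    of p, divided by p^2 and by 2 \<pi> \<i>.\<close>
  define \<kappa> where "\<kappa> t = (2 * pi * \<i> * R * exp (2 * of_real pi * \<i> * t)) / (p t)\<^sup>2 / (2 * pi * \<i>)" for t
  have pR: "cmod (p t) = R" for t using R by (simp add: p_def circlepath norm_mult)
  have p0: "p t \<noteq> 0" for t using pR[of t] R by auto
  have pc: "continuous_on X p" for X by (simp add: p_def circlepath) (intro continuous_intros)
  have \<kappa>c: "continuous_on X \<kappa>" for X unfolding \<kappa>_def by (intro continuous_intros pc) (use p0 in auto)
  have rep: "frechet_derivative f (at x) v = integral (cbox 0 1) (\<lambda>t. f (x + p t *s v) * \<kappa> t)" if x: "x \<in> U" for x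
  proof -
    define q where "q \<zeta> = f (x + \<zeta> *s v)" for \<zeta>
    have q': "(q has_field_derivative frechet_derivative f (at (x + \<zeta> *s v)) v) (at \<zeta>)" if "cmod \<zeta> \<le> R" for \<zeta>
      unfolding q_def by (intro complex_line_derivative[OF f] inS x that)
    have hol: "q holomorphic_on ball 0 R" unfolding holomorphic_on_def
    proof
      fix \<zeta> assume "\<zeta> \<in> ball (0::complex) R"
      then have "q field_differentiable (at \<zeta>)" using q'[of \<zeta>] by (auto simp: field_differentiable_def)
      then show "q field_differentiable at \<zeta> within ball 0 R" by (rule field_differentiable_at_within)
    qed
    have cont: "continuous_on (cball 0 R) q"
      by (rule continuous_at_imp_continuous_on) (auto intro!: DERIV_isCont[OF q'] simp: dist_norm)
    have "contour_integral p (\<lambda>u. q u/(u-0)^(Suc 1)) = (2 * pi * \<i>) * (deriv ^^ 1) q 0 / (fact 1)"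
      unfolding p_def by (rule Cauchy_contour_integral_circlepath[OF cont hol]) (use R in auto)
    then have "deriv q 0 = contour_integral p (\<lambda>u. q u/u\<^sup>2) / (2 * pi * \<i>)" by (simp add: power2_eq_square)
    also have "\<dots> = integral {0..1} (\<lambda>t. q (p t) / (p t)\<^sup>2 * (2 * pi * \<i> * R * exp (2 * of_real pi * \<i> * t))) / (2 * pi * \<i>)"
      unfolding contour_integral_integral p_def vector_derivative_circlepath ..
    also have "\<dots> = integral {0..1} (\<lambda>t. q (p t) / (p t)\<^sup>2 * (2 * pi * \<i> * R * exp (2 * of_real pi * \<i> * t)) / (2 * pi * \<i>))"
      by (rule integral_divide[symmetric])
    also have "\<dots> = integral (cbox 0 1) (\<lambda>t. f (x + p t *s v) * \<kappa> t)"
      by (simp add: \<kappa>_def q_def mult_ac)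
    finally show ?thesis using DERIV_imp_deriv[OF q'[of 0]] R by simp
  qed
  \<comment> \<open>Leibniz' rule takes the derivative of the integrand as a continuous family of
    bounded linear maps.\<close>
  define fx where "fx x t = Blinfun (\<lambda>w. frechet_derivative f (at (x + p t *s v)) w * \<kappa> t)" for x t
  have fx: "blinfun_apply (fx x t) = (\<lambda>w. frechet_derivative f (at (x + p t *s v)) w * \<kappa> t)" if "x \<in> U" for x t
    unfolding fx_def
    by (rule bounded_linear_Blinfun_apply)
       (intro bounded_linear_mult_const has_derivative_bounded_linear[OF complex_differentiable_onD(1)[OF f]] inS that, simp add: pR)
  have der: "((\<lambda>x. integral (cbox 0 1) (\<lambda>t. f (x + p t *s v) * \<kappa> t)) has_derivative integral (cbox 0 1) (fx x0)) (at x0 within U)"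
  proof (rule leibniz_rule)
    show "((\<lambda>x. f (x + p t *s v) * \<kappa> t) has_derivative blinfun_apply (fx x t)) (at x within U)" if "x \<in> U" for x t
      unfolding fx[OF that]
      by (rule has_derivative_mult_left, rule has_derivative_compose[where f="\<lambda>x. x + p t *s v" and f'="\<lambda>w. w"])
         (use that in \<open>auto intro!: derivative_eq_intros complex_differentiable_onD[OF f] inS simp: pR\<close>)
    show "(\<lambda>t. f (x + p t *s v) * \<kappa> t) integrable_on cbox 0 1" if "x \<in> U" for x
      by (intro integrable_continuous continuous_intros \<kappa>c
            continuous_on_compose2[OF complex_differentiable_on_continuous[OF f]] pc)
         (use that in \<open>auto intro!: inS simp: pR\<close>)
    show "continuous_on (U \<times> cbox 0 1) (\<lambda>(x, t). fx x t)"
    proof (rule continuous_on_blinfun_componentwise)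
      fix i :: "complex^'m"
      have "continuous_on (U \<times> cbox 0 1) (\<lambda>z. frechet_derivative f (at (fst z + p (snd z) *s v)) i * \<kappa> (snd z))"
        by (intro continuous_intros continuous_on_compose2[OF complex_differentiable_derivative_continuous[OF assms]]
              continuous_on_compose2[OF pc[of UNIV]] continuous_on_compose2[OF \<kappa>c[of UNIV]])
           (auto intro!: inS simp: pR)
      then show "continuous_on (U \<times> cbox 0 1) (\<lambda>x. blinfun_apply (case x of (x, t) \<Rightarrow> fx x t) i)"
        by (rule continuous_on_eq) (auto simp: fx)
    qed
  qed (use r in \<open>auto simp: U_def\<close>)
  have x0U: "x0 \<in> U" "open U" using r by (auto simp: U_def)
  have "((\<lambda>x. frechet_derivative f (at x) v) has_derivative integral (cbox 0 1) (fx x0)) (at x0)"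
    using der x0U rep by (metis (no_types, lifting) at_within_open has_derivative_transform)
  moreover have "integral (cbox 0 1) (fx x0) (c *s w) = c * integral (cbox 0 1) (fx x0) w" for c w
  proof -
    have c: "continuous_on (cbox 0 1) (fx x0)"
    proof (rule continuous_on_blinfun_componentwise)
      fix i :: "complex^'m"
      show "continuous_on (cbox 0 1) (\<lambda>t. blinfun_apply (fx x0 t) i)" unfolding fx[OF x0U(1)]
        by (intro continuous_intros continuous_on_compose2[OF complex_differentiable_derivative_continuous[OF assms]] pc \<kappa>c)
           (auto intro!: inS x0U simp: pR)
    qed
    have "integral (cbox 0 1) (fx x0) (c *s w) = integral (cbox 0 1) (\<lambda>t. c * fx x0 t w)"
      unfolding blinfun_apply_integral[OF integrable_continuous[OF c]] fx[OF x0U(1)]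
      by (subst complex_differentiable_onD(2)[OF f]) (auto intro!: inS x0U simp: pR mult.assoc)
    then show ?thesis unfolding blinfun_apply_integral[OF integrable_continuous[OF c]] by simp
  qed
  ultimately show "\<exists>D. ((\<lambda>x. frechet_derivative f (at x) v) has_derivative D) (at x0) \<and> (\<forall>c v. D (c *s v) = c * D v)"
    by blast
qed

text \<open>Complex differentiability at every point implies all orders of smoothness, since the
  derivative along a fixed vector is of the same kind. This supplies the regularity of the
  transition maps of a complex manifold.\<close>

lemma complex_differentiable_ck:
  assumes "open S" "complex_differentiable_on S f"
  shows "ck k S f"
  using assms(2)
proof (induction k arbitrary: f)
  case 0 then show ?case by (simp add: complex_differentiable_on_continuous)
next
  case (Suc k)
  show ?case
    by (rule ck_SucI[OF assms(1) complex_differentiable_onD(1)[OF Suc.prems]])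
       (auto intro: Suc.IH complex_differentiable_derivative assms Suc.prems)
qed

lemma holomorphic_map_component:
  assumes "holomorphic_map_on S F"
  shows "complex_differentiable_on S (\<lambda>x. F x $ i)"
  unfolding complex_differentiable_on_def
proof
  fix x assume "x \<in> S"
  then obtain D where "(F has_derivative D) (at x)" "\<And>c v. D (c *s v) = c *s D v"
    using assms unfolding holomorphic_map_on_def by metis
  then show "\<exists>D. ((\<lambda>x. F x $ i) has_derivative D) (at x) \<and> (\<forall>c v. D (c *s v) = c * D v)"
    by (intro exI[of _ "\<lambda>v. D v $ i"]) (auto intro: bounded_linear.has_derivative[OF bounded_linear_vec_nth])
qed

lemma ck_vec_lambda:
  fixes u :: "'a::real_normed_vector \<Rightarrow> 'b::real_normed_vector^'n::finite"
  assumes "open S" "\<And>i. ck k S (\<lambda>x. u x $ i)"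
  shows "ck k S u"
proof -
  have bl: "bounded_linear (\<lambda>y::'b. axis i y :: 'b^'n)" for i
  proof (rule bounded_linear_intro[where K=1])
    show "norm (axis i y :: 'b^'n) \<le> norm y * 1" for y :: 'b
      using L2_set_le_sum[of UNIV "\<lambda>j. norm ((axis i y :: 'b^'n) $ j)"]
      by (simp add: norm_vec_def axis_def if_distrib[of norm] cong: if_cong)
  qed (auto simp: vec_eq_iff axis_def)
  have "u x = (\<Sum>i\<in>UNIV. axis i (u x $ i))" for x
    by (simp add: vec_eq_iff axis_def if_distrib[where f="\<lambda>f. f _"] cong: if_cong)
  then have "u = (\<lambda>x. \<Sum>i\<in>UNIV. axis i (u x $ i))" by (rule ext)
  moreover have "ck k S (\<lambda>x. \<Sum>i\<in>UNIV. axis i (u x $ i))"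
    by (intro ck_sum assms ck_linear_compose[OF assms(1) bl])
  ultimately show ?thesis by simp
qed

lemma holomorphic_map_ck:
  assumes "open S" "holomorphic_map_on S F"
  shows "ck k S F"
  by (intro ck_vec_lambda complex_differentiable_ck assms holomorphic_map_component)

section \<open>Wirtinger derivatives\<close>

lemma d_dz_eq: "(u has_derivative D) (at x) \<Longrightarrow> d_dz \<alpha> u x = (D (axis \<alpha> 1) - \<i> * D (axis \<alpha> \<i>)) / 2"
  by (simp add: d_dz_def frechet_derivative_eqI)

lemma d_dzbar_eq: "(u has_derivative D) (at x) \<Longrightarrow> d_dzbar \<alpha> u x = (D (axis \<alpha> 1) + \<i> * D (axis \<alpha> \<i>)) / 2"
  by (simp add: d_dzbar_def frechet_derivative_eqI)

lemma wirtinger_cong: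
  assumes "open S" "x \<in> S" "\<And>y. y \<in> S \<Longrightarrow> u y = v y"
  shows "d_dz \<alpha> u x = d_dz \<alpha> v x" "d_dzbar \<alpha> u x = d_dzbar \<alpha> v x"
  by (simp_all add: d_dz_def d_dzbar_def frechet_derivative_cong[OF assms])

lemma wirtinger_const [simp]: "d_dz \<alpha> (\<lambda>x. c) x = 0" "d_dzbar \<alpha> (\<lambda>x. c) x = 0"
  by (simp_all add: d_dz_def d_dzbar_def)

lemma wirtinger_add:
  assumes "u differentiable at x" "v differentiable at x"
  shows "d_dz \<alpha> (\<lambda>x. u x + v x) x = d_dz \<alpha> u x + d_dz \<alpha> v x"
    "d_dzbar \<alpha> (\<lambda>x. u x + v x) x = d_dzbar \<alpha> u x + d_dzbar \<alpha> v x"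
  using has_derivative_add[OF assms[THEN differentiable_has_frechet]]
  by (simp_all add: d_dz_eq d_dzbar_eq, simp_all add: d_dz_def d_dzbar_def field_simps)

lemma wirtinger_mult:
  assumes "u differentiable at x" "v differentiable at x"
  shows "d_dz \<alpha> (\<lambda>x. u x * v x) x = u x * d_dz \<alpha> v x + d_dz \<alpha> u x * v x"
    "d_dzbar \<alpha> (\<lambda>x. u x * v x) x = u x * d_dzbar \<alpha> v x + d_dzbar \<alpha> u x * v x"
  using has_derivative_mult[OF assms[THEN differentiable_has_frechet]]
  by (simp_all add: d_dz_eq d_dzbar_eq, simp_all add: d_dz_def d_dzbar_def field_simps)

lemma wirtinger_sum:
  assumes "\<And>i. i \<in> I \<Longrightarrow> u i differentiable at x"
  shows "d_dz \<alpha> (\<lambda>x. \<Sum>i\<in>I. u i x) x = (\<Sum>i\<in>I. d_dz \<alpha> (u i) x)"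
    "d_dzbar \<alpha> (\<lambda>x. \<Sum>i\<in>I. u i x) x = (\<Sum>i\<in>I. d_dzbar \<alpha> (u i) x)"
proof -
  have "((\<lambda>x. \<Sum>i\<in>I. u i x) has_derivative (\<lambda>v. \<Sum>i\<in>I. frechet_derivative (u i) (at x) v)) (at x)"
    by (intro has_derivative_sum differentiable_has_frechet assms)
  from d_dz_eq[OF this] d_dzbar_eq[OF this]
  show "d_dz \<alpha> (\<lambda>x. \<Sum>i\<in>I. u i x) x = (\<Sum>i\<in>I. d_dz \<alpha> (u i) x)"
    "d_dzbar \<alpha> (\<lambda>x. \<Sum>i\<in>I. u i x) x = (\<Sum>i\<in>I. d_dzbar \<alpha> (u i) x)"
    by (simp_all add: d_dz_def d_dzbar_def sum_subtractf sum.distrib sum_distrib_left sum_divide_distrib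
        diff_divide_distrib add_divide_distrib)
qed

lemma wirtinger_cmult:
  assumes "u differentiable at x"
  shows "d_dz \<alpha> (\<lambda>x. c * u x) x = c * d_dz \<alpha> u x" "d_dzbar \<alpha> (\<lambda>x. c * u x) x = c * d_dzbar \<alpha> u x"
  using wirtinger_mult[of "\<lambda>x. c" x u \<alpha>] assms by simp_all

lemma wirtinger_cnj:
  assumes "u differentiable at x"
  shows "d_dz \<alpha> (\<lambda>x. cnj (u x)) x = cnj (d_dzbar \<alpha> u x)" "d_dzbar \<alpha> (\<lambda>x. cnj (u x)) x = cnj (d_dz \<alpha> u x)"
  using has_derivative_cnj[OF differentiable_has_frechet[OF assms]]
  by (simp_all add: d_dz_eq d_dzbar_eq, simp_all add: d_dz_def d_dzbar_def)

lemma wirtinger_of_real: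
  assumes "u differentiable at x"
  shows "d_dzbar \<alpha> (\<lambda>x. complex_of_real (u x)) x = cnj (d_dz \<alpha> (\<lambda>x. complex_of_real (u x)) x)"
proof -
  have "(\<lambda>x. complex_of_real (u x)) differentiable at x"
    using assms by (auto simp: differentiable_def intro: has_derivative_of_real)
  from wirtinger_cnj(2)[OF this, of \<alpha>] show ?thesis by simp
qed

lemma ck_wirtinger:
  assumes "open S" "ck (Suc k) S u"
  shows "ck k S (d_dz \<alpha> u)" "ck k S (d_dzbar \<alpha> u)"
proof -
  have *: "ck k S (\<lambda>x. frechet_derivative u (at x) v)" for v using assms(2) by simp
  have "ck k S (\<lambda>x. inverse 2 * (frechet_derivative u (at x) (axis \<alpha> 1) - \<i> * frechet_derivative u (at x) (axis \<alpha> \<i>)))"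
    by (intro ck_mult ck_const ck_diff assms(1) *)
  moreover have "d_dz \<alpha> u = (\<lambda>x. inverse 2 * (frechet_derivative u (at x) (axis \<alpha> 1) - \<i> * frechet_derivative u (at x) (axis \<alpha> \<i>)))"
    by (rule ext) (simp add: d_dz_def field_simps)
  ultimately show "ck k S (d_dz \<alpha> u)" by simp
  have "ck k S (\<lambda>x. inverse 2 * (frechet_derivative u (at x) (axis \<alpha> 1) + \<i> * frechet_derivative u (at x) (axis \<alpha> \<i>)))"
    by (intro ck_mult ck_const ck_add assms(1) *)
  moreover have "d_dzbar \<alpha> u = (\<lambda>x. inverse 2 * (frechet_derivative u (at x) (axis \<alpha> 1) + \<i> * frechet_derivative u (at x) (axis \<alpha> \<i>)))"
    by (rule ext) (simp add: d_dzbar_def field_simps)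
  ultimately show "ck k S (d_dzbar \<alpha> u)" by simp
qed

lemma ck_differentiable: "ck (Suc k) S u \<Longrightarrow> x \<in> S \<Longrightarrow> u differentiable at x"
  by simp

lemma wirtinger_commute:
  assumes "open S" "ck 2 S u" "x \<in> S"
  shows "d_dz \<alpha> (d_dzbar \<beta> u) x = d_dzbar \<beta> (d_dz \<alpha> u) x"
    and "d_dz \<alpha> (d_dz \<beta> u) x = d_dz \<beta> (d_dz \<alpha> u) x"
    and "d_dzbar \<alpha> (d_dzbar \<beta> u) x = d_dzbar \<beta> (d_dzbar \<alpha> u) x"
proof -
  define E where "E v = (\<lambda>y. frechet_derivative u (at y) v)" for v
  have E: "(E v has_derivative frechet_derivative (E v) (at x)) (at x)" for v
  proof (rule ck_has_derivative[of 0])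
    show "ck (Suc 0) S (E v)" using assms(2) by (simp add: E_def numeral_2_eq_2)
  qed fact
  have 1: "(d_dz \<alpha> u has_derivative (\<lambda>w. (frechet_derivative (E (axis \<alpha> 1)) (at x) w
      - \<i> * frechet_derivative (E (axis \<alpha> \<i>)) (at x) w) / 2)) (at x)" for \<alpha>
    unfolding d_dz_def[abs_def] E_def[symmetric]
    using E by (auto intro!: derivative_eq_intros simp: E_def)
  have 2: "(d_dzbar \<alpha> u has_derivative (\<lambda>w. (frechet_derivative (E (axis \<alpha> 1)) (at x) w
      + \<i> * frechet_derivative (E (axis \<alpha> \<i>)) (at x) w) / 2)) (at x)" for \<alpha>
    unfolding d_dzbar_def[abs_def] E_def[symmetric]
    using E by (auto intro!: derivative_eq_intros simp: E_def)
  have sym: "frechet_derivative (E v) (at x) w = frechet_derivative (E w) (at x) v" for v w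
    unfolding E_def by (rule second_derivative_symmetric[OF assms])
  show "d_dz \<alpha> (d_dzbar \<beta> u) x = d_dzbar \<beta> (d_dz \<alpha> u) x"
    and "d_dz \<alpha> (d_dz \<beta> u) x = d_dz \<beta> (d_dz \<alpha> u) x"
    and "d_dzbar \<alpha> (d_dzbar \<beta> u) x = d_dzbar \<beta> (d_dzbar \<alpha> u) x"
    unfolding d_dz_eq[OF 1] d_dz_eq[OF 2] d_dzbar_eq[OF 1] d_dzbar_eq[OF 2]
    by (simp_all add: sym[of "axis \<alpha> _" "axis \<beta> _"] field_simps)
qed

lemma complex_vec_real_expansion:
  fixes v :: "complex^'m::finite"
  shows "v = (\<Sum>\<alpha>\<in>UNIV. Re (v $ \<alpha>) *\<^sub>R axis \<alpha> 1 + Im (v $ \<alpha>) *\<^sub>R axis \<alpha> \<i>)"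
proof (subst vec_eq_iff, rule allI)
  fix i
  have "(\<Sum>\<alpha>\<in>UNIV. Re (v $ \<alpha>) *\<^sub>R axis \<alpha> 1 + Im (v $ \<alpha>) *\<^sub>R axis \<alpha> \<i>) $ i
      = (\<Sum>\<alpha>\<in>UNIV. if \<alpha> = i then Re (v $ \<alpha>) *\<^sub>R 1 + Im (v $ \<alpha>) *\<^sub>R \<i> else 0)"
    unfolding sum_component by (rule sum.cong) (auto simp: axis_def)
  also have "\<dots> = v $ i" by (simp add: complex_eq_iff)
  finally show "v $ i = (\<Sum>\<alpha>\<in>UNIV. Re (v $ \<alpha>) *\<^sub>R axis \<alpha> 1 + Im (v $ \<alpha>) *\<^sub>R axis \<alpha> \<i>) $ i" by simp
qed

lemma wirtinger_expansion:
  fixes u :: "complex^'m::finite \<Rightarrow> complex"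
  assumes "u differentiable at x"
  shows "frechet_derivative u (at x) v = (\<Sum>\<alpha>\<in>UNIV. d_dz \<alpha> u x * v $ \<alpha> + d_dzbar \<alpha> u x * cnj (v $ \<alpha>))"
proof -
  let ?D = "frechet_derivative u (at x)"
  have l: "linear ?D" using differentiable_has_frechet[OF assms] has_derivative_linear by blast
  have "?D v = ?D (\<Sum>\<alpha>\<in>UNIV. Re (v $ \<alpha>) *\<^sub>R axis \<alpha> 1 + Im (v $ \<alpha>) *\<^sub>R axis \<alpha> \<i>)"
    using complex_vec_real_expansion[of v] by simp
  also have "\<dots> = (\<Sum>\<alpha>\<in>UNIV. Re (v $ \<alpha>) * ?D (axis \<alpha> 1) + Im (v $ \<alpha>) * ?D (axis \<alpha> \<i>))"
    by (simp only: linear_sum[OF l] linear_add[OF l] linear_cmul[OF l]) (simp add: scaleR_conv_of_real)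
  also have "\<dots> = (\<Sum>\<alpha>\<in>UNIV. d_dz \<alpha> u x * v $ \<alpha> + d_dzbar \<alpha> u x * cnj (v $ \<alpha>))"
  proof (rule sum.cong[OF refl])
    have "of_real (Re c) * p + of_real (Im c) * q = (p - \<i> * q) / 2 * c + (p + \<i> * q) / 2 * cnj c" for c p q :: complex
      by (simp add: complex_eq_iff field_simps)
    then show "Re (v $ \<alpha>) * ?D (axis \<alpha> 1) + Im (v $ \<alpha>) * ?D (axis \<alpha> \<i>)
        = d_dz \<alpha> u x * v $ \<alpha> + d_dzbar \<alpha> u x * cnj (v $ \<alpha>)" for \<alpha>
      unfolding d_dz_def d_dzbar_def .
  qed
  finally show ?thesis .
qed

lemma real_vec_linear_expansion:
  fixes D :: "real^'n::finite \<Rightarrow> 'b::real_vector"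
  assumes "linear D"
  shows "D w = (\<Sum>k\<in>UNIV. (w $ k) *\<^sub>R D (axis k 1))"
proof -
  have "D w = D (\<Sum>k\<in>UNIV. (w $ k) *\<^sub>R axis k 1)"
    using basis_expansion[of w] by (simp add: scalar_mult_eq_scaleR)
  then show ?thesis by (simp add: linear_sum[OF assms] linear_cmul[OF assms])
qed

lemma frechet_compose_real_vec:
  fixes F :: "'a::real_normed_vector \<Rightarrow> real^'n::finite" and G :: "real^'n \<Rightarrow> real"
  assumes "F differentiable at x" "G differentiable at (F x)"
  shows "((\<lambda>x. G (F x)) has_derivative
      (\<lambda>v. \<Sum>k\<in>UNIV. partial_deriv k G (F x) * frechet_derivative F (at x) v $ k)) (at x)"
proof -
  have l: "linear (frechet_derivative G (at (F x)))"
    using differentiable_has_frechet[OF assms(2)] has_derivative_linear by blast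
  show ?thesis
    using has_derivative_compose[OF assms[THEN differentiable_has_frechet]]
    by (rule has_derivative_eq_rhs)
       (subst real_vec_linear_expansion[OF l], simp add: partial_deriv_def mult.commute)
qed

lemma wirtinger_chain_real:
  fixes F :: "complex^'m::finite \<Rightarrow> real^'n::finite" and G :: "real^'n \<Rightarrow> real"
  assumes "F differentiable at x" "G differentiable at (F x)"
  shows "d_dz \<alpha> (\<lambda>x. complex_of_real (G (F x))) x
      = (\<Sum>k\<in>UNIV. of_real (partial_deriv k G (F x)) * d_dz \<alpha> (\<lambda>x. complex_of_real (F x $ k)) x)" (is ?A)
    and "d_dzbar \<alpha> (\<lambda>x. complex_of_real (G (F x))) x
      = (\<Sum>k\<in>UNIV. of_real (partial_deriv k G (F x)) * d_dzbar \<alpha> (\<lambda>x. complex_of_real (F x $ k)) x)" (is ?B)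
proof -
  have 1: "((\<lambda>x. complex_of_real (G (F x))) has_derivative
      (\<lambda>v. of_real (\<Sum>k\<in>UNIV. partial_deriv k G (F x) * frechet_derivative F (at x) v $ k))) (at x)"
    by (rule has_derivative_of_real[OF frechet_compose_real_vec[OF assms]])
  have 2: "((\<lambda>x. complex_of_real (F x $ k)) has_derivative
      (\<lambda>v. of_real (frechet_derivative F (at x) v $ k))) (at x)" for k
    by (rule has_derivative_of_real[OF bounded_linear.has_derivative[OF bounded_linear_vec_nth
        differentiable_has_frechet[OF assms(1)]]])
  show ?A ?B
    unfolding d_dz_eq[OF 1] d_dz_eq[OF 2] d_dzbar_eq[OF 1] d_dzbar_eq[OF 2]
    by (simp_all add: sum_subtractf sum.distrib sum_distrib_left sum_divide_distrib algebra_simps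
        diff_divide_distrib add_divide_distrib)
qed

lemma wirtinger_holomorphic:
  assumes "complex_differentiable_on S f" "x \<in> S"
  shows "d_dzbar \<alpha> f x = 0" "d_dz \<alpha> f x = frechet_derivative f (at x) (axis \<alpha> 1)"
proof -
  have "axis \<alpha> \<i> = \<i> *s (axis \<alpha> 1 :: complex^'a)" by (simp add: vec_eq_iff axis_def)
  then have *: "frechet_derivative f (at x) (axis \<alpha> \<i>) = \<i> * frechet_derivative f (at x) (axis \<alpha> 1)"
    using complex_differentiable_onD(2)[OF assms] by simp
  show "d_dzbar \<alpha> f x = 0" "d_dz \<alpha> f x = frechet_derivative f (at x) (axis \<alpha> 1)"
    by (simp_all add: d_dz_def d_dzbar_def *)
qed

lemma wirtinger_chain_holomorphic:
  fixes T :: "complex^'m::finite \<Rightarrow> complex^'k::finite"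
  assumes T: "holomorphic_map_on S T" and x: "x \<in> S" and u: "u differentiable at (T x)"
  shows "d_dz \<alpha> (\<lambda>x. u (T x)) x = (\<Sum>\<gamma>\<in>UNIV. d_dz \<gamma> u (T x) * d_dz \<alpha> (\<lambda>x. T x $ \<gamma>) x)"
    and "d_dzbar \<alpha> (\<lambda>x. u (T x)) x = (\<Sum>\<gamma>\<in>UNIV. d_dzbar \<gamma> u (T x) * cnj (d_dz \<alpha> (\<lambda>x. T x $ \<gamma>) x))"
proof -
  obtain D where D: "(T has_derivative D) (at x)" "\<And>c v. D (c *s v) = c *s D v"
    using T x unfolding holomorphic_map_on_def by metis
  have Dk: "((\<lambda>x. T x $ \<gamma>) has_derivative (\<lambda>v. D v $ \<gamma>)) (at x)" for \<gamma>
    by (rule bounded_linear.has_derivative[OF bounded_linear_vec_nth D(1)])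
  have J: "d_dz \<alpha> (\<lambda>x. T x $ \<gamma>) x = D (axis \<alpha> 1) $ \<gamma>" for \<gamma>
    unfolding wirtinger_holomorphic(2)[OF holomorphic_map_component[OF T] x] frechet_derivative_eqI[OF Dk] ..
  have ai: "D (axis \<alpha> \<i>) = \<i> *s D (axis \<alpha> 1)"
  proof -
    have "axis \<alpha> \<i> = \<i> *s (axis \<alpha> 1 :: complex^'m)" by (simp add: vec_eq_iff axis_def)
    then show ?thesis by (simp add: D(2))
  qed
  have c: "((\<lambda>x. u (T x)) has_derivative (\<lambda>v. \<Sum>\<gamma>\<in>UNIV. d_dz \<gamma> u (T x) * D v $ \<gamma> + d_dzbar \<gamma> u (T x) * cnj (D v $ \<gamma>))) (at x)"
    using has_derivative_compose[OF D(1) differentiable_has_frechet[OF u]]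
    by (simp add: wirtinger_expansion[OF u])
  show "d_dz \<alpha> (\<lambda>x. u (T x)) x = (\<Sum>\<gamma>\<in>UNIV. d_dz \<gamma> u (T x) * d_dz \<alpha> (\<lambda>x. T x $ \<gamma>) x)"
    and "d_dzbar \<alpha> (\<lambda>x. u (T x)) x = (\<Sum>\<gamma>\<in>UNIV. d_dzbar \<gamma> u (T x) * cnj (d_dz \<alpha> (\<lambda>x. T x $ \<gamma>) x))"
    unfolding d_dz_eq[OF c] d_dzbar_eq[OF c] ai J
    by (simp_all add: sum_subtractf[symmetric] sum.distrib[symmetric] sum_distrib_left sum_divide_distrib algebra_simps
        diff_divide_distrib add_divide_distrib)
qed

text \<open>No second derivatives of T survive: \<partial> applied to the conjugate of \<partial>T
  is the conjugate of \<partial>bar \<partial>T, which vanishes. Hence the complex Hessian, unlike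
  the full one, is a tensor under holomorphic changes of coordinates.\<close>

lemma wirtinger_hessian_holomorphic:
  fixes T :: "complex^'m::finite \<Rightarrow> complex^'k::finite"
  assumes S: "open S" and V: "open V" and T: "holomorphic_map_on S T" "T ` S \<subseteq> V" and x: "x \<in> S" and u: "ck 2 V u"
  shows "d_dz \<alpha> (d_dzbar \<beta> (\<lambda>x. u (T x))) x = (\<Sum>\<gamma>\<in>UNIV. \<Sum>\<delta>\<in>UNIV. d_dz \<gamma> (d_dzbar \<delta> u) (T x)
      * d_dz \<alpha> (\<lambda>x. T x $ \<gamma>) x * cnj (d_dz \<beta> (\<lambda>x. T x $ \<delta>) x))"
proof -
  have u': "ck (Suc 0) V u" "ck (Suc 0) V (d_dzbar \<delta> u)" for \<delta>
    using u V by (auto intro!: ck_wirtinger ck_le[OF u] simp del: continuously_differentiable_on.simps simp: numeral_2_eq_2)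
  have TV: "y \<in> S \<Longrightarrow> T y \<in> V" for y using T(2) by auto
  have cT: "ck 2 S (\<lambda>x. T x $ \<delta>)" for \<delta>
    by (rule complex_differentiable_ck[OF S holomorphic_map_component[OF T(1)]])
  have cT': "ck (Suc 0) S (d_dz \<beta> (\<lambda>x. T x $ \<delta>))" for \<beta> \<delta>
    by (rule ck_wirtinger[OF S]) (use cT in \<open>simp del: continuously_differentiable_on.simps add: numeral_2_eq_2\<close>)
  have d1: "(\<lambda>x. d_dzbar \<delta> u (T x)) differentiable at x" for \<delta>
  proof (rule ck_differentiable[of 0 S])
    show "ck (Suc 0) S (\<lambda>x. d_dzbar \<delta> u (T x))"
      by (rule ck_compose[OF S V T(2) holomorphic_map_ck[OF S T(1)] u'(2)])
  qed fact
  have d2: "(\<lambda>x. cnj (d_dz \<beta> (\<lambda>x. T x $ \<delta>) x)) differentiable at x" for \<beta> \<delta>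
    by (rule ck_differentiable[OF ck_cnj[OF S cT'] x])
  have z: "d_dz \<alpha> (\<lambda>x. cnj (d_dz \<beta> (\<lambda>x. T x $ \<delta>) x)) x = 0" for \<delta>
  proof -
    have "d_dz \<alpha> (\<lambda>x. cnj (d_dz \<beta> (\<lambda>x. T x $ \<delta>) x)) x = cnj (d_dzbar \<alpha> (d_dz \<beta> (\<lambda>x. T x $ \<delta>)) x)"
      by (rule wirtinger_cnj(1)[OF ck_differentiable[OF cT' x]])
    also have "d_dzbar \<alpha> (d_dz \<beta> (\<lambda>x. T x $ \<delta>)) x = d_dz \<beta> (d_dzbar \<alpha> (\<lambda>x. T x $ \<delta>)) x"
      by (rule wirtinger_commute(1)[OF S cT x, symmetric])
    also have "\<dots> = d_dz \<beta> (\<lambda>x. 0) x"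
      by (rule wirtinger_cong(1)[OF S x]) (rule wirtinger_holomorphic(1)[OF holomorphic_map_component[OF T(1)]])
    finally show ?thesis by simp
  qed
  have "d_dz \<alpha> (d_dzbar \<beta> (\<lambda>x. u (T x))) x
     = d_dz \<alpha> (\<lambda>x. \<Sum>\<delta>\<in>UNIV. d_dzbar \<delta> u (T x) * cnj (d_dz \<beta> (\<lambda>x. T x $ \<delta>) x)) x"
    by (rule wirtinger_cong(1)[OF S x])
       (rule wirtinger_chain_holomorphic(2)[OF T(1)], auto intro!: ck_differentiable[OF u'(1)] TV)
  also have "\<dots> = (\<Sum>\<delta>\<in>UNIV. d_dz \<alpha> (\<lambda>x. d_dzbar \<delta> u (T x)) x * cnj (d_dz \<beta> (\<lambda>x. T x $ \<delta>) x))"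
    by (subst wirtinger_sum(1)) (auto intro!: differentiable_mult d1 d2 simp: wirtinger_mult(1)[OF d1 d2] z)
  also have "\<dots> = (\<Sum>\<delta>\<in>UNIV. (\<Sum>\<gamma>\<in>UNIV. d_dz \<gamma> (d_dzbar \<delta> u) (T x) * d_dz \<alpha> (\<lambda>x. T x $ \<gamma>) x) * cnj (d_dz \<beta> (\<lambda>x. T x $ \<delta>) x))"
    by (subst wirtinger_chain_holomorphic(1)[OF T(1) x]) (auto intro!: ck_differentiable[OF u'(2)] TV x)
  also have "\<dots> = (\<Sum>\<gamma>\<in>UNIV. \<Sum>\<delta>\<in>UNIV. d_dz \<gamma> (d_dzbar \<delta> u) (T x)
      * d_dz \<alpha> (\<lambda>x. T x $ \<gamma>) x * cnj (d_dz \<beta> (\<lambda>x. T x $ \<delta>) x))"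
    by (simp add: sum_distrib_right, rule sum.swap)
  finally show ?thesis .
qed

section \<open>Determinants and mixed minors\<close>

text \<open>Conjugation by a bijection preserves signs. This moves Leibniz sums between index sets:
  from a block to the whole matrix, from one index type to another, and from matrix indices to list
  positions.\<close>

lemma sum_permutations_map:
  assumes "bij_betw f A B" "finite A"
  shows "(\<Sum>p | p permutes B. of_int (sign p) * G p)
       = (\<Sum>p | p permutes A. of_int (sign p) * (G (map_permutation A f p) :: 'c::comm_ring_1))"
proof (rule sum.reindex_bij_witness[where i="map_permutation A f" and j="map_permutation B (inv_into A f)"])
  have B: "finite B" using assms bij_betw_finite by blast
  have inv: "bij_betw (inv_into A f) B A" by (rule bij_betw_inv_into[OF assms(1)])
  have l: "inv_into A f (f x) = x" if "x \<in> A" for x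
    using assms(1) that by (simp add: bij_betw_def)
  have r: "f (inv_into A f y) = y" if "y \<in> B" for y
    using assms(1) that by (simp add: bij_betw_def f_inv_into_f)
  fix p assume p: "p \<in> {p. p permutes B}"
  then have pB: "p permutes B" by simp
  show *: "map_permutation A f (map_permutation B (inv_into A f) p) = p"
    by (rule map_permutation_compose_inv[OF inv pB r])
  show pA: "map_permutation B (inv_into A f) p \<in> {p. p permutes A}"
    using map_permutation_permutes[OF inv pB] by simp
  show "of_int (sign (map_permutation B (inv_into A f) p)) * G (map_permutation A f (map_permutation B (inv_into A f) p))
     = of_int (sign p) * G p"
    unfolding * using sign_map_permutation[OF _ pB B, of "inv_into A f"] inv by (simp add: bij_betw_def)
next
  fix p assume "p \<in> {p. p permutes A}"
  then have pA: "p permutes A" by simp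
  show "map_permutation B (inv_into A f) (map_permutation A f p) = p"
    by (rule map_permutation_compose_inv[OF assms(1) pA]) (use assms(1) in \<open>simp add: bij_betw_def\<close>)
  show "map_permutation A f p \<in> {p. p permutes B}"
    using map_permutation_permutes[OF assms(1) pA] by simp
qed

section \<open>Determinants of block matrices and the passage between real and Wirtinger
  coordinates\<close>

definition block_embed :: "bool \<Rightarrow> 'a^'m^'m \<Rightarrow> 'a::comm_ring_1^('m::finite\<times>bool)^('m\<times>bool)" where
  "block_embed s c = (\<chi> i j. if snd i = s \<and> snd j = s then c $ fst i $ fst j else if i = j then 1 else 0)"

definition block_diag :: "'a^'m^'m \<Rightarrow> 'a^'m^'m \<Rightarrow> 'a::comm_ring_1^('m::finite\<times>bool)^('m\<times>bool)" where
  "block_diag a b = (\<chi> i j. if snd i = snd j then (if snd i then b else a) $ fst i $ fst j else 0)"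

text \<open>A permutation that moves an index outside the block meets an off-diagonal zero of the
  identity part; the remaining permutations are those of the block.\<close>

lemma det_block_embed: "det (block_embed s c) = det (c :: 'a::comm_ring_1^'m::finite^'m)"
proof -
  let ?F = "UNIV \<times> {s} :: ('m \<times> bool) set"
  let ?e = "\<lambda>k::'m. (k, s)"
  have e: "bij_betw ?e UNIV ?F" by (auto simp: bij_betw_def inj_on_def)
  have ie: "inj ?e" by (simp add: inj_on_def)
  let ?t = "\<lambda>p. (\<Prod>i\<in>UNIV. block_embed s c $ i $ p i)"
  have "det (block_embed s c) = (\<Sum>p | p permutes UNIV. of_int (sign p) * ?t p)"
    by (simp add: det_def)
  also have "\<dots> = (\<Sum>p | p permutes ?F. of_int (sign p) * ?t p)"
  proof (rule sum.mono_neutral_right)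
    show "{p. p permutes ?F} \<subseteq> {p. p permutes UNIV}" by (auto intro: permutes_subset)
    show "\<forall>p\<in>{p. p permutes UNIV} - {p. p permutes ?F}. of_int (sign p) * ?t p = 0"
    proof
      fix p assume p: "p \<in> {p. p permutes UNIV} - {p. p permutes ?F}"
      then have "bij p" using permutes_bij by auto
      have "\<exists>i. i \<notin> ?F \<and> p i \<noteq> i"
      proof (rule ccontr)
        assume "\<not> ?thesis"
        then have "p permutes ?F" using p by (auto simp: permutes_def)
        then show False using p by simp
      qed
      then obtain i where i: "i \<notin> ?F" "p i \<noteq> i" by blast
      then have "block_embed s c $ i $ p i = 0" by (cases i) (auto simp: block_embed_def)
      then have "?t p = 0" by (intro prod_zero[OF finite]) blast
      then show "of_int (sign p) * ?t p = 0" by simp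
    qed
  qed simp
  also have "\<dots> = (\<Sum>p | p permutes UNIV. of_int (sign p) * ?t (map_permutation UNIV ?e p))"
    by (rule sum_permutations_map[OF e]) simp
  also have "\<dots> = (\<Sum>p | p permutes UNIV. of_int (sign p) * (\<Prod>k\<in>UNIV. c $ k $ p k))"
  proof (rule sum.cong[OF refl])
    fix p :: "'m \<Rightarrow> 'm" assume "p \<in> {p. p permutes UNIV}"
    let ?p = "map_permutation UNIV ?e p"
    have "?p permutes ?F" using \<open>p \<in> _\<close> map_permutation_permutes[OF e] by simp
    have "?t ?p = (\<Prod>i\<in>?F. block_embed s c $ i $ ?p i)"
    proof (rule prod.mono_neutral_right)
      show "\<forall>i\<in>UNIV - ?F. block_embed s c $ i $ ?p i = 1"
        using permutes_not_in[OF \<open>?p permutes ?F\<close>] by (auto simp: block_embed_def)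
    qed auto
    also have "\<dots> = (\<Prod>k\<in>UNIV. block_embed s c $ ?e k $ ?p (?e k))"
      using prod.reindex_bij_betw[OF e, of "\<lambda>i. block_embed s c $ i $ ?p i"] by simp
    also have "\<dots> = (\<Prod>k\<in>UNIV. c $ k $ p k)"
      by (simp add: map_permutation_apply[OF ie] block_embed_def)
    finally show "of_int (sign p) * ?t ?p = of_int (sign p) * (\<Prod>k\<in>UNIV. c $ k $ p k)" by simp
  qed
  also have "\<dots> = det c" by (simp add: det_def)
  finally show ?thesis .
qed

lemma sum_prod_bool:
  "(\<Sum>t\<in>(UNIV::('m::finite\<times>bool) set). f t) = (\<Sum>k\<in>UNIV. f (k, False) + f (k, True))"
proof -
  have "(\<Sum>t\<in>(UNIV::('m\<times>bool) set). f t) = (\<Sum>k\<in>UNIV. \<Sum>s\<in>UNIV. f (k, s))"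
    by (simp add: sum.cartesian_product UNIV_Times_UNIV[symmetric] del: UNIV_Times_UNIV)
  then show ?thesis by (simp add: UNIV_bool)
qed

lemma prod_prod_bool:
  "(\<Prod>t\<in>(UNIV::('m::finite\<times>bool) set). f t) = (\<Prod>k\<in>UNIV. f (k, False) * f (k, True))"
proof -
  have "(\<Prod>t\<in>(UNIV::('m\<times>bool) set). f t) = (\<Prod>k\<in>UNIV. \<Prod>s\<in>UNIV. f (k, s))"
    by (simp add: prod.cartesian_product UNIV_Times_UNIV[symmetric] del: UNIV_Times_UNIV)
  then show ?thesis by (simp add: UNIV_bool)
qed

lemma block_diag_eq: "block_diag a b = block_embed False a ** block_embed True b"
proof -
  have "block_diag a b $ (i,s) $ (j,t) = (block_embed False a ** block_embed True b) $ (i,s) $ (j,t)" for i s j t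
    by (cases s; cases t) (simp_all add: block_diag_def block_embed_def matrix_matrix_mult_def sum_prod_bool
        if_distrib[of "\<lambda>x. x * _"] if_distrib[of "\<lambda>x. _ * x"] cong: if_cong)
  then show ?thesis by (simp add: vec_eq_iff)
qed

lemma det_block_diag: "det (block_diag a b) = det a * det (b :: 'a::comm_ring_1^'m::finite^'m)"
  by (simp add: block_diag_eq det_mul det_block_embed)

text \<open>Rows: \<open>dz\<^sup>k\<close> and its conjugate; columns: the real coordinate directions.\<close>

definition wirtinger_matrix :: "complex^('m::finite\<times>bool)^('m\<times>bool)" where
  "wirtinger_matrix = (\<chi> i j. if fst i = fst j then (if snd j then (if snd i then - \<i> else \<i>) else 1) else 0)"

lemma det_wirtinger_matrix: "det (wirtinger_matrix :: complex^('m::finite\<times>bool)^('m\<times>bool)) \<noteq> 0"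
proof -
  \<comment> \<open>The inverse expresses x = (z + zbar) / 2 and y = (z - zbar) / (2 i).\<close>
  define V :: "complex^('m\<times>bool)^('m\<times>bool)" where
    "V = (\<chi> i j. if fst i = fst j then (if snd i then (if snd j then \<i> else - \<i>) else 1) / 2 else 0)"
  have "(wirtinger_matrix ** V) $ (i,s) $ (j,t) = mat 1 $ (i,s) $ (j,t)" for i j s t
    by (cases s; cases t) (simp_all add: wirtinger_matrix_def V_def matrix_matrix_mult_def mat_def sum_prod_bool
       if_distrib[of "\<lambda>x. x * _"] if_distrib[of "\<lambda>x. _ * x"] sum.distrib cong: if_cong)
  then have "wirtinger_matrix ** V = mat 1" by (simp add: vec_eq_iff)
  then have "det (wirtinger_matrix :: complex^('m\<times>bool)^('m\<times>bool)) * det V = 1" by (metis det_I det_mul)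
  then show ?thesis by auto
qed

section \<open>Selection matrices, whose determinants are the Levi-Civita symbols, and mixed
  minors\<close>

definition select_matrix :: "('m \<Rightarrow> 'm) \<Rightarrow> 'a::comm_ring_1^'m::finite^'m" where
  "select_matrix a = (\<chi> i j. if a i = j then 1 else 0)"

lemma select_matrix_mult: "select_matrix a ** H = (\<chi> i. H $ a i)"
  by (simp add: vec_eq_iff select_matrix_def matrix_matrix_mult_def if_distrib[of "\<lambda>x. x * _"] cong: if_cong)

lemma det_select_not_inj:
  assumes "\<not> inj a" shows "det (select_matrix a) = 0"
proof -
  obtain i j where "i \<noteq> j" "a i = a j" using assms by (auto simp: inj_on_def)
  then show ?thesis by (intro det_identical_rows[of i j]) (auto simp: select_matrix_def row_def)
qed

lemma det_select_square:
  assumes "inj (a :: 'm::finite \<Rightarrow> 'm)" shows "det (select_matrix a :: 'a::comm_ring_1^'m^'m) * det (select_matrix a) = 1"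
proof -
  have "a permutes UNIV" using assms
    by (intro bij_imp_permutes) (auto simp: bij_def finite_UNIV_inj_surj)
  have "(select_matrix a :: 'a^'m^'m) = (\<chi> i. (mat 1 :: 'a^'m^'m) $ a i)"
    by (simp add: vec_eq_iff select_matrix_def mat_def)
  then have "det (select_matrix a :: 'a^'m^'m) = of_int (sign a) * det (mat 1 :: 'a^'m^'m)"
    using det_permute_rows[OF \<open>a permutes UNIV\<close>, of "mat 1 :: 'a^'m^'m"] by simp
  then show ?thesis by (simp add: sign_idempotent flip: of_int_mult)
qed

definition slots :: "'m \<Rightarrow> 'm \<Rightarrow> 'm \<Rightarrow> 'm \<Rightarrow> ('m \<Rightarrow> 'm) \<Rightarrow> 'm \<Rightarrow> 'm" where
  "slots s0 s1 \<alpha> \<gamma> a = (\<lambda>i. if i = s0 then \<alpha> else if i = s1 then \<gamma> else a i)"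

text \<open>Contraction of two Levi-Civita symbols over all but two indices, a generalized Kronecker
  delta. N counts the ways to complete two distinct values to a permutation; relabelling shows that
  the count is the same for all pairs.\<close>

lemma select_sum_two_slots:
  fixes s0 s1 :: "'m::finite"
  assumes ne: "s0 \<noteq> s1"
  obtains N :: nat where "N \<noteq> 0"
    "\<And>\<alpha> \<gamma> \<mu> \<nu>. (\<Sum>a\<in>PiE (UNIV - {s0,s1}) (\<lambda>_. UNIV). det (select_matrix (slots s0 s1 \<alpha> \<gamma> a)) * det (select_matrix (slots s0 s1 \<mu> \<nu> a)))
      = of_nat N * ((if \<alpha> = \<mu> \<and> \<gamma> = \<nu> then 1 else 0) - (if \<alpha> = \<nu> \<and> \<gamma> = \<mu> then 1 else 0) :: complex)"
proof -
  let ?P = "PiE (UNIV - {s0,s1}) (\<lambda>_. UNIV) :: ('m \<Rightarrow> 'm) set"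
  let ?s = "slots s0 s1"
  let ?d = "\<lambda>a. det (select_matrix a :: complex^'m^'m)"
  define f where "f \<alpha> \<gamma> = card {a \<in> ?P. inj (?s \<alpha> \<gamma> a)}" for \<alpha> \<gamma>
  have fin: "finite ?P" by (simp add: finite_PiE)
  have sq: "(\<Sum>a\<in>?P. ?d (?s \<alpha> \<gamma> a) * ?d (?s \<alpha> \<gamma> a)) = of_nat (f \<alpha> \<gamma>)" for \<alpha> \<gamma>
  proof -
    have "(\<Sum>a\<in>?P. ?d (?s \<alpha> \<gamma> a) * ?d (?s \<alpha> \<gamma> a)) = (\<Sum>a\<in>?P. if inj (?s \<alpha> \<gamma> a) then 1 else 0)"
      by (rule sum.cong) (auto simp: det_select_square det_select_not_inj)
    also have "\<dots> = of_nat (f \<alpha> \<gamma>)" by (simp add: sum.If_cases[OF fin] f_def Int_def)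
    finally show ?thesis .
  qed
  have le: "f \<alpha> \<gamma> \<le> f \<alpha>' \<gamma>'" if "\<alpha> \<noteq> \<gamma>" "\<alpha>' \<noteq> \<gamma>'" for \<alpha> \<gamma> \<alpha>' \<gamma>'
  proof -
    \<comment> \<open>\<pi> is to carry \<alpha> to \<alpha>' and \<gamma> to \<gamma>'. The first
      transposition leaves \<gamma> at X; the second moves X to \<gamma>' without touching
      \<alpha>'.\<close>
    define X where "X = Transposition.transpose \<alpha> \<alpha>' \<gamma>"
    define \<pi> where "\<pi> = Transposition.transpose X \<gamma>' \<circ> Transposition.transpose \<alpha> \<alpha>'"
    have X: "X \<noteq> \<alpha>'" using that by (auto simp: X_def Transposition.transpose_def split: if_splits)
    have \<pi>: "inj \<pi>" "\<pi> \<alpha> = \<alpha>'" "\<pi> \<gamma> = \<gamma>'"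
      using X that by (auto simp: \<pi>_def X_def[symmetric] intro!: inj_compose)
    show ?thesis unfolding f_def
    proof (rule card_inj_on_le[where f="\<lambda>a. restrict (\<pi> \<circ> a) (UNIV - {s0,s1})"])
      show "inj_on (\<lambda>a. restrict (\<pi> \<circ> a) (UNIV - {s0,s1})) {a \<in> ?P. inj (?s \<alpha> \<gamma> a)}"
      proof (rule inj_onI)
        fix a b assume a: "a \<in> {a \<in> ?P. inj (?s \<alpha> \<gamma> a)}" "b \<in> {a \<in> ?P. inj (?s \<alpha> \<gamma> a)}"
          and eq: "restrict (\<pi> \<circ> a) (UNIV - {s0,s1}) = restrict (\<pi> \<circ> b) (UNIV - {s0,s1})"
        show "a = b"
        proof (rule PiE_ext)
          show "a \<in> ?P" "b \<in> ?P" using a by auto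
          fix i assume "i \<in> UNIV - {s0,s1}"
          then show "a i = b i" using fun_cong[OF eq, of i] injD[OF \<pi>(1)] by simp
        qed
      qed
      show "(\<lambda>a. restrict (\<pi> \<circ> a) (UNIV - {s0,s1})) ` {a \<in> ?P. inj (?s \<alpha> \<gamma> a)} \<subseteq> {a \<in> ?P. inj (?s \<alpha>' \<gamma>' a)}"
      proof safe
        fix a assume "inj (?s \<alpha> \<gamma> a)"
        have "?s \<alpha>' \<gamma>' (restrict (\<pi> \<circ> a) (UNIV - {s0,s1})) = \<pi> \<circ> ?s \<alpha> \<gamma> a"
          using \<pi> by (auto simp: slots_def fun_eq_iff)
        then show "inj (?s \<alpha>' \<gamma>' (restrict (\<pi> \<circ> a) (UNIV - {s0,s1})))"
          using inj_compose[OF \<pi>(1) \<open>inj (?s \<alpha> \<gamma> a)\<close>] by simp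
      qed auto
      show "finite {a \<in> ?P. inj (?s \<alpha>' \<gamma>' a)}" using fin by simp
    qed
  qed
  have swap: "?d (?s \<gamma> \<alpha> a) = - ?d (?s \<alpha> \<gamma> a)" for \<alpha> \<gamma> a
  proof -
    let ?t = "Transposition.transpose s0 s1"
    have "?d (\<lambda>i. ?s \<alpha> \<gamma> a (?t i)) = of_int (sign ?t) * ?d (?s \<alpha> \<gamma> a)"
      using det_permute_rows[of ?t "select_matrix (?s \<alpha> \<gamma> a) :: complex^'m^'m"] permutes_swap_id[of s0 UNIV s1]
      by (simp add: select_matrix_def)
    moreover have "(\<lambda>i. ?s \<alpha> \<gamma> a (?t i)) = ?s \<gamma> \<alpha> a"
      using ne by (auto simp: slots_def fun_eq_iff Transposition.transpose_def)
    ultimately show ?thesis using ne by (simp add: sign_swap_id)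
  qed
  have main: "(\<Sum>a\<in>?P. ?d (?s \<alpha> \<gamma> a) * ?d (?s \<mu> \<nu> a))
      = of_nat (f s0 s1) * ((if \<alpha> = \<mu> \<and> \<gamma> = \<nu> then 1 else 0) - (if \<alpha> = \<nu> \<and> \<gamma> = \<mu> then 1 else 0))" for \<alpha> \<gamma> \<mu> \<nu>
  proof -
    have eqz: "?d (?s \<alpha> \<alpha> a) = 0" for \<alpha> a
    proof (rule det_select_not_inj)
      show "\<not> inj (?s \<alpha> \<alpha> a)" using ne injD[of "?s \<alpha> \<alpha> a" s0 s1] by (auto simp: slots_def)
    qed
    have fN: "f \<alpha> \<gamma> = f s0 s1" if "\<alpha> \<noteq> \<gamma>" for \<alpha> \<gamma>
      using le[OF that ne] le[OF ne that] by simp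
    consider "\<alpha> = \<gamma>" | "\<mu> = \<nu>" | "\<alpha> \<noteq> \<gamma>" "\<alpha> = \<mu>" "\<gamma> = \<nu>" | "\<alpha> \<noteq> \<gamma>" "\<alpha> = \<nu>" "\<gamma> = \<mu>"
      | "\<alpha> \<noteq> \<gamma>" "\<mu> \<noteq> \<nu>" "{\<alpha>,\<gamma>} \<noteq> {\<mu>,\<nu>}" by fastforce
    then show ?thesis
    proof cases
      case 3 then show ?thesis using sq[of \<alpha> \<gamma>] fN by simp
    next
      case 4
      then have "(\<Sum>a\<in>?P. ?d (?s \<alpha> \<gamma> a) * ?d (?s \<mu> \<nu> a)) = - (\<Sum>a\<in>?P. ?d (?s \<alpha> \<gamma> a) * ?d (?s \<alpha> \<gamma> a))"
        unfolding 4(2,3)[symmetric] swap[of \<gamma> \<alpha>] by (simp add: sum_negf)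
      then show ?thesis using sq[of \<alpha> \<gamma>] fN 4 by auto
    next
      case 5
      \<comment> \<open>If both determinants were nonzero, both completed functions would be
        bijections and each pair would be the complement of the image of a; but the two pairs
        differ.\<close>
      have "?d (?s \<alpha> \<gamma> a) * ?d (?s \<mu> \<nu> a) = 0" for a
      proof (rule ccontr)
        assume "\<not> ?thesis"
        then have nz: "?d (?s \<alpha> \<gamma> a) \<noteq> 0" "?d (?s \<mu> \<nu> a) \<noteq> 0" by simp_all
        have i: "inj (?s \<alpha> \<gamma> a)" "inj (?s \<mu> \<nu> a)"
          using nz(1) det_select_not_inj[of "?s \<alpha> \<gamma> a"] nz(2) det_select_not_inj[of "?s \<mu> \<nu> a"] by blast+
        then have s: "surj (?s \<alpha> \<gamma> a)" "surj (?s \<mu> \<nu> a)" by (simp_all add: finite_UNIV_inj_surj)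
        have img: "range (?s \<alpha> \<gamma> a) = {\<alpha>,\<gamma>} \<union> a ` (UNIV - {s0,s1})" for \<alpha> \<gamma>
        proof -
          have "UNIV = {s0,s1} \<union> (UNIV - {s0,s1})" by auto
          then have "range (?s \<alpha> \<gamma> a) = ?s \<alpha> \<gamma> a ` {s0,s1} \<union> ?s \<alpha> \<gamma> a ` (UNIV - {s0,s1})"
            by (metis image_Un)
          also have "?s \<alpha> \<gamma> a ` (UNIV - {s0,s1}) = a ` (UNIV - {s0,s1})"
            by (rule image_cong) (auto simp: slots_def)
          finally show ?thesis using ne by (simp add: slots_def insert_commute)
        qed
        have dis: "{\<alpha>,\<gamma>} \<inter> a ` (UNIV - {s0,s1}) = {}" if "inj (?s \<alpha> \<gamma> a)" for \<alpha> \<gamma>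
        proof -
          have "a i \<noteq> \<alpha> \<and> a i \<noteq> \<gamma>" if "i \<in> UNIV - {s0,s1}" for i
          proof -
            have v: "?s \<alpha> \<gamma> a i = a i" "?s \<alpha> \<gamma> a s0 = \<alpha>" "?s \<alpha> \<gamma> a s1 = \<gamma>" using that ne by (auto simp: slots_def)
            show ?thesis
              using that injD[OF \<open>inj (?s \<alpha> \<gamma> a)\<close>, of i s0] injD[OF \<open>inj (?s \<alpha> \<gamma> a)\<close>, of i s1]
              unfolding v by blast
          qed
          then show ?thesis by auto
        qed
        have comp: "A = UNIV - B" if "A \<union> B = UNIV" "A \<inter> B = {}" for A B :: "'m set"
          using that by blast
        have "{\<alpha>,\<gamma>} = UNIV - a ` (UNIV - {s0,s1})"
          by (rule comp[OF _ dis[OF i(1)]]) (simp only: img[symmetric] s)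
        moreover have "{\<mu>,\<nu>} = UNIV - a ` (UNIV - {s0,s1})"
          by (rule comp[OF _ dis[OF i(2)]]) (simp only: img[symmetric] s)
        ultimately show False using 5(3) by simp
      qed
      moreover have "\<not> (\<alpha> = \<mu> \<and> \<gamma> = \<nu>)" "\<not> (\<alpha> = \<nu> \<and> \<gamma> = \<mu>)" using 5 by auto
      ultimately show ?thesis by (simp only: sum.neutral_const if_False) simp
    next
      case 1 then show ?thesis unfolding 1 eqz by auto
    next
      case 2 then show ?thesis unfolding 2 eqz by auto
    qed
  qed
  have "f s0 s1 \<noteq> 0"
  proof -
    have "restrict id (UNIV - {s0,s1}) \<in> {a \<in> ?P. inj (?s s0 s1 a)}"
    proof -
      have "?s s0 s1 (restrict id (UNIV - {s0,s1})) = id" by (auto simp: slots_def fun_eq_iff)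
      then show ?thesis by simp
    qed
    then have "{a \<in> ?P. inj (?s s0 s1 a)} \<noteq> {}" by blast
    then show ?thesis unfolding f_def using fin by (simp add: card_eq_0_iff del: Collect_empty_eq)
  qed
  with main show thesis using that by blast
qed

text \<open>Up to constants, the coefficient of dz^\<alpha> \<and> dzbar^\<beta> \<and> dz^\<gamma>
  \<and> dzbar^\<delta> \<and> \<omega>^(m-2). The function a lists the holomorphic indices taken
  from the m - 2 factors \<omega>, while s0 and s1 hold the places of the four explicit covectors.
  The expression is polynomial in H.\<close>

definition mixed_minor :: "'m \<Rightarrow> 'm \<Rightarrow> complex^'m^'m \<Rightarrow> 'm \<Rightarrow> 'm \<Rightarrow> 'm \<Rightarrow> 'm \<Rightarrow> complex" where
  "mixed_minor s0 s1 H \<alpha> \<beta> \<gamma> \<delta> = (\<Sum>a\<in>PiE (UNIV - {s0,s1}) (\<lambda>_. UNIV::'m::finite set).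
     det (select_matrix (slots s0 s1 \<alpha> \<gamma> a) :: complex^'m^'m)
     * det (\<chi> i. if i = s0 then axis \<beta> 1 else if i = s1 then axis \<delta> 1 else H $ a i))"

lemma det_row_axis_sum:
  fixes c :: "'m::finite \<Rightarrow> complex^'m"
  shows "(\<Sum>\<beta>\<in>UNIV. w $ \<beta> * det (\<chi> i. if i = k then axis \<beta> 1 else c i)) = det (\<chi> i. if i = k then w else c i)"
proof -
  have "(\<Sum>\<beta>\<in>UNIV. w $ \<beta> * det (\<chi> i. if i = k then axis \<beta> 1 else c i))
      = (\<Sum>\<beta>\<in>UNIV. det (\<chi> i. if i = k then w $ \<beta> *s axis \<beta> 1 else c i))"
    by (simp add: det_row_mul)
  also have "\<dots> = det (\<chi> i. if i = k then (\<Sum>\<beta>\<in>UNIV. w $ \<beta> *s axis \<beta> 1) else c i)"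
    using det_linear_row_sum[of UNIV k "\<lambda>_ \<beta>. w $ \<beta> *s axis \<beta> 1" c] by simp
  finally show ?thesis unfolding basis_expansion .
qed

text \<open>Contracting the axis rows of the determinants with the rows \<mu> and \<nu> of H turns
  them into these rows. Then every row is a row of H, the matrix is a selection matrix times H, and
  det H splits off.\<close>

lemma mixed_minor_contract:
  fixes s0 s1 :: "'m::finite"
  assumes ne: "s0 \<noteq> s1"
  shows "(\<Sum>\<beta>\<in>UNIV. \<Sum>\<delta>\<in>UNIV. H $ \<mu> $ \<beta> * H $ \<nu> $ \<delta> * mixed_minor s0 s1 H \<alpha> \<beta> \<gamma> \<delta>)
    = det H * (\<Sum>a\<in>PiE (UNIV - {s0,s1}) (\<lambda>_. UNIV). det (select_matrix (slots s0 s1 \<alpha> \<gamma> a)) * det (select_matrix (slots s0 s1 \<mu> \<nu> a)))"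
proof -
  let ?P = "PiE (UNIV - {s0,s1}) (\<lambda>_. UNIV) :: ('m \<Rightarrow> 'm) set"
  have sw: "(\<chi> i. if i = s0 then x else if i = s1 then y else c i) = (\<chi> i. if i = s1 then y else if i = s0 then x else c i)"
    for x y :: "complex^'m" and c
    using ne by (simp add: vec_eq_iff)
  let ?D = "\<lambda>a x y. det (\<chi> i. if i = s0 then x else if i = s1 then y else H $ a i)"
  have 1: "(\<Sum>\<beta>\<in>UNIV. \<Sum>\<delta>\<in>UNIV. H $ \<mu> $ \<beta> * H $ \<nu> $ \<delta> * ?D a (axis \<beta> 1) (axis \<delta> 1))
     = det (select_matrix (slots s0 s1 \<mu> \<nu> a)) * det H" for a
  proof -
    have "(\<Sum>\<delta>\<in>UNIV. H $ \<nu> $ \<delta> * ?D a x (axis \<delta> 1)) = ?D a x (H $ \<nu>)" for x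
      using det_row_axis_sum[of "H $ \<nu>" s1 "\<lambda>i. if i = s0 then x else H $ a i"] ne
      by (simp only: sw)
    then have "(\<Sum>\<beta>\<in>UNIV. \<Sum>\<delta>\<in>UNIV. H $ \<mu> $ \<beta> * H $ \<nu> $ \<delta> * ?D a (axis \<beta> 1) (axis \<delta> 1))
      = (\<Sum>\<beta>\<in>UNIV. H $ \<mu> $ \<beta> * ?D a (axis \<beta> 1) (H $ \<nu>))"
      by (simp add: mult.assoc flip: sum_distrib_left)
    also have "\<dots> = ?D a (H $ \<mu>) (H $ \<nu>)"
      by (rule det_row_axis_sum)
    also have "\<dots> = det (select_matrix (slots s0 s1 \<mu> \<nu> a) ** H)"
      unfolding select_matrix_mult by (rule arg_cong[where f=det]) (simp add: vec_eq_iff slots_def)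
    finally show ?thesis by (simp add: det_mul)
  qed
  have "(\<Sum>\<beta>\<in>UNIV. \<Sum>\<delta>\<in>UNIV. H $ \<mu> $ \<beta> * H $ \<nu> $ \<delta> * mixed_minor s0 s1 H \<alpha> \<beta> \<gamma> \<delta>)
    = (\<Sum>\<beta>\<in>UNIV. \<Sum>\<delta>\<in>UNIV. \<Sum>a\<in>?P. det (select_matrix (slots s0 s1 \<alpha> \<gamma> a)) *
         (H $ \<mu> $ \<beta> * H $ \<nu> $ \<delta> * ?D a (axis \<beta> 1) (axis \<delta> 1)))"
    unfolding mixed_minor_def by (simp add: sum_distrib_left mult_ac)
  also have "\<dots> = (\<Sum>\<beta>\<in>UNIV. \<Sum>a\<in>?P. \<Sum>\<delta>\<in>UNIV. det (select_matrix (slots s0 s1 \<alpha> \<gamma> a)) *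
         (H $ \<mu> $ \<beta> * H $ \<nu> $ \<delta> * ?D a (axis \<beta> 1) (axis \<delta> 1)))"
    by (intro sum.cong refl sum.swap)
  also have "\<dots> = (\<Sum>a\<in>?P. \<Sum>\<beta>\<in>UNIV. \<Sum>\<delta>\<in>UNIV. det (select_matrix (slots s0 s1 \<alpha> \<gamma> a)) *
         (H $ \<mu> $ \<beta> * H $ \<nu> $ \<delta> * ?D a (axis \<beta> 1) (axis \<delta> 1)))"
    by (rule sum.swap)
  also have "\<dots> = (\<Sum>a\<in>?P. det (select_matrix (slots s0 s1 \<alpha> \<gamma> a)) * (det (select_matrix (slots s0 s1 \<mu> \<nu> a)) * det H))"
    unfolding sum_distrib_left[symmetric] 1 ..
  finally show ?thesis by (simp add: sum_distrib_left mult_ac)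
qed

lemma
  fixes H :: "'a::semiring_1^'m^'m"
  assumes "invertible H"
  shows invertible_right: "H ** matrix_inv H = mat 1" and invertible_left: "matrix_inv H ** H = mat 1"
proof -
  have "H ** matrix_inv H = mat 1 \<and> matrix_inv H ** H = mat 1"
    unfolding matrix_inv_def by (rule someI_ex) (use assms in \<open>simp add: invertible_def\<close>)
  then show "H ** matrix_inv H = mat 1" "matrix_inv H ** H = mat 1" by auto
qed

text \<open>Applying the inverse of H in both barred indices to \<open>mixed_minor_contract\<close>
  isolates the minor: Jacobi's formula for complementary minors of order two. N is obtained before H
  and the indices, so it stays constant under differentiation.\<close>

lemma mixed_minor_eq:
  fixes s0 s1 :: "'m::finite"
  assumes ne: "s0 \<noteq> s1"
  obtains N :: nat where "N \<noteq> 0"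
    "\<And>H \<alpha> \<beta> \<gamma> \<delta>. invertible H \<Longrightarrow> mixed_minor s0 s1 H \<alpha> \<beta> \<gamma> \<delta>
      = of_nat N * (det H * (inverse_metric H \<alpha> \<beta> * inverse_metric H \<gamma> \<delta> - inverse_metric H \<alpha> \<delta> * inverse_metric H \<gamma> \<beta>))"
proof -
  obtain N :: nat where N: "N \<noteq> 0" "\<And>\<alpha> \<gamma> \<mu> \<nu>. (\<Sum>a\<in>PiE (UNIV - {s0,s1}) (\<lambda>_. UNIV). det (select_matrix (slots s0 s1 \<alpha> \<gamma> a)) * det (select_matrix (slots s0 s1 \<mu> \<nu> a)))
      = of_nat N * ((if \<alpha> = \<mu> \<and> \<gamma> = \<nu> then 1 else 0) - (if \<alpha> = \<nu> \<and> \<gamma> = \<mu> then 1 else 0) :: complex)"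
    by (rule select_sum_two_slots[OF ne]) (rule that)
  have "mixed_minor s0 s1 H \<alpha> \<beta> \<gamma> \<delta>
      = of_nat N * (det H * (inverse_metric H \<alpha> \<beta> * inverse_metric H \<gamma> \<delta> - inverse_metric H \<alpha> \<delta> * inverse_metric H \<gamma> \<beta>))"
    if inv: "invertible H" for H \<alpha> \<beta> \<gamma> \<delta>
  proof -
    let ?M = "\<lambda>\<beta> \<delta>. mixed_minor s0 s1 H \<alpha> \<beta> \<gamma> \<delta>"
    define V where "V = matrix_inv H"
    have VH: "(\<Sum>\<mu>\<in>UNIV. V $ i $ \<mu> * H $ \<mu> $ j) = (if i = j then 1 else 0)" for i j
      using invertible_left[OF inv] by (simp add: V_def vec_eq_iff matrix_matrix_mult_def mat_def)
    have "(\<Sum>\<mu>\<in>UNIV. \<Sum>\<nu>\<in>UNIV. V $ \<beta> $ \<mu> * V $ \<delta> $ \<nu> * (\<Sum>b\<in>UNIV. \<Sum>d\<in>UNIV. H $ \<mu> $ b * H $ \<nu> $ d * ?M b d))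
      = (\<Sum>\<mu>\<in>UNIV. \<Sum>\<nu>\<in>UNIV. \<Sum>b\<in>UNIV. \<Sum>d\<in>UNIV. (V $ \<beta> $ \<mu> * H $ \<mu> $ b) * ((V $ \<delta> $ \<nu> * H $ \<nu> $ d) * ?M b d))"
      by (simp add: sum_distrib_left mult_ac)
    also have "\<dots> = (\<Sum>\<mu>\<in>UNIV. \<Sum>b\<in>UNIV. \<Sum>\<nu>\<in>UNIV. \<Sum>d\<in>UNIV. (V $ \<beta> $ \<mu> * H $ \<mu> $ b) * ((V $ \<delta> $ \<nu> * H $ \<nu> $ d) * ?M b d))"
      by (intro sum.cong refl sum.swap)
    also have "\<dots> = (\<Sum>b\<in>UNIV. \<Sum>\<mu>\<in>UNIV. (V $ \<beta> $ \<mu> * H $ \<mu> $ b) * (\<Sum>\<nu>\<in>UNIV. \<Sum>d\<in>UNIV. ((V $ \<delta> $ \<nu> * H $ \<nu> $ d) * ?M b d)))"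
      by (subst sum.swap) (simp add: sum_distrib_left)
    also have "\<dots> = (\<Sum>b\<in>UNIV. (if \<beta> = b then 1 else 0) * (\<Sum>\<nu>\<in>UNIV. \<Sum>d\<in>UNIV. ((V $ \<delta> $ \<nu> * H $ \<nu> $ d) * ?M b d)))"
      by (simp add: VH flip: sum_distrib_right)
    also have "\<dots> = (\<Sum>\<nu>\<in>UNIV. \<Sum>d\<in>UNIV. ((V $ \<delta> $ \<nu> * H $ \<nu> $ d) * ?M \<beta> d))"
      by (simp add: if_distrib[of "\<lambda>x. x * _"] cong: if_cong)
    also have "\<dots> = (\<Sum>d\<in>UNIV. (if \<delta> = d then 1 else 0) * ?M \<beta> d)"
      by (subst sum.swap) (simp add: VH flip: sum_distrib_right)
    also have "\<dots> = ?M \<beta> \<delta>"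
      by (simp add: if_distrib[of "\<lambda>x. x * _"] cong: if_cong)
    finally have "?M \<beta> \<delta> = (\<Sum>\<mu>\<in>UNIV. \<Sum>\<nu>\<in>UNIV. V $ \<beta> $ \<mu> * V $ \<delta> $ \<nu> *
        (det H * (of_nat N * ((if \<alpha> = \<mu> \<and> \<gamma> = \<nu> then 1 else 0) - (if \<alpha> = \<nu> \<and> \<gamma> = \<mu> then 1 else 0)))))"
      unfolding mixed_minor_contract[OF ne] N(2) by simp
    also have "\<dots> = of_nat N * (det H * (V $ \<beta> $ \<alpha> * V $ \<delta> $ \<gamma> - V $ \<beta> $ \<gamma> * V $ \<delta> $ \<alpha>))"
    proof -
      have "(\<Sum>\<mu>\<in>UNIV. \<Sum>\<nu>\<in>UNIV. V $ \<beta> $ \<mu> * V $ \<delta> $ \<nu> * (if a = \<mu> \<and> c = \<nu> then 1 else 0)) = V $ \<beta> $ a * V $ \<delta> $ c" for a c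
      proof -
        have "(\<Sum>\<nu>\<in>UNIV. V $ \<beta> $ \<mu> * V $ \<delta> $ \<nu> * (if a = \<mu> \<and> c = \<nu> then 1 else 0)) = (if a = \<mu> then V $ \<beta> $ \<mu> * V $ \<delta> $ c else 0)" for \<mu>
          by (simp add: if_distrib[of "\<lambda>x. _ * x"] cong: if_cong)
        then show ?thesis by simp
      qed
      note e = this
      have e': "(\<Sum>\<mu>\<in>UNIV. \<Sum>\<nu>\<in>UNIV. V $ \<beta> $ \<mu> * V $ \<delta> $ \<nu> * (if \<alpha> = \<nu> \<and> \<gamma> = \<mu> then 1 else 0)) = V $ \<beta> $ \<gamma> * V $ \<delta> $ \<alpha>"
        using e[of \<gamma> \<alpha>] by (simp only: conj_commute)
      have "(\<Sum>\<mu>\<in>UNIV. \<Sum>\<nu>\<in>UNIV. V $ \<beta> $ \<mu> * V $ \<delta> $ \<nu> *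
        (det H * (of_nat N * ((if \<alpha> = \<mu> \<and> \<gamma> = \<nu> then 1 else 0) - (if \<alpha> = \<nu> \<and> \<gamma> = \<mu> then 1 else 0)))))
       = of_nat N * (det H * ((\<Sum>\<mu>\<in>UNIV. \<Sum>\<nu>\<in>UNIV. V $ \<beta> $ \<mu> * V $ \<delta> $ \<nu> * (if \<alpha> = \<mu> \<and> \<gamma> = \<nu> then 1 else 0))
         - (\<Sum>\<mu>\<in>UNIV. \<Sum>\<nu>\<in>UNIV. V $ \<beta> $ \<mu> * V $ \<delta> $ \<nu> * (if \<alpha> = \<nu> \<and> \<gamma> = \<mu> then 1 else 0))))"
        by (simp only: sum_distrib_left sum_subtractf[symmetric] right_diff_distrib mult_ac)
      then show ?thesis unfolding e e' .
    qed
    finally show ?thesis by (simp add: inverse_metric_def V_def mult_ac)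
  qed
  with N(1) show thesis using that by blast
qed

section \<open>The divergence identity for the minors of the metric\<close>

definition alternate :: "nat \<Rightarrow> ('v list \<Rightarrow> complex) \<Rightarrow> 'v list \<Rightarrow> complex" where
  "alternate n F vs = (\<Sum>\<sigma> | \<sigma> permutes {..<n}. of_int (sign \<sigma>) * F (permute_list \<sigma> vs))"

lemma alternate_cong:
  assumes "\<And>ws. length ws = length vs \<Longrightarrow> F ws = G ws"
  shows "alternate n F vs = alternate n G vs"
  unfolding alternate_def by (rule sum.cong) (auto simp: assms)

lemma alternate_sum: "alternate n (\<lambda>ws. \<Sum>i\<in>I. F i ws) vs = (\<Sum>i\<in>I. alternate n (F i) vs)"
  unfolding alternate_def sum_distrib_left by (rule sum.swap)

lemma alternate_cmult: "alternate n (\<lambda>ws. c * F ws) vs = c * alternate n F vs"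
  unfolding alternate_def sum_distrib_left by (rule sum.cong) (auto simp: mult_ac)

text \<open>\<open>alternate\<close> carries no factor 1/n!, so that the division by k! l! in the
  wedge is cancelled exactly by the two absorption lemmas that follow.\<close>

lemma wedge_alternate:
  "wedge k l a b x vs = alternate (k + l) (\<lambda>ws. a x (take k ws) * b x (drop k ws)) vs / (fact k * fact l)"
  by (simp add: wedge_def alternate_def mult.assoc)

text \<open>An alternation inside the last l arguments is absorbed by the outer one: composing
  \<sigma> with the shifted inner permutation reindexes the outer sum and multiplies the signs, so
  each of the l! inner permutations contributes the same amount.\<close>

lemma alternate_right:
  fixes vs :: "'v list"
  assumes len: "length vs = k + l"
  shows "alternate (k + l) (\<lambda>ws. a (take k ws) * alternate l b (drop k ws)) vs
       = fact l * alternate (k + l) (\<lambda>ws. a (take k ws) * b (drop k ws)) vs"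
proof -
  let ?F = "\<lambda>ws. a (take k ws) * b (drop k ws)"
  let ?P = "\<lambda>n. {\<sigma>. \<sigma> permutes {..<n::nat}}"
  define up where "up \<tau> = map_permutation {..<l} (\<lambda>i. i + k) \<tau>" for \<tau> :: "nat \<Rightarrow> nat"
  have bij: "bij_betw (\<lambda>i. i + k) {..<l} {k..<k + l}"
    by (rule bij_betwI[of _ _ _ "\<lambda>i. i - k"]) auto
  have up: "up \<tau> permutes {..<k + l}" "up \<tau> permutes {k..<k + l}" "sign (up \<tau>) = sign \<tau>" if "\<tau> permutes {..<l}" for \<tau>
  proof -
    show *: "up \<tau> permutes {k..<k + l}" unfolding up_def by (rule map_permutation_permutes[OF bij that])
    then show "up \<tau> permutes {..<k + l}" by (rule permutes_subset) auto
    show "sign (up \<tau>) = sign \<tau>" unfolding up_def by (rule sign_map_permutation) (use that in auto)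
  qed
  have tk: "take k (permute_list (up \<tau>) ws) = take k ws" if "\<tau> permutes {..<l}" "length ws = k + l" for \<tau> and ws :: "'v list"
    using that up(2)[OF that(1)] by (intro nth_equalityI) (auto simp: permute_list_def permutes_not_in)
  have dk: "drop k (permute_list (up \<tau>) ws) = permute_list \<tau> (drop k ws)" if "\<tau> permutes {..<l}" "length ws = k + l" for \<tau> and ws :: "'v list"
  proof (intro nth_equalityI)
    fix i assume "i < length (drop k (permute_list (up \<tau>) ws))"
    then have i: "i < l" using that by simp
    have "up \<tau> (i + k) = \<tau> i + k" unfolding up_def by (rule map_permutation_apply) (use i in \<open>auto simp: inj_on_def\<close>)
    moreover have "\<tau> i < l" using permutes_in_image[OF that(1), of i] i by simp
    ultimately show "drop k (permute_list (up \<tau>) ws) ! i = permute_list \<tau> (drop k ws) ! i"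
      using i that by (simp add: permute_list_def add.commute)
  qed (use that in simp)
  have "alternate (k + l) (\<lambda>ws. a (take k ws) * alternate l b (drop k ws)) vs
      = (\<Sum>\<sigma>\<in>?P (k + l). \<Sum>\<tau>\<in>?P l. of_int (sign \<sigma>) * of_int (sign \<tau>) * ?F (permute_list (up \<tau>) (permute_list \<sigma> vs)))"
    unfolding alternate_def sum_distrib_left
    by (intro sum.cong refl) (simp add: tk dk len mult_ac)
  also have "\<dots> = (\<Sum>\<tau>\<in>?P l. \<Sum>\<sigma>\<in>?P (k + l). of_int (sign \<sigma>) * of_int (sign \<tau>) * ?F (permute_list (up \<tau>) (permute_list \<sigma> vs)))"
    by (rule sum.swap)
  also have "\<dots> = (\<Sum>\<tau>\<in>?P l. alternate (k + l) ?F vs)"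
  proof (rule sum.cong[OF refl])
    fix \<tau> :: "nat \<Rightarrow> nat" assume "\<tau> \<in> ?P l"
    then have t: "\<tau> permutes {..<l}" by simp
    have "alternate (k + l) ?F vs = (\<Sum>\<sigma>\<in>?P (k + l). of_int (sign (\<sigma> \<circ> up \<tau>)) * ?F (permute_list (\<sigma> \<circ> up \<tau>) vs))"
      unfolding alternate_def by (rule sum_permutations_compose_right[OF up(1)[OF t]])
    also have "\<dots> = (\<Sum>\<sigma>\<in>?P (k + l). of_int (sign \<sigma>) * of_int (sign \<tau>) * ?F (permute_list (up \<tau>) (permute_list \<sigma> vs)))"
    proof (rule sum.cong[OF refl])
      fix \<sigma> :: "nat \<Rightarrow> nat" assume "\<sigma> \<in> ?P (k + l)"
      then have s: "\<sigma> permutes {..<k + l}" by simp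
      have "sign (\<sigma> \<circ> up \<tau>) = sign \<sigma> * sign \<tau>"
        using sign_compose[of \<sigma> "up \<tau>"] permutation_permutes[of \<sigma>] permutation_permutes[of "up \<tau>"] s up[OF t]
        by (metis finite_lessThan)
      moreover have "permute_list (\<sigma> \<circ> up \<tau>) vs = permute_list (up \<tau>) (permute_list \<sigma> vs)"
        by (rule permute_list_compose) (use up(1)[OF t] len in simp)
      ultimately show "of_int (sign (\<sigma> \<circ> up \<tau>)) * ?F (permute_list (\<sigma> \<circ> up \<tau>) vs)
         = of_int (sign \<sigma>) * of_int (sign \<tau>) * ?F (permute_list (up \<tau>) (permute_list \<sigma> vs))"
        by simp
    qed
    finally show "(\<Sum>\<sigma>\<in>?P (k + l). of_int (sign \<sigma>) * of_int (sign \<tau>) * ?F (permute_list (up \<tau>) (permute_list \<sigma> vs)))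
       = alternate (k + l) ?F vs" by simp
  qed
  also have "\<dots> = fact l * alternate (k + l) ?F vs"
    by (simp add: card_permutations)
  finally show ?thesis .
qed

text \<open>The same absorption for the first k arguments. These are an initial segment of the
  positions, so the inner permutations act without a shift.\<close>

lemma alternate_left:
  fixes vs :: "'v list"
  assumes len: "length vs = k + l"
  shows "alternate (k + l) (\<lambda>ws. alternate k a (take k ws) * b (drop k ws)) vs
       = fact k * alternate (k + l) (\<lambda>ws. a (take k ws) * b (drop k ws)) vs"
proof -
  let ?F = "\<lambda>ws. a (take k ws) * b (drop k ws)"
  let ?P = "\<lambda>n. {\<sigma>. \<sigma> permutes {..<n::nat}}"
  have up: "\<tau> permutes {..<k + l}" if "\<tau> permutes {..<k}" for \<tau>
    by (rule permutes_subset[OF that]) auto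
  have dk: "drop k (permute_list \<tau> ws) = drop k ws" if "\<tau> permutes {..<k}" "length ws = k + l" for \<tau> and ws :: "'v list"
    using that by (intro nth_equalityI) (auto simp: permute_list_def permutes_not_in)
  have tk: "take k (permute_list \<tau> ws) = permute_list \<tau> (take k ws)" if "\<tau> permutes {..<k}" "length ws = k + l" for \<tau> and ws :: "'v list"
  proof (intro nth_equalityI)
    fix i assume "i < length (take k (permute_list \<tau> ws))"
    then have i: "i < k" using that by simp
    moreover have "\<tau> i < k" using permutes_in_image[OF that(1), of i] i by simp
    ultimately show "take k (permute_list \<tau> ws) ! i = permute_list \<tau> (take k ws) ! i"
      using i that by (simp add: permute_list_def)
  qed (use that in simp)
  have "alternate (k + l) (\<lambda>ws. alternate k a (take k ws) * b (drop k ws)) vs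
      = (\<Sum>\<sigma>\<in>?P (k + l). \<Sum>\<tau>\<in>?P k. of_int (sign \<sigma>) * of_int (sign \<tau>) * ?F (permute_list \<tau> (permute_list \<sigma> vs)))"
    unfolding alternate_def sum_distrib_left sum_distrib_right
    by (intro sum.cong refl) (simp add: tk dk len mult_ac)
  also have "\<dots> = (\<Sum>\<tau>\<in>?P k. \<Sum>\<sigma>\<in>?P (k + l). of_int (sign \<sigma>) * of_int (sign \<tau>) * ?F (permute_list \<tau> (permute_list \<sigma> vs)))"
    by (rule sum.swap)
  also have "\<dots> = (\<Sum>\<tau>\<in>?P k. alternate (k + l) ?F vs)"
  proof (rule sum.cong[OF refl])
    fix \<tau> :: "nat \<Rightarrow> nat" assume "\<tau> \<in> ?P k"
    then have t: "\<tau> permutes {..<k}" by simp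
    have "alternate (k + l) ?F vs = (\<Sum>\<sigma>\<in>?P (k + l). of_int (sign (\<sigma> \<circ> \<tau>)) * ?F (permute_list (\<sigma> \<circ> \<tau>) vs))"
      unfolding alternate_def by (rule sum_permutations_compose_right[OF up[OF t]])
    also have "\<dots> = (\<Sum>\<sigma>\<in>?P (k + l). of_int (sign \<sigma>) * of_int (sign \<tau>) * ?F (permute_list \<tau> (permute_list \<sigma> vs)))"
    proof (rule sum.cong[OF refl])
      fix \<sigma> :: "nat \<Rightarrow> nat" assume "\<sigma> \<in> ?P (k + l)"
      then have s: "\<sigma> permutes {..<k + l}" by simp
      have "sign (\<sigma> \<circ> \<tau>) = sign \<sigma> * sign \<tau>"
        using sign_compose[of \<sigma> \<tau>] permutation_permutes[of \<sigma>] permutation_permutes[of \<tau>] s t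
        by (metis finite_lessThan)
      moreover have "permute_list (\<sigma> \<circ> \<tau>) vs = permute_list \<tau> (permute_list \<sigma> vs)"
        by (rule permute_list_compose) (use up[OF t] len in simp)
      ultimately show "of_int (sign (\<sigma> \<circ> \<tau>)) * ?F (permute_list (\<sigma> \<circ> \<tau>) vs)
         = of_int (sign \<sigma>) * of_int (sign \<tau>) * ?F (permute_list \<tau> (permute_list \<sigma> vs))"
        by simp
    qed
    finally show "(\<Sum>\<sigma>\<in>?P (k + l). of_int (sign \<sigma>) * of_int (sign \<tau>) * ?F (permute_list \<tau> (permute_list \<sigma> vs)))
       = alternate (k + l) ?F vs" by simp
  qed
  also have "\<dots> = fact k * alternate (k + l) ?F vs"
    by (simp add: card_permutations)
  finally show ?thesis .
qed

text \<open>Multilinear but not alternating representatives of \<omega>, and below of its powers.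
  Alternating once at the end instead of at every wedge reduces \<partial>, \<partial>bar and the
  evaluation in top degree to operations on a single product.\<close>

definition form_kernel :: "complex^'m::finite^'m \<Rightarrow> (complex^'m) list \<Rightarrow> complex" where
  "form_kernel H vs = \<i> / 2 * (\<Sum>\<alpha>\<in>UNIV. \<Sum>\<beta>\<in>UNIV. H $ \<alpha> $ \<beta> * (vs ! 0 $ \<alpha> * cnj (vs ! 1 $ \<beta>)))"

primrec power_kernel :: "complex^'m::finite^'m \<Rightarrow> nat \<Rightarrow> (complex^'m) list \<Rightarrow> complex" where
  "power_kernel H 0 vs = 1"
| "power_kernel H (Suc r) vs = form_kernel H (take 2 vs) * power_kernel H r (drop 2 vs)"

lemma fundamental_form_alternate:
  assumes "length vs = 2"
  shows "fundamental_form H x vs = alternate 2 (form_kernel (H x)) vs"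
proof -
  have "wedge 1 1 (dz \<alpha>) (dzbar \<beta>) x vs = alternate 2 (\<lambda>ws. ws ! 0 $ \<alpha> * cnj (ws ! 1 $ \<beta>)) vs" for \<alpha> \<beta>
    unfolding wedge_alternate using assms
    by (simp add: numeral_2_eq_2, intro alternate_cong)
       (auto simp: dz_def dzbar_def length_Suc_conv numeral_2_eq_2)
  then show ?thesis
    unfolding fundamental_form_def form_kernel_def[abs_def]
    by (simp only: alternate_sum alternate_cmult)
qed

text \<open>The factorials produced by absorbing the two inner alternations cancel the normalization
  of the wedge, so no constant accumulates with r.\<close>

lemma wedge_power_alternate:
  "length vs = 2 * r \<Longrightarrow> wedge_power (fundamental_form H) r x vs = alternate (2 * r) (power_kernel (H x) r) vs"
proof (induction r arbitrary: vs)
  case 0 then show ?case by (simp add: alternate_def)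
next
  case (Suc r)
  have len: "length vs = 2 + 2 * r" using Suc.prems by simp
  have "wedge_power (fundamental_form H) (Suc r) x vs
     = alternate (2 + 2 * r) (\<lambda>ws. fundamental_form H x (take 2 ws) * wedge_power (fundamental_form H) r x (drop 2 ws)) vs / (fact 2 * fact (2 * r))"
    by (simp add: wedge_alternate)
  also have "alternate (2 + 2 * r) (\<lambda>ws. fundamental_form H x (take 2 ws) * wedge_power (fundamental_form H) r x (drop 2 ws)) vs
    = alternate (2 + 2 * r) (\<lambda>ws. alternate 2 (form_kernel (H x)) (take 2 ws) * alternate (2 * r) (power_kernel (H x) r) (drop 2 ws)) vs"
    by (rule alternate_cong) (simp add: len fundamental_form_alternate Suc.IH)
  also have "\<dots> = fact 2 * fact (2 * r) * alternate (2 + 2 * r) (\<lambda>ws. form_kernel (H x) (take 2 ws) * power_kernel (H x) r (drop 2 ws)) vs"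
    unfolding alternate_left[OF len] alternate_right[OF len] by simp
  finally show ?case by simp
qed

lemma ck_Suc0_alternate:
  assumes "open S" "\<And>vs. ck k S (\<lambda>z. b z vs)"
  shows "ck k S (\<lambda>z. alternate n (b z) vs)"
  unfolding alternate_def by (intro ck_sum ck_mult ck_const assms)

lemma wirtinger_alternate:
  assumes "open S" "\<And>vs. ck (Suc 0) S (\<lambda>z. b z vs)" "x \<in> S"
  shows "d_dz \<gamma> (\<lambda>z. alternate n (b z) vs) x = alternate n (\<lambda>ws. d_dz \<gamma> (\<lambda>z. b z ws) x) vs"
    "d_dzbar \<gamma> (\<lambda>z. alternate n (b z) vs) x = alternate n (\<lambda>ws. d_dzbar \<gamma> (\<lambda>z. b z ws) x) vs"
proof -
  have d: "(\<lambda>z. b z ws) differentiable at x" for ws using assms(2)[of ws] assms(3) by (rule ck_differentiable)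
  show "d_dz \<gamma> (\<lambda>z. alternate n (b z) vs) x = alternate n (\<lambda>ws. d_dz \<gamma> (\<lambda>z. b z ws) x) vs"
    "d_dzbar \<gamma> (\<lambda>z. alternate n (b z) vs) x = alternate n (\<lambda>ws. d_dzbar \<gamma> (\<lambda>z. b z ws) x) vs"
    unfolding alternate_def
    by (simp_all add: wirtinger_sum wirtinger_cmult differentiable_mult d)
qed

text \<open>Permutations do not depend on the point, so differentiation passes through the
  alternation, and the k! from absorbing the inner one cancels that of the wedge. On kernels the
  Dolbeault operators thus just put one new covector in front.\<close>

lemma del_alternate:
  assumes S: "open S" and a: "\<And>z vs. z \<in> S \<Longrightarrow> length vs = k \<Longrightarrow> a z vs = alternate k (b z) vs"
    and b: "\<And>vs. ck (Suc 0) S (\<lambda>z. b z vs)" and x: "x \<in> S" and len: "length vs = Suc k"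
  shows "del k a x vs = alternate (Suc k) (\<lambda>ws. \<Sum>\<alpha>\<in>UNIV. hd ws $ \<alpha> * d_dz \<alpha> (\<lambda>z. b z (tl ws)) x) vs"
    and "delbar k a x vs = alternate (Suc k) (\<lambda>ws. \<Sum>\<alpha>\<in>UNIV. cnj (hd ws $ \<alpha>) * d_dzbar \<alpha> (\<lambda>z. b z (tl ws)) x) vs"
proof -
  have len': "length vs = 1 + k" using len by simp
  have D: "d_dz \<alpha> (\<lambda>z. a z ws) x = alternate k (\<lambda>ws. d_dz \<alpha> (\<lambda>z. b z ws) x) ws"
     "d_dzbar \<alpha> (\<lambda>z. a z ws) x = alternate k (\<lambda>ws. d_dzbar \<alpha> (\<lambda>z. b z ws) x) ws" if "length ws = k" for \<alpha> ws
    using wirtinger_cong[OF S x, of "\<lambda>z. a z ws" "\<lambda>z. alternate k (b z) ws"] a that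
    by (simp_all add: wirtinger_alternate[OF S b x])
  have "wedge 1 k (dz \<alpha>) (\<lambda>y ws. d_dz \<alpha> (\<lambda>z. a z ws) y) x vs
      = alternate (1 + k) (\<lambda>ws. hd (take 1 ws) $ \<alpha> * d_dz \<alpha> (\<lambda>z. b z (drop 1 ws)) x) vs" for \<alpha>
  proof -
    have "alternate (1 + k) (\<lambda>ws. dz \<alpha> x (take 1 ws) * d_dz \<alpha> (\<lambda>z. a z (drop 1 ws)) x) vs
      = alternate (1 + k) (\<lambda>ws. hd (take 1 ws) $ \<alpha> * alternate k (\<lambda>ws. d_dz \<alpha> (\<lambda>z. b z ws) x) (drop 1 ws)) vs"
      by (rule alternate_cong) (simp add: len D dz_def)
    then show ?thesis unfolding wedge_alternate alternate_right[OF len', where a="\<lambda>ws. hd ws $ \<alpha>"] by simp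
  qed
  then have "del k a x vs = (\<Sum>\<alpha>\<in>UNIV. alternate (Suc k) (\<lambda>ws. hd (take 1 ws) $ \<alpha> * d_dz \<alpha> (\<lambda>z. b z (drop 1 ws)) x) vs)"
    by (simp add: del_def)
  also have "\<dots> = alternate (Suc k) (\<lambda>ws. \<Sum>\<alpha>\<in>UNIV. hd ws $ \<alpha> * d_dz \<alpha> (\<lambda>z. b z (tl ws)) x) vs"
    unfolding alternate_sum[symmetric] by (rule alternate_cong) (use len in \<open>simp add: drop_Suc hd_take\<close>)
  finally show "del k a x vs = alternate (Suc k) (\<lambda>ws. \<Sum>\<alpha>\<in>UNIV. hd ws $ \<alpha> * d_dz \<alpha> (\<lambda>z. b z (tl ws)) x) vs" .
  have "wedge 1 k (dzbar \<alpha>) (\<lambda>y ws. d_dzbar \<alpha> (\<lambda>z. a z ws) y) x vs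
      = alternate (1 + k) (\<lambda>ws. cnj (hd (take 1 ws) $ \<alpha>) * d_dzbar \<alpha> (\<lambda>z. b z (drop 1 ws)) x) vs" for \<alpha>
  proof -
    have "alternate (1 + k) (\<lambda>ws. dzbar \<alpha> x (take 1 ws) * d_dzbar \<alpha> (\<lambda>z. a z (drop 1 ws)) x) vs
      = alternate (1 + k) (\<lambda>ws. cnj (hd (take 1 ws) $ \<alpha>) * alternate k (\<lambda>ws. d_dzbar \<alpha> (\<lambda>z. b z ws) x) (drop 1 ws)) vs"
      by (rule alternate_cong) (simp add: len D dzbar_def)
    then show ?thesis unfolding wedge_alternate alternate_right[OF len', where a="\<lambda>ws. cnj (hd ws $ \<alpha>)"] by simp
  qed
  then have "delbar k a x vs = (\<Sum>\<alpha>\<in>UNIV. alternate (Suc k) (\<lambda>ws. cnj (hd (take 1 ws) $ \<alpha>) * d_dzbar \<alpha> (\<lambda>z. b z (drop 1 ws)) x) vs)"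
    by (simp add: delbar_def)
  also have "\<dots> = alternate (Suc k) (\<lambda>ws. \<Sum>\<alpha>\<in>UNIV. cnj (hd ws $ \<alpha>) * d_dzbar \<alpha> (\<lambda>z. b z (tl ws)) x) vs"
    unfolding alternate_sum[symmetric] by (rule alternate_cong) (use len in \<open>simp add: drop_Suc hd_take\<close>)
  finally show "delbar k a x vs = alternate (Suc k) (\<lambda>ws. \<Sum>\<alpha>\<in>UNIV. cnj (hd ws $ \<alpha>) * d_dzbar \<alpha> (\<lambda>z. b z (tl ws)) x) vs" .
qed

lemma ck_form_kernel:
  assumes "open S" "ck k S H"
  shows "ck k S (\<lambda>z. form_kernel (H z) vs)"
  unfolding form_kernel_def by (intro ck_mult ck_const ck_sum ck_vec_nth assms)

lemma ck_power_kernel: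
  assumes "open S" "ck k S H"
  shows "ck k S (\<lambda>z. power_kernel (H z) r vs)"
proof (induction r arbitrary: vs)
  case (Suc r) show ?case unfolding power_kernel.simps by (intro ck_mult ck_form_kernel Suc.IH assms)
qed (simp add: ck_const)

text \<open>The operator applied last takes the first argument: \<partial> reads position 0,
  \<partial>bar reads position 1, and the kernel of \<omega>^r receives the rest.\<close>

lemma del_delbar_alternate:
  assumes S: "open S" and H: "ck 2 S H" and x: "x \<in> S" and len: "length vs = 2 * r + 2"
  shows "del (2 * r + 1) (delbar (2 * r) (wedge_power (fundamental_form H) r)) x vs
     = alternate (2 * r + 2) (\<lambda>ws. \<Sum>\<gamma>\<in>UNIV. \<Sum>\<delta>\<in>UNIV. ws ! 0 $ \<gamma> * (cnj (ws ! 1 $ \<delta>) *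
         d_dz \<gamma> (d_dzbar \<delta> (\<lambda>z. power_kernel (H z) r (drop 2 ws))) x)) vs"
proof -
  have H1: "ck (Suc 0) S H" and H2: "ck (Suc (Suc 0)) S H" using ck_le[OF H] H by (auto simp: numeral_2_eq_2 simp del: continuously_differentiable_on.simps)
  have pk: "ck (Suc 0) S (d_dzbar \<alpha> (\<lambda>z. power_kernel (H z) r vs))" for \<alpha> vs
    by (rule ck_wirtinger[OF S ck_power_kernel[OF S H2]])
  define b where "b z ws = (\<Sum>\<alpha>\<in>UNIV. cnj (hd ws $ \<alpha>) * d_dzbar \<alpha> (\<lambda>z. power_kernel (H z) r (tl ws)) z)" for z ws
  have 1: "delbar (2 * r) (wedge_power (fundamental_form H) r) z ws = alternate (2 * r + 1) (b z) ws"
    if "z \<in> S" "length ws = 2 * r + 1" for z ws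
    using del_alternate(2)[where a="wedge_power (fundamental_form H) r" and b="\<lambda>z. power_kernel (H z) r",
        OF S wedge_power_alternate ck_power_kernel[OF S H1] that(1)] that(2)
    by (simp add: b_def[abs_def])
  have b1: "ck (Suc 0) S (\<lambda>z. b z ws)" for ws
    unfolding b_def by (intro ck_sum ck_mult ck_const S pk)
  have "del (2 * r + 1) (delbar (2 * r) (wedge_power (fundamental_form H) r)) x vs
     = alternate (Suc (2 * r + 1)) (\<lambda>ws. \<Sum>\<alpha>\<in>UNIV. hd ws $ \<alpha> * d_dz \<alpha> (\<lambda>z. b z (tl ws)) x) vs"
    by (rule del_alternate(1)[OF S 1 b1 x]) (use len in auto)
  also have "\<dots> = alternate (2 * r + 2) (\<lambda>ws. \<Sum>\<gamma>\<in>UNIV. \<Sum>\<delta>\<in>UNIV. ws ! 0 $ \<gamma> * (cnj (ws ! 1 $ \<delta>) *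
         d_dz \<gamma> (d_dzbar \<delta> (\<lambda>z. power_kernel (H z) r (drop 2 ws))) x)) vs"
  proof -
    have "(\<Sum>\<alpha>\<in>UNIV. hd ws $ \<alpha> * d_dz \<alpha> (\<lambda>z. b z (tl ws)) x)
       = (\<Sum>\<gamma>\<in>UNIV. \<Sum>\<delta>\<in>UNIV. ws ! 0 $ \<gamma> * (cnj (ws ! 1 $ \<delta>) *
         d_dz \<gamma> (d_dzbar \<delta> (\<lambda>z. power_kernel (H z) r (drop 2 ws))) x))" if "length ws = length vs" for ws
    proof -
      have d: "d_dzbar \<alpha> (\<lambda>z. power_kernel (H z) r us) differentiable at x" for \<alpha> us
        by (rule ck_differentiable[OF pk x])
      have hd: "hd ws = ws ! 0" "hd (tl ws) = ws ! 1" "tl (tl ws) = drop 2 ws"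
        using that len by (simp_all add: hd_conv_nth nth_tl length_greater_0_conv[symmetric] drop_Suc numeral_2_eq_2 del: length_greater_0_conv)
      have "d_dz \<gamma> (\<lambda>z. b z (tl ws)) x = (\<Sum>\<delta>\<in>UNIV. cnj (ws ! 1 $ \<delta>) *
         d_dz \<gamma> (d_dzbar \<delta> (\<lambda>z. power_kernel (H z) r (drop 2 ws))) x)" for \<gamma>
        unfolding b_def hd by (subst wirtinger_sum(1)) (auto simp: wirtinger_cmult(1)[OF d] intro!: differentiable_mult d)
      then show ?thesis by (simp add: hd(1) sum_distrib_left)
    qed
    then show ?thesis by (simp, intro alternate_cong) simp
  qed
  finally show ?thesis .
qed

section \<open>Forms of top degree as determinants\<close>

definition basis_matrix :: "('m \<Rightarrow> nat) \<Rightarrow> (complex^'m::finite) list \<Rightarrow> complex^('m\<times>bool)^('m\<times>bool)" where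
  "basis_matrix idx vs = (\<chi> i j. let v = vs ! (2 * idx (fst j) + of_bool (snd j)) $ fst i in if snd i then cnj v else v)"

text \<open>A product of covectors, alternated over its arguments, is the determinant of the matrix
  of their values. With m covectors of type (1,0) and m of type (0,1) that matrix is a block
  diagonal one times the values of all dz and dzbar, which separates coefficients from vectors. The
  vector at list position 2 * idx i + of_bool s belongs to column (i, s).\<close>

lemma alternate_product:
  fixes idx :: "'m::finite \<Rightarrow> nat" and P Q :: "complex^'m^'m"
  assumes idx: "bij_betw idx UNIV {..<CARD('m)}" and len: "length vs = 2 * CARD('m)"
  shows "alternate (2 * CARD('m)) (\<lambda>ws. \<Prod>i\<in>UNIV. (\<Sum>j\<in>UNIV. P $ i $ j * ws ! (2 * idx i) $ j)
          * (\<Sum>j\<in>UNIV. Q $ i $ j * cnj (ws ! (2 * idx i + 1) $ j))) vs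
     = det P * det Q * det (basis_matrix idx vs)"
proof -
  \<comment> \<open>The list positions 0, ..., 2m - 1 are matched with the matrix indices by
    \<open>pos\<close>, through which the Leibniz sum of \<open>?B\<close> becomes the
    alternation.\<close>
  let ?n = "2 * CARD('m)"
  let ?B = "block_diag P Q ** basis_matrix idx vs"
  define pos where "pos j = 2 * idx (fst j) + of_bool (snd j)" for j :: "'m \<times> bool"
  have inj: "idx x = idx y \<longleftrightarrow> x = y" for x y using idx by (auto simp: bij_betw_def inj_on_def)
  have im: "idx x < CARD('m)" for x using idx by (auto simp: bij_betw_def)
  have inj_pos: "inj pos"
  proof (rule injI)
    fix x y assume "pos x = pos y"
    then have "2 * idx (fst x) + of_bool (snd x) = 2 * idx (fst y) + of_bool (snd y)" by (simp add: pos_def)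
    then have "idx (fst x) = idx (fst y) \<and> snd x = snd y" by (auto simp: of_bool_def split: if_splits) presburger+
    then show "x = y" by (simp add: inj prod_eq_iff)
  qed
  have pos: "bij_betw pos UNIV {..<?n}"
  proof -
    have "pos j < ?n" for j using im[of "fst j"] by (auto simp: pos_def of_bool_def)
    then have "pos ` UNIV \<subseteq> {..<?n}" by auto
    moreover have "card (pos ` UNIV) = card {..<?n}"
      using card_image[OF inj_pos] by (simp add: card_cartesian_product flip: UNIV_Times_UNIV)
    ultimately have "pos ` UNIV = {..<?n}" by (intro card_subset_eq) auto
    then show ?thesis using inj_pos by (simp add: bij_betw_def)
  qed
  have B: "?B $ (i, s) $ t = (if s then (\<Sum>j\<in>UNIV. Q $ i $ j * cnj (vs ! pos t $ j)) else (\<Sum>j\<in>UNIV. P $ i $ j * vs ! pos t $ j))" for i s t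
    by (cases s) (simp_all add: matrix_matrix_mult_def block_diag_def basis_matrix_def sum_prod_bool pos_def Let_def)
  have "det P * det Q * det (basis_matrix idx vs) = det ?B"
    by (simp add: det_mul det_block_diag)
  also have "\<dots> = (\<Sum>p | p permutes UNIV. of_int (sign p) * (\<Prod>t\<in>UNIV. ?B $ t $ p t))"
    by (simp add: det_def)
  also have "\<dots> = (\<Sum>\<sigma> | \<sigma> permutes {..<?n}. of_int (sign \<sigma>) *
      (\<Prod>t\<in>UNIV. ?B $ t $ (map_permutation {..<?n} (inv_into UNIV pos) \<sigma>) t))"
    by (rule sum_permutations_map[OF bij_betw_inv_into[OF pos]]) simp
  also have "\<dots> = alternate ?n (\<lambda>ws. \<Prod>i\<in>UNIV. (\<Sum>j\<in>UNIV. P $ i $ j * ws ! (2 * idx i) $ j)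
          * (\<Sum>j\<in>UNIV. Q $ i $ j * cnj (ws ! (2 * idx i + 1) $ j))) vs"
    unfolding alternate_def
  proof (rule sum.cong[OF refl])
    fix \<sigma> assume "\<sigma> \<in> {\<sigma>. \<sigma> permutes {..<?n}}"
    then have s: "\<sigma> permutes {..<?n}" by simp
    let ?p = "map_permutation {..<?n} (inv_into UNIV pos) \<sigma>"
    have p: "vs ! pos (?p t) = permute_list \<sigma> vs ! pos t" for t
    proof -
      have t: "pos t < ?n" using pos by (auto simp: bij_betw_def)
      have "?p (inv_into UNIV pos (pos t)) = inv_into UNIV pos (\<sigma> (pos t))"
        by (rule map_permutation_apply) (use bij_betw_inv_into[OF pos] t in \<open>auto simp: bij_betw_def\<close>)
      then have "?p t = inv_into UNIV pos (\<sigma> (pos t))" using inj_pos by simp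
      moreover have "\<sigma> (pos t) \<in> range pos" using permutes_in_image[OF s, of "pos t"] t pos by (simp add: bij_betw_def)
      ultimately have "pos (?p t) = \<sigma> (pos t)" by (simp add: f_inv_into_f)
      then show ?thesis using s t len by (simp add: permute_list_nth)
    qed
    have "(\<Prod>t\<in>UNIV. ?B $ t $ ?p t) = (\<Prod>i\<in>UNIV. (\<Sum>j\<in>UNIV. P $ i $ j * permute_list \<sigma> vs ! (2 * idx i) $ j)
          * (\<Sum>j\<in>UNIV. Q $ i $ j * cnj (permute_list \<sigma> vs ! (2 * idx i + 1) $ j)))"
      unfolding prod_prod_bool B p by (simp add: pos_def)
    then show "of_int (sign \<sigma>) * (\<Prod>t\<in>UNIV. ?B $ t $ ?p t) = of_int (sign \<sigma>) *
      (\<Prod>i\<in>UNIV. (\<Sum>j\<in>UNIV. P $ i $ j * permute_list \<sigma> vs ! (2 * idx i) $ j)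
          * (\<Sum>j\<in>UNIV. Q $ i $ j * cnj (permute_list \<sigma> vs ! (2 * idx i + 1) $ j)))" by simp
  qed
  finally show ?thesis by simp
qed

lemma exists_basis_list:
  fixes idx :: "'m::finite \<Rightarrow> nat"
  assumes idx: "bij_betw idx UNIV {..<CARD('m)}"
  obtains vs :: "(complex^'m) list" where "length vs = 2 * CARD('m)" "det (basis_matrix idx vs) \<noteq> 0"
proof
  define vs :: "(complex^'m) list" where
    "vs = map (\<lambda>n. axis (inv_into UNIV idx (n div 2)) (if odd n then \<i> else 1)) [0..<2 * CARD('m)]"
  show "length vs = 2 * CARD('m)" by (simp add: vs_def)
  have im: "idx x < CARD('m)" for x using idx by (auto simp: bij_betw_def)
  have inj: "inj idx" using idx by (simp add: bij_betw_def)
  have "vs ! (2 * idx j + of_bool s) = axis j (if s then \<i> else 1)" for j s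
    using im[of j] inj by (cases s) (simp_all add: vs_def)
  then have "basis_matrix idx vs = wirtinger_matrix"
    unfolding basis_matrix_def wirtinger_matrix_def
    by (simp only:) (simp add: vec_eq_iff axis_def Let_def)
  then show "det (basis_matrix idx vs) \<noteq> 0" by (simp add: det_wirtinger_matrix)
qed

lemma power_kernel_prod:
  "length vs = 2 * r \<Longrightarrow> power_kernel H r vs = (\<i> / 2) ^ r * (\<Prod>k<r. \<Sum>a\<in>UNIV. vs ! (2 * k) $ a * (\<Sum>b\<in>UNIV. H $ a $ b * cnj (vs ! (2 * k + 1) $ b)))"
proof (induction r arbitrary: vs)
  case (Suc r)
  have "power_kernel H (Suc r) vs = form_kernel H (take 2 vs) * ((\<i> / 2) ^ r * (\<Prod>k<r. \<Sum>a\<in>UNIV. vs ! (2 * Suc k) $ a * (\<Sum>b\<in>UNIV. H $ a $ b * cnj (vs ! (2 * Suc k + 1) $ b))))"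
    using Suc.prems by (simp add: Suc.IH)
  also have "form_kernel H (take 2 vs) = (\<i> / 2) * (\<Sum>a\<in>UNIV. vs ! (2 * 0) $ a * (\<Sum>b\<in>UNIV. H $ a $ b * cnj (vs ! (2 * 0 + 1) $ b)))"
    by (simp add: form_kernel_def sum_distrib_left mult_ac)
  finally show ?case unfolding prod.lessThan_Suc_shift by (simp add: o_def mult_ac)
qed simp


text \<open>Distributing the product of the m - 2 factors of \<omega>^r over its sums gives one term
  for each choice a of a holomorphic index per factor. The places s0 and s1, with \<open>idx\<close>
  0 and 1, are reserved for the four extra covectors, so each term is a product over all of
  \<open>'m\<close> as in \<open>alternate_product\<close>.\<close>

lemma kernel_expansion:
  fixes H :: "complex^'m::finite^'m" and idx :: "'m \<Rightarrow> nat"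
  assumes idx: "bij_betw idx UNIV {..<CARD('m)}" and r: "CARD('m) = r + 2"
    and s: "idx s0 = 0" "idx s1 = 1" and len: "length ws = 2 * CARD('m)"
  shows "ws ! 0 $ \<alpha> * cnj (ws ! 1 $ \<beta>) * (ws ! 2 $ \<gamma> * (cnj (ws ! 3 $ \<delta>) * power_kernel H r (drop 4 ws)))
    = (\<i> / 2) ^ r * (\<Sum>a\<in>PiE (UNIV - {s0,s1}) (\<lambda>_. UNIV). \<Prod>i\<in>UNIV.
        (\<Sum>j\<in>UNIV. select_matrix (slots s0 s1 \<alpha> \<gamma> a) $ i $ j * ws ! (2 * idx i) $ j)
        * (\<Sum>j\<in>UNIV. (\<chi> i. if i = s0 then axis \<beta> 1 else if i = s1 then axis \<delta> 1 else H $ a i) $ i $ j * cnj (ws ! (2 * idx i + 1) $ j)))"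
proof -
  let ?R = "UNIV - {s0,s1} :: 'm set"
  define f where "f k b = ws ! (2 * k) $ b * (\<Sum>c\<in>UNIV. H $ b $ c * cnj (ws ! (2 * k + 1) $ c))" for k b
  have inj: "inj idx" using idx by (simp add: bij_betw_def)
  have ne: "s0 \<noteq> s1" using s by auto
  have bij: "bij_betw (\<lambda>i. idx i - 2) ?R {..<r}"
  proof -
    have "bij_betw idx ?R ({..<CARD('m)} - {0, 1})"
      using image_set_diff[OF inj, of UNIV "{s0,s1}"] idx s inj_on_subset[OF inj, of ?R]
      by (simp add: bij_betw_def)
    moreover have "bij_betw (\<lambda>n. n - 2) ({..<CARD('m)} - {0, 1}) {..<r}"
      by (rule bij_betwI[of _ _ _ "\<lambda>n. n + 2"]) (auto simp: r)
    ultimately have "bij_betw ((\<lambda>n. n - 2) \<circ> idx) ?R {..<r}" by (rule bij_betw_trans)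
    then show ?thesis by (simp add: o_def)
  qed
  have ge2: "idx i \<ge> 2" if "i \<in> ?R" for i
  proof -
    have "idx i \<noteq> 0" "idx i \<noteq> 1" using that s injD[OF inj, of i] by (metis DiffE insertCI)+
    then show ?thesis by linarith
  qed
  have "power_kernel H r (drop 4 ws) = (\<i> / 2) ^ r * (\<Prod>k<r. \<Sum>b\<in>UNIV. f (k + 2) b)"
  proof -
    have e: "4 + 2 * k = 2 * (k + 2)" "4 + (2 * k + 1) = 2 * (k + 2) + 1" for k :: nat by simp_all
    have "drop 4 ws ! j = ws ! (4 + j)" for j using len r by simp
    then have "drop 4 ws ! (2 * k) = ws ! (2 * (k + 2))" "drop 4 ws ! (2 * k + 1) = ws ! (2 * (k + 2) + 1)" for k
      by (simp_all only: e)
    moreover have "length (drop 4 ws) = 2 * r" using len r by simp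
    ultimately show ?thesis by (simp only: power_kernel_prod f_def)
  qed
  also have "(\<Prod>k<r. \<Sum>b\<in>UNIV. f (k + 2) b) = (\<Prod>i\<in>?R. \<Sum>b\<in>UNIV. f (idx i - 2 + 2) b)"
    by (rule prod.reindex_bij_betw[OF bij, symmetric])
  also have "\<dots> = (\<Prod>i\<in>?R. \<Sum>b\<in>UNIV. f (idx i) b)"
  proof (rule prod.cong[OF refl])
    fix i assume "i \<in> ?R"
    then have "idx i - 2 + 2 = idx i" using ge2 by (intro le_add_diff_inverse2)
    then show "(\<Sum>b\<in>UNIV. f (idx i - 2 + 2) b) = (\<Sum>b\<in>UNIV. f (idx i) b)" by (simp only:)
  qed
  also have "\<dots> = (\<Sum>a\<in>PiE ?R (\<lambda>_. UNIV). \<Prod>i\<in>?R. f (idx i) (a i))"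
    by (rule prod_sum_PiE) auto
  finally have pk: "power_kernel H r (drop 4 ws) = (\<i> / 2) ^ r * (\<Sum>a\<in>PiE ?R (\<lambda>_. UNIV). \<Prod>i\<in>?R. f (idx i) (a i))" .
  have "(\<Prod>i\<in>UNIV.
        (\<Sum>j\<in>UNIV. select_matrix (slots s0 s1 \<alpha> \<gamma> a) $ i $ j * ws ! (2 * idx i) $ j)
        * (\<Sum>j\<in>UNIV. (\<chi> i. if i = s0 then axis \<beta> 1 else if i = s1 then axis \<delta> 1 else H $ a i) $ i $ j * cnj (ws ! (2 * idx i + 1) $ j)))
      = ws ! 0 $ \<alpha> * cnj (ws ! 1 $ \<beta>) * (ws ! 2 $ \<gamma> * cnj (ws ! 3 $ \<delta>) * (\<Prod>i\<in>?R. f (idx i) (a i)))" (is "prod ?g UNIV = _") for a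
  proof -
    have sel: "(\<Sum>j\<in>UNIV. select_matrix A $ i $ j * w $ j) = w $ A i" for A :: "'m \<Rightarrow> 'm" and i and w :: "complex^'m"
      by (simp add: select_matrix_def if_distrib[of "\<lambda>x. x * _"] cong: if_cong)
    have ax: "(\<Sum>j\<in>UNIV. axis b 1 $ j * w j) = w b" for b :: 'm and w :: "'m \<Rightarrow> complex"
      by (simp add: axis_def if_distrib[of "\<lambda>x. x * _"] cong: if_cong)
    have "prod ?g UNIV = ?g s0 * (?g s1 * prod ?g ?R)"
    proof -
      have "prod ?g UNIV = ?g s0 * prod ?g (UNIV - {s0})" by (rule prod.remove) auto
      also have "prod ?g (UNIV - {s0}) = ?g s1 * prod ?g (UNIV - {s0} - {s1})" by (rule prod.remove) (use ne in auto)
      also have "UNIV - {s0} - {s1} = ?R" by auto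
      finally show ?thesis .
    qed
    also have "?g s0 = ws ! 0 $ \<alpha> * cnj (ws ! 1 $ \<beta>)" using ne by (simp add: sel ax s slots_def)
    also have "?g s1 = ws ! 2 $ \<gamma> * cnj (ws ! 3 $ \<delta>)" using ne by (simp add: sel ax s slots_def)
    also have "prod ?g ?R = (\<Prod>i\<in>?R. f (idx i) (a i))"
      by (rule prod.cong) (auto simp: sel slots_def f_def)
    finally show ?thesis by (simp add: mult_ac)
  qed
  then show ?thesis unfolding pk by (simp add: sum_distrib_left mult_ac)
qed

lemma alternate_kernel:
  fixes H :: "complex^'m::finite^'m" and idx :: "'m \<Rightarrow> nat"
  assumes idx: "bij_betw idx UNIV {..<CARD('m)}" and r: "CARD('m) = r + 2"
    and s: "idx s0 = 0" "idx s1 = 1" and len: "length vs = 2 * CARD('m)"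
  shows "alternate (2 * CARD('m)) (\<lambda>ws. ws ! 0 $ \<alpha> * cnj (ws ! 1 $ \<beta>) * (ws ! 2 $ \<gamma> * (cnj (ws ! 3 $ \<delta>) * power_kernel H r (drop 4 ws)))) vs
    = (\<i> / 2) ^ r * det (basis_matrix idx vs) * mixed_minor s0 s1 H \<alpha> \<beta> \<gamma> \<delta>"
proof -
  have "alternate (2 * CARD('m)) (\<lambda>ws. ws ! 0 $ \<alpha> * cnj (ws ! 1 $ \<beta>) * (ws ! 2 $ \<gamma> * (cnj (ws ! 3 $ \<delta>) * power_kernel H r (drop 4 ws)))) vs
    = alternate (2 * CARD('m)) (\<lambda>ws. (\<i> / 2) ^ r * (\<Sum>a\<in>PiE (UNIV - {s0,s1}) (\<lambda>_. UNIV). \<Prod>i\<in>UNIV.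
        (\<Sum>j\<in>UNIV. select_matrix (slots s0 s1 \<alpha> \<gamma> a) $ i $ j * ws ! (2 * idx i) $ j)
        * (\<Sum>j\<in>UNIV. (\<chi> i. if i = s0 then axis \<beta> 1 else if i = s1 then axis \<delta> 1 else H $ a i) $ i $ j * cnj (ws ! (2 * idx i + 1) $ j)))) vs"
    by (rule alternate_cong, rule kernel_expansion[OF idx r s]) (simp add: len)
  also have "\<dots> = (\<i> / 2) ^ r * det (basis_matrix idx vs) * mixed_minor s0 s1 H \<alpha> \<beta> \<gamma> \<delta>"
    unfolding alternate_cmult alternate_sum alternate_product[OF idx len] mixed_minor_def
    by (simp add: sum_distrib_left mult_ac)
  finally show ?thesis .
qed

text \<open>Wedging \<open>\<partial>\<partial>bar \<omega>\<^sup>m\<^sup>-\<^sup>2 = 0\<close> with \<open>dz\<^sup>\<alpha> \<and> dzbar\<^sup>\<beta>\<close> gives a divergence identity for the second-order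
  minors of the metric; it makes the operator in \<open>integral_contraction_zero\<close> formally exact.\<close>

lemma minors_divergence_free:
  fixes H :: "complex^'m::finite \<Rightarrow> complex^'m^'m"
  assumes card: "CARD('m) \<ge> 2" and S: "open S" and H: "ck 2 S H" and inv: "\<And>z. z \<in> S \<Longrightarrow> invertible (H z)" and x: "x \<in> S"
    and cond: "\<And>vs. length vs = 2 * (CARD('m) - 2) + 2 \<Longrightarrow>
      del (2 * (CARD('m) - 2) + 1) (delbar (2 * (CARD('m) - 2)) (wedge_power (fundamental_form H) (CARD('m) - 2))) x vs = 0"
  shows "(\<Sum>\<gamma>\<in>UNIV. \<Sum>\<delta>\<in>UNIV. d_dz \<gamma> (d_dzbar \<delta> (\<lambda>z. det (H z) *
      (inverse_metric (H z) \<alpha> \<beta> * inverse_metric (H z) \<gamma> \<delta> - inverse_metric (H z) \<alpha> \<delta> * inverse_metric (H z) \<gamma> \<beta>))) x) = 0"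
proof -
  define r where "r = CARD('m) - 2"
  have r: "CARD('m) = r + 2" using card by (simp add: r_def)
  obtain idx :: "'m \<Rightarrow> nat" where idx: "bij_betw idx UNIV {..<CARD('m)}"
    using ex_bij_betw_finite_nat[of "UNIV :: 'm set"] by (auto simp: atLeast0LessThan)
  obtain s0 s1 where s: "idx s0 = 0" "idx s1 = 1"
  proof -
    have "0 \<in> range idx" "1 \<in> range idx" using idx r by (auto simp: bij_betw_def)
    then show ?thesis using that by (metis rangeE)
  qed
  have ne: "s0 \<noteq> s1" using s by auto
  \<comment> \<open>A form of top degree is determined by its value on one list on which the
    standard volume form does not vanish.\<close>
  obtain vs :: "(complex^'m) list" where len: "length vs = 2 * CARD('m)" and K: "det (basis_matrix idx vs) \<noteq> 0"
    by (rule exists_basis_list[OF idx])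
  have len2: "length vs = 2 + (2 * r + 2)" using len r by simp
  let ?n = "2 + (2 * r + 2)"
  have n: "2 * CARD('m) = ?n" using r by simp
  define G where "G ws = (\<Sum>\<gamma>\<in>UNIV. \<Sum>\<delta>\<in>UNIV. ws ! 0 $ \<gamma> * (cnj (ws ! 1 $ \<delta>) *
         d_dz \<gamma> (d_dzbar \<delta> (\<lambda>z. power_kernel (H z) r (drop 2 ws))) x))" for ws
  define Z where "Z = del (2 * r + 1) (delbar (2 * r) (wedge_power (fundamental_form H) r)) x"
  define c where "c ws \<gamma> \<delta> = ws ! 0 $ \<alpha> * cnj (ws ! 1 $ \<beta>) * (ws ! 2 $ \<gamma> * cnj (ws ! 3 $ \<delta>))" for ws :: "(complex^'m) list" and \<gamma> \<delta>
  define \<Psi> where "\<Psi> \<gamma> \<delta> z ws = c ws \<gamma> \<delta> * power_kernel (H z) r (drop 4 ws)" for \<gamma> \<delta> z ws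
  have "0 = alternate ?n (\<lambda>ws. (ws ! 0 $ \<alpha> * cnj (ws ! 1 $ \<beta>)) * Z (drop 2 ws)) vs"
  proof -
    have "alternate ?n (\<lambda>ws. (ws ! 0 $ \<alpha> * cnj (ws ! 1 $ \<beta>)) * Z (drop 2 ws)) vs = alternate ?n (\<lambda>ws. 0) vs"
      by (rule alternate_cong) (use cond in \<open>simp add: Z_def len2 r_def\<close>)
    then show ?thesis by (simp add: alternate_def)
  qed
  also have "\<dots> = alternate ?n (\<lambda>ws. (\<lambda>us. us ! 0 $ \<alpha> * cnj (us ! 1 $ \<beta>)) (take 2 ws) * alternate (2 * r + 2) G (drop 2 ws)) vs"
  proof (rule alternate_cong)
    fix ws :: "(complex^'m) list" assume "length ws = length vs"
    then have l: "length (drop 2 ws) = 2 * r + 2" "take 2 ws ! 0 = ws ! 0" "take 2 ws ! 1 = ws ! 1" by (simp_all add: len2)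
    show "(ws ! 0 $ \<alpha> * cnj (ws ! 1 $ \<beta>)) * Z (drop 2 ws)
       = (\<lambda>us. us ! 0 $ \<alpha> * cnj (us ! 1 $ \<beta>)) (take 2 ws) * alternate (2 * r + 2) G (drop 2 ws)"
      unfolding l(2,3) Z_def G_def[abs_def] del_delbar_alternate[OF S H x l(1)] ..
  qed
  also have "\<dots> = fact (2 * r + 2) * alternate ?n (\<lambda>ws. (\<lambda>us. us ! 0 $ \<alpha> * cnj (us ! 1 $ \<beta>)) (take 2 ws) * G (drop 2 ws)) vs"
    by (rule alternate_right[OF len2])
  finally have z1: "alternate ?n (\<lambda>ws. (\<lambda>us. us ! 0 $ \<alpha> * cnj (us ! 1 $ \<beta>)) (take 2 ws) * G (drop 2 ws)) vs = 0"
    by (metis (no_types, lifting) fact_nonzero mult_eq_0_iff)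
  have H1: "ck (Suc 0) S H" and H2: "ck (Suc (Suc 0)) S H" using ck_le[OF H] H by (auto simp: numeral_2_eq_2 simp del: continuously_differentiable_on.simps)
  have pk: "ck (Suc 0) S (d_dzbar \<delta> (\<lambda>z. power_kernel (H z) r us))" for \<delta> us
    by (rule ck_wirtinger[OF S ck_power_kernel[OF S H2]])
  have d: "(\<lambda>z. power_kernel (H z) r us) differentiable at z" if "z \<in> S" for us z
    by (rule ck_differentiable[OF ck_power_kernel[OF S H1] that])
  have d': "d_dzbar \<delta> (\<lambda>z. power_kernel (H z) r us) differentiable at x" for \<delta> us
    by (rule ck_differentiable[OF pk x])
  have ck\<Psi>: "ck (Suc (Suc 0)) S (\<lambda>z. \<Psi> \<gamma> \<delta> z ws)" for \<gamma> \<delta> ws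
    unfolding \<Psi>_def by (intro ck_mult ck_const ck_power_kernel S H2)
  have \<Psi>': "d_dz \<gamma> (d_dzbar \<delta> (\<lambda>z. \<Psi> \<gamma>' \<delta>' z ws)) x
       = c ws \<gamma>' \<delta>' * d_dz \<gamma> (d_dzbar \<delta> (\<lambda>z. power_kernel (H z) r (drop 4 ws))) x" for \<gamma> \<delta> \<gamma>' \<delta>' ws
  proof -
    have "d_dz \<gamma> (d_dzbar \<delta> (\<lambda>z. \<Psi> \<gamma>' \<delta>' z ws)) x = d_dz \<gamma> (\<lambda>z. c ws \<gamma>' \<delta>' * d_dzbar \<delta> (\<lambda>z. power_kernel (H z) r (drop 4 ws)) z) x"
      unfolding \<Psi>_def by (rule wirtinger_cong(1)[OF S x]) (rule wirtinger_cmult(2)[OF d])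
    then show ?thesis by (simp add: wirtinger_cmult(1)[OF d'])
  qed
  have alt\<Psi>: "d_dz \<gamma> (d_dzbar \<delta> (\<lambda>z. alternate ?n (\<Psi> \<gamma> \<delta> z) vs)) x
      = alternate ?n (\<lambda>ws. d_dz \<gamma> (d_dzbar \<delta> (\<lambda>z. \<Psi> \<gamma> \<delta> z ws)) x) vs" for \<gamma> \<delta>
  proof -
    have "d_dz \<gamma> (d_dzbar \<delta> (\<lambda>z. alternate ?n (\<Psi> \<gamma> \<delta> z) vs)) x
        = d_dz \<gamma> (\<lambda>z. alternate ?n (\<lambda>ws. d_dzbar \<delta> (\<lambda>z. \<Psi> \<gamma> \<delta> z ws) z) vs) x"
      by (rule wirtinger_cong(1)[OF S x])
         (rule wirtinger_alternate(2)[where b="\<Psi> \<gamma> \<delta>", OF S ck_SucD[OF ck\<Psi>]])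
    also have "\<dots> = alternate ?n (\<lambda>ws. d_dz \<gamma> (d_dzbar \<delta> (\<lambda>z. \<Psi> \<gamma> \<delta> z ws)) x) vs"
      by (rule wirtinger_alternate(1)[where b="\<lambda>z ws. d_dzbar \<delta> (\<lambda>z. \<Psi> \<gamma> \<delta> z ws) z", OF S _ x])
         (rule ck_wirtinger[OF S ck\<Psi>])
    finally show ?thesis .
  qed
  have "alternate ?n (\<lambda>ws. (\<lambda>us. us ! 0 $ \<alpha> * cnj (us ! 1 $ \<beta>)) (take 2 ws) * G (drop 2 ws)) vs
      = alternate ?n (\<lambda>ws. \<Sum>\<gamma>\<in>UNIV. \<Sum>\<delta>\<in>UNIV. d_dz \<gamma> (d_dzbar \<delta> (\<lambda>z. \<Psi> \<gamma> \<delta> z ws)) x) vs"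
  proof (rule alternate_cong)
    fix ws :: "(complex^'m) list" assume "length ws = length vs"
    then have l: "length ws \<ge> 4" using len2 by simp
    have dr: "drop 2 ws ! 0 = ws ! 2" "drop 2 ws ! 1 = ws ! 3" "drop 2 (drop 2 ws) = drop 4 ws" "take 2 ws ! 0 = ws ! 0" "take 2 ws ! 1 = ws ! 1"
      using l by (simp_all add: numeral_eq_Suc)
    show "(\<lambda>us. us ! 0 $ \<alpha> * cnj (us ! 1 $ \<beta>)) (take 2 ws) * G (drop 2 ws)
       = (\<Sum>\<gamma>\<in>UNIV. \<Sum>\<delta>\<in>UNIV. d_dz \<gamma> (d_dzbar \<delta> (\<lambda>z. \<Psi> \<gamma> \<delta> z ws)) x)"
      unfolding \<Psi>' G_def dr c_def by (simp add: sum_distrib_left mult_ac)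
  qed
  also have "\<dots> = (\<Sum>\<gamma>\<in>UNIV. \<Sum>\<delta>\<in>UNIV. d_dz \<gamma> (d_dzbar \<delta> (\<lambda>z. alternate ?n (\<Psi> \<gamma> \<delta> z) vs)) x)"
    unfolding alternate_sum alt\<Psi> ..
  finally have z2: "(\<Sum>\<gamma>\<in>UNIV. \<Sum>\<delta>\<in>UNIV. d_dz \<gamma> (d_dzbar \<delta> (\<lambda>z. alternate ?n (\<Psi> \<gamma> \<delta> z) vs)) x) = 0"
    using z1 by simp
  obtain N :: nat where N: "N \<noteq> 0"
    "\<And>H \<alpha> \<beta> \<gamma> \<delta>. invertible H \<Longrightarrow> mixed_minor s0 s1 H \<alpha> \<beta> \<gamma> \<delta>
      = of_nat N * (det H * (inverse_metric H \<alpha> \<beta> * inverse_metric H \<gamma> \<delta> - inverse_metric H \<alpha> \<delta> * inverse_metric H \<gamma> \<beta>))"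
    by (rule mixed_minor_eq[OF ne]) (rule that)
  define q where "q \<gamma> \<delta> z = det (H z) *
      (inverse_metric (H z) \<alpha> \<beta> * inverse_metric (H z) \<gamma> \<delta> - inverse_metric (H z) \<alpha> \<delta> * inverse_metric (H z) \<gamma> \<beta>)" for \<gamma> \<delta> z
  \<comment> \<open>Collects the powers of i/2 from \<omega>^r, the value of the volume form on vs
    and the combinatorial factor N; none of them depends on the point or on \<gamma>, \<delta>, so C
    can be taken out of the derivatives and divided out.\<close>
  define C where "C = (\<i> / 2) ^ r * det (basis_matrix idx vs) * of_nat N"
  have C: "C \<noteq> 0" using K N(1) by (simp add: C_def)
  have altq: "alternate ?n (\<Psi> \<gamma> \<delta> z) vs = C * q \<gamma> \<delta> z" if "z \<in> S" for \<gamma> \<delta> z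
    using alternate_kernel[OF idx r s len, of \<alpha> \<beta> \<gamma> \<delta> "H z"] N(2)[OF inv[OF that]]
    unfolding \<Psi>_def c_def C_def q_def n by (simp add: mult_ac)
  \<comment> \<open>The regularity of q is read off from its expression as an alternation of
    kernels, which is polynomial in H.\<close>
  have ckq: "ck (Suc (Suc 0)) S (q \<gamma> \<delta>)" for \<gamma> \<delta>
  proof (rule ck_cong[OF S])
    show "ck (Suc (Suc 0)) S (\<lambda>z. inverse C * alternate ?n (\<Psi> \<gamma> \<delta> z) vs)"
      by (intro ck_mult ck_const S ck_Suc0_alternate ck\<Psi>)
    show "inverse C * alternate ?n (\<Psi> \<gamma> \<delta> z) vs = q \<gamma> \<delta> z" if "z \<in> S" for z
      unfolding altq[OF that] using C by simp
  qed
  have Cq: "d_dz \<gamma> (d_dzbar \<delta> (\<lambda>z. alternate ?n (\<Psi> \<gamma> \<delta> z) vs)) x = C * d_dz \<gamma> (d_dzbar \<delta> (q \<gamma> \<delta>)) x" for \<gamma> \<delta>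
  proof -
    have "d_dz \<gamma> (d_dzbar \<delta> (\<lambda>z. alternate ?n (\<Psi> \<gamma> \<delta> z) vs)) x = d_dz \<gamma> (\<lambda>z. C * d_dzbar \<delta> (q \<gamma> \<delta>) z) x"
    proof (rule wirtinger_cong(1)[OF S x])
      fix z assume z: "z \<in> S"
      have "d_dzbar \<delta> (\<lambda>z. alternate ?n (\<Psi> \<gamma> \<delta> z) vs) z = d_dzbar \<delta> (\<lambda>z. C * q \<gamma> \<delta> z) z"
        by (rule wirtinger_cong(2)[OF S z altq])
      also have "\<dots> = C * d_dzbar \<delta> (q \<gamma> \<delta>) z"
        by (rule wirtinger_cmult(2)[OF ck_differentiable[OF ckq z]])
      finally show "d_dzbar \<delta> (\<lambda>z. alternate ?n (\<Psi> \<gamma> \<delta> z) vs) z = C * d_dzbar \<delta> (q \<gamma> \<delta>) z" .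
    qed
    also have "\<dots> = C * d_dz \<gamma> (d_dzbar \<delta> (q \<gamma> \<delta>)) x"
      by (rule wirtinger_cmult(1)[OF ck_differentiable[OF ck_wirtinger(2)[OF S ckq] x]])
    finally show ?thesis .
  qed
  from z2 have "C * (\<Sum>\<gamma>\<in>UNIV. \<Sum>\<delta>\<in>UNIV. d_dz \<gamma> (d_dzbar \<delta> (q \<gamma> \<delta>)) x) = 0"
    unfolding Cq by (simp add: sum_distrib_left)
  then show ?thesis using C by (simp add: q_def[abs_def])
qed

section \<open>Integration by parts\<close>

text \<open>The library's change of variables theorem is stated for \<open>real^'n\<close> with a well-ordered index
  type, so the real coordinates of \<open>complex^'m\<close> are indexed by a copy of \<open>'m \<times> bool\<close> carrying
  an arbitrary linear order.\<close>

typedef 'm real_index = "UNIV :: ('m \<times> bool) set" by simp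

lemma bij_Abs_real_index: "bij Abs_real_index"
  by (metis Abs_real_index_inverse Rep_real_index_inverse UNIV_I bij_betw_def inj_on_def surj_def)

lemma real_index_inverse [simp]: "Rep_real_index (Abs_real_index t) = t"
  by (simp add: Abs_real_index_inverse)

instance real_index :: (finite) finite
proof
  have "range Abs_real_index = (UNIV :: 'a real_index set)" by (rule bij_is_surj[OF bij_Abs_real_index])
  then show "finite (UNIV :: 'a real_index set)" by (metis finite finite_imageI)
qed

definition real_index_rank :: "'m::finite real_index \<Rightarrow> nat" where
  "real_index_rank = (SOME f. inj f)"

lemma inj_real_index_rank: "inj real_index_rank"
proof -
  have "\<exists>f :: 'm::finite real_index \<Rightarrow> nat. inj f"
    using finite_imp_inj_to_nat_seg[of "UNIV :: 'm real_index set"] by auto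
  then show ?thesis unfolding real_index_rank_def by (rule someI_ex)
qed

instantiation real_index :: (finite) wellorder
begin
definition less_eq_real_index :: "'a real_index \<Rightarrow> 'a real_index \<Rightarrow> bool" where
  "less_eq_real_index x y \<longleftrightarrow> real_index_rank x \<le> real_index_rank y"
definition less_real_index :: "'a real_index \<Rightarrow> 'a real_index \<Rightarrow> bool" where
  "less_real_index x y \<longleftrightarrow> real_index_rank x < real_index_rank y"
instance
proof
  fix P :: "'a real_index \<Rightarrow> bool" and a
  assume *: "\<And>x. (\<And>y. y < x \<Longrightarrow> P y) \<Longrightarrow> P x"
  show "P a"
  proof (induction "real_index_rank a" arbitrary: a rule: less_induct)
    case less then show ?case by (metis * less_real_index_def)
  qed
qed (auto simp: less_eq_real_index_def less_real_index_def injD[OF inj_real_index_rank])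
end

section \<open>Real coordinates on the model space\<close>

definition of_coords :: "real^('m::finite) real_index \<Rightarrow> complex^'m" where
  "of_coords y = (\<chi> k. Complex (y $ Abs_real_index (k, False)) (y $ Abs_real_index (k, True)))"

definition to_coords :: "complex^'m \<Rightarrow> real^('m::finite) real_index" where
  "to_coords x = (\<chi> t. case Rep_real_index t of (k, s) \<Rightarrow> if s then Im (x $ k) else Re (x $ k))"

lemma of_to_coords [simp]: "of_coords (to_coords x) = x"
  by (simp add: of_coords_def to_coords_def vec_eq_iff)

lemma to_of_coords [simp]: "to_coords (of_coords y) = y"
proof -
  have "to_coords (of_coords y) $ t = y $ t" for t
    by (cases t) (auto simp: of_coords_def to_coords_def Abs_real_index_inverse split: prod.splits)
  then show ?thesis by (simp add: vec_eq_iff)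
qed

lemma bounded_linear_of_coords: "bounded_linear of_coords"
  by (simp add: linear_conv_bounded_linear[symmetric] linear_iff of_coords_def vec_eq_iff complex_eq_iff)

lemma bounded_linear_to_coords: "bounded_linear to_coords"
  by (simp add: linear_conv_bounded_linear[symmetric] linear_iff to_coords_def vec_eq_iff split: prod.splits)

lemma continuous_on_of_coords [continuous_intros]: "continuous_on S f \<Longrightarrow> continuous_on S (\<lambda>x. of_coords (f x))"
  by (rule bounded_linear.continuous_on[OF bounded_linear_of_coords])

lemma continuous_on_to_coords [continuous_intros]: "continuous_on S f \<Longrightarrow> continuous_on S (\<lambda>x. to_coords (f x))"
  by (rule bounded_linear.continuous_on[OF bounded_linear_to_coords])

section \<open>Compactly supported functions and their integrals\<close>

definition extend_zero :: "'a set \<Rightarrow> ('a \<Rightarrow> 'b::zero) \<Rightarrow> 'a \<Rightarrow> 'b" where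
  "extend_zero U f x = (if x \<in> U then f x else 0)"

text \<open>U and the complement of K are open and cover the space, and on the latter the extension
  is the zero function.\<close>

lemma extend_zero_ck:
  assumes "open U" "compact K" "K \<subseteq> U" "ck k U f" "\<And>x. x \<in> U - K \<Longrightarrow> f x = 0"
  shows "ck k UNIV (extend_zero U f)"
proof (rule ck_local)
  fix x :: 'a
  show "\<exists>T. open T \<and> x \<in> T \<and> ck k T (extend_zero U f)"
  proof (cases "x \<in> U")
    case True
    have "ck k U (extend_zero U f)" by (rule ck_cong[OF assms(1,4)]) (simp add: extend_zero_def)
    then show ?thesis using True assms(1) by blast
  next
    case False
    have o: "open (- K)" using assms(2) compact_imp_closed by blast
    have "ck k (- K) (extend_zero U f)"
      by (rule ck_cong[OF o ck_const[of _ _ 0]]) (use assms(5) in \<open>auto simp: extend_zero_def\<close>)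
    then show ?thesis using False assms(3) o by blast
  qed
qed

definition compactly_supported :: "('a::topological_space \<Rightarrow> 'b::zero) \<Rightarrow> bool" where
  "compactly_supported f \<longleftrightarrow> (\<exists>K. compact K \<and> (\<forall>x. x \<notin> K \<longrightarrow> f x = 0))"

definition coord_integral :: "(complex^'m::finite \<Rightarrow> 'b::euclidean_space) \<Rightarrow> 'b" where
  "coord_integral u = integral UNIV (\<lambda>y. u (of_coords y))"

lemma compactly_supported_coords:
  assumes "compactly_supported (u :: complex^'m::finite \<Rightarrow> 'b::zero)"
  shows "compactly_supported (\<lambda>y. u (of_coords y))"
proof -
  obtain K where K: "compact K" "\<And>x. x \<notin> K \<Longrightarrow> u x = 0" using assms by (auto simp: compactly_supported_def)
  have "compact (to_coords ` K)" by (intro compact_continuous_image continuous_on_to_coords continuous_on_id K)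
  moreover have "u (of_coords y) = 0" if "y \<notin> to_coords ` K" for y
    using that K(2) by (metis imageI to_of_coords)
  ultimately show ?thesis by (auto simp: compactly_supported_def)
qed

lemma compactly_supported_absolutely_integrable:
  fixes u :: "'a::euclidean_space \<Rightarrow> 'b::euclidean_space"
  assumes "continuous_on UNIV u" "compactly_supported u"
  shows "u absolutely_integrable_on UNIV"
proof -
  obtain K where K: "compact K" "\<And>x. x \<notin> K \<Longrightarrow> u x = 0" using assms by (auto simp: compactly_supported_def)
  obtain a where a: "K \<subseteq> cbox (- a) a" using bounded_subset_cbox_symmetric compact_imp_bounded[OF K(1)] by blast
  have "u absolutely_integrable_on cbox (- a) a"
    by (intro absolutely_integrable_continuous continuous_on_subset[OF assms(1)]) auto
  then have "(\<lambda>x. if x \<in> cbox (- a) a then u x else 0) absolutely_integrable_on UNIV"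
    by (simp only: absolutely_integrable_restrict_UNIV)
  moreover have "(\<lambda>x. if x \<in> cbox (- a) a then u x else 0) = u" using K(2) a by (auto simp: fun_eq_iff)
  ultimately show ?thesis by simp
qed

lemma coord_integrable:
  assumes "continuous_on UNIV (u :: complex^'m::finite \<Rightarrow> 'b::euclidean_space)" "compactly_supported u"
  shows "(\<lambda>y. u (of_coords y)) absolutely_integrable_on UNIV" "(\<lambda>y. u (of_coords y)) integrable_on UNIV"
proof -
  show "(\<lambda>y. u (of_coords y)) absolutely_integrable_on UNIV"
    by (intro compactly_supported_absolutely_integrable compactly_supported_coords assms(2)
        continuous_on_compose2[OF assms(1)] continuous_on_of_coords continuous_on_id) auto
  then show "(\<lambda>y. u (of_coords y)) integrable_on UNIV" by (simp add: absolutely_integrable_on_def)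
qed

lemma integral_translate:
  fixes u :: "'a::euclidean_space \<Rightarrow> 'b::euclidean_space"
  assumes "continuous_on UNIV u" "\<And>x. x \<notin> cbox a b \<Longrightarrow> u x = 0"
  shows "integral UNIV (\<lambda>x. u (x + c)) = integral UNIV u"
proof -
  have "(u has_integral integral (cbox a b) u) (cbox a b)"
    by (intro integrable_integral integrable_continuous continuous_on_subset[OF assms(1)]) auto
  note I = this
  have "((\<lambda>x. u (1 *\<^sub>R x + c)) has_integral (integral (cbox a b) u /\<^sub>R 1 ^ DIM('a))) (cbox ((a - c) /\<^sub>R 1) ((b - c) /\<^sub>R 1))"
    by (rule has_integral_affinity'[OF I]) simp
  then have J: "((\<lambda>x. u (x + c)) has_integral integral (cbox a b) u) (cbox (a - c) (b - c))" by simp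
  have "((\<lambda>x. u (x + c)) has_integral integral (cbox a b) u) UNIV"
  proof (rule has_integral_on_superset[OF J])
    fix x assume "x \<notin> cbox (a - c) (b - c)"
    then have "x + c \<notin> cbox a b" by (auto simp: mem_box algebra_simps)
    then show "u (x + c) = 0" by (rule assms(2))
  qed auto
  moreover have "(u has_integral integral (cbox a b) u) UNIV"
    by (rule has_integral_on_superset[OF I]) (use assms in auto)
  ultimately show ?thesis by (simp add: integral_unique)
qed

text \<open>Translation invariance makes \<open>\<integral> u(x + t v) dx\<close> constant in \<open>t\<close>; differentiate at \<open>t = 0\<close>.\<close>

lemma integral_directional_derivative:
  fixes u :: "'a::euclidean_space \<Rightarrow> 'b::euclidean_space"
  assumes u: "ck (Suc 0) UNIV u" and "compactly_supported u"
  shows "integral UNIV (\<lambda>x. frechet_derivative u (at x) v) = 0"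
proof -
  obtain K where K: "compact K" "\<And>x. x \<notin> K \<Longrightarrow> u x = 0" using assms by (auto simp: compactly_supported_def)
  obtain B where B: "\<And>x. x \<in> K \<Longrightarrow> norm x \<le> B" using compact_imp_bounded[OF K(1)] by (auto simp: bounded_iff)
  \<comment> \<open>The box contains the support of u thickened by the length of v, hence the
    support of every translate u(x + t v) with t between -1 and 1.\<close>
  obtain a where a: "cball 0 (B + norm v) \<subseteq> cbox (- a) (a :: 'a)"
    using bounded_subset_cbox_symmetric[OF bounded_cball] by blast
  have uc: "continuous_on UNIV u" using ck_continuous_on[OF u] .
  have dc: "continuous_on UNIV (\<lambda>x. frechet_derivative u (at x) v)" using u by simp
  have zero: "u (x + t *\<^sub>R v) = 0" if "x \<notin> cbox (- a) a" "t \<in> {-1..1}" for x t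
  proof (rule K(2), rule notI)
    assume "x + t *\<^sub>R v \<in> K"
    then have "norm (x + t *\<^sub>R v) \<le> B" by (rule B)
    moreover have "norm x \<le> norm (x + t *\<^sub>R v) + norm (t *\<^sub>R v)" by (metis add_diff_cancel_right' norm_triangle_ineq4)
    moreover have "norm (t *\<^sub>R v) \<le> 1 * norm v" unfolding norm_scaleR by (rule mult_right_mono) (use that in auto)
    ultimately have "x \<in> cball 0 (B + norm v)" by simp
    then show False using a that by blast
  qed
  have der0: "frechet_derivative u (at x) v = 0" if x: "x \<notin> cbox (- a) a" for x
  proof -
    have "frechet_derivative u (at x) = frechet_derivative (\<lambda>x. 0) (at x)"
    proof (rule frechet_derivative_cong)
      show "open (- cbox (- a) a)" by (simp add: closed_cbox open_Compl)
    qed (use x zero[of _ 0] in auto)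
    then show ?thesis by simp
  qed
  have U: "integral (cbox (- a) a) (\<lambda>x. u (x + t *\<^sub>R v)) = integral UNIV u" if "t \<in> {-1..1}" for t
  proof -
    have "integral (cbox (- a) a) (\<lambda>x. u (x + t *\<^sub>R v)) = integral UNIV (\<lambda>x. u (x + t *\<^sub>R v))"
      by (subst integral_restrict_UNIV[symmetric]) (auto intro!: integral_cong simp: zero[OF _ that])
    also have "\<dots> = integral UNIV u"
      by (rule integral_translate[OF uc, of "- a" a]) (use zero[of _ 0] in auto)
    finally show ?thesis .
  qed
  have D: "((\<lambda>t. integral (cbox (- a) a) (\<lambda>x. u (x + t *\<^sub>R v))) has_vector_derivative
      integral (cbox (- a) a) (\<lambda>x. frechet_derivative u (at (x + 0 *\<^sub>R v)) v)) (at 0 within {-1..1})"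
  proof (rule leibniz_rule_vector_derivative)
    fix t :: real and x :: 'a
    have h: "(u has_derivative frechet_derivative u (at (x + t *\<^sub>R v))) (at (x + t *\<^sub>R v))"
      by (rule ck_has_derivative[OF u]) simp
    have l: "linear (frechet_derivative u (at (x + t *\<^sub>R v)))" using h has_derivative_linear by blast
    have "((\<lambda>t. u (x + t *\<^sub>R v)) has_derivative (\<lambda>s. frechet_derivative u (at (x + t *\<^sub>R v)) (s *\<^sub>R v))) (at t within {-1..1})"
      by (rule has_derivative_compose[where g=u and f="\<lambda>t. x + t *\<^sub>R v", OF _ h]) (auto intro!: derivative_eq_intros)
    then show "((\<lambda>t. u (x + t *\<^sub>R v)) has_vector_derivative frechet_derivative u (at (x + t *\<^sub>R v)) v) (at t within {-1..1})"
      by (simp add: has_vector_derivative_def linear_cmul[OF l])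
  next
    show "(\<lambda>x. u (x + t *\<^sub>R v)) integrable_on cbox (- a) a" for t
      by (intro integrable_continuous continuous_on_compose2[OF uc] continuous_intros) auto
    have "continuous_on ({-1..1} \<times> cbox (- a) a) (\<lambda>z. frechet_derivative u (at (snd z + fst z *\<^sub>R v)) v)"
      by (intro continuous_on_compose2[OF dc] continuous_intros) auto
    then show "continuous_on ({-1..1} \<times> cbox (- a) a) (\<lambda>(t, x). frechet_derivative u (at (x + t *\<^sub>R v)) v)"
      by (simp add: case_prod_unfold)
  qed auto
  have "((\<lambda>t. integral UNIV u) has_vector_derivative
      integral (cbox (- a) a) (\<lambda>x. frechet_derivative u (at x) v)) (at 0 within {-1..1})"
    using has_vector_derivative_transform[OF _ _ D, of "\<lambda>t. integral UNIV u"] U by simp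
  moreover have "((\<lambda>t::real. integral UNIV u) has_vector_derivative 0) (at 0 within {-1..1})" by simp
  ultimately have "integral (cbox (- a) a) (\<lambda>x. frechet_derivative u (at x) v) = 0"
    by (intro vector_derivative_unique_within_closed_interval[of "-1" 1 0 "\<lambda>t. integral UNIV u"]) auto
  moreover have "integral UNIV (\<lambda>x. frechet_derivative u (at x) v) = integral (cbox (- a) a) (\<lambda>x. frechet_derivative u (at x) v)"
    by (subst (2) integral_restrict_UNIV[symmetric]) (auto intro!: integral_cong simp: der0)
  ultimately show ?thesis by simp
qed

lemma coord_integral_wirtinger:
  fixes u :: "complex^'m::finite \<Rightarrow> complex"
  assumes u: "ck (Suc 0) UNIV u" and c: "compactly_supported u"
  shows "coord_integral (d_dz \<alpha> u) = 0" "coord_integral (d_dzbar \<alpha> u) = 0"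
proof -
  let ?v = "\<lambda>y. u (of_coords y)"
  have v: "ck (Suc 0) UNIV ?v"
    by (rule ck_compose[OF open_UNIV open_UNIV _ ck_bounded_linear[OF bounded_linear_of_coords] u]) simp
  have D: "frechet_derivative ?v (at y) w = frechet_derivative u (at (of_coords y)) (of_coords w)" for y w
    by (subst frechet_derivative_eqI[OF has_derivative_compose[OF bounded_linear_imp_has_derivative[OF bounded_linear_of_coords] ck_has_derivative[OF u]]]) auto
  have I: "integral UNIV (\<lambda>y. frechet_derivative u (at (of_coords y)) w) = 0" for w
    using integral_directional_derivative[OF v compactly_supported_coords[OF c], of "to_coords w"] by (simp add: D)
  obtain K where K: "compact K" "\<And>x. x \<notin> K \<Longrightarrow> u x = 0" using c by (auto simp: compactly_supported_def)
  have int: "(\<lambda>y. frechet_derivative u (at (of_coords y)) w) integrable_on UNIV" for w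
  proof (rule coord_integrable(2))
    show "continuous_on UNIV (\<lambda>x. frechet_derivative u (at x) w)" using u by simp
    have "frechet_derivative u (at x) w = 0" if "x \<notin> K" for x
    proof -
      have "frechet_derivative u (at x) = frechet_derivative (\<lambda>x. 0) (at x)"
        by (rule frechet_derivative_cong[of "- K"]) (use that K compact_imp_closed in auto)
      then show ?thesis by simp
    qed
    then show "compactly_supported (\<lambda>x. frechet_derivative u (at x) w)" using K(1) by (auto simp: compactly_supported_def)
  qed
  show "coord_integral (d_dz \<alpha> u) = 0" "coord_integral (d_dzbar \<alpha> u) = 0"
    unfolding coord_integral_def d_dz_def d_dzbar_def
    by (simp_all add: integral_diff integral_add integrable_on_mult_right int I)
qed


section \<open>Integration by parts for functions supported in one chart\<close>

lemma supported_on_wirtinger: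
  assumes "open U" "compact K" "\<And>x. x \<in> U - K \<Longrightarrow> u x = 0" "x \<in> U - K"
  shows "d_dz \<alpha> u x = 0" "d_dzbar \<alpha> u x = 0"
proof -
  have o: "open (U - K)" using assms(1,2) by (simp add: open_Diff compact_imp_closed)
  show "d_dz \<alpha> u x = 0" "d_dzbar \<alpha> u x = 0"
    using wirtinger_cong[OF o assms(4), of u "\<lambda>_. 0"] assms(3) by simp_all
qed

lemma extend_zero_wirtinger:
  assumes "open U" "compact K" "K \<subseteq> U" "\<And>x. x \<in> U - K \<Longrightarrow> u x = 0"
  shows "d_dz \<alpha> (extend_zero U u) = extend_zero U (d_dz \<alpha> u)"
    "d_dzbar \<alpha> (extend_zero U u) = extend_zero U (d_dzbar \<alpha> u)"
proof -
  have "d_dz \<alpha> (extend_zero U u) x = extend_zero U (d_dz \<alpha> u) x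
      \<and> d_dzbar \<alpha> (extend_zero U u) x = extend_zero U (d_dzbar \<alpha> u) x" for x
  proof (cases "x \<in> U")
    case True
    then show ?thesis using wirtinger_cong[OF assms(1) True, of "extend_zero U u" u] by (simp add: extend_zero_def)
  next
    case False
    have o: "open (- K)" using assms(2) compact_imp_closed by blast
    have "x \<in> - K" using False assms(3) by blast
    with wirtinger_cong[OF o this, of "extend_zero U u" "\<lambda>_. 0"] assms(4) False
    show ?thesis by (auto simp: extend_zero_def)
  qed
  then show "d_dz \<alpha> (extend_zero U u) = extend_zero U (d_dz \<alpha> u)"
    "d_dzbar \<alpha> (extend_zero U u) = extend_zero U (d_dzbar \<alpha> u)" by auto
qed

lemma extend_zero_supported:
  assumes "compact K" "\<And>x. x \<in> U - K \<Longrightarrow> u x = 0"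
  shows "compactly_supported (extend_zero U u)"
  using assms by (auto simp: compactly_supported_def extend_zero_def)

lemma coord_integral_extend_wirtinger:
  assumes "open U" "compact K" "K \<subseteq> U" "ck (Suc 0) U u" "\<And>x. x \<in> U - K \<Longrightarrow> u x = 0"
  shows "coord_integral (extend_zero U (d_dz \<alpha> u)) = 0" "coord_integral (extend_zero U (d_dzbar \<alpha> u)) = 0"
proof -
  have e: "d_dz \<alpha> (extend_zero U u) = extend_zero U (d_dz \<alpha> u)" "d_dzbar \<alpha> (extend_zero U u) = extend_zero U (d_dzbar \<alpha> u)"
    by (rule extend_zero_wirtinger[OF assms(1-3)], fact assms(5))+
  have c: "ck (Suc 0) UNIV (extend_zero U u)" by (rule extend_zero_ck[OF assms(1-4)]) (fact assms(5))
  have s: "compactly_supported (extend_zero U u)" by (rule extend_zero_supported[OF assms(2)]) (fact assms(5))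
  show "coord_integral (extend_zero U (d_dz \<alpha> u)) = 0" "coord_integral (extend_zero U (d_dzbar \<alpha> u)) = 0"
    using coord_integral_wirtinger[OF c s, of \<alpha>] by (simp_all add: e)
qed

lemma extend_zero_integrable:
  fixes u :: "complex^'m::finite \<Rightarrow> 'b::euclidean_space"
  assumes "open U" "compact K" "K \<subseteq> U" "continuous_on U u" "\<And>x. x \<in> U - K \<Longrightarrow> u x = 0"
  shows "(\<lambda>y. extend_zero U u (of_coords y)) integrable_on UNIV"
  using coord_integrable(2)[OF _ extend_zero_supported[OF assms(2,5)]] extend_zero_ck[of U K 0 u] assms by simp

lemma coord_integral_extend_diff:
  fixes u v :: "complex^'m::finite \<Rightarrow> 'b::euclidean_space"
  assumes "open U" "compact K" "K \<subseteq> U" "continuous_on U u" "\<And>x. x \<in> U - K \<Longrightarrow> u x = 0"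
    "continuous_on U v" "\<And>x. x \<in> U - K \<Longrightarrow> v x = 0"
  shows "coord_integral (extend_zero U (\<lambda>x. u x - v x)) = coord_integral (extend_zero U u) - coord_integral (extend_zero U v)"
proof -
  have "extend_zero U (\<lambda>x. u x - v x) = (\<lambda>x. extend_zero U u x - extend_zero U v x)"
    by (auto simp: extend_zero_def)
  moreover have "(\<lambda>y. extend_zero U u (of_coords y)) integrable_on UNIV" "(\<lambda>y. extend_zero U v (of_coords y)) integrable_on UNIV"
    by (rule extend_zero_integrable[OF assms(1-3)], use assms(4-7) in auto)+
  ultimately show ?thesis unfolding coord_integral_def by (simp only: integral_diff)
qed

lemma coord_integral_extend_sum:
  fixes u :: "'i \<Rightarrow> complex^'m::finite \<Rightarrow> 'b::euclidean_space"
  assumes "finite I" "open U" "compact K" "K \<subseteq> U" "\<And>i. i \<in> I \<Longrightarrow> continuous_on U (u i)" "\<And>i x. i \<in> I \<Longrightarrow> x \<in> U - K \<Longrightarrow> u i x = 0"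
  shows "coord_integral (extend_zero U (\<lambda>x. \<Sum>i\<in>I. u i x)) = (\<Sum>i\<in>I. coord_integral (extend_zero U (u i)))"
proof -
  have "extend_zero U (\<lambda>x. \<Sum>i\<in>I. u i x) = (\<lambda>x. \<Sum>i\<in>I. extend_zero U (u i) x)"
    by (auto simp: extend_zero_def)
  moreover have "(\<lambda>y. extend_zero U (u i) (of_coords y)) integrable_on UNIV" if "i \<in> I" for i
    by (rule extend_zero_integrable[OF assms(2-4)]) (use assms(5,6) that in auto)
  ultimately show ?thesis unfolding coord_integral_def by (simp add: integral_sum[OF assms(1)])
qed

text \<open>Green's identity: q \<partial>\<partial>bar \<psi> - \<psi> \<partial>\<partial>bar q =
  \<partial>(q \<partial>bar \<psi>) - \<partial>bar(\<psi> \<partial>q). Both terms on the right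
  are derivatives of functions with compact support in U, because \<psi> or its derivative is a
  factor.\<close>

lemma coord_integral_by_parts:
  fixes q \<psi> :: "complex^'m::finite \<Rightarrow> complex"
  assumes U: "open U" "compact K" "K \<subseteq> U" and q: "ck 2 U q" and \<psi>: "ck 2 U \<psi>" "\<And>x. x \<in> U - K \<Longrightarrow> \<psi> x = 0"
  shows "coord_integral (extend_zero U (\<lambda>x. q x * d_dz \<gamma> (d_dzbar \<delta> \<psi>) x))
       = coord_integral (extend_zero U (\<lambda>x. \<psi> x * d_dz \<gamma> (d_dzbar \<delta> q) x))"
proof -
  have q2: "ck (Suc (Suc 0)) U q" and \<psi>2: "ck (Suc (Suc 0)) U \<psi>" using q \<psi> by (simp_all add: numeral_2_eq_2 del: continuously_differentiable_on.simps)
  note q1 = ck_SucD[OF q2] and \<psi>1 = ck_SucD[OF \<psi>2]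
  note dq = ck_wirtinger[OF U(1) q2] and d\<psi> = ck_wirtinger[OF U(1) \<psi>2]
  note ddq = ck_wirtinger(1)[OF U(1) dq(2)] and dd\<psi> = ck_wirtinger(1)[OF U(1) d\<psi>(2)]
  have z1: "d_dzbar \<delta> \<psi> x = 0" if "x \<in> U - K" for x by (rule supported_on_wirtinger(2)[OF U(1,2) \<psi>(2) that])
  have z2: "d_dz \<gamma> (d_dzbar \<delta> \<psi>) x = 0" if "x \<in> U - K" for x by (rule supported_on_wirtinger(1)[OF U(1,2) z1 that])
  let ?a = "\<lambda>x. q x * d_dzbar \<delta> \<psi> x" and ?b = "\<lambda>x. d_dz \<gamma> q x * \<psi> x"
  have eq: "q x * d_dz \<gamma> (d_dzbar \<delta> \<psi>) x - \<psi> x * d_dz \<gamma> (d_dzbar \<delta> q) x = d_dz \<gamma> ?a x - d_dzbar \<delta> ?b x" if x: "x \<in> U" for x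
    unfolding wirtinger_mult(1)[OF ck_differentiable[OF q1 x] ck_differentiable[OF d\<psi>(2) x]]
      wirtinger_mult(2)[OF ck_differentiable[OF dq(1) x] ck_differentiable[OF \<psi>1 x]]
      wirtinger_commute(1)[OF U(1) q x]
    by (simp add: algebra_simps)
  have 1: "coord_integral (extend_zero U (d_dz \<gamma> ?a)) = 0"
    by (rule coord_integral_extend_wirtinger(1)[OF U]) (auto intro!: ck_mult U q1 d\<psi> simp: z1 simp del: continuously_differentiable_on.simps)
  have 2: "coord_integral (extend_zero U (d_dzbar \<delta> ?b)) = 0"
    by (rule coord_integral_extend_wirtinger(2)[OF U]) (auto intro!: ck_mult U \<psi>1 dq simp: \<psi>(2) simp del: continuously_differentiable_on.simps)
  have ca: "continuous_on U (d_dz \<gamma> ?a)"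
    by (rule ck_continuous_on[OF ck_wirtinger(1)[OF U(1), of 0]]) (intro ck_mult U q1 d\<psi>)
  have cb: "continuous_on U (d_dzbar \<delta> ?b)"
    by (rule ck_continuous_on[OF ck_wirtinger(2)[OF U(1), of 0]]) (intro ck_mult U \<psi>1 dq)
  have za: "d_dz \<gamma> ?a x = 0" if "x \<in> U - K" for x
    by (rule supported_on_wirtinger(1)[OF U(1,2) _ that]) (simp add: z1)
  have zb: "d_dzbar \<delta> ?b x = 0" if "x \<in> U - K" for x
    by (rule supported_on_wirtinger(2)[OF U(1,2) _ that]) (simp add: \<psi>(2))
  have "coord_integral (extend_zero U (\<lambda>x. q x * d_dz \<gamma> (d_dzbar \<delta> \<psi>) x)) - coord_integral (extend_zero U (\<lambda>x. \<psi> x * d_dz \<gamma> (d_dzbar \<delta> q) x))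
     = coord_integral (extend_zero U (\<lambda>x. q x * d_dz \<gamma> (d_dzbar \<delta> \<psi>) x - \<psi> x * d_dz \<gamma> (d_dzbar \<delta> q) x))"
    by (rule coord_integral_extend_diff[OF U, symmetric])
       (auto intro!: continuous_intros ck_continuous_on[OF ddq] ck_continuous_on[OF dd\<psi>] ck_continuous_on[OF q] ck_continuous_on[OF \<psi>(1)] simp: z2 \<psi>(2))
  also have "extend_zero U (\<lambda>x. q x * d_dz \<gamma> (d_dzbar \<delta> \<psi>) x - \<psi> x * d_dz \<gamma> (d_dzbar \<delta> q) x)
      = extend_zero U (\<lambda>x. d_dz \<gamma> ?a x - d_dzbar \<delta> ?b x)"
    by (rule ext) (simp only: extend_zero_def eq cong: if_cong)
  also have "coord_integral \<dots> = 0"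
    by (subst coord_integral_extend_diff[OF U ca za cb zb]) (simp_all add: 1 2)
  finally show ?thesis by simp
qed

section \<open>The 2x2 minors of the inverse metric with rows \<alpha>, \<gamma> and columns
  \<beta>, \<delta>\<close>

definition minor_coeff :: "complex^'m::finite^'m \<Rightarrow> 'm \<Rightarrow> 'm \<Rightarrow> 'm \<Rightarrow> 'm \<Rightarrow> complex" where
  "minor_coeff H \<alpha> \<beta> \<gamma> \<delta> = inverse_metric H \<alpha> \<beta> * inverse_metric H \<gamma> \<delta> - inverse_metric H \<alpha> \<delta> * inverse_metric H \<gamma> \<beta>"

definition minor_contraction :: "complex^'m::finite^'m \<Rightarrow> ('m \<Rightarrow> 'm \<Rightarrow> 'm \<Rightarrow> 'm \<Rightarrow> complex) \<Rightarrow> complex" where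
  "minor_contraction H X = (\<Sum>\<alpha>\<in>UNIV. \<Sum>\<beta>\<in>UNIV. \<Sum>\<gamma>\<in>UNIV. \<Sum>\<delta>\<in>UNIV. minor_coeff H \<alpha> \<beta> \<gamma> \<delta> * X \<alpha> \<beta> \<gamma> \<delta>)"

text \<open>Integration by parts moves both derivatives from \<psi> to the coefficient for each
  quadruple of indices separately. For fixed \<alpha>, \<beta> the factor \<psi> then comes out of
  the sum over \<gamma>, \<delta>, and the divergence identity removes what is left.\<close>

lemma integral_contraction_zero:
  fixes \<psi> :: "'m::finite \<Rightarrow> 'm \<Rightarrow> complex^'m \<Rightarrow> complex" and H :: "complex^'m \<Rightarrow> complex^'m^'m"
  assumes U: "open U" "compact K" "K \<subseteq> U"
    and q: "\<And>\<alpha> \<beta> \<gamma> \<delta>. ck 2 U (\<lambda>z. det (H z) * minor_coeff (H z) \<alpha> \<beta> \<gamma> \<delta>)"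
    and div: "\<And>\<alpha> \<beta> x. x \<in> U \<Longrightarrow> (\<Sum>\<gamma>\<in>UNIV. \<Sum>\<delta>\<in>UNIV. d_dz \<gamma> (d_dzbar \<delta> (\<lambda>z. det (H z) * minor_coeff (H z) \<alpha> \<beta> \<gamma> \<delta>)) x) = 0"
    and \<psi>: "\<And>\<alpha> \<beta>. ck 2 U (\<psi> \<alpha> \<beta>)" "\<And>\<alpha> \<beta> x. x \<in> U - K \<Longrightarrow> \<psi> \<alpha> \<beta> x = 0"
  shows "coord_integral (extend_zero U (\<lambda>x. det (H x) * minor_contraction (H x) (\<lambda>\<alpha> \<beta> \<gamma> \<delta>. d_dz \<gamma> (d_dzbar \<delta> (\<psi> \<alpha> \<beta>)) x))) = 0"
proof -
  define Q where "Q = (\<lambda>(\<alpha>,\<beta>,\<gamma>,\<delta>) z. det (H z) * minor_coeff (H z) \<alpha> \<beta> \<gamma> \<delta>)"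
  define L where "L = (\<lambda>(\<alpha>::'m,\<beta>::'m,\<gamma>,\<delta>) f. d_dz \<gamma> (d_dzbar \<delta> f) :: complex^'m \<Rightarrow> complex)"
  define \<psi>' where "\<psi>' = (\<lambda>(\<alpha>,\<beta>,\<gamma>::'m,\<delta>::'m). \<psi> \<alpha> \<beta>)"
  have cL: "continuous_on U (L t f)" if "ck 2 U f" for t f
  proof -
    have "ck (Suc (Suc 0)) U f" using that by (simp add: numeral_2_eq_2 del: continuously_differentiable_on.simps)
    from ck_wirtinger(1)[OF U(1) ck_wirtinger(2)[OF U(1) this]] show ?thesis
      by (cases t) (simp add: L_def)
  qed
  have ckQ: "ck 2 U (Q t)" for t by (cases t) (simp add: Q_def q)
  have ck\<psi>: "ck 2 U (\<psi>' t)" for t by (cases t) (simp add: \<psi>'_def \<psi>)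
  have z\<psi>: "\<psi>' t x = 0" if "x \<in> U - K" for t x using that by (cases t) (simp add: \<psi>'_def \<psi>)
  have zL: "L t (\<psi>' t) x = 0" if "x \<in> U - K" for t x
  proof (cases t)
    case (fields \<alpha> \<beta> \<gamma> \<delta>)
    have "d_dz \<gamma> (d_dzbar \<delta> (\<psi> \<alpha> \<beta>)) x = 0"
      by (rule supported_on_wirtinger(1)[OF U(1,2) supported_on_wirtinger(2)[OF U(1,2) \<psi>(2)] that])
    then show ?thesis by (simp add: fields L_def \<psi>'_def)
  qed
  have parts: "coord_integral (extend_zero U (\<lambda>x. Q t x * L t (\<psi>' t) x)) = coord_integral (extend_zero U (\<lambda>x. \<psi>' t x * L t (Q t) x))" for t
    using coord_integral_by_parts[OF U ckQ[of t] ck\<psi>[of t] z\<psi>[of _ t]] by (cases t) (simp add: L_def)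
  have s4: "(\<Sum>t\<in>UNIV. f t) = (\<Sum>\<alpha>\<in>UNIV. \<Sum>\<beta>\<in>UNIV. \<Sum>\<gamma>\<in>UNIV. \<Sum>\<delta>\<in>UNIV. f (\<alpha>,\<beta>,\<gamma>,\<delta>))" for f :: "'m \<times> 'm \<times> 'm \<times> 'm \<Rightarrow> complex"
    by (simp add: sum.cartesian_product UNIV_Times_UNIV[symmetric] del: UNIV_Times_UNIV)
  have "coord_integral (extend_zero U (\<lambda>x. \<Sum>t\<in>UNIV. Q t x * L t (\<psi>' t) x)) = (\<Sum>t\<in>UNIV. coord_integral (extend_zero U (\<lambda>x. Q t x * L t (\<psi>' t) x)))"
    by (rule coord_integral_extend_sum[OF _ U])
       (auto intro!: continuous_intros cL ck\<psi> ck_continuous_on[OF ckQ] simp: zL)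
  also have "\<dots> = (\<Sum>t\<in>UNIV. coord_integral (extend_zero U (\<lambda>x. \<psi>' t x * L t (Q t) x)))" by (simp add: parts)
  also have "\<dots> = coord_integral (extend_zero U (\<lambda>x. \<Sum>t\<in>UNIV. \<psi>' t x * L t (Q t) x))"
    by (rule coord_integral_extend_sum[OF _ U, symmetric])
       (auto intro!: continuous_intros cL ckQ ck_continuous_on[OF ck\<psi>] simp: z\<psi>)
  also have "extend_zero U (\<lambda>x. \<Sum>t\<in>UNIV. \<psi>' t x * L t (Q t) x) = (\<lambda>x. 0)"
  proof -
    have "(\<Sum>t\<in>UNIV. \<psi>' t x * L t (Q t) x) = 0" if "x \<in> U" for x
      unfolding s4 using div[OF that] by (simp add: \<psi>'_def L_def Q_def flip: sum_distrib_left)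
    then show ?thesis by (auto simp: extend_zero_def)
  qed
  also have "coord_integral (\<lambda>x. 0 :: complex) = 0" by (simp add: coord_integral_def)
  also have "(\<lambda>x. \<Sum>t\<in>UNIV. Q t x * L t (\<psi>' t) x)
      = (\<lambda>x. det (H x) * minor_contraction (H x) (\<lambda>\<alpha> \<beta> \<gamma> \<delta>. d_dz \<gamma> (d_dzbar \<delta> (\<psi> \<alpha> \<beta>)) x))"
    unfolding s4 by (simp add: Q_def L_def \<psi>'_def minor_contraction_def sum_distrib_left mult_ac)
  finally show ?thesis .
qed

section \<open>Change of variables\<close>

lemma det_reindex:
  fixes M :: "'a::comm_ring_1^'i::finite^'i" and f :: "'j::finite \<Rightarrow> 'i"
  assumes "bij f"
  shows "det M = det (\<chi> i j. M $ f i $ f j)"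
proof -
  have "det M = (\<Sum>p | p permutes UNIV. of_int (sign p) * (\<Prod>i\<in>UNIV. M $ i $ map_permutation UNIV f p i))"
    unfolding det_def using sum_permutations_map[OF assms, of "\<lambda>p. \<Prod>i\<in>UNIV. M $ i $ p i"] by simp
  also have "\<dots> = (\<Sum>p | p permutes UNIV. of_int (sign p) * (\<Prod>i\<in>UNIV. M $ f i $ f (p i)))"
  proof (rule sum.cong[OF refl])
    fix p :: "'j \<Rightarrow> 'j"
    have "(\<Prod>i\<in>UNIV. M $ i $ map_permutation UNIV f p i) = (\<Prod>i\<in>UNIV. M $ f i $ map_permutation UNIV f p (f i))"
      using prod.reindex_bij_betw[OF assms, of "\<lambda>i. M $ i $ map_permutation UNIV f p i"] by simp
    then show "of_int (sign p) * (\<Prod>i\<in>UNIV. M $ i $ map_permutation UNIV f p i) = of_int (sign p) * (\<Prod>i\<in>UNIV. M $ f i $ f (p i))"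
      using assms by (simp add: map_permutation_apply bij_is_inj)
  qed
  finally show ?thesis by (simp add: det_def)
qed

lemma det_of_real: "of_real (det M) = det (\<chi> i j. (of_real (M $ i $ j) :: 'b::{comm_ring_1,real_algebra_1}))"
  by (simp add: det_def)

text \<open>Expressed in dz and dzbar instead of dx and dy, a complex linear map is block diagonal
  with blocks J and its conjugate. Conjugation by \<open>wirtinger_matrix\<close> preserves the
  determinant, which is therefore the square modulus of det J.\<close>

lemma det_complex_linear:
  fixes D :: "complex^'m::finite \<Rightarrow> complex^'m"
  assumes D: "\<And>c v. D (c *s v) = c *s D v"
  shows "\<bar>det (matrix (\<lambda>y. to_coords (D (of_coords y))))\<bar> = (cmod (det (\<chi> k l. D (axis l 1) $ k)))\<^sup>2"
proof -
  let ?M = "matrix (\<lambda>y. to_coords (D (of_coords y)))"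
  let ?J = "\<chi> k l. D (axis l 1) $ k"
  define R :: "complex^('m\<times>bool)^('m\<times>bool)" where "R = (\<chi> i j. of_real (?M $ Abs_real_index i $ Abs_real_index j))"
  have ax: "of_coords (axis (Abs_real_index (l, t)) 1) = axis l (if t then \<i> else 1)" for l :: 'm and t
  proof -
    have [simp]: "Abs_real_index a = Abs_real_index b \<longleftrightarrow> a = b" for a b :: "'m \<times> bool"
      by (metis real_index_inverse)
    show ?thesis by (simp add: of_coords_def axis_def vec_eq_iff complex_eq_iff)
  qed
  have Dax: "D (axis l (if t then \<i> else 1)) = (if t then \<i> else 1) *s D (axis l 1)" for l t
  proof -
    have "axis l (if t then \<i> else 1) = (if t then \<i> else 1) *s (axis l 1 :: complex^'m)" by (simp add: vec_eq_iff axis_def)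
    then show ?thesis by (simp only: D)
  qed
  have R: "R $ (k,s) $ (l,t) = of_real (if s then Im ((if t then \<i> else 1) * ?J $ k $ l) else Re ((if t then \<i> else 1) * ?J $ k $ l))" for k s l t
    by (simp only: R_def matrix_def vec_lambda_beta ax Dax to_coords_def real_index_inverse case_prod_conv vector_smult_component)
  have "of_real (det ?M) = det R"
  proof -
    have "of_real (det ?M) = (det (\<chi> i j. of_real (?M $ i $ j)) :: complex)" by (rule det_of_real)
    also have "\<dots> = det R" unfolding R_def
      by (subst det_reindex[OF bij_Abs_real_index]) simp
    finally show ?thesis .
  qed
  moreover have "wirtinger_matrix ** R = block_diag ?J (\<chi> k l. cnj (?J $ k $ l)) ** wirtinger_matrix"
  proof -
    have "(wirtinger_matrix ** R) $ (k,s) $ (l,t) = (block_diag ?J (\<chi> k l. cnj (?J $ k $ l)) ** wirtinger_matrix) $ (k,s) $ (l,t)" for k s l t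
    proof -
      have 1: "(wirtinger_matrix ** R) $ (k,s) $ (l,t) = R $ (k,False) $ (l,t) + (if s then - \<i> else \<i>) * R $ (k,True) $ (l,t)"
        by (simp add: matrix_matrix_mult_def wirtinger_matrix_def sum_prod_bool if_distrib[of "\<lambda>x. x * _"] sum.distrib cong: if_cong)
      have 2: "(block_diag ?J (\<chi> k l. cnj (?J $ k $ l)) ** wirtinger_matrix) $ (k,s) $ (l,t)
          = (if s then cnj (?J $ k $ l) else ?J $ k $ l) * (if t then (if s then - \<i> else \<i>) else 1)"
        by (cases s) (simp_all add: matrix_matrix_mult_def wirtinger_matrix_def block_diag_def sum_prod_bool if_distrib[of "\<lambda>x. _ * x"] cong: if_cong)
      show ?thesis unfolding 1 2 R by (cases s; cases t) (simp_all add: complex_eq_iff)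
    qed
    then show ?thesis by (simp add: vec_eq_iff)
  qed
  from arg_cong[OF this, of det] have "det (wirtinger_matrix :: complex^('m\<times>bool)^('m\<times>bool)) * det R = (det ?J * det (\<chi> k l. cnj (?J $ k $ l))) * det (wirtinger_matrix :: complex^('m\<times>bool)^('m\<times>bool))"
    by (simp only: det_mul det_block_diag)
  then have "det R = det ?J * det (\<chi> k l. cnj (?J $ k $ l))" using det_wirtinger_matrix[where 'm='m] by simp
  moreover have "det (\<chi> k l. cnj (?J $ k $ l)) = cnj (det ?J)" by (simp add: det_def)
  ultimately have "complex_of_real (det ?M) = complex_of_real ((cmod (det ?J))\<^sup>2)"
    by (simp add: complex_norm_square del: of_real_power)
  then show ?thesis by (simp only: of_real_eq_iff abs_power2)
qed

definition complex_jacobian :: "(complex^'m::finite \<Rightarrow> complex^'m) \<Rightarrow> complex^'m \<Rightarrow> complex^'m^'m" where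
  "complex_jacobian T x = (\<chi> \<gamma> \<alpha>. d_dz \<alpha> (\<lambda>x. T x $ \<gamma>) x)"

text \<open>Integrability over T U is inherited from the extension by zero, which is continuous with
  compact support. Wrapping u into real^1 serves a theorem about vector-valued integrands.\<close>

lemma coord_integral_change_of_variables:
  fixes T :: "complex^'m::finite \<Rightarrow> complex^'m" and u :: "complex^'m \<Rightarrow> real"
  assumes U: "open U" and T: "holomorphic_map_on U T" "inj_on T U" and TU: "open (T ` U)"
    and u: "continuous_on (T ` U) u" and K: "compact K" "K \<subseteq> T ` U" "\<And>y. y \<in> T ` U - K \<Longrightarrow> u y = 0"
  shows "coord_integral (extend_zero U (\<lambda>x. u (T x) * (cmod (det (complex_jacobian T x)))\<^sup>2)) = coord_integral (extend_zero (T ` U) u)"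
proof -
  let ?D = "\<lambda>x. frechet_derivative T (at x)"
  let ?S = "to_coords ` U"
  let ?g = "\<lambda>y. to_coords (T (of_coords y))"
  let ?g' = "\<lambda>y w. to_coords (?D (of_coords y) (of_coords w))"
  let ?f = "\<lambda>y. vec (u (of_coords y)) :: real^1"
  have S: "?S = of_coords -` U" by (auto intro: image_eqI[of _ _ "of_coords _"])
  have oS: "open ?S" unfolding S
    by (rule open_vimage[OF U]) (intro continuous_on_of_coords continuous_on_id)
  have D: "(T has_derivative ?D x) (at x)" "?D x (c *s v) = c *s ?D x v" if "x \<in> U" for x c v
  proof -
    from bspec[OF T(1)[unfolded holomorphic_map_on_def] that]
    obtain D where D: "(T has_derivative D) (at x)" "\<forall>c v. D (c *s v) = c *s D v" by blast
    moreover from D(1) have "?D x = D" by (rule frechet_derivative_eqI)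
    ultimately show "(T has_derivative ?D x) (at x)" "?D x (c *s v) = c *s ?D x v" by simp_all
  qed
  have det: "\<bar>det (matrix (?g' y))\<bar> = (cmod (det (complex_jacobian T (of_coords y))))\<^sup>2" if "y \<in> ?S" for y
  proof -
    have y: "of_coords y \<in> U" using that by (simp add: S)
    have "complex_jacobian T (of_coords y) = (\<chi> k l. ?D (of_coords y) (axis l 1) $ k)"
    proof -
      have "d_dz l (\<lambda>x. T x $ k) (of_coords y) = ?D (of_coords y) (axis l 1) $ k" for k l
        unfolding wirtinger_holomorphic(2)[OF holomorphic_map_component[OF T(1)] y]
        by (subst frechet_derivative_eqI[OF bounded_linear.has_derivative[OF bounded_linear_vec_nth D(1)[OF y]]]) simp
      then show ?thesis by (simp add: complex_jacobian_def)
    qed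
    then show ?thesis using det_complex_linear[of "?D (of_coords y)", OF D(2)[OF y]] by simp
  qed
  have img: "?g ` ?S = to_coords ` (T ` U)" by (auto simp: image_image)
  have ext: "extend_zero (T ` U) u (of_coords y) = (if y \<in> ?g ` ?S then u (of_coords y) else 0)" for y
  proof -
    have "y \<in> to_coords ` (T ` U) \<longleftrightarrow> of_coords y \<in> T ` U"
    proof
      assume "of_coords y \<in> T ` U"
      then have "to_coords (of_coords y) \<in> to_coords ` (T ` U)" by (rule imageI)
      then show "y \<in> to_coords ` (T ` U)" by (simp only: to_of_coords)
    next
      assume "y \<in> to_coords ` (T ` U)"
      then obtain v where "v \<in> T ` U" "y = to_coords v" by (rule imageE)
      then show "of_coords y \<in> T ` U" by (simp only: of_to_coords)
    qed
    then show ?thesis unfolding img extend_zero_def by simp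
  qed
  have "(\<lambda>y. extend_zero (T ` U) u (of_coords y)) absolutely_integrable_on UNIV"
  proof (rule coord_integrable(1))
    show "continuous_on UNIV (extend_zero (T ` U) u)"
      using extend_zero_ck[OF TU K(1,2), of 0 u] u K(3) by simp
    show "compactly_supported (extend_zero (T ` U) u)" using K by (intro extend_zero_supported) auto
  qed
  then have uai: "(\<lambda>y. u (of_coords y)) absolutely_integrable_on ?g ` ?S"
    unfolding ext by (simp only: absolutely_integrable_restrict_UNIV)
  have bl: "bounded_linear (vec :: real \<Rightarrow> real^1)"
    by (simp add: linear_conv_bounded_linear[symmetric] linear_iff vec_eq_iff)
  have fai: "?f absolutely_integrable_on ?g ` ?S"
    using absolutely_integrable_linear[OF uai bl] by (simp add: o_def)
  have "(\<lambda>x. \<bar>det (matrix (?g' x))\<bar> *\<^sub>R ?f (?g x)) absolutely_integrable_on ?S \<and>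
        integral ?S (\<lambda>x. \<bar>det (matrix (?g' x))\<bar> *\<^sub>R ?f (?g x)) = integral (?g ` ?S) ?f
     \<longleftrightarrow> ?f absolutely_integrable_on (?g ` ?S) \<and> integral (?g ` ?S) ?f = integral (?g ` ?S) ?f"
  proof (rule has_absolute_integral_change_of_variables)
    show "?S \<in> sets lebesgue" using oS by (simp add: borel_open)
    show "(?g has_derivative ?g' y) (at y within ?S)" if "y \<in> ?S" for y
    proof -
      have y: "of_coords y \<in> U" using that by (simp add: S)
      show ?thesis
        by (rule has_derivative_at_withinI)
           (intro bounded_linear.has_derivative[OF bounded_linear_to_coords]
             has_derivative_compose[OF bounded_linear_imp_has_derivative[OF bounded_linear_of_coords] D(1)[OF y]])
    qed
    show "inj_on ?g ?S"
    proof (rule inj_onI)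
      fix a b assume "a \<in> ?S" "b \<in> ?S" "?g a = ?g b"
      then have "T (of_coords a) = T (of_coords b)" by (metis of_to_coords)
      then have "of_coords a = of_coords b" using T(2) \<open>a \<in> ?S\<close> \<open>b \<in> ?S\<close> by (auto simp: S inj_on_def)
      then show "a = b" by (metis to_of_coords)
    qed
  qed
  then have C: "(\<lambda>x. \<bar>det (matrix (?g' x))\<bar> *\<^sub>R ?f (?g x)) absolutely_integrable_on ?S"
    "integral ?S (\<lambda>x. \<bar>det (matrix (?g' x))\<bar> *\<^sub>R ?f (?g x)) = integral (?g ` ?S) ?f"
    using fai by auto
  have "integral ?S (\<lambda>x. \<bar>det (matrix (?g' x))\<bar> * u (T (of_coords x))) = integral (?g ` ?S) (\<lambda>y. u (of_coords y))"
  proof -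
    have "integral ?S (\<lambda>x. (\<bar>det (matrix (?g' x))\<bar> *\<^sub>R ?f (?g x)) $ 1) = integral (?g ` ?S) (\<lambda>y. ?f y $ 1)"
      using C fai by (simp add: integral_component_eq_cart absolutely_integrable_on_def del: vec_component vector_scaleR_component)
    then show ?thesis by simp
  qed
  moreover have "coord_integral (extend_zero (T ` U) u) = integral (?g ` ?S) (\<lambda>y. u (of_coords y))"
    unfolding coord_integral_def ext by (rule integral_restrict_UNIV)
  moreover have "coord_integral (extend_zero U (\<lambda>x. u (T x) * (cmod (det (complex_jacobian T x)))\<^sup>2))
     = integral ?S (\<lambda>x. \<bar>det (matrix (?g' x))\<bar> * u (T (of_coords x)))"
  proof -
    have "coord_integral (extend_zero U (\<lambda>x. u (T x) * (cmod (det (complex_jacobian T x)))\<^sup>2))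
      = integral UNIV (\<lambda>y. if y \<in> ?S then \<bar>det (matrix (?g' y))\<bar> * u (T (of_coords y)) else 0)"
      unfolding coord_integral_def by (rule integral_cong) (simp add: extend_zero_def det S[symmetric] del: vimage_eq, simp add: S)
    then show ?thesis by (simp only: integral_restrict_UNIV)
  qed
  ultimately show ?thesis by simp
qed

section \<open>Hermitian metrics and the invariant operator\<close>

text \<open>Cholesky factorization by induction on the index set. Kernels on arbitrary finite sets
  are used in place of matrices because one index is removed at each step.\<close>

lemma positive_kernel_factorization:
  fixes h :: "'i \<Rightarrow> 'i \<Rightarrow> complex"
  assumes "finite S" "\<And>a b. a \<in> S \<Longrightarrow> b \<in> S \<Longrightarrow> h b a = cnj (h a b)"
    "\<And>v. \<exists>i\<in>S. v i \<noteq> 0 \<Longrightarrow> Re (\<Sum>a\<in>S. \<Sum>b\<in>S. h a b * v a * cnj (v b)) > 0"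
  shows "\<exists>E. \<forall>a\<in>S. \<forall>b\<in>S. h a b = (\<Sum>s\<in>S. E s a * cnj (E s b))"
  using assms
proof (induction S arbitrary: h rule: finite_induct)
  case empty then show ?case by simp
next
  case (insert x S)
  note herm = insert.prems(1) and pos = insert.prems(2)
  define d where "d = Re (h x x)"
  have hxx: "h x x = of_real d" using herm[of x x] by (simp add: d_def complex_eq_iff)
  have d: "d > 0"
  proof -
    have "(\<Sum>a\<in>insert x S. \<Sum>b\<in>insert x S. h a b * (if a = x then 1 else 0) * cnj (if b = x then 1 else 0)) = h x x"
    proof -
      have "(\<Sum>b\<in>insert x S. h a b * (if a = x then 1 else 0) * cnj (if b = x then 1 else 0)) = (if a = x then h x x else 0)" for a
        using insert.hyps by (simp add: if_distrib[of cnj] if_distrib[of "\<lambda>y. _ * y"] cong: if_cong)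
      then show ?thesis using insert.hyps by simp
    qed
    then show ?thesis using pos[of "\<lambda>i. if i = x then 1 else 0"] hxx by simp
  qed
  \<comment> \<open>Schur complement of the diagonal entry at x.\<close>
  define h' where "h' a b = h a b - h a x * h x b / d" for a b
  have "\<exists>E. \<forall>a\<in>S. \<forall>b\<in>S. h' a b = (\<Sum>s\<in>S. E s a * cnj (E s b))"
  proof (rule insert.IH)
    fix a b assume "a \<in> S" "b \<in> S"
    then show "h' b a = cnj (h' a b)" using herm[of a b] herm[of a x] herm[of x b] by (simp add: h'_def)
  next
    fix v :: "'i \<Rightarrow> complex" assume v: "\<exists>i\<in>S. v i \<noteq> 0"
    define c where "c = (\<Sum>a\<in>S. h a x * v a)"
    have c': "cnj c = (\<Sum>b\<in>S. h x b * cnj (v b))"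
    proof -
      have "cnj c = (\<Sum>b\<in>S. cnj (h b x) * cnj (v b))" by (simp add: c_def)
      also have "\<dots> = (\<Sum>b\<in>S. h x b * cnj (v b))"
      proof (rule sum.cong[OF refl])
        fix b assume "b \<in> S"
        then show "cnj (h b x) * cnj (v b) = h x b * cnj (v b)" using herm[of b x] by simp
      qed
      finally show ?thesis .
    qed
    \<comment> \<open>The value at x minimizes the form of h for prescribed v on S; at this minimum
      it equals the form of the Schur complement, which is therefore positive.\<close>
    define w where "w i = (if i = x then - c / d else v i)" for i
    have wS: "w i = v i" if "i \<in> S" for i using that insert.hyps by (auto simp: w_def)
    let ?S = "\<Sum>a\<in>S. \<Sum>b\<in>S. h a b * v a * cnj (v b)"
    have "(\<Sum>a\<in>insert x S. \<Sum>b\<in>insert x S. h a b * w a * cnj (w b))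
      = h x x * w x * cnj (w x) + (\<Sum>b\<in>S. h x b * w x * cnj (w b)) + ((\<Sum>a\<in>S. h a x * w a * cnj (w x)) + (\<Sum>a\<in>S. \<Sum>b\<in>S. h a b * w a * cnj (w b)))"
      using insert.hyps by (simp add: sum.distrib)
    also have "(\<Sum>a\<in>S. \<Sum>b\<in>S. h a b * w a * cnj (w b)) = ?S"
      by (intro sum.cong refl) (simp add: wS)
    also have "(\<Sum>b\<in>S. h x b * w x * cnj (w b)) = w x * cnj c"
      unfolding c' sum_distrib_left by (rule sum.cong) (auto simp: wS)
    also have "(\<Sum>a\<in>S. h a x * w a * cnj (w x)) = c * cnj (w x)"
      unfolding c_def sum_distrib_right by (rule sum.cong) (auto simp: wS)
    also have "h x x * w x * cnj (w x) + w x * cnj c + (c * cnj (w x) + ?S) = ?S - c * cnj c / d"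
      using d by (simp add: w_def hxx field_simps power2_eq_square)
    also have "?S - c * cnj c / d = (\<Sum>a\<in>S. \<Sum>b\<in>S. h' a b * v a * cnj (v b))"
    proof -
      have "c * cnj c / d = (\<Sum>a\<in>S. \<Sum>b\<in>S. (h a x * v a) * (h x b * cnj (v b)) / d)"
        unfolding c' unfolding c_def sum_product sum_divide_distrib ..
      then show ?thesis by (simp add: h'_def sum_subtractf[symmetric] algebra_simps)
    qed
    finally have eq: "(\<Sum>a\<in>insert x S. \<Sum>b\<in>insert x S. h a b * w a * cnj (w b)) = (\<Sum>a\<in>S. \<Sum>b\<in>S. h' a b * v a * cnj (v b))" .
    have "\<exists>i\<in>insert x S. w i \<noteq> 0" using v wS by auto
    from pos[OF this] show "Re (\<Sum>a\<in>S. \<Sum>b\<in>S. h' a b * v a * cnj (v b)) > 0" unfolding eq .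
  qed
  then obtain E where E: "\<And>a b. a \<in> S \<Longrightarrow> b \<in> S \<Longrightarrow> h' a b = (\<Sum>s\<in>S. E s a * cnj (E s b))" by blast
  \<comment> \<open>The new row s = x is h(a, x) divided by the square root of d; it reproduces the
    part removed in the Schur complement. The old rows are set to zero at x.\<close>
  define E' where "E' s a = (if s = x then h a x / sqrt d else if a = x then 0 else E s a)" for s a
  have sq: "complex_of_real (sqrt d) * complex_of_real (sqrt d) = of_real d" using d by (simp flip: of_real_mult)
  have xx: "E' x a * cnj (E' x b) = h a x * h x b / d" if "a \<in> insert x S" "b \<in> insert x S" for a b
    using herm[of b x] that d by (simp add: E'_def sq)
  have "h a b = (\<Sum>s\<in>insert x S. E' s a * cnj (E' s b))" if ab: "a \<in> insert x S" "b \<in> insert x S" for a b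
  proof (cases "a = x \<or> b = x")
    case True
    have "(\<Sum>s\<in>S. E' s a * cnj (E' s b)) = 0" by (rule sum.neutral) (use True insert.hyps in \<open>auto simp: E'_def\<close>)
    then show ?thesis using True insert.hyps d xx[OF ab] by (auto simp: hxx)
  next
    case False
    then have "a \<in> S" "b \<in> S" using ab by auto
    have "(\<Sum>s\<in>S. E' s a * cnj (E' s b)) = h' a b"
      unfolding E[OF \<open>a \<in> S\<close> \<open>b \<in> S\<close>] by (rule sum.cong) (use False insert.hyps in \<open>auto simp: E'_def\<close>)
    then show ?thesis using insert.hyps xx[OF ab] by (simp add: h'_def)
  qed
  then show ?case by blast
qed

lemma positive_definite_invertible:
  fixes H :: "complex^'m::finite^'m"
  assumes "hermitian_positive_definite H" shows "invertible H"
proof -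
  have "x = 0" if "H *v x = 0" for x
  proof (rule ccontr)
    assume "x \<noteq> 0"
    \<comment> \<open>\<open>hermitian_form\<close> conjugates the vector in the second index, the
      one contracted by the matrix product, so a kernel vector has to be inserted
      conjugated.\<close>
    then have "(\<chi> i. cnj (x $ i)) \<noteq> 0" by (simp add: vec_eq_iff)
    then have "Re (hermitian_form H (\<chi> i. cnj (x $ i))) > 0" using assms by (simp add: hermitian_positive_definite_def)
    moreover have "hermitian_form H (\<chi> i. cnj (x $ i)) = (\<Sum>a\<in>UNIV. cnj (x $ a) * (H *v x) $ a)"
      by (simp add: hermitian_form_def matrix_vector_mult_def sum_distrib_left mult_ac)
    ultimately show False using that by simp
  qed
  then show ?thesis by (simp add: invertible_left_inverse matrix_left_invertible_ker)
qed

lemma positive_definite_factor: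
  fixes H :: "complex^'m::finite^'m"
  assumes "hermitian_positive_definite H"
  obtains M :: "complex^'m^'m" where "H = M ** (\<chi> s b. cnj (M $ b $ s))" "invertible M"
proof -
  have herm: "H $ b $ a = cnj (H $ a $ b)" for a b
    using assms unfolding hermitian_positive_definite_def hermitian_matrix_def by blast
  have pos: "Re (\<Sum>a\<in>UNIV. \<Sum>b\<in>UNIV. H $ a $ b * v a * cnj (v b)) > 0" if "\<exists>i\<in>UNIV. v i \<noteq> 0" for v
  proof -
    have "(\<chi> i. v i) \<noteq> 0" using that by (simp add: vec_eq_iff)
    then have "Re (hermitian_form H (\<chi> i. v i)) > 0" using assms by (simp add: hermitian_positive_definite_def)
    then show ?thesis by (simp add: hermitian_form_def)
  qed
  have "\<exists>E :: 'm \<Rightarrow> 'm \<Rightarrow> complex. \<forall>a\<in>UNIV. \<forall>b\<in>UNIV. H $ a $ b = (\<Sum>s\<in>UNIV. E s a * cnj (E s b))"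
    by (rule positive_kernel_factorization[of UNIV "\<lambda>a b. H $ a $ b"]) (rule finite, rule herm, rule pos)
  then obtain E :: "'m \<Rightarrow> 'm \<Rightarrow> complex" where E: "H $ a $ b = (\<Sum>s\<in>UNIV. E s a * cnj (E s b))" for a b by blast
  define M :: "complex^'m^'m" where "M = (\<chi> a s. E s a)"
  have HM: "H = M ** (\<chi> s b. cnj (M $ b $ s))" by (simp add: vec_eq_iff matrix_matrix_mult_def M_def E)
  have "det H \<noteq> 0" using positive_definite_invertible[OF assms] by (simp add: invertible_det_nz)
  then have "invertible M" using HM by (metis det_mul invertible_det_nz mult_zero_left)
  with HM show thesis by (rule that)
qed

lemma det_cnj: "det (\<chi> i j. cnj (M $ i $ j)) = cnj (det M)"
  by (simp add: det_def)

lemma det_cnj_transpose: "det (\<chi> i j. cnj (M $ j $ i)) = cnj (det (M :: complex^'m::finite^'m))"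
proof -
  have "(\<chi> i j. cnj (M $ j $ i)) = (\<chi> i j. cnj (transpose M $ i $ j))" by (simp add: transpose_def vec_eq_iff)
  then show ?thesis by (simp only: det_cnj det_transpose)
qed

lemma positive_definite_det:
  fixes H :: "complex^'m::finite^'m"
  assumes "hermitian_positive_definite H"
  shows "Re (det H) > 0" "det H = of_real (Re (det H))"
proof -
  obtain M :: "complex^'m^'m" where M: "H = M ** (\<chi> s b. cnj (M $ b $ s))" "invertible M" by (rule positive_definite_factor[OF assms])
  have "det H = det M * cnj (det M)" by (subst M(1)) (simp add: det_mul det_cnj_transpose)
  then have d: "det H = of_real ((cmod (det M))\<^sup>2)" by (simp only: complex_norm_square)
  then have "Re (det H) = (cmod (det M))\<^sup>2" by (metis Re_complex_of_real)
  then show "Re (det H) > 0" "det H = of_real (Re (det H))" using d M(2) by (simp_all add: invertible_det_nz)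
qed

lemma invertible_unique_inv:
  fixes A :: "'a::field^'n::finite^'n"
  assumes "A ** B = mat 1" shows "matrix_inv A = B"
proof -
  have "invertible A" using assms by (metis invertible_right_inverse)
  have "matrix_inv A = matrix_inv A ** (A ** B)" by (simp add: assms matrix_mul_rid)
  also have "\<dots> = B" by (simp add: matrix_mul_assoc invertible_left[OF \<open>invertible A\<close>] matrix_mul_lid)
  finally show ?thesis .
qed

text \<open>With the factorization of H into M and its adjoint, the rows of E, the inverse of M,
  form a unitary frame. In it traces with the inverse metric become ordinary traces, and the
  contractions become sums over pairs of frame vectors.\<close>

lemma inverse_metric_frame:
  fixes H :: "complex^'m::finite^'m"
  assumes "hermitian_positive_definite H"
  obtains E :: "complex^'m^'m" where "matrix_inv H = (\<chi> b s. cnj (E $ s $ b)) ** E" "invertible E"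
proof -
  obtain M :: "complex^'m^'m" where M: "H = M ** (\<chi> s b. cnj (M $ b $ s))" "invertible M" by (rule positive_definite_factor[OF assms])
  define E where "E = matrix_inv M"
  let ?M' = "\<chi> s b. cnj (M $ b $ s)" and ?E' = "\<chi> b s. cnj (E $ s $ b)"
  have "?M' ** ?E' = (\<chi> i j. cnj ((E ** M) $ j $ i))"
    by (simp add: vec_eq_iff matrix_matrix_mult_def mult.commute)
  also have "\<dots> = mat 1" by (simp add: E_def invertible_left[OF M(2)] vec_eq_iff mat_def)
  finally have M'E': "?M' ** ?E' = mat 1" .
  have "H ** (?E' ** E) = M ** (?M' ** ?E') ** E" by (subst M(1)) (simp add: matrix_mul_assoc)
  also have "\<dots> = mat 1" unfolding M'E' matrix_mul_rid unfolding E_def by (rule invertible_right[OF M(2)])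
  finally have "matrix_inv H = ?E' ** E" by (rule invertible_unique_inv)
  moreover have "invertible E" unfolding E_def using M(2) invertible_left invertible_right
    by (metis invertible_left_inverse)
  ultimately show thesis using that by blast
qed

section \<open>Regularity of determinants and inverse matrices, by Cramer's rule\<close>

lemma ck_det:
  fixes A :: "'a::real_normed_vector \<Rightarrow> 'b::{real_normed_field}^'n::finite^'n"
  assumes "open S" "\<And>i j. ck k S (\<lambda>x. A x $ i $ j)"
  shows "ck k S (\<lambda>x. det (A x))"
  unfolding det_def by (intro ck_sum ck_mult ck_const ck_prod assms)

lemma matrix_inv_cramer:
  fixes A :: "'a::field^'n::finite^'n"
  assumes "invertible A"
  shows "matrix_inv A $ k $ l = det (\<chi> i j. if j = k then axis l 1 $ i else A $ i $ j) / det A"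
proof -
  have "A *v column l (matrix_inv A) = axis l 1"
    using invertible_right[OF assms]
    by (simp add: vec_eq_iff matrix_vector_mult_def column_def matrix_matrix_mult_def mat_def axis_def)
  then have "column l (matrix_inv A) = (\<chi> k. det (\<chi> i j. if j = k then axis l 1 $ i else A $ i $ j) / det A)"
    using assms by (subst (asm) cramer) (auto simp: invertible_det_nz)
  then show ?thesis by (simp add: vec_eq_iff column_def)
qed

lemma ck_matrix_inv:
  fixes A :: "'a::real_normed_vector \<Rightarrow> 'b::{real_normed_field}^'n::finite^'n"
  assumes S: "open S" and A: "\<And>i j. ck k S (\<lambda>x. A x $ i $ j)" and inv: "\<And>x. x \<in> S \<Longrightarrow> invertible (A x)"
  shows "ck k S (\<lambda>x. matrix_inv (A x) $ i $ j)"
proof (rule ck_cong[OF S])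
  show "ck k S (\<lambda>x. det (\<chi> i' j'. if j' = i then axis j 1 $ i' else A x $ i' $ j') * inverse (det (A x)))"
  proof (intro ck_mult ck_inverse ck_det S A)
    show "ck k S (\<lambda>x. (\<chi> i' j'. if j' = i then axis j 1 $ i' else A x $ i' $ j') $ a $ b)" for a b
      by (cases "b = i") (simp_all add: ck_const A)
  qed (use inv in \<open>simp add: invertible_det_nz\<close>)
qed (simp add: matrix_inv_cramer[OF inv] divide_inverse)

section \<open>Algebra of the contraction with second-order minors\<close>

lemma minor_contraction_add: "minor_contraction H (\<lambda>\<alpha> \<beta> \<gamma> \<delta>. X \<alpha> \<beta> \<gamma> \<delta> + Y \<alpha> \<beta> \<gamma> \<delta>) = minor_contraction H X + minor_contraction H Y"
  by (simp add: minor_contraction_def distrib_left sum.distrib)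

lemma minor_contraction_cmult: "minor_contraction H (\<lambda>\<alpha> \<beta> \<gamma> \<delta>. c * X \<alpha> \<beta> \<gamma> \<delta>) = c * minor_contraction H X"
  by (simp add: minor_contraction_def sum_distrib_left mult_ac)

lemma minor_contraction_sum: "minor_contraction H (\<lambda>\<alpha> \<beta> \<gamma> \<delta>. \<Sum>i\<in>I. X i \<alpha> \<beta> \<gamma> \<delta>) = (\<Sum>i\<in>I. minor_contraction H (X i))"
proof (induction I rule: infinite_finite_induct)
  case (insert x F)
  then show ?case by (simp add: minor_contraction_add)
qed (simp_all add: minor_contraction_def)

lemma minor_contraction_swap_bar: "minor_contraction H (\<lambda>\<alpha> \<beta> \<gamma> \<delta>. X \<alpha> \<delta> \<gamma> \<beta>) = - minor_contraction H X"
proof -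
  have "minor_contraction H (\<lambda>\<alpha> \<beta> \<gamma> \<delta>. X \<alpha> \<delta> \<gamma> \<beta>)
     = (\<Sum>\<alpha>\<in>UNIV. \<Sum>\<beta>\<in>UNIV. \<Sum>\<gamma>\<in>UNIV. \<Sum>\<delta>\<in>UNIV. - (minor_coeff H \<alpha> \<delta> \<gamma> \<beta> * X \<alpha> \<delta> \<gamma> \<beta>))"
    unfolding minor_contraction_def
    by (intro sum.cong refl) (simp add: minor_coeff_def algebra_simps)
  also have "\<dots> = (\<Sum>\<alpha>\<in>UNIV. \<Sum>\<beta>\<in>UNIV. \<Sum>\<delta>\<in>UNIV. \<Sum>\<gamma>\<in>UNIV. - (minor_coeff H \<alpha> \<delta> \<gamma> \<beta> * X \<alpha> \<delta> \<gamma> \<beta>))"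
    by (intro sum.cong refl sum.swap)
  also have "\<dots> = (\<Sum>\<alpha>\<in>UNIV. \<Sum>\<delta>\<in>UNIV. \<Sum>\<beta>\<in>UNIV. \<Sum>\<gamma>\<in>UNIV. - (minor_coeff H \<alpha> \<delta> \<gamma> \<beta> * X \<alpha> \<delta> \<gamma> \<beta>))"
    by (intro sum.cong refl sum.swap)
  also have "\<dots> = (\<Sum>\<alpha>\<in>UNIV. \<Sum>\<delta>\<in>UNIV. \<Sum>\<gamma>\<in>UNIV. \<Sum>\<beta>\<in>UNIV. - (minor_coeff H \<alpha> \<delta> \<gamma> \<beta> * X \<alpha> \<delta> \<gamma> \<beta>))"
    by (intro sum.cong refl sum.swap)
  finally show ?thesis by (simp add: minor_contraction_def sum_negf)
qed

lemma minor_contraction_swap: "minor_contraction H (\<lambda>\<alpha> \<beta> \<gamma> \<delta>. X \<gamma> \<beta> \<alpha> \<delta>) = - minor_contraction H X"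
proof -
  have "minor_contraction H (\<lambda>\<alpha> \<beta> \<gamma> \<delta>. X \<gamma> \<beta> \<alpha> \<delta>)
     = (\<Sum>\<alpha>\<in>UNIV. \<Sum>\<beta>\<in>UNIV. \<Sum>\<gamma>\<in>UNIV. \<Sum>\<delta>\<in>UNIV. - (minor_coeff H \<gamma> \<beta> \<alpha> \<delta> * X \<gamma> \<beta> \<alpha> \<delta>))"
    unfolding minor_contraction_def
    by (intro sum.cong refl) (simp add: minor_coeff_def algebra_simps)
  also have "\<dots> = (\<Sum>\<alpha>\<in>UNIV. \<Sum>\<gamma>\<in>UNIV. \<Sum>\<beta>\<in>UNIV. \<Sum>\<delta>\<in>UNIV. - (minor_coeff H \<gamma> \<beta> \<alpha> \<delta> * X \<gamma> \<beta> \<alpha> \<delta>))"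
    by (intro sum.cong refl sum.swap)
  also have "\<dots> = (\<Sum>\<gamma>\<in>UNIV. \<Sum>\<alpha>\<in>UNIV. \<Sum>\<beta>\<in>UNIV. \<Sum>\<delta>\<in>UNIV. - (minor_coeff H \<gamma> \<beta> \<alpha> \<delta> * X \<gamma> \<beta> \<alpha> \<delta>))"
    by (rule sum.swap)
  also have "\<dots> = (\<Sum>\<gamma>\<in>UNIV. \<Sum>\<beta>\<in>UNIV. \<Sum>\<alpha>\<in>UNIV. \<Sum>\<delta>\<in>UNIV. - (minor_coeff H \<gamma> \<beta> \<alpha> \<delta> * X \<gamma> \<beta> \<alpha> \<delta>))"
    by (intro sum.cong refl sum.swap)
  finally show ?thesis by (simp add: minor_contraction_def sum_negf)
qed

text \<open>Antisymmetry of the minors in \<alpha>, \<gamma> cancels every term in which both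
  holomorphic derivatives fall on the same function; the conjugate version below does this for
  antiholomorphic ones. These are the terms that would not transform as tensors.\<close>

lemma minor_contraction_symmetric:
  assumes "\<And>\<alpha> \<beta> \<gamma> \<delta>. X \<gamma> \<beta> \<alpha> \<delta> = X \<alpha> \<beta> \<gamma> \<delta>"
  shows "minor_contraction H X = 0"
  using minor_contraction_swap[of H X] by (simp add: assms)

lemma minor_contraction_symmetric_bar:
  assumes "\<And>\<alpha> \<beta> \<gamma> \<delta>. X \<alpha> \<delta> \<gamma> \<beta> = X \<alpha> \<beta> \<gamma> \<delta>"
  shows "minor_contraction H X = 0"
  using minor_contraction_swap_bar[of H X] by (simp add: assms)

text \<open>Polarization of twice the second elementary symmetric function of the eigenvalues of
  H^-1 A. On a trace-free Hermitian matrix it is minus a square norm, which is the origin of the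
  good sign in the Bochner formula.\<close>

definition trace_contraction :: "complex^'m::finite^'m \<Rightarrow> complex^'m^'m \<Rightarrow> complex^'m^'m \<Rightarrow> complex" where
  "trace_contraction H A B = trace (matrix_inv H ** A) * trace (matrix_inv H ** B) - trace (matrix_inv H ** A ** matrix_inv H ** B)"

lemma trace_inv_mult: "trace (matrix_inv H ** A) = (\<Sum>\<alpha>\<in>UNIV. \<Sum>\<beta>\<in>UNIV. inverse_metric H \<alpha> \<beta> * A $ \<alpha> $ \<beta>)"
  unfolding trace_def matrix_matrix_mult_def inverse_metric_def by (simp, rule sum.swap)

lemma minor_contraction_product:
  "minor_contraction H (\<lambda>\<alpha> \<beta> \<gamma> \<delta>. A $ \<alpha> $ \<beta> * B $ \<gamma> $ \<delta>) = trace_contraction H A B"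
proof -
  let ?i = "inverse_metric H"
  have 1: "(\<Sum>\<alpha>\<in>UNIV. \<Sum>\<beta>\<in>UNIV. \<Sum>\<gamma>\<in>UNIV. \<Sum>\<delta>\<in>UNIV. (?i \<alpha> \<beta> * ?i \<gamma> \<delta>) * (A $ \<alpha> $ \<beta> * B $ \<gamma> $ \<delta>)) = trace (matrix_inv H ** A) * trace (matrix_inv H ** B)"
    unfolding trace_inv_mult sum_distrib_right unfolding sum_distrib_left
    by (intro sum.cong refl) (simp add: mult_ac)
  have "trace (matrix_inv H ** A ** matrix_inv H ** B)
     = (\<Sum>\<delta>\<in>UNIV. \<Sum>\<gamma>\<in>UNIV. \<Sum>\<beta>\<in>UNIV. \<Sum>\<alpha>\<in>UNIV. (?i \<alpha> \<delta> * ?i \<gamma> \<beta>) * (A $ \<alpha> $ \<beta> * B $ \<gamma> $ \<delta>))"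
    by (simp add: trace_def matrix_matrix_mult_def inverse_metric_def sum_distrib_left sum_distrib_right mult_ac)
  also have "\<dots> = (\<Sum>\<delta>\<in>UNIV. \<Sum>\<gamma>\<in>UNIV. \<Sum>\<alpha>\<in>UNIV. \<Sum>\<beta>\<in>UNIV. (?i \<alpha> \<delta> * ?i \<gamma> \<beta>) * (A $ \<alpha> $ \<beta> * B $ \<gamma> $ \<delta>))"
    by (intro sum.cong refl sum.swap)
  also have "\<dots> = (\<Sum>\<delta>\<in>UNIV. \<Sum>\<alpha>\<in>UNIV. \<Sum>\<gamma>\<in>UNIV. \<Sum>\<beta>\<in>UNIV. (?i \<alpha> \<delta> * ?i \<gamma> \<beta>) * (A $ \<alpha> $ \<beta> * B $ \<gamma> $ \<delta>))"
    by (intro sum.cong refl sum.swap)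
  also have "\<dots> = (\<Sum>\<alpha>\<in>UNIV. \<Sum>\<delta>\<in>UNIV. \<Sum>\<beta>\<in>UNIV. \<Sum>\<gamma>\<in>UNIV. (?i \<alpha> \<delta> * ?i \<gamma> \<beta>) * (A $ \<alpha> $ \<beta> * B $ \<gamma> $ \<delta>))"
    by (subst sum.swap) (intro sum.cong refl sum.swap)
  also have "\<dots> = (\<Sum>\<alpha>\<in>UNIV. \<Sum>\<beta>\<in>UNIV. \<Sum>\<delta>\<in>UNIV. \<Sum>\<gamma>\<in>UNIV. (?i \<alpha> \<delta> * ?i \<gamma> \<beta>) * (A $ \<alpha> $ \<beta> * B $ \<gamma> $ \<delta>))"
    by (intro sum.cong refl sum.swap)
  also have "\<dots> = (\<Sum>\<alpha>\<in>UNIV. \<Sum>\<beta>\<in>UNIV. \<Sum>\<gamma>\<in>UNIV. \<Sum>\<delta>\<in>UNIV. (?i \<alpha> \<delta> * ?i \<gamma> \<beta>) * (A $ \<alpha> $ \<beta> * B $ \<gamma> $ \<delta>))"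
    by (intro sum.cong refl sum.swap)
  finally have 2: "trace (matrix_inv H ** A ** matrix_inv H ** B)
     = (\<Sum>\<alpha>\<in>UNIV. \<Sum>\<beta>\<in>UNIV. \<Sum>\<gamma>\<in>UNIV. \<Sum>\<delta>\<in>UNIV. (?i \<alpha> \<delta> * ?i \<gamma> \<beta>) * (A $ \<alpha> $ \<beta> * B $ \<gamma> $ \<delta>))" .
  show ?thesis unfolding trace_contraction_def 1[symmetric] 2 minor_contraction_def minor_coeff_def
    by (simp add: left_diff_distrib sum_subtractf)
qed

text \<open>The Jacobian factors of A and B cancel against those of the inverse metric; the
  outermost pair meets after one cyclic shift under the trace.\<close>

lemma trace_contraction_pullback:
  fixes H H' J :: "complex^'m::finite^'m"
  assumes inv: "invertible H" and H: "H = transpose J ** H' ** (\<chi> i j. cnj (J $ i $ j))"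
  shows "trace_contraction H (transpose J ** A ** (\<chi> i j. cnj (J $ i $ j))) (transpose J ** B ** (\<chi> i j. cnj (J $ i $ j)))
    = trace_contraction H' A B"
proof -
  let ?C = "\<chi> i j. cnj (J $ i $ j)" and ?V = "matrix_inv H"
  have "det J \<noteq> 0" using inv unfolding H by (auto simp: invertible_det_nz det_mul det_transpose)
  then have "invertible (transpose J)" by (simp add: invertible_det_nz det_transpose)
  have "transpose J ** (H' ** (?C ** ?V ** transpose J)) = (H ** ?V) ** transpose J"
    unfolding H by (simp add: matrix_mul_assoc)
  also have "\<dots> = transpose J ** mat 1" by (simp add: invertible_right[OF inv] matrix_mul_lid matrix_mul_rid)
  finally have "matrix_inv (transpose J) ** (transpose J ** (H' ** (?C ** ?V ** transpose J))) = matrix_inv (transpose J) ** (transpose J ** mat 1)" by simp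
  then have "H' ** (?C ** ?V ** transpose J) = mat 1"
    by (simp only: matrix_mul_assoc[of "matrix_inv (transpose J)"] invertible_left[OF \<open>invertible (transpose J)\<close>] matrix_mul_lid)
  then have V': "matrix_inv H' = ?C ** ?V ** transpose J" by (rule invertible_unique_inv)
  have t: "trace (?V ** (transpose J ** A ** ?C)) = trace (matrix_inv H' ** A)" for A
  proof -
    have "trace (?V ** (transpose J ** A ** ?C)) = trace ((?V ** transpose J ** A) ** ?C)" by (simp add: matrix_mul_assoc)
    also have "\<dots> = trace (?C ** (?V ** transpose J ** A))" by (rule trace_mul_sym)
    finally show ?thesis by (simp add: V' matrix_mul_assoc)
  qed
  have "trace (?V ** (transpose J ** A ** ?C) ** ?V ** (transpose J ** B ** ?C)) = trace ((?V ** transpose J ** A ** ?C ** ?V ** transpose J ** B) ** ?C)"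
    by (simp add: matrix_mul_assoc)
  also have "\<dots> = trace (?C ** (?V ** transpose J ** A ** ?C ** ?V ** transpose J ** B))" by (rule trace_mul_sym)
  also have "\<dots> = trace (matrix_inv H' ** A ** matrix_inv H' ** B)" by (simp add: V' matrix_mul_assoc)
  finally show ?thesis unfolding trace_contraction_def by (simp add: t)
qed

section \<open>The scalar second-order operator and its invariance\<close>

definition hessian :: "(complex^'m::finite \<Rightarrow> complex) \<Rightarrow> complex^'m \<Rightarrow> complex^'m^'m" where
  "hessian u x = (\<chi> \<alpha> \<beta>. d_dz \<alpha> (d_dzbar \<beta> u) x)"

definition gradient_product :: "(complex^'m::finite \<Rightarrow> complex) \<Rightarrow> (complex^'m \<Rightarrow> complex) \<Rightarrow> complex^'m \<Rightarrow> complex^'m^'m" where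
  "gradient_product v w x = (\<chi> \<alpha> \<beta>. d_dz \<alpha> v x * d_dzbar \<beta> w x)"

text \<open>The operator \<open>\<partial>\<partial>bar(u \<partial>v \<and> \<partial>bar w) \<and> \<omega>\<^sup>m\<^sup>-\<^sup>2\<close> only involves first derivatives and complex Hessians,
  which is why it does not depend on the holomorphic chart.\<close>

definition triple_operator :: "complex^'m::finite^'m \<Rightarrow> (complex^'m \<Rightarrow> complex) \<Rightarrow> (complex^'m \<Rightarrow> complex) \<Rightarrow> (complex^'m \<Rightarrow> complex) \<Rightarrow> complex^'m \<Rightarrow> complex" where
  "triple_operator H u v w x = trace_contraction H (gradient_product v w x) (hessian u x)
     - trace_contraction H (gradient_product v u x) (hessian w x)
     - trace_contraction H (hessian v x) (gradient_product u w x)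
     - u x * trace_contraction H (hessian v x) (hessian w x)"

text \<open>Two derivatives of a product of three factors give nine terms. Five of them contain two
  holomorphic derivatives of v or two antiholomorphic derivatives of w and cancel. Of the other
  four, three become pairings of matrices only after exchanging \<beta> and \<delta>, which produces
  the three minus signs.\<close>

lemma minor_contraction_triple:
  assumes S: "open S" and u: "ck 2 S u" and v: "ck 3 S v" and w: "ck 3 S w" and x: "x \<in> S"
  shows "minor_contraction H (\<lambda>\<alpha> \<beta> \<gamma> \<delta>. d_dz \<gamma> (d_dzbar \<delta> (\<lambda>z. u z * (d_dz \<alpha> v z * d_dzbar \<beta> w z))) x) = triple_operator H u v w x"
proof -
  have u2: "ck (Suc (Suc 0)) S u" and v3: "ck (Suc (Suc (Suc 0))) S v" and w3: "ck (Suc (Suc (Suc 0))) S w"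
    using u v w by (simp_all add: numeral_2_eq_2 numeral_3_eq_3 del: continuously_differentiable_on.simps)
  note u1 = ck_SucD[OF u2] and v2 = ck_SucD[OF v3] and w2 = ck_SucD[OF w3]
  have v2': "ck 2 S v" and w2': "ck 2 S w" using v2 w2 by (simp_all add: numeral_2_eq_2 del: continuously_differentiable_on.simps)
  note du = ck_wirtinger[OF S u2] and dv2 = ck_wirtinger[OF S v3] and dw2 = ck_wirtinger[OF S w3]
  note ddv = ck_wirtinger[OF S dv2(1)] and ddw = ck_wirtinger[OF S dw2(2)]
  note dv = dv2[THEN ck_SucD] and dw = dw2[THEN ck_SucD]
  let ?v = "\<lambda>\<alpha>. d_dz \<alpha> v" and ?w = "\<lambda>\<beta>. d_dzbar \<beta> w"
  note D = ck_differentiable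
  have 1: "d_dzbar \<delta> (\<lambda>z. u z * (?v \<alpha> z * ?w \<beta> z)) z
     = d_dzbar \<delta> u z * (?v \<alpha> z * ?w \<beta> z) + u z * (d_dzbar \<delta> (?v \<alpha>) z * ?w \<beta> z) + u z * (?v \<alpha> z * d_dzbar \<delta> (?w \<beta>) z)"
    if z: "z \<in> S" for \<alpha> \<beta> \<delta> z
    by (simp add: wirtinger_mult(2) D[OF u1 z] D[OF dv(1) z] D[OF dw(2) z] differentiable_mult algebra_simps)
  have vb: "d_dzbar \<delta> (?v \<alpha>) z = d_dz \<alpha> (d_dzbar \<delta> v) z" if "z \<in> S" for \<alpha> \<delta> z
    by (rule wirtinger_commute(1)[OF S v2' that, symmetric])
  \<comment> \<open>Grouped for the contraction: four surviving terms, then three symmetric in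
    \<alpha>, \<gamma>, then two symmetric in \<beta>, \<delta>.\<close>
  have 2: "d_dz \<gamma> (d_dzbar \<delta> (\<lambda>z. u z * (?v \<alpha> z * ?w \<beta> z))) x
    = ?v \<alpha> x * ?w \<beta> x * d_dz \<gamma> (d_dzbar \<delta> u) x
      + (?v \<alpha> x * d_dzbar \<delta> u x) * d_dz \<gamma> (?w \<beta>) x
      + d_dz \<alpha> (d_dzbar \<delta> v) x * (d_dz \<gamma> u x * ?w \<beta> x)
      + u x * (d_dz \<alpha> (d_dzbar \<delta> v) x * d_dz \<gamma> (?w \<beta>) x)
      + (d_dzbar \<delta> u x * d_dz \<gamma> (?v \<alpha>) x * ?w \<beta> x + u x * d_dz \<gamma> (d_dzbar \<delta> (?v \<alpha>)) x * ?w \<beta> x + u x * d_dz \<gamma> (?v \<alpha>) x * d_dzbar \<delta> (?w \<beta>) x)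
      + (d_dz \<gamma> u x * ?v \<alpha> x * d_dzbar \<delta> (?w \<beta>) x + u x * ?v \<alpha> x * d_dz \<gamma> (d_dzbar \<delta> (?w \<beta>)) x)" for \<alpha> \<beta> \<gamma> \<delta>
  proof -
    have "d_dz \<gamma> (d_dzbar \<delta> (\<lambda>z. u z * (?v \<alpha> z * ?w \<beta> z))) x
      = d_dz \<gamma> (\<lambda>z. d_dzbar \<delta> u z * (?v \<alpha> z * ?w \<beta> z) + u z * (d_dzbar \<delta> (?v \<alpha>) z * ?w \<beta> z) + u z * (?v \<alpha> z * d_dzbar \<delta> (?w \<beta>) z)) x"
      by (rule wirtinger_cong(1)[OF S x 1])
    also have "\<dots> = ?v \<alpha> x * ?w \<beta> x * d_dz \<gamma> (d_dzbar \<delta> u) x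
      + (?v \<alpha> x * d_dzbar \<delta> u x) * d_dz \<gamma> (?w \<beta>) x
      + d_dzbar \<delta> (?v \<alpha>) x * (d_dz \<gamma> u x * ?w \<beta> x)
      + u x * (d_dzbar \<delta> (?v \<alpha>) x * d_dz \<gamma> (?w \<beta>) x)
      + (d_dzbar \<delta> u x * d_dz \<gamma> (?v \<alpha>) x * ?w \<beta> x + u x * d_dz \<gamma> (d_dzbar \<delta> (?v \<alpha>)) x * ?w \<beta> x + u x * d_dz \<gamma> (?v \<alpha>) x * d_dzbar \<delta> (?w \<beta>) x)
      + (d_dz \<gamma> u x * ?v \<alpha> x * d_dzbar \<delta> (?w \<beta>) x + u x * ?v \<alpha> x * d_dz \<gamma> (d_dzbar \<delta> (?w \<beta>)) x)"
      by (simp add: wirtinger_mult(1) wirtinger_add(1) D[OF u1 x] D[OF dv(1) x] D[OF dw(2) x] D[OF du(2) x] D[OF ddv(2) x] D[OF ddw(2) x]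
            differentiable_mult differentiable_add algebra_simps)
    finally show ?thesis unfolding vb[OF x] .
  qed
  have s1: "d_dz \<gamma> (?v \<alpha>) x = d_dz \<alpha> (?v \<gamma>) x" for \<alpha> \<gamma> by (rule wirtinger_commute(2)[OF S v2' x])
  have s2: "d_dzbar \<delta> (?w \<beta>) z = d_dzbar \<beta> (?w \<delta>) z" if "z \<in> S" for \<beta> \<delta> z by (rule wirtinger_commute(3)[OF S w2' that])
  have s3: "d_dz \<gamma> (d_dzbar \<delta> (?v \<alpha>)) x = d_dz \<alpha> (d_dzbar \<delta> (?v \<gamma>)) x" for \<alpha> \<gamma> \<delta>
  proof -
    have vb2: "ck 2 S (d_dzbar \<delta> v)" using dv2(2) by (simp add: numeral_2_eq_2 del: continuously_differentiable_on.simps)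
    have "d_dz \<gamma> (d_dzbar \<delta> (?v \<alpha>)) x = d_dz \<gamma> (d_dz \<alpha> (d_dzbar \<delta> v)) x" for \<alpha> \<gamma>
      by (rule wirtinger_cong(1)[OF S x vb])
    then show ?thesis using wirtinger_commute(2)[OF S vb2 x, of \<gamma> \<alpha>] by simp
  qed
  have s4: "d_dz \<gamma> (d_dzbar \<delta> (?w \<beta>)) x = d_dz \<gamma> (d_dzbar \<beta> (?w \<delta>)) x" for \<beta> \<gamma> \<delta>
    by (rule wirtinger_cong(1)[OF S x s2])
  have z1: "minor_contraction H (\<lambda>\<alpha> \<beta> \<gamma> \<delta>. d_dzbar \<delta> u x * d_dz \<gamma> (?v \<alpha>) x * ?w \<beta> x + u x * d_dz \<gamma> (d_dzbar \<delta> (?v \<alpha>)) x * ?w \<beta> x + u x * d_dz \<gamma> (?v \<alpha>) x * d_dzbar \<delta> (?w \<beta>) x) = 0"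
  proof (rule minor_contraction_symmetric)
    fix \<alpha> \<beta> \<gamma> \<delta>
    show "d_dzbar \<delta> u x * d_dz \<alpha> (?v \<gamma>) x * ?w \<beta> x + u x * d_dz \<alpha> (d_dzbar \<delta> (?v \<gamma>)) x * ?w \<beta> x + u x * d_dz \<alpha> (?v \<gamma>) x * d_dzbar \<delta> (?w \<beta>) x
      = d_dzbar \<delta> u x * d_dz \<gamma> (?v \<alpha>) x * ?w \<beta> x + u x * d_dz \<gamma> (d_dzbar \<delta> (?v \<alpha>)) x * ?w \<beta> x + u x * d_dz \<gamma> (?v \<alpha>) x * d_dzbar \<delta> (?w \<beta>) x"
      by (simp only: s1[of \<gamma> \<alpha>] s3[of \<gamma> \<delta> \<alpha>])
  qed
  have z2: "minor_contraction H (\<lambda>\<alpha> \<beta> \<gamma> \<delta>. d_dz \<gamma> u x * ?v \<alpha> x * d_dzbar \<delta> (?w \<beta>) x + u x * ?v \<alpha> x * d_dz \<gamma> (d_dzbar \<delta> (?w \<beta>)) x) = 0"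
  proof (rule minor_contraction_symmetric_bar)
    fix \<alpha> \<beta> \<gamma> \<delta>
    show "d_dz \<gamma> u x * ?v \<alpha> x * d_dzbar \<beta> (?w \<delta>) x + u x * ?v \<alpha> x * d_dz \<gamma> (d_dzbar \<beta> (?w \<delta>)) x
      = d_dz \<gamma> u x * ?v \<alpha> x * d_dzbar \<delta> (?w \<beta>) x + u x * ?v \<alpha> x * d_dz \<gamma> (d_dzbar \<delta> (?w \<beta>)) x"
      by (simp only: s2[OF x, of \<beta> \<delta>] s4[of \<gamma> \<beta> \<delta>])
  qed
  have t1: "minor_contraction H (\<lambda>\<alpha> \<beta> \<gamma> \<delta>. ?v \<alpha> x * ?w \<beta> x * d_dz \<gamma> (d_dzbar \<delta> u) x) = trace_contraction H (gradient_product v w x) (hessian u x)"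
    unfolding minor_contraction_product[symmetric] by (simp add: gradient_product_def hessian_def)
  have t2: "minor_contraction H (\<lambda>\<alpha> \<beta> \<gamma> \<delta>. (?v \<alpha> x * d_dzbar \<delta> u x) * d_dz \<gamma> (?w \<beta>) x) = - trace_contraction H (gradient_product v u x) (hessian w x)"
    unfolding minor_contraction_product[symmetric] gradient_product_def hessian_def vec_lambda_beta
    by (rule minor_contraction_swap_bar[of H "\<lambda>\<alpha> \<beta> \<gamma> \<delta>. (?v \<alpha> x * d_dzbar \<beta> u x) * d_dz \<gamma> (?w \<delta>) x"])
  have t3: "minor_contraction H (\<lambda>\<alpha> \<beta> \<gamma> \<delta>. d_dz \<alpha> (d_dzbar \<delta> v) x * (d_dz \<gamma> u x * ?w \<beta> x)) = - trace_contraction H (hessian v x) (gradient_product u w x)"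
    unfolding minor_contraction_product[symmetric] gradient_product_def hessian_def vec_lambda_beta
    by (rule minor_contraction_swap_bar[of H "\<lambda>\<alpha> \<beta> \<gamma> \<delta>. d_dz \<alpha> (d_dzbar \<beta> v) x * (d_dz \<gamma> u x * ?w \<delta> x)"])
  have t4: "minor_contraction H (\<lambda>\<alpha> \<beta> \<gamma> \<delta>. d_dz \<alpha> (d_dzbar \<delta> v) x * d_dz \<gamma> (?w \<beta>) x) = - trace_contraction H (hessian v x) (hessian w x)"
    unfolding minor_contraction_product[symmetric] gradient_product_def hessian_def vec_lambda_beta
    by (rule minor_contraction_swap_bar[of H "\<lambda>\<alpha> \<beta> \<gamma> \<delta>. d_dz \<alpha> (d_dzbar \<beta> v) x * d_dz \<gamma> (?w \<delta>) x"])
  show ?thesis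
    unfolding 2 minor_contraction_add[of H "\<lambda>\<alpha> \<beta> \<gamma> \<delta>. _ \<alpha> \<beta> \<gamma> \<delta> + (_ \<alpha> \<beta> \<gamma> \<delta> + _ \<alpha> \<beta> \<gamma> \<delta> + _ \<alpha> \<beta> \<gamma> \<delta>)"]
    unfolding minor_contraction_add t1 t2 t3 minor_contraction_cmult t4
    using z1 z2 by (simp add: minor_contraction_add triple_operator_def)
qed

lemma triple_operator_pullback:
  fixes T :: "complex^'m::finite \<Rightarrow> complex^'m"
  assumes S: "open S" and V: "open V" and T: "holomorphic_map_on S T" "T ` S \<subseteq> V" and x: "x \<in> S"
    and uvw: "ck 2 V u" "ck 2 V v" "ck 2 V w"
    and inv: "invertible H" and H: "H = transpose (complex_jacobian T x) ** H' ** (\<chi> i j. cnj (complex_jacobian T x $ i $ j))"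
  shows "triple_operator H (\<lambda>x. u (T x)) (\<lambda>x. v (T x)) (\<lambda>x. w (T x)) x = triple_operator H' u v w (T x)"
proof -
  let ?J = "complex_jacobian T x"
  have Tx: "T x \<in> V" using T(2) x by auto
  have d: "s differentiable at (T x)" if "ck 2 V s" for s :: "complex^'m \<Rightarrow> complex"
    using that Tx by (simp add: numeral_2_eq_2)
  have hess: "hessian (\<lambda>x. s (T x)) x = transpose ?J ** hessian s (T x) ** (\<chi> i j. cnj (?J $ i $ j))" if "ck 2 V s" for s
  proof -
    have "d_dz \<alpha> (d_dzbar \<beta> (\<lambda>x. s (T x))) x = (transpose ?J ** hessian s (T x) ** (\<chi> i j. cnj (?J $ i $ j))) $ \<alpha> $ \<beta>" for \<alpha> \<beta>
      unfolding wirtinger_hessian_holomorphic[OF S V T x that]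
      by (simp add: matrix_matrix_mult_def hessian_def transpose_def complex_jacobian_def sum_distrib_left sum_distrib_right mult_ac)
         (rule sum.swap)
    then show ?thesis by (simp add: vec_eq_iff hessian_def)
  qed
  have grad: "gradient_product (\<lambda>x. s (T x)) (\<lambda>x. r (T x)) x = transpose ?J ** gradient_product s r (T x) ** (\<chi> i j. cnj (?J $ i $ j))"
    if "ck 2 V s" "ck 2 V r" for s r
  proof -
    have "d_dz \<alpha> (\<lambda>x. s (T x)) x * d_dzbar \<beta> (\<lambda>x. r (T x)) x = (transpose ?J ** gradient_product s r (T x) ** (\<chi> i j. cnj (?J $ i $ j))) $ \<alpha> $ \<beta>" for \<alpha> \<beta>
      unfolding wirtinger_chain_holomorphic(1)[OF T(1) x d[OF that(1)]] wirtinger_chain_holomorphic(2)[OF T(1) x d[OF that(2)]]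
      by (simp add: matrix_matrix_mult_def gradient_product_def transpose_def complex_jacobian_def sum_distrib_left sum_distrib_right mult_ac)
    then show ?thesis by (simp add: vec_eq_iff gradient_product_def)
  qed
  show ?thesis
    unfolding triple_operator_def hess[OF uvw(1)] hess[OF uvw(2)] hess[OF uvw(3)]
      grad[OF uvw(1,3)] grad[OF uvw(2,3)] grad[OF uvw(2,1)] trace_contraction_pullback[OF inv H] ..
qed

section \<open>Curvature in coordinates\<close>

text \<open>Christoffel symbols of the first kind, with the lowered index in front.\<close>

definition lowered_christoffel :: "(real^'n \<Rightarrow> real^'n^'n) \<Rightarrow> 'n::finite \<Rightarrow> 'n \<Rightarrow> 'n \<Rightarrow> real^'n \<Rightarrow> real" where
  "lowered_christoffel G a j k y =
     (partial_deriv j (\<lambda>y. G y $ k $ a) y + partial_deriv k (\<lambda>y. G y $ j $ a) y - partial_deriv a (\<lambda>y. G y $ j $ k) y) / 2"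

definition metric_second_derivative :: "(real^'n \<Rightarrow> real^'n^'n) \<Rightarrow> 'n::finite \<Rightarrow> 'n \<Rightarrow> 'n \<Rightarrow> 'n \<Rightarrow> real^'n \<Rightarrow> real" where
  "metric_second_derivative G k l p q y = partial_deriv k (partial_deriv l (\<lambda>y. G y $ p $ q)) y"

text \<open>Not a tensor by itself. It is the coefficient that the Bochner computation puts in front
  of A_pq A_kl - A_pl A_kq; summed against these products it gives minus the curvature
  contraction.\<close>

definition curvature_coeff :: "(real^'n \<Rightarrow> real^'n^'n) \<Rightarrow> real^'n \<Rightarrow> 'n::finite \<Rightarrow> 'n \<Rightarrow> 'n \<Rightarrow> 'n \<Rightarrow> real" where
  "curvature_coeff G y p q k l = metric_second_derivative G k l p q y
     + (\<Sum>a\<in>UNIV. lowered_christoffel G a p q y * christoffel G a k l y)"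

lemma christoffel_eq: "christoffel G i j k y = (\<Sum>l\<in>UNIV. matrix_inv (G y) $ i $ l * lowered_christoffel G l j k y)"
  by (simp add: christoffel_def lowered_christoffel_def sum_divide_distrib)

lemma ck_partial_deriv:
  "ck (Suc k) S u \<Longrightarrow> ck k S (partial_deriv i u)"
  by (simp add: partial_deriv_def[abs_def])

lemma partial_deriv_cong:
  "open S \<Longrightarrow> x \<in> S \<Longrightarrow> (\<And>y. y \<in> S \<Longrightarrow> u y = v y) \<Longrightarrow> partial_deriv i u x = partial_deriv i v x"
  unfolding partial_deriv_def by (metis frechet_derivative_cong)

lemma partial_deriv_eq: "(u has_derivative D) (at x) \<Longrightarrow> partial_deriv i u x = D (axis i 1)"
  by (simp add: partial_deriv_def frechet_derivative_eqI)

lemma partial_deriv_sum_mult: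
  assumes "\<And>a. u a differentiable at x" "\<And>a. v a differentiable at x"
  shows "partial_deriv i (\<lambda>y. \<Sum>a\<in>A. u a y * v a y) x = (\<Sum>a\<in>A. u a x * partial_deriv i (v a) x + partial_deriv i (u a) x * v a x)"
proof -
  have "((\<lambda>y. \<Sum>a\<in>A. u a y * v a y) has_derivative (\<lambda>w. \<Sum>a\<in>A. u a x * frechet_derivative (v a) (at x) w + frechet_derivative (u a) (at x) w * v a x)) (at x)"
    by (intro has_derivative_sum has_derivative_mult differentiable_has_frechet assms)
  then show ?thesis by (simp add: partial_deriv_eq) (simp add: partial_deriv_def)
qed

lemma partial_deriv_lowered:
  assumes "\<And>i j k. partial_deriv k (\<lambda>y. G y $ i $ j) differentiable at y"
  shows "partial_deriv i (lowered_christoffel G a j k) y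
     = (metric_second_derivative G i j k a y + metric_second_derivative G i k j a y - metric_second_derivative G i a j k y) / 2"
proof -
  note D = assms[THEN differentiable_has_frechet]
  have "(lowered_christoffel G a j k has_derivative (\<lambda>w. (frechet_derivative (partial_deriv j (\<lambda>y. G y $ k $ a)) (at y) w
      + frechet_derivative (partial_deriv k (\<lambda>y. G y $ j $ a)) (at y) w - frechet_derivative (partial_deriv a (\<lambda>y. G y $ j $ k)) (at y) w) / 2)) (at y)"
    unfolding lowered_christoffel_def[abs_def]
    by (intro bounded_linear.has_derivative[OF bounded_linear_divide] has_derivative_add has_derivative_diff D)
  then show ?thesis by (simp add: partial_deriv_eq) (simp add: metric_second_derivative_def partial_deriv_def)
qed

locale riemannian_coordinates =
  fixes G :: "real^'n::finite \<Rightarrow> real^'n^'n" and V :: "(real^'n) set"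
  assumes V: "open V" and smooth: "\<And>k. ck k V G"
    and symmetric: "\<And>y i j. y \<in> V \<Longrightarrow> G y $ i $ j = G y $ j $ i"
    and positive: "\<And>y v. y \<in> V \<Longrightarrow> v \<noteq> 0 \<Longrightarrow> v \<bullet> (G y *v v) > 0"
begin

lemma entry_ck: "ck k V (\<lambda>y. G y $ i $ j)"
  by (intro ck_vec_nth V smooth)

lemma partial_ck: "ck k V (partial_deriv l (\<lambda>y. G y $ i $ j))"
  by (rule ck_partial_deriv[OF entry_ck])

lemma invertible_G: "y \<in> V \<Longrightarrow> invertible (G y)"
proof -
  assume y: "y \<in> V"
  have "x = 0" if "G y *v x = 0" for x
    using positive[OF y, of x] that by auto
  then show ?thesis by (simp add: invertible_left_inverse matrix_left_invertible_ker)
qed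

lemma lowered_ck: "ck k V (lowered_christoffel G a i j)"
proof -
  have "ck k V (\<lambda>y. inverse 2 * (partial_deriv i (\<lambda>y. G y $ j $ a) y + partial_deriv j (\<lambda>y. G y $ i $ a) y - partial_deriv a (\<lambda>y. G y $ i $ j) y))"
    by (intro ck_mult ck_const ck_diff ck_add V partial_ck)
  moreover have "lowered_christoffel G a i j = (\<lambda>y. inverse 2 * (partial_deriv i (\<lambda>y. G y $ j $ a) y + partial_deriv j (\<lambda>y. G y $ i $ a) y - partial_deriv a (\<lambda>y. G y $ i $ j) y))"
    by (rule ext) (simp add: lowered_christoffel_def)
  ultimately show ?thesis by simp
qed

lemma christoffel_ck: "ck k V (christoffel G a i j)"
proof -
  have "ck k V (\<lambda>y. \<Sum>l\<in>UNIV. matrix_inv (G y) $ a $ l * lowered_christoffel G l i j y)"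
    by (intro ck_sum ck_mult V lowered_ck ck_matrix_inv entry_ck invertible_G)
  then show ?thesis by (simp add: christoffel_eq[abs_def])
qed

lemma partial_symmetric: "y \<in> V \<Longrightarrow> partial_deriv k (\<lambda>y. G y $ i $ j) y = partial_deriv k (\<lambda>y. G y $ j $ i) y"
  by (rule partial_deriv_cong[OF V]) (auto intro: symmetric)

lemma second_symmetric:
  assumes y: "y \<in> V"
  shows "metric_second_derivative G k l p q y = metric_second_derivative G k l q p y"
    and "metric_second_derivative G k l p q y = metric_second_derivative G l k p q y"
proof -
  show "metric_second_derivative G k l p q y = metric_second_derivative G k l q p y"
    unfolding metric_second_derivative_def by (rule partial_deriv_cong[OF V y partial_symmetric])
  show "metric_second_derivative G k l p q y = metric_second_derivative G l k p q y"
    unfolding metric_second_derivative_def partial_deriv_def[abs_def]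
    by (rule second_derivative_symmetric[OF V entry_ck y])
qed

lemma lowered_symmetric:
  assumes y: "y \<in> V" shows "lowered_christoffel G a j k y = lowered_christoffel G a k j y"
  using partial_symmetric[OF y] by (simp add: lowered_christoffel_def)

lemma christoffel_symmetric:
  assumes y: "y \<in> V" shows "christoffel G a j k y = christoffel G a k j y"
  unfolding christoffel_eq by (simp add: lowered_symmetric[OF y, of _ j k])

lemma lower_christoffel:
  assumes y: "y \<in> V"
  shows "(\<Sum>a\<in>UNIV. G y $ a $ l * christoffel G a j k y) = lowered_christoffel G l j k y"
proof -
  have "(\<Sum>a\<in>UNIV. G y $ a $ l * christoffel G a j k y)
    = (\<Sum>a\<in>UNIV. \<Sum>m\<in>UNIV. G y $ l $ a * matrix_inv (G y) $ a $ m * lowered_christoffel G m j k y)"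
    unfolding christoffel_eq sum_distrib_left by (simp add: symmetric[OF y, of _ l] mult.assoc)
  also have "\<dots> = (\<Sum>m\<in>UNIV. (G y ** matrix_inv (G y)) $ l $ m * lowered_christoffel G m j k y)"
    by (subst sum.swap) (simp add: matrix_matrix_mult_def sum_distrib_right)
  also have "\<dots> = lowered_christoffel G l j k y"
    by (simp add: invertible_right[OF invertible_G[OF y]] mat_def if_distrib[of "\<lambda>x. x * _"] cong: if_cong)
  finally show ?thesis .
qed

lemma metric_compatible:
  assumes y: "y \<in> V"
  shows "partial_deriv i (\<lambda>y. G y $ a $ l) y = lowered_christoffel G l i a y + lowered_christoffel G a i l y"
  using partial_symmetric[OF y, of i a l] partial_symmetric[OF y, of a i l] partial_symmetric[OF y, of l i a]
  by (simp add: lowered_christoffel_def field_simps)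

text \<open>The classical formula with two derivatives of the metric. The lowered derivative of
  \<Gamma> is obtained by differentiating g \<Gamma> = lowered \<Gamma>; metric compatibility splits
  the derivative of g in two, and one half cancels the quadratic terms in the definition of
  curvature.\<close>

lemma curvature_eq:
  assumes y: "y \<in> V"
  shows "curvature G i j k l y = (metric_second_derivative G i k j l y - metric_second_derivative G i l j k y
      - metric_second_derivative G j k i l y + metric_second_derivative G j l i k y) / 2
      - (\<Sum>a\<in>UNIV. lowered_christoffel G a i l y * christoffel G a j k y) + (\<Sum>a\<in>UNIV. lowered_christoffel G a j l y * christoffel G a i k y)"
proof -
  let ?\<Gamma> = "\<lambda>a j k. christoffel G a j k y" and ?L = "\<lambda>a j k. lowered_christoffel G a j k y"
  have dG: "(\<lambda>y. G y $ a $ b) differentiable at y" for a b by (rule ck_differentiable[OF entry_ck y])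
  have d\<Gamma>: "christoffel G a j k differentiable at y" for a j k by (rule ck_differentiable[OF christoffel_ck y])
  have dp: "partial_deriv c (\<lambda>y. G y $ a $ b) differentiable at y" for a b c by (rule ck_differentiable[OF partial_ck y])
  have der: "(\<Sum>a\<in>UNIV. G y $ a $ l * partial_deriv i (christoffel G a j k) y)
     = partial_deriv i (lowered_christoffel G l j k) y - (\<Sum>a\<in>UNIV. (?L l i a + ?L a i l) * ?\<Gamma> a j k)" for i j k
  proof -
    have "partial_deriv i (lowered_christoffel G l j k) y = partial_deriv i (\<lambda>y. \<Sum>a\<in>UNIV. G y $ a $ l * christoffel G a j k y) y"
      by (rule partial_deriv_cong[OF V y]) (simp add: lower_christoffel)
    also have "\<dots> = (\<Sum>a\<in>UNIV. G y $ a $ l * partial_deriv i (christoffel G a j k) y + partial_deriv i (\<lambda>y. G y $ a $ l) y * ?\<Gamma> a j k)"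
      by (rule partial_deriv_sum_mult[OF dG d\<Gamma>])
    finally show ?thesis by (simp add: metric_compatible[OF y] sum.distrib)
  qed
  have quad: "(\<Sum>a\<in>UNIV. G y $ a $ l * (\<Sum>b\<in>UNIV. ?\<Gamma> b j k * ?\<Gamma> a i b - ?\<Gamma> b i k * ?\<Gamma> a j b))
     = (\<Sum>b\<in>UNIV. ?L l i b * ?\<Gamma> b j k) - (\<Sum>b\<in>UNIV. ?L l j b * ?\<Gamma> b i k)"
  proof -
    have "(\<Sum>a\<in>UNIV. G y $ a $ l * (\<Sum>b\<in>UNIV. ?\<Gamma> b j k * ?\<Gamma> a i b - ?\<Gamma> b i k * ?\<Gamma> a j b))
       = (\<Sum>b\<in>UNIV. \<Sum>a\<in>UNIV. (G y $ a $ l * ?\<Gamma> a i b) * ?\<Gamma> b j k - (G y $ a $ l * ?\<Gamma> a j b) * ?\<Gamma> b i k)"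
      unfolding sum_distrib_left by (subst sum.swap) (simp add: algebra_simps)
    then show ?thesis by (simp add: sum_subtractf lower_christoffel[OF y] flip: sum_distrib_right)
  qed
  have "curvature G i j k l y = (\<Sum>a\<in>UNIV. G y $ a $ l * partial_deriv i (christoffel G a j k) y)
     - (\<Sum>a\<in>UNIV. G y $ a $ l * partial_deriv j (christoffel G a i k) y)
     + (\<Sum>a\<in>UNIV. G y $ a $ l * (\<Sum>b\<in>UNIV. ?\<Gamma> b j k * ?\<Gamma> a i b - ?\<Gamma> b i k * ?\<Gamma> a j b))"
    by (simp add: curvature_def algebra_simps sum.distrib sum_subtractf)
  also have "\<dots> = (metric_second_derivative G i k j l y - metric_second_derivative G i l j k y
      - metric_second_derivative G j k i l y + metric_second_derivative G j l i k y) / 2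
      - (\<Sum>a\<in>UNIV. ?L a i l * ?\<Gamma> a j k) + (\<Sum>a\<in>UNIV. ?L a j l * ?\<Gamma> a i k)"
    unfolding der quad partial_deriv_lowered[OF dp]
    using second_symmetric(2)[OF y, of i j k l]
    by (simp add: distrib_right sum.distrib field_simps)
  finally show ?thesis .
qed

end

lemma sum_quadruple:
  "(\<Sum>i\<in>UNIV. \<Sum>j\<in>UNIV. \<Sum>k\<in>UNIV. \<Sum>l\<in>UNIV. f i j k l) = (\<Sum>(i,j,k,l)\<in>(UNIV::('n::finite\<times>'n\<times>'n\<times>'n) set). f i j k l)"
  by (simp add: sum.cartesian_product UNIV_Times_UNIV[symmetric] del: UNIV_Times_UNIV)

definition curvature_quadratic :: "(real^'n \<Rightarrow> real^'n^'n) \<Rightarrow> real^'n \<Rightarrow> complex^'n::finite^'n \<Rightarrow> complex" where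
  "curvature_quadratic G y A = (\<Sum>p\<in>UNIV. \<Sum>q\<in>UNIV. \<Sum>k\<in>UNIV. \<Sum>l\<in>UNIV.
     of_real (curvature_coeff G y p q k l) * (A $ p $ q * A $ k $ l - A $ p $ l * A $ k $ q))"

context riemannian_coordinates
begin

text \<open>A enters quadratically, so each summand may be relabelled on its own. The four second
  derivatives of the metric then meet A_pq A_kl twice and A_pl A_kq twice, which cancels the factor
  1/2, and the two quadratic Christoffel terms follow the same pattern.\<close>

lemma curvature_contraction_eq:
  assumes y: "y \<in> V"
  shows "curvature_contraction G y A = - curvature_quadratic G y A"
proof -
  let ?S = "\<lambda>f :: 'n \<Rightarrow> 'n \<Rightarrow> 'n \<Rightarrow> 'n \<Rightarrow> complex. \<Sum>i\<in>UNIV. \<Sum>j\<in>UNIV. \<Sum>k\<in>UNIV. \<Sum>l\<in>UNIV. f i j k l"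
  let ?d = "\<lambda>k l p q. complex_of_real (metric_second_derivative G k l p q y)"
  let ?c = "\<lambda>p q k l. complex_of_real (\<Sum>a\<in>UNIV. lowered_christoffel G a p q y * christoffel G a k l y)"
  have lin: "?S (\<lambda>i j k l. f i j k l + g i j k l) = ?S f + ?S g" for f g by (simp add: sum.distrib)
  have "curvature_contraction G y A = ?S (\<lambda>i j k l. ?d i k j l / 2 * (A $ j $ k * A $ i $ l) + (- (?d i l j k / 2) * (A $ j $ k * A $ i $ l)
      + (- (?d j k i l / 2) * (A $ i $ l * A $ j $ k) + (?d j l i k / 2 * (A $ i $ l * A $ j $ k)
      + (- ?c i l j k * (A $ i $ l * A $ j $ k) + ?c j l i k * (A $ j $ k * A $ i $ l))))))"
    unfolding curvature_contraction_def curvature_eq[OF y]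
    by (intro sum.cong refl) (simp add: field_simps)
  also have "\<dots> = ?S (\<lambda>p q k l. ?d k l p q / 2 * (A $ p $ l * A $ k $ q)) + (?S (\<lambda>p q k l. - (?d k l p q / 2) * (A $ p $ q * A $ k $ l))
      + (?S (\<lambda>p q k l. - (?d k l p q / 2) * (A $ p $ q * A $ k $ l)) + (?S (\<lambda>p q k l. ?d k l p q / 2 * (A $ p $ l * A $ k $ q))
      + (?S (\<lambda>p q k l. - ?c p q k l * (A $ p $ q * A $ k $ l)) + ?S (\<lambda>p q k l. ?c p q k l * (A $ p $ l * A $ k $ q))))))"
  proof -
    have 1: "?S (\<lambda>i j k l. ?d i k j l / 2 * (A $ j $ k * A $ i $ l)) = ?S (\<lambda>p q k l. ?d k l p q / 2 * (A $ p $ l * A $ k $ q))"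
      unfolding sum_quadruple by (rule sum.reindex_bij_witness[of _ "\<lambda>(p,q,k,l). (k,p,l,q)" "\<lambda>(i,j,k,l). (j,l,i,k)"]) auto
    have 2: "?S (\<lambda>i j k l. - (?d i l j k / 2) * (A $ j $ k * A $ i $ l)) = ?S (\<lambda>p q k l. - (?d k l p q / 2) * (A $ p $ q * A $ k $ l))"
      unfolding sum_quadruple by (rule sum.reindex_bij_witness[of _ "\<lambda>(p,q,k,l). (k,p,q,l)" "\<lambda>(i,j,k,l). (j,k,i,l)"]) auto
    have 3: "?S (\<lambda>i j k l. - (?d j k i l / 2) * (A $ i $ l * A $ j $ k)) = ?S (\<lambda>p q k l. - (?d k l p q / 2) * (A $ p $ q * A $ k $ l))"
      unfolding sum_quadruple by (rule sum.reindex_bij_witness[of _ "\<lambda>(p,q,k,l). (p,k,l,q)" "\<lambda>(i,j,k,l). (i,l,j,k)"]) auto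
    have 4: "?S (\<lambda>i j k l. ?d j l i k / 2 * (A $ i $ l * A $ j $ k)) = ?S (\<lambda>p q k l. ?d k l p q / 2 * (A $ p $ l * A $ k $ q))"
      unfolding sum_quadruple by (rule sum.reindex_bij_witness[of _ "\<lambda>(p,q,k,l). (p,k,q,l)" "\<lambda>(i,j,k,l). (i,k,j,l)"]) auto
    have 5: "?S (\<lambda>i j k l. - ?c i l j k * (A $ i $ l * A $ j $ k)) = ?S (\<lambda>p q k l. - ?c p q k l * (A $ p $ q * A $ k $ l))"
      unfolding sum_quadruple by (rule sum.reindex_bij_witness[of _ "\<lambda>(p,q,k,l). (p,k,l,q)" "\<lambda>(i,j,k,l). (i,l,j,k)"]) auto
    have 6: "?S (\<lambda>i j k l. ?c j l i k * (A $ j $ k * A $ i $ l)) = ?S (\<lambda>p q k l. ?c p q k l * (A $ p $ l * A $ k $ q))"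
      unfolding sum_quadruple by (rule sum.reindex_bij_witness[of _ "\<lambda>(p,q,k,l). (k,p,l,q)" "\<lambda>(i,j,k,l). (j,l,i,k)"]) auto
    show ?thesis unfolding lin 1 2 3 4 5 6 ..
  qed
  also have "\<dots> = - curvature_quadratic G y A"
    unfolding curvature_quadratic_def curvature_coeff_def lin[symmetric] sum_negf[symmetric]
    by (intro sum.cong refl) (simp add: field_simps)
  finally show ?thesis .
qed

lemma curvature_coeff_symmetric:
  assumes y: "y \<in> V"
  shows "curvature_coeff G y q p l k = curvature_coeff G y p q k l"
  unfolding curvature_coeff_def second_symmetric(2)[OF y, of l k q p] second_symmetric(1)[OF y, of k l q p]
    lowered_symmetric[OF y, of _ q p] christoffel_symmetric[OF y, of _ l k] ..

text \<open>The integral argument yields that a real part vanishes, while the equality case of the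
  curvature condition is about the complex number; for Hermitian A the two agree. Conjugation
  exchanges p with q and k with l, a symmetry of the coefficient.\<close>

lemma curvature_quadratic_real:
  assumes y: "y \<in> V" and A: "\<And>i j. A $ j $ i = cnj (A $ i $ j)"
  shows "cnj (curvature_quadratic G y A) = curvature_quadratic G y A"
proof -
  have "cnj (curvature_quadratic G y A) = (\<Sum>p\<in>UNIV. \<Sum>q\<in>UNIV. \<Sum>k\<in>UNIV. \<Sum>l\<in>UNIV.
     of_real (curvature_coeff G y q p l k) * (A $ q $ p * A $ l $ k - A $ l $ p * A $ q $ k))"
    unfolding curvature_quadratic_def
    by (simp add: A[symmetric] curvature_coeff_symmetric[OF y])
  also have "\<dots> = curvature_quadratic G y A"
    unfolding curvature_quadratic_def sum_quadruple
    by (rule sum.reindex_bij_witness[of _ "\<lambda>(p,q,k,l). (q,p,l,k)" "\<lambda>(p,q,k,l). (q,p,l,k)"]) (auto simp: mult.commute)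
  finally show ?thesis .
qed

end

section \<open>Gram matrices of frames and the equality case of the curvature condition\<close>

definition frame_matrix :: "('m::finite \<Rightarrow> complex^'n) \<Rightarrow> complex^'n^'n::finite" where
  "frame_matrix f = (\<chi> i l. \<Sum>s\<in>UNIV. f s $ i * cnj (f s $ l))"

text \<open>What the integral argument takes from the curvature of the target, stated for m complex
  vectors, the derivatives of f along a unitary frame of the domain. The strongly Hermitian-negative
  case and the constant negative case both supply it.\<close>

definition rank_one_curvature :: "'m::finite itself \<Rightarrow> (real^'n \<Rightarrow> real^'n^'n) \<Rightarrow> real^'n::finite \<Rightarrow> bool" where
  "rank_one_curvature TYPE('m) G y \<longleftrightarrow> (\<forall>f :: 'm \<Rightarrow> complex^'n.
     Re (curvature_contraction G y (frame_matrix f)) \<le> 0 \<and>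
     (curvature_contraction G y (frame_matrix f) = 0 \<longrightarrow> (\<exists>w. \<forall>s. \<exists>c. f s = c *s w)))"

lemma frame_matrix_form:
  "(\<Sum>i\<in>UNIV. \<Sum>l\<in>UNIV. frame_matrix f $ i $ l * cnj (v $ i) * v $ l) = of_real (\<Sum>s\<in>UNIV. (cmod (\<Sum>l\<in>UNIV. cnj (f s $ l) * v $ l))\<^sup>2)"
proof -
  have "(\<Sum>i\<in>UNIV. \<Sum>l\<in>UNIV. frame_matrix f $ i $ l * cnj (v $ i) * v $ l)
     = (\<Sum>i\<in>UNIV. \<Sum>l\<in>UNIV. \<Sum>s\<in>UNIV. (f s $ i * cnj (v $ i)) * (cnj (f s $ l) * v $ l))"
    by (simp add: frame_matrix_def sum_distrib_right sum_distrib_left mult_ac)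
  also have "\<dots> = (\<Sum>i\<in>UNIV. \<Sum>s\<in>UNIV. \<Sum>l\<in>UNIV. (f s $ i * cnj (v $ i)) * (cnj (f s $ l) * v $ l))"
    by (intro sum.cong refl sum.swap)
  also have "\<dots> = (\<Sum>s\<in>UNIV. (\<Sum>i\<in>UNIV. f s $ i * cnj (v $ i)) * (\<Sum>l\<in>UNIV. cnj (f s $ l) * v $ l))"
    by (subst sum.swap) (simp add: sum_product)
  also have "\<dots> = (\<Sum>s\<in>UNIV. of_real ((cmod (\<Sum>l\<in>UNIV. cnj (f s $ l) * v $ l))\<^sup>2))"
  proof (rule sum.cong[OF refl])
    fix s
    have "(\<Sum>i\<in>UNIV. f s $ i * cnj (v $ i)) = cnj (\<Sum>l\<in>UNIV. cnj (f s $ l) * v $ l)" by simp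
    then show "(\<Sum>i\<in>UNIV. f s $ i * cnj (v $ i)) * (\<Sum>l\<in>UNIV. cnj (f s $ l) * v $ l) = of_real ((cmod (\<Sum>l\<in>UNIV. cnj (f s $ l) * v $ l))\<^sup>2)"
      by (simp only: complex_norm_square mult.commute)
  qed
  finally show ?thesis by simp
qed

lemma frame_matrix_semidefinite: "hermitian_positive_semidefinite (frame_matrix f)"
proof -
  have "Re (hermitian_form (frame_matrix f) v) \<ge> 0" for v
  proof -
    have "hermitian_form (frame_matrix f) v = (\<Sum>i\<in>UNIV. \<Sum>l\<in>UNIV. frame_matrix f $ i $ l * cnj ((\<chi> i. cnj (v $ i)) $ i) * (\<chi> i. cnj (v $ i)) $ l)"
      by (simp add: hermitian_form_def)
    then show ?thesis unfolding frame_matrix_form by (simp add: sum_nonneg)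
  qed
  moreover have "hermitian_matrix (frame_matrix f)"
    by (simp add: hermitian_matrix_def frame_matrix_def mult.commute)
  ultimately show ?thesis by (simp add: hermitian_positive_semidefinite_def)
qed

text \<open>All rows of the matrix are multiples of one w. The component v of f s orthogonal to the
  conjugate of w is annihilated by the matrix, whose form at v is a sum of squares of products with
  the frame vectors; so v is orthogonal to f s itself, hence to itself.\<close>

lemma frame_collinear_of_rank:
  fixes f :: "'m::finite \<Rightarrow> complex^'n::finite"
  assumes "rank (frame_matrix f) \<le> 1"
  shows "\<exists>w. \<forall>s. \<exists>c. f s = c *s w"
proof -
  let ?A = "frame_matrix f"
  obtain B where B: "B \<subseteq> rows ?A" "vec.independent B" "rows ?A \<subseteq> vec.span B" "card B = vec.dim (rows ?A)"
    by (rule vec.basis_exists)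
  have "finite B" using vec.finiteI_independent[OF B(2)] .
  have "card B \<le> 1" using assms B(4) by (simp add: row_rank_def_gen)
  then have "\<exists>w. B \<subseteq> {w}" using \<open>finite B\<close> by (metis card_le_Suc0_iff_eq One_nat_def insertI1 subsetI subset_insertI2 all_not_in_conv empty_subsetI singleton_iff)
  then obtain w where w: "B \<subseteq> {w}" by blast
  have "\<exists>c. ?A $ i = c *s w" for i
  proof -
    have "row i ?A \<in> vec.span {w}" using B(3) vec.span_mono[OF w] by (auto simp: rows_def)
    then show ?thesis by (auto simp: vec.span_singleton row_def)
  qed
  then have "\<forall>i. \<exists>c. ?A $ i = c *s w" by blast
  then obtain c where c: "\<And>i. ?A $ i = c i *s w" by metis
  define w' where "w' = (\<chi> l. cnj (w $ l))"
  have "\<exists>d. f s = d *s w'" for s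
  proof -
    \<comment> \<open>Coefficient of the orthogonal projection. For w = 0 also w' = 0 and v = f s,
      with the quotient 0 by convention.\<close>
    define d where "d = (\<Sum>l\<in>UNIV. w $ l * f s $ l) / (\<Sum>l\<in>UNIV. w $ l * cnj (w $ l))"
    define v where "v = f s - d *s w'"
    have wv: "(\<Sum>l\<in>UNIV. w $ l * v $ l) = 0"
    proof (cases "w = 0")
      case False
      have "(\<Sum>l\<in>UNIV. w $ l * cnj (w $ l)) = of_real (\<Sum>l\<in>UNIV. (cmod (w $ l))\<^sup>2)"
        by (simp add: complex_norm_square[symmetric])
      moreover have "(\<Sum>l\<in>UNIV. (cmod (w $ l))\<^sup>2) \<noteq> 0"
        using False by (subst sum_nonneg_eq_0_iff) (auto simp: vec_eq_iff)
      ultimately have nz: "(\<Sum>l\<in>UNIV. w $ l * cnj (w $ l)) \<noteq> 0" by (simp del: of_real_sum)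
      have "(\<Sum>l\<in>UNIV. w $ l * v $ l) = (\<Sum>l\<in>UNIV. w $ l * f s $ l) - d * (\<Sum>l\<in>UNIV. w $ l * cnj (w $ l))"
        by (simp add: v_def w'_def algebra_simps sum_subtractf sum_distrib_left)
      then show ?thesis using nz by (simp add: d_def)
    qed simp
    have "?A $ i $ l = c i * w $ l" for i l by (simp add: c)
    then have "(\<Sum>i\<in>UNIV. \<Sum>l\<in>UNIV. ?A $ i $ l * cnj (v $ i) * v $ l) = (\<Sum>i\<in>UNIV. c i * cnj (v $ i) * (\<Sum>l\<in>UNIV. w $ l * v $ l))"
      by (simp add: sum_distrib_left mult_ac)
    then have "of_real (\<Sum>s\<in>UNIV. (cmod (\<Sum>l\<in>UNIV. cnj (f s $ l) * v $ l))\<^sup>2) = (0::complex)"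
      unfolding frame_matrix_form wv by simp
    then have "(\<Sum>s\<in>UNIV. (cmod (\<Sum>l\<in>UNIV. cnj (f s $ l) * v $ l))\<^sup>2) = 0" by (simp only: of_real_eq_0_iff)
    then have "\<forall>s\<in>UNIV. (cmod (\<Sum>l\<in>UNIV. cnj (f s $ l) * v $ l))\<^sup>2 = 0"
      by (subst (asm) sum_nonneg_eq_0_iff) auto
    then have fv: "(\<Sum>l\<in>UNIV. cnj (f s $ l) * v $ l) = 0" by simp
    have "(\<Sum>l\<in>UNIV. cnj (v $ l) * v $ l) = (\<Sum>l\<in>UNIV. cnj (f s $ l) * v $ l) - cnj d * (\<Sum>l\<in>UNIV. w $ l * v $ l)"
    proof -
      have "cnj (v $ l) = cnj (f s $ l) - cnj d * w $ l" for l by (simp add: v_def w'_def)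
      then have "(\<Sum>l\<in>UNIV. cnj (v $ l) * v $ l) = (\<Sum>l\<in>UNIV. cnj (f s $ l) * v $ l - cnj d * (w $ l * v $ l))"
        by (simp only: left_diff_distrib mult.assoc)
      then show ?thesis by (simp only: sum_subtractf sum_distrib_left)
    qed
    also have "\<dots> = 0" unfolding fv wv by simp
    finally have "(\<Sum>l\<in>UNIV. of_real ((cmod (v $ l))\<^sup>2)) = (0::complex)"
      by (simp only: complex_norm_square mult.commute)
    then have "(\<Sum>l\<in>UNIV. (cmod (v $ l))\<^sup>2) = 0" by (simp only: of_real_sum[symmetric] of_real_eq_0_iff)
    then have "\<forall>l\<in>UNIV. (cmod (v $ l))\<^sup>2 = 0" by (subst (asm) sum_nonneg_eq_0_iff) auto
    then have "v = 0" by (simp add: vec_eq_iff)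
    then show ?thesis by (auto simp: v_def)
  qed
  then show ?thesis by blast
qed

lemma strongly_negative_rank_one:
  assumes "strongly_hermitian_negative B g" "d \<in> B" "y \<in> chart_image d"
  shows "rank_one_curvature TYPE('m::finite) (g d) y"
  using assms frame_matrix_semidefinite frame_collinear_of_rank
  unfolding strongly_hermitian_negative_def rank_one_curvature_def by blast

section \<open>The Bochner formula\<close>

definition metric_form :: "real^'n^'n \<Rightarrow> complex^'n::finite \<Rightarrow> complex^'n \<Rightarrow> complex" where
  "metric_form g z w = (\<Sum>i\<in>UNIV. \<Sum>j\<in>UNIV. of_real (g $ i $ j) * z $ i * cnj (w $ j))"

context riemannian_coordinates
begin

lemma metric_form_cnj: "y \<in> V \<Longrightarrow> cnj (metric_form (G y) z w) = metric_form (G y) w z"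
  unfolding metric_form_def by (simp add: symmetric mult_ac) (subst sum.swap, simp add: symmetric mult_ac)

lemma metric_form_positive:
  assumes y: "y \<in> V"
  shows "metric_form (G y) z z = of_real (Re (metric_form (G y) z z))" "Re (metric_form (G y) z z) \<ge> 0"
    "Re (metric_form (G y) z z) = 0 \<Longrightarrow> z = 0"
proof -
  show "metric_form (G y) z z = of_real (Re (metric_form (G y) z z))"
    using metric_form_cnj[OF y, of z z] by (simp add: complex_eq_iff)
  define a b where "a = (\<chi> i. Re (z $ i))" and "b = (\<chi> i. Im (z $ i))"
  have e: "Re (metric_form (G y) z z) = a \<bullet> (G y *v a) + b \<bullet> (G y *v b)"
    by (simp add: metric_form_def a_def b_def inner_vec_def matrix_vector_mult_def sum_distrib_left sum.distrib[symmetric] algebra_simps)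
  have nn: "v \<bullet> (G y *v v) \<ge> 0" for v using positive[OF y, of v] by (cases "v = 0") auto
  show "Re (metric_form (G y) z z) \<ge> 0" unfolding e using nn[of a] nn[of b] by simp
  assume "Re (metric_form (G y) z z) = 0"
  then have "a \<bullet> (G y *v a) = 0" "b \<bullet> (G y *v b) = 0" using e nn[of a] nn[of b] by linarith+
  then have "a = 0" "b = 0" using positive[OF y] by (metis less_irrefl)+
  then show "z = 0" by (simp add: a_def b_def vec_eq_iff complex_eq_iff)
qed

lemma metric_form_residual:
  assumes y: "y \<in> V"
  shows "metric_form (G y) (z - c *s w) (z - c *s w) = metric_form (G y) z z - cnj c * metric_form (G y) z w
     - c * metric_form (G y) w z + c * cnj c * metric_form (G y) w w"
  by (simp add: metric_form_def algebra_simps sum.distrib sum_subtractf sum_distrib_left)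

lemma metric_form_cauchy_schwarz:
  assumes y: "y \<in> V"
  defines "B \<equiv> metric_form (G y)"
  shows "Re (B z z * B w w - B z w * B w z) \<ge> 0"
    and "Re (B z z * B w w - B z w * B w z) = 0 \<Longrightarrow> w \<noteq> 0 \<Longrightarrow> \<exists>c. z = c *s w"
    and "Im (B z z * B w w - B z w * B w z) = 0"
proof -
  have zw: "B w z = cnj (B z w)" using metric_form_cnj[OF y] by (simp add: B_def)
  note zz = metric_form_positive[OF y, of z, folded B_def] and ww = metric_form_positive[OF y, of w, folded B_def]
  have "B z z * B w w - B z w * B w z = of_real (Re (B z z) * Re (B w w) - (cmod (B z w))\<^sup>2)"
    by (subst zz(1), subst ww(1)) (simp add: zw complex_norm_square[symmetric] del: of_real_power)
  then show "Im (B z z * B w w - B z w * B w z) = 0" by simp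
  have "Re (B z z * B w w - B z w * B w z) \<ge> 0 \<and> (Re (B z z * B w w - B z w * B w z) = 0 \<longrightarrow> w \<noteq> 0 \<longrightarrow> (\<exists>c. z = c *s w))" (is "?P z w")
  proof (cases "w = 0")
    case True
    then show ?thesis by (simp add: B_def metric_form_def)
  next
    case False
    then have pos: "Re (B w w) > 0" using ww(2,3) by fastforce
    define c where "c = B z w / B w w"
    have nz: "B w w \<noteq> 0" using pos by auto
    have cw: "cnj (B w w) = B w w" using metric_form_cnj[OF y] by (simp add: B_def)
    have "B (z - c *s w) (z - c *s w) * B w w = B z z * B w w - B z w * B w z"
      using nz unfolding B_def metric_form_residual[OF y] unfolding B_def[symmetric]
      by (simp add: c_def zw cw field_simps)
    then have "of_real (Re (B (z - c *s w) (z - c *s w)) * Re (B w w)) = B z z * B w w - B z w * B w z"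
      using metric_form_positive(1)[OF y, of "z - c *s w", folded B_def] ww(1) by (metis of_real_mult)
    then have e: "Re (B z z * B w w - B z w * B w z) = Re (B (z - c *s w) (z - c *s w)) * Re (B w w)"
      by (metis Re_complex_of_real)
    show ?thesis unfolding e using pos metric_form_positive(2,3)[OF y, of "z - c *s w", folded B_def]
      by (auto intro!: exI[of _ c])
  qed
  then show "Re (B z z * B w w - B z w * B w z) \<ge> 0"
    and "Re (B z z * B w w - B z w * B w z) = 0 \<Longrightarrow> w \<noteq> 0 \<Longrightarrow> \<exists>c. z = c *s w" by blast+
qed

text \<open>On a frame the contraction is \<kappa> times the sum of the Gram determinants of all
  pairs of vectors. Each is nonnegative, so equality makes every pair dependent, and any nonzero
  member of the frame can serve as w.\<close>

lemma constant_curvature_rank_one: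
  assumes y: "y \<in> V" and \<kappa>: "\<kappa> < 0"
    and K: "\<And>i j k l. curvature G i j k l y = \<kappa> * (G y $ i $ l * G y $ j $ k - G y $ i $ k * G y $ j $ l)"
  shows "rank_one_curvature TYPE('m::finite) G y"
  unfolding rank_one_curvature_def
proof (intro allI)
  fix f :: "'m \<Rightarrow> complex^'n"
  let ?A = "frame_matrix f"
  let ?B = "metric_form (G y)"
  have 1: "(\<Sum>i\<in>UNIV. \<Sum>l\<in>UNIV. of_real (G y $ i $ l) * ?A $ i $ l) = (\<Sum>s\<in>UNIV. ?B (f s) (f s))"
  proof -
    have "(\<Sum>i\<in>UNIV. \<Sum>l\<in>UNIV. of_real (G y $ i $ l) * ?A $ i $ l)
      = (\<Sum>i\<in>UNIV. \<Sum>l\<in>UNIV. \<Sum>s\<in>UNIV. of_real (G y $ i $ l) * f s $ i * cnj (f s $ l))"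
      by (simp add: frame_matrix_def sum_distrib_left mult_ac)
    also have "\<dots> = (\<Sum>i\<in>UNIV. \<Sum>s\<in>UNIV. \<Sum>l\<in>UNIV. of_real (G y $ i $ l) * f s $ i * cnj (f s $ l))"
      by (intro sum.cong refl sum.swap)
    also have "\<dots> = (\<Sum>s\<in>UNIV. ?B (f s) (f s))"
      unfolding metric_form_def by (rule sum.swap)
    finally show ?thesis .
  qed
  have 2: "(\<Sum>i\<in>UNIV. \<Sum>j\<in>UNIV. \<Sum>k\<in>UNIV. \<Sum>l\<in>UNIV. of_real (G y $ i $ k) * of_real (G y $ j $ l) * (?A $ i $ l * ?A $ j $ k))
     = (\<Sum>s\<in>UNIV. \<Sum>t\<in>UNIV. ?B (f s) (f t) * ?B (f t) (f s))"
  proof -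
    have "(\<Sum>i\<in>UNIV. \<Sum>j\<in>UNIV. \<Sum>k\<in>UNIV. \<Sum>l\<in>UNIV. of_real (G y $ i $ k) * of_real (G y $ j $ l) * (?A $ i $ l * ?A $ j $ k))
      = (\<Sum>(i,j,k,l)\<in>UNIV. \<Sum>s\<in>UNIV. \<Sum>t\<in>UNIV. (of_real (G y $ i $ k) * f s $ i * cnj (f t $ k)) * (of_real (G y $ j $ l) * f t $ j * cnj (f s $ l)))"
      unfolding sum_quadruple
    proof (rule sum.cong[OF refl])
      fix x :: "'n \<times> 'n \<times> 'n \<times> 'n"
      obtain i j k l where x: "x = (i,j,k,l)" by (cases x)
      show "(case x of (i,j,k,l) \<Rightarrow> of_real (G y $ i $ k) * of_real (G y $ j $ l) * (?A $ i $ l * ?A $ j $ k))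
        = (case x of (i,j,k,l) \<Rightarrow> \<Sum>s\<in>UNIV. \<Sum>t\<in>UNIV. (of_real (G y $ i $ k) * f s $ i * cnj (f t $ k)) * (of_real (G y $ j $ l) * f t $ j * cnj (f s $ l)))"
        unfolding x prod.case frame_matrix_def vec_lambda_beta sum_product unfolding sum_distrib_left
        by (intro sum.cong refl) (simp add: mult_ac)
    qed
    also have "\<dots> = (\<Sum>x\<in>UNIV. \<Sum>s\<in>UNIV. \<Sum>t\<in>UNIV. (case x of (i,j,k,l) \<Rightarrow> (of_real (G y $ i $ k) * f s $ i * cnj (f t $ k)) * (of_real (G y $ j $ l) * f t $ j * cnj (f s $ l))))"
      by (rule sum.cong[OF refl]) (simp split: prod.splits)
    also have "\<dots> = (\<Sum>s\<in>UNIV. \<Sum>x\<in>UNIV. \<Sum>t\<in>UNIV. (case x of (i,j,k,l) \<Rightarrow> (of_real (G y $ i $ k) * f s $ i * cnj (f t $ k)) * (of_real (G y $ j $ l) * f t $ j * cnj (f s $ l))))"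
      by (rule sum.swap)
    also have "\<dots> = (\<Sum>s\<in>UNIV. \<Sum>t\<in>UNIV. \<Sum>x\<in>UNIV. (case x of (i,j,k,l) \<Rightarrow> (of_real (G y $ i $ k) * f s $ i * cnj (f t $ k)) * (of_real (G y $ j $ l) * f t $ j * cnj (f s $ l))))"
      by (intro sum.cong[OF refl] sum.swap)
    also have "\<dots> = (\<Sum>s\<in>UNIV. \<Sum>t\<in>UNIV. ?B (f s) (f t) * ?B (f t) (f s))"
      unfolding sum_quadruple[symmetric] metric_form_def sum_product ..
    finally show ?thesis .
  qed
  have "curvature_contraction G y ?A = of_real \<kappa> * ((\<Sum>s\<in>UNIV. ?B (f s) (f s)) * (\<Sum>t\<in>UNIV. ?B (f t) (f t)) - (\<Sum>s\<in>UNIV. \<Sum>t\<in>UNIV. ?B (f s) (f t) * ?B (f t) (f s)))"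
  proof -
    have "curvature_contraction G y ?A = of_real \<kappa> * ((\<Sum>i\<in>UNIV. \<Sum>j\<in>UNIV. \<Sum>k\<in>UNIV. \<Sum>l\<in>UNIV. (of_real (G y $ i $ l) * ?A $ i $ l) * (of_real (G y $ j $ k) * ?A $ j $ k))
        - (\<Sum>i\<in>UNIV. \<Sum>j\<in>UNIV. \<Sum>k\<in>UNIV. \<Sum>l\<in>UNIV. of_real (G y $ i $ k) * of_real (G y $ j $ l) * (?A $ i $ l * ?A $ j $ k)))"
      unfolding curvature_contraction_def K sum_subtractf[symmetric] sum_distrib_left
      by (intro sum.cong refl) (simp add: algebra_simps)
    also have "(\<Sum>i\<in>UNIV. \<Sum>j\<in>UNIV. \<Sum>k\<in>UNIV. \<Sum>l\<in>UNIV. (of_real (G y $ i $ l) * ?A $ i $ l) * (of_real (G y $ j $ k) * ?A $ j $ k))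
      = (\<Sum>i\<in>UNIV. \<Sum>l\<in>UNIV. of_real (G y $ i $ l) * ?A $ i $ l) * (\<Sum>j\<in>UNIV. \<Sum>k\<in>UNIV. of_real (G y $ j $ k) * ?A $ j $ k)"
      unfolding sum_product by (intro sum.cong refl sum.swap)
    finally show ?thesis unfolding 1 2 .
  qed
  also have "\<dots> = of_real \<kappa> * (\<Sum>s\<in>UNIV. \<Sum>t\<in>UNIV. ?B (f s) (f s) * ?B (f t) (f t) - ?B (f s) (f t) * ?B (f t) (f s))"
    by (simp add: sum_product sum_subtractf)
  also have "\<dots> = of_real (\<kappa> * (\<Sum>s\<in>UNIV. \<Sum>t\<in>UNIV. Re (?B (f s) (f s) * ?B (f t) (f t) - ?B (f s) (f t) * ?B (f t) (f s))))"
  proof -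
    have "b = of_real (Re b)" if "Im b = 0" for b :: complex using that by (simp add: complex_eq_iff)
    then have "?B z z * ?B w w - ?B z w * ?B w z = of_real (Re (?B z z * ?B w w - ?B z w * ?B w z))" for z w
      using metric_form_cauchy_schwarz(3)[OF y, of z w] by blast
    then show ?thesis by (simp only: of_real_mult of_real_sum)
  qed
  finally have C: "curvature_contraction G y ?A = of_real (\<kappa> * (\<Sum>s\<in>UNIV. \<Sum>t\<in>UNIV. Re (?B (f s) (f s) * ?B (f t) (f t) - ?B (f s) (f t) * ?B (f t) (f s))))" .
  note cs = metric_form_cauchy_schwarz[OF y]
  have nn: "(\<Sum>s\<in>UNIV. \<Sum>t\<in>UNIV. Re (?B (f s) (f s) * ?B (f t) (f t) - ?B (f s) (f t) * ?B (f t) (f s))) \<ge> 0"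
    by (intro sum_nonneg cs(1))
  have "Re (curvature_contraction G y ?A) \<le> 0"
    unfolding C using nn \<kappa> by (simp only: Re_complex_of_real) (simp add: mult_nonpos_nonneg)
  moreover have "\<exists>w. \<forall>s. \<exists>c. f s = c *s w" if "curvature_contraction G y ?A = 0"
  proof (cases "\<forall>s. f s = 0")
    case True
    then have "\<forall>s. f s = 0 *s 0" by simp
    then show ?thesis by blast
  next
    case False
    then obtain t where t: "f t \<noteq> 0" by blast
    have "(\<Sum>s\<in>UNIV. \<Sum>t\<in>UNIV. Re (?B (f s) (f s) * ?B (f t) (f t) - ?B (f s) (f t) * ?B (f t) (f s))) = 0"
      using that \<kappa> unfolding C by (simp only: of_real_eq_0_iff mult_eq_0_iff) simp
    then have "\<forall>s\<in>UNIV. (\<Sum>t\<in>UNIV. Re (?B (f s) (f s) * ?B (f t) (f t) - ?B (f s) (f t) * ?B (f t) (f s))) = 0"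
      by (subst (asm) sum_nonneg_eq_0_iff) (auto intro!: sum_nonneg cs(1) simp del: minus_complex.simps times_complex.simps)
    then have "(\<Sum>t\<in>UNIV. Re (?B (f s) (f s) * ?B (f t) (f t) - ?B (f s) (f t) * ?B (f t) (f s))) = 0" for s by simp
    then have "\<forall>t\<in>UNIV. Re (?B (f s) (f s) * ?B (f t) (f t) - ?B (f s) (f t) * ?B (f t) (f s)) = 0" for s
      by (rule iffD1[OF sum_nonneg_eq_0_iff[OF finite cs(1)]])
    then have "\<exists>c. f s = c *s f t" for s using cs(2)[OF _ t] by blast
    then show ?thesis by blast
  qed
  ultimately show "Re (curvature_contraction G y ?A) \<le> 0 \<and> (curvature_contraction G y ?A = 0 \<longrightarrow> (\<exists>w. \<forall>s. \<exists>c. f s = c *s w))" by blast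
qed

end

section \<open>Linearity of the matrix pairing and its expression in a unitary frame\<close>

lemma trace_contraction_commute: "trace_contraction H A B = trace_contraction H B A"
proof -
  have "trace (matrix_inv H ** A ** matrix_inv H ** B) = trace ((matrix_inv H ** A) ** (matrix_inv H ** B))" by (simp add: matrix_mul_assoc)
  also have "\<dots> = trace ((matrix_inv H ** B) ** (matrix_inv H ** A))" by (rule trace_mul_sym)
  finally show ?thesis by (simp add: trace_contraction_def matrix_mul_assoc mult.commute)
qed

lemma trace_contraction_sum:
  "trace_contraction H A (\<chi> \<alpha> \<beta>. \<Sum>i\<in>I. c i * B i $ \<alpha> $ \<beta>) = (\<Sum>i\<in>I. c i * trace_contraction H A (B i))"
proof -
  have "trace_contraction H A (\<chi> \<alpha> \<beta>. \<Sum>i\<in>I. c i * B i $ \<alpha> $ \<beta>)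
     = minor_contraction H (\<lambda>\<alpha> \<beta> \<gamma> \<delta>. \<Sum>i\<in>I. c i * (A $ \<alpha> $ \<beta> * B i $ \<gamma> $ \<delta>))"
    unfolding minor_contraction_product[symmetric] by (simp add: sum_distrib_left mult_ac)
  then show ?thesis by (simp add: minor_contraction_sum minor_contraction_cmult minor_contraction_product)
qed

lemma trace_contraction_add:
  "trace_contraction H A (B + C) = trace_contraction H A B + trace_contraction H A C"
  unfolding minor_contraction_product[symmetric] by (simp add: distrib_left minor_contraction_add)

lemma trace_frame:
  fixes H E :: "complex^'m::finite^'m"
  assumes E: "matrix_inv H = (\<chi> b s. cnj (E $ s $ b)) ** E"
  shows "trace (matrix_inv H ** A) = trace (E ** A ** (\<chi> b s. cnj (E $ s $ b)))"
    and "trace (matrix_inv H ** A ** matrix_inv H ** B)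
      = trace ((E ** A ** (\<chi> b s. cnj (E $ s $ b))) ** (E ** B ** (\<chi> b s. cnj (E $ s $ b))))"
proof -
  let ?E = "\<chi> b s. cnj (E $ s $ b)"
  have "trace (matrix_inv H ** A) = trace (?E ** (E ** A))" by (simp add: E matrix_mul_assoc)
  also have "\<dots> = trace ((E ** A) ** ?E)" by (rule trace_mul_sym)
  finally show "trace (matrix_inv H ** A) = trace (E ** A ** ?E)" .
  have "trace (matrix_inv H ** A ** matrix_inv H ** B) = trace (?E ** (E ** A ** ?E ** E ** B))" by (simp add: E matrix_mul_assoc)
  also have "\<dots> = trace ((E ** A ** ?E ** E ** B) ** ?E)" by (rule trace_mul_sym)
  finally show "trace (matrix_inv H ** A ** matrix_inv H ** B) = trace ((E ** A ** ?E) ** (E ** B ** ?E))"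
    by (simp add: matrix_mul_assoc)
qed

text \<open>Coefficients in dz^\<alpha> and dzbar^\<beta> of the (1,1) part of the pulled back
  metric.\<close>

definition pullback_form :: "(real^'n \<Rightarrow> real^'n^'n) \<Rightarrow> (complex^'m \<Rightarrow> real^'n) \<Rightarrow> 'm::finite \<Rightarrow> 'm \<Rightarrow> complex^'m \<Rightarrow> complex" where
  "pullback_form G F \<alpha> \<beta> x = (\<Sum>i\<in>UNIV. \<Sum>j\<in>UNIV. of_real (G (F x) $ i $ j) *
     (d_dz \<alpha> (\<lambda>z. of_real (F z $ i)) x * d_dzbar \<beta> (\<lambda>z. of_real (F z $ j)) x))"


text \<open>The weight joins the metric coefficient in the first slot of the triple operator, so
  that weighted and unweighted forms are treated alike; the constant weight 1 is the case used in
  the Bochner formula.\<close>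

lemma pullback_triple:
  fixes F :: "complex^'m::finite \<Rightarrow> real^'n::finite"
  assumes "riemannian_coordinates G V" and U: "open U" and F: "\<And>k. ck k U F" and FU: "F ` U \<subseteq> V" and x: "x \<in> U"
    and \<rho>: "ck 2 U \<rho>"
  shows "minor_contraction H (\<lambda>\<alpha> \<beta> \<gamma> \<delta>. d_dz \<gamma> (d_dzbar \<delta> (\<lambda>z. \<rho> z * pullback_form G F \<alpha> \<beta> z)) x)
    = (\<Sum>i\<in>UNIV. \<Sum>j\<in>UNIV. triple_operator H (\<lambda>z. \<rho> z * of_real (G (F z) $ i $ j)) (\<lambda>z. of_real (F z $ i)) (\<lambda>z. of_real (F z $ j)) x)"
proof -
  interpret riemannian_coordinates G V by fact
  let ?u = "\<lambda>i j z. \<rho> z * complex_of_real (G (F z) $ i $ j)" and ?F = "\<lambda>i z. complex_of_real (F z $ i)"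
  have cF: "ck k U (?F i)" for k i by (intro ck_of_real ck_vec_nth U F)
  have cG: "ck k U (\<lambda>z. complex_of_real (G (F z) $ i $ j))" for k i j
    by (intro ck_of_real U ck_compose[OF U V FU F entry_ck])
  have cu: "ck 2 U (?u i j)" for i j by (intro ck_mult U \<rho> cG)
  define w where "w = (\<lambda>(i,j) \<alpha> \<beta> z. ?u i j z * (d_dz \<alpha> (?F i) z * d_dzbar \<beta> (?F j) z))"
  have cw: "ck (Suc (Suc 0)) U (w t \<alpha> \<beta>)" for t \<alpha> \<beta>
  proof (cases t)
    case (Pair i j)
    have "ck (Suc (Suc 0)) U (?u i j)" using cu by (simp add: numeral_2_eq_2 del: continuously_differentiable_on.simps)
    then show ?thesis unfolding Pair w_def prod.case
      by (rule ck_mult[OF U _ ck_mult[OF U ck_wirtinger(1)[OF U cF] ck_wirtinger(2)[OF U cF]]])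
  qed
  have "(\<lambda>z. \<rho> z * pullback_form G F \<alpha> \<beta> z) = (\<lambda>z. \<Sum>t\<in>UNIV. w t \<alpha> \<beta> z)" for \<alpha> \<beta>
  proof
    fix z
    have "(\<Sum>t\<in>UNIV. w t \<alpha> \<beta> z) = (\<Sum>i\<in>UNIV. \<Sum>j\<in>UNIV. w (i,j) \<alpha> \<beta> z)"
      by (simp add: sum.cartesian_product UNIV_Times_UNIV[symmetric] del: UNIV_Times_UNIV)
    then show "\<rho> z * pullback_form G F \<alpha> \<beta> z = (\<Sum>t\<in>UNIV. w t \<alpha> \<beta> z)"
      by (simp add: w_def pullback_form_def sum_distrib_left mult.assoc)
  qed
  then have e: "d_dz \<gamma> (d_dzbar \<delta> (\<lambda>z. \<rho> z * pullback_form G F \<alpha> \<beta> z)) x = (\<Sum>t\<in>UNIV. d_dz \<gamma> (d_dzbar \<delta> (w t \<alpha> \<beta>)) x)" for \<alpha> \<beta> \<gamma> \<delta>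
  proof -
    have "d_dzbar \<delta> (\<lambda>z. \<Sum>t\<in>UNIV. w t \<alpha> \<beta> z) z = (\<Sum>t\<in>UNIV. d_dzbar \<delta> (w t \<alpha> \<beta>) z)" if "z \<in> U" for z
      by (rule wirtinger_sum(2)) (rule ck_differentiable[OF ck_SucD[OF cw] that])
    then have "d_dz \<gamma> (d_dzbar \<delta> (\<lambda>z. \<Sum>t\<in>UNIV. w t \<alpha> \<beta> z)) x = d_dz \<gamma> (\<lambda>z. \<Sum>t\<in>UNIV. d_dzbar \<delta> (w t \<alpha> \<beta>) z) x"
      by (rule wirtinger_cong(1)[OF U x])
    also have "\<dots> = (\<Sum>t\<in>UNIV. d_dz \<gamma> (d_dzbar \<delta> (w t \<alpha> \<beta>)) x)"
      by (rule wirtinger_sum(1)) (rule ck_differentiable[OF ck_wirtinger(2)[OF U cw] x])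
    finally show ?thesis using \<open>\<And>\<alpha> \<beta>. (\<lambda>z. \<rho> z * pullback_form G F \<alpha> \<beta> z) = _ \<alpha> \<beta>\<close> by simp
  qed
  have "minor_contraction H (\<lambda>\<alpha> \<beta> \<gamma> \<delta>. d_dz \<gamma> (d_dzbar \<delta> (\<lambda>z. \<rho> z * pullback_form G F \<alpha> \<beta> z)) x)
     = (\<Sum>t\<in>UNIV. minor_contraction H (\<lambda>\<alpha> \<beta> \<gamma> \<delta>. d_dz \<gamma> (d_dzbar \<delta> (w t \<alpha> \<beta>)) x))"
    unfolding e minor_contraction_sum ..
  also have "\<dots> = (\<Sum>(i,j)\<in>UNIV. triple_operator H (?u i j) (?F i) (?F j) x)"
  proof (rule sum.cong[OF refl])
    fix t :: "'n \<times> 'n"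
    obtain i j where t: "t = (i,j)" by (cases t)
    show "minor_contraction H (\<lambda>\<alpha> \<beta> \<gamma> \<delta>. d_dz \<gamma> (d_dzbar \<delta> (w t \<alpha> \<beta>)) x) = (case t of (i,j) \<Rightarrow> triple_operator H (?u i j) (?F i) (?F j) x)"
      unfolding t w_def prod.case by (rule minor_contraction_triple[OF U cu cF cF x])
  qed
  finally show ?thesis
    by (simp add: sum.cartesian_product UNIV_Times_UNIV[symmetric] del: UNIV_Times_UNIV)
qed

text \<open>In arbitrary target coordinates, \<partial>\<partial>bar of the form contains second
  derivatives of the metric, terms linear in its first derivatives, and a pairing of coordinate
  Hessians. Passing to covariant Hessians completes the square: the linear terms are its cross
  terms, and the defect, quadratic in \<Gamma>, joins the second derivatives of the metric to form
  the curvature.\<close>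

lemma bochner_formula:
  fixes F :: "complex^'m::finite \<Rightarrow> real^'n::finite" and H :: "complex^'m^'m"
  assumes "riemannian_coordinates G V" and U: "open U" and F: "\<And>k. ck k U F" and FU: "F ` U \<subseteq> V" and x: "x \<in> U"
    and H: "hermitian_positive_definite H"
    and harmonic: "\<And>i. (\<Sum>\<alpha>\<in>UNIV. \<Sum>\<beta>\<in>UNIV. inverse_metric H \<alpha> \<beta> * (d_dz \<alpha> (d_dzbar \<beta> (\<lambda>z. complex_of_real (F z $ i))) x +
          (\<Sum>j\<in>UNIV. \<Sum>k\<in>UNIV. complex_of_real (christoffel G i j k (F x))
             * d_dzbar \<beta> (\<lambda>z. complex_of_real (F z $ j)) x * d_dz \<alpha> (\<lambda>z. complex_of_real (F z $ k)) x))) = 0"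
  obtains b :: real and E :: "complex^'m^'m" where "b \<ge> 0" "invertible E"
    "minor_contraction H (\<lambda>\<alpha> \<beta> \<gamma> \<delta>. d_dz \<gamma> (d_dzbar \<delta> (pullback_form G F \<alpha> \<beta>)) x)
      = of_real b - curvature_contraction G (F x) (frame_matrix (\<lambda>s. \<chi> i. \<Sum>\<alpha>\<in>UNIV. E $ s $ \<alpha> * d_dz \<alpha> (\<lambda>z. complex_of_real (F z $ i)) x))"
proof -
  interpret riemannian_coordinates G V by fact
  let ?F = "\<lambda>i z. complex_of_real (F z $ i)"
  let ?y = "F x"
  have y: "?y \<in> V" using FU x by auto
  obtain E :: "complex^'m^'m" where E: "matrix_inv H = (\<chi> b s. cnj (E $ s $ b)) ** E" "invertible E"
    by (rule inverse_metric_frame[OF H])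
  let ?E = "\<chi> b s. cnj (E $ s $ b)"
  have cF: "ck k U (?F i)" for k i by (intro ck_of_real ck_vec_nth U F)
  have dF: "F differentiable at z" if "z \<in> U" for z by (rule ck_differentiable[OF F that])
  have FV: "F z \<in> V" if "z \<in> U" for z using that FU by auto
  define u where "u i j z = complex_of_real (G (F z) $ i $ j)" for i j z
  define O' where "O' p q = gradient_product (?F p) (?F q) x" for p q
  define P where "P i = hessian (?F i) x" for i
  define \<Gamma> where "\<Gamma> a k l = complex_of_real (christoffel G a k l ?y)" for a k l
  define L where "L a k l = complex_of_real (lowered_christoffel G a k l ?y)" for a k l
  define dG where "dG l i j = complex_of_real (partial_deriv l (\<lambda>y. G y $ i $ j) ?y)" for l i j
  define dd where "dd k l i j = complex_of_real (metric_second_derivative G k l i j ?y)" for k l i j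
  define g where "g i j = complex_of_real (G ?y $ i $ j)" for i j
  define m where "m = trace_contraction H"
  define mO where "mO p q k l = m (O' p q) (O' k l)" for p q k l
  define \<phi> where "\<phi> a p q = m (P a) (O' p q)" for a p q
  \<comment> \<open>The covariant complex Hessian of the map. Its trace with the inverse metric is
    the left side of the harmonic map equation.\<close>
  define M where "M i = P i + (\<chi> \<alpha> \<beta>. \<Sum>t\<in>UNIV. (case t of (k, l) \<Rightarrow> \<Gamma> i k l) * (case t of (k, l) \<Rightarrow> O' k l) $ \<alpha> $ \<beta>)" for i
  have m_sum: "m A (\<chi> \<alpha> \<beta>. \<Sum>i\<in>I. c i * B i $ \<alpha> $ \<beta>) = (\<Sum>i\<in>I. c i * m A (B i))" for A I c and B :: "'z \<Rightarrow> complex^'m^'m"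
    unfolding m_def by (rule trace_contraction_sum)
  have m_comm: "m A B = m B A" for A B unfolding m_def by (rule trace_contraction_commute)
  have m_add: "m A (B + C) = m A B + m A C" for A B C unfolding m_def by (rule trace_contraction_add)
  have pair: "(\<Sum>t\<in>UNIV. f t) = (\<Sum>k\<in>UNIV. \<Sum>l\<in>UNIV. f (k, l))" for f :: "'n \<times> 'n \<Rightarrow> complex"
    by (simp add: sum.cartesian_product UNIV_Times_UNIV[symmetric] del: UNIV_Times_UNIV)
  have grad: "d_dz \<alpha> (u i j) z = (\<Sum>l\<in>UNIV. of_real (partial_deriv l (\<lambda>y. G y $ i $ j) (F z)) * d_dz \<alpha> (?F l) z)"
    "d_dzbar \<alpha> (u i j) z = (\<Sum>l\<in>UNIV. of_real (partial_deriv l (\<lambda>y. G y $ i $ j) (F z)) * d_dzbar \<alpha> (?F l) z)" if "z \<in> U" for \<alpha> i j z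
    unfolding u_def by (rule wirtinger_chain_real[OF dF[OF that] ck_differentiable[OF entry_ck FV[OF that]]])+
  \<comment> \<open>Chain rule twice through the metric: second derivatives of G meet products of
    gradients, first derivatives meet Hessians of the components of F.\<close>
  have hess_u: "hessian (u i j) x = (\<chi> \<alpha> \<beta>. \<Sum>t\<in>UNIV. (case t of (k,l) \<Rightarrow> dd k l i j) * (case t of (k,l) \<Rightarrow> O' k l) $ \<alpha> $ \<beta>)
     + (\<chi> \<alpha> \<beta>. \<Sum>l\<in>UNIV. dG l i j * P l $ \<alpha> $ \<beta>)" for i j
  proof -
    have "d_dz \<alpha> (d_dzbar \<beta> (u i j)) x = (\<Sum>k\<in>UNIV. \<Sum>l\<in>UNIV. dd k l i j * (O' k l $ \<alpha> $ \<beta>)) + (\<Sum>l\<in>UNIV. dG l i j * P l $ \<alpha> $ \<beta>)" for \<alpha> \<beta>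
    proof -
      let ?a = "\<lambda>l z. complex_of_real (partial_deriv l (\<lambda>y. G y $ i $ j) (F z))" and ?b = "\<lambda>l. d_dzbar \<beta> (?F l)"
      have a: "?a l differentiable at x" for l
        by (rule ck_differentiable[OF ck_of_real[OF U ck_compose[OF U V FU F partial_ck]] x])
      have b: "?b l differentiable at x" for l
        by (rule ck_differentiable[OF ck_wirtinger(2)[OF U cF] x])
      have "d_dz \<alpha> (d_dzbar \<beta> (u i j)) x = d_dz \<alpha> (\<lambda>z. \<Sum>l\<in>UNIV. ?a l z * ?b l z) x"
        by (rule wirtinger_cong(1)[OF U x grad(2)])
      also have "\<dots> = (\<Sum>l\<in>UNIV. ?a l x * d_dz \<alpha> (?b l) x + d_dz \<alpha> (?a l) x * ?b l x)"
        by (subst wirtinger_sum(1)) (auto intro!: differentiable_mult a b simp: wirtinger_mult(1)[OF a b])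
      also have "\<dots> = (\<Sum>l\<in>UNIV. \<Sum>k\<in>UNIV. dd k l i j * (O' k l $ \<alpha> $ \<beta>)) + (\<Sum>l\<in>UNIV. dG l i j * P l $ \<alpha> $ \<beta>)"
      proof -
        have "d_dz \<alpha> (?a l) x = (\<Sum>k\<in>UNIV. dd k l i j * d_dz \<alpha> (?F k) x)" for l
          unfolding dd_def metric_second_derivative_def
          by (rule wirtinger_chain_real(1)[OF dF[OF x] ck_differentiable[OF partial_ck y]])
        then show ?thesis
          by (simp add: sum.distrib dG_def P_def hessian_def O'_def gradient_product_def sum_distrib_right sum_distrib_left mult_ac add.commute)
      qed
      also have "(\<Sum>l\<in>UNIV. \<Sum>k\<in>UNIV. dd k l i j * (O' k l $ \<alpha> $ \<beta>)) = (\<Sum>k\<in>UNIV. \<Sum>l\<in>UNIV. dd k l i j * (O' k l $ \<alpha> $ \<beta>))"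
        by (rule sum.swap)
      finally show ?thesis .
    qed
    then show ?thesis by (simp add: vec_eq_iff hessian_def pair)
  qed
  have gp1: "gradient_product (?F i) (u i j) x = (\<chi> \<alpha> \<beta>. \<Sum>l\<in>UNIV. dG l i j * O' i l $ \<alpha> $ \<beta>)" for i j
    by (simp add: vec_eq_iff gradient_product_def O'_def dG_def grad(2)[OF x] sum_distrib_left mult_ac)
  have gp2: "gradient_product (u i j) (?F j) x = (\<chi> \<alpha> \<beta>. \<Sum>l\<in>UNIV. dG l i j * O' l j $ \<alpha> $ \<beta>)" for i j
    by (simp add: vec_eq_iff gradient_product_def O'_def dG_def grad(1)[OF x] sum_distrib_left sum_distrib_right mult_ac)
  have triple: "triple_operator H (u i j) (?F i) (?F j) x = (\<Sum>k\<in>UNIV. \<Sum>l\<in>UNIV. dd k l i j * mO i j k l)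
      + (\<Sum>l\<in>UNIV. dG l i j * (\<phi> l i j - \<phi> j i l - \<phi> i l j)) - g i j * m (P i) (P j)" for i j
  proof -
    have 1: "m (O' i j) (hessian (u i j) x) = (\<Sum>k\<in>UNIV. \<Sum>l\<in>UNIV. dd k l i j * mO i j k l) + (\<Sum>l\<in>UNIV. dG l i j * \<phi> l i j)"
      unfolding hess_u m_add m_sum unfolding pair \<phi>_def mO_def prod.case m_comm[of "O' i j" "P _"] ..
    have 2: "m (gradient_product (?F i) (u i j) x) (P j) = (\<Sum>l\<in>UNIV. dG l i j * \<phi> j i l)"
      unfolding m_comm[of _ "P j"] gp1 m_sum \<phi>_def ..
    have 3: "m (P i) (gradient_product (u i j) (?F j) x) = (\<Sum>l\<in>UNIV. dG l i j * \<phi> i l j)"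
      unfolding gp2 m_sum \<phi>_def ..
    have "triple_operator H (u i j) (?F i) (?F j) x = m (O' i j) (hessian (u i j) x) - m (gradient_product (?F i) (u i j) x) (P j)
        - m (P i) (gradient_product (u i j) (?F j) x) - g i j * m (P i) (P j)"
      by (simp add: triple_operator_def O'_def P_def m_def u_def g_def)
    then show ?thesis unfolding 1 2 3 by (simp add: right_diff_distrib sum_subtractf)
  qed
  have low: "(\<Sum>a\<in>UNIV. g a l * \<Gamma> a j k) = L l j k" for l j k
    using lower_christoffel[OF y, of l j k, symmetric] by (simp add: g_def \<Gamma>_def L_def)
  have gsym: "g i j = g j i" for i j by (simp add: g_def symmetric[OF y, of i j])
  \<comment> \<open>After relabelling, all three terms pair P_a with O'_pq, and the three first
    derivatives of the metric combine to -2 times the Christoffel symbol of the first kind.\<close>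
  have cubic: "(\<Sum>i\<in>UNIV. \<Sum>j\<in>UNIV. \<Sum>l\<in>UNIV. dG l i j * (\<phi> l i j - \<phi> j i l - \<phi> i l j))
      = - 2 * (\<Sum>a\<in>UNIV. \<Sum>p\<in>UNIV. \<Sum>q\<in>UNIV. L a p q * \<phi> a p q)"
  proof -
    have tr: "(\<Sum>i\<in>UNIV. \<Sum>j\<in>UNIV. \<Sum>l\<in>UNIV. f i j l) = (\<Sum>(i,j,l)\<in>UNIV. f i j l)" for f :: "'n \<Rightarrow> 'n \<Rightarrow> 'n \<Rightarrow> complex"
      by (simp add: sum.cartesian_product UNIV_Times_UNIV[symmetric] del: UNIV_Times_UNIV)
    have 1: "(\<Sum>i\<in>UNIV. \<Sum>j\<in>UNIV. \<Sum>l\<in>UNIV. dG l i j * \<phi> l i j) = (\<Sum>a\<in>UNIV. \<Sum>p\<in>UNIV. \<Sum>q\<in>UNIV. dG a p q * \<phi> a p q)"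
      unfolding tr by (rule sum.reindex_bij_witness[of _ "\<lambda>(a,p,q). (p,q,a)" "\<lambda>(i,j,l). (l,i,j)"]) auto
    have 2: "(\<Sum>i\<in>UNIV. \<Sum>j\<in>UNIV. \<Sum>l\<in>UNIV. dG l i j * \<phi> j i l) = (\<Sum>a\<in>UNIV. \<Sum>p\<in>UNIV. \<Sum>q\<in>UNIV. dG q p a * \<phi> a p q)"
      unfolding tr by (rule sum.reindex_bij_witness[of _ "\<lambda>(a,p,q). (p,a,q)" "\<lambda>(i,j,l). (j,i,l)"]) auto
    have 3: "(\<Sum>i\<in>UNIV. \<Sum>j\<in>UNIV. \<Sum>l\<in>UNIV. dG l i j * \<phi> i l j) = (\<Sum>a\<in>UNIV. \<Sum>p\<in>UNIV. \<Sum>q\<in>UNIV. dG p q a * \<phi> a p q)"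
      unfolding tr by (rule sum.reindex_bij_witness[of _ "\<lambda>(a,p,q). (a,q,p)" "\<lambda>(i,j,l). (i,l,j)"])
        (auto simp: dG_def partial_symmetric[OF y])
    have "(\<Sum>i\<in>UNIV. \<Sum>j\<in>UNIV. \<Sum>l\<in>UNIV. dG l i j * (\<phi> l i j - \<phi> j i l - \<phi> i l j))
      = (\<Sum>a\<in>UNIV. \<Sum>p\<in>UNIV. \<Sum>q\<in>UNIV. dG a p q * \<phi> a p q) - (\<Sum>a\<in>UNIV. \<Sum>p\<in>UNIV. \<Sum>q\<in>UNIV. dG q p a * \<phi> a p q)
        - (\<Sum>a\<in>UNIV. \<Sum>p\<in>UNIV. \<Sum>q\<in>UNIV. dG p q a * \<phi> a p q)"
      unfolding 1[symmetric] 2[symmetric] 3[symmetric] by (simp add: right_diff_distrib sum_subtractf)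
    also have "\<dots> = (\<Sum>a\<in>UNIV. \<Sum>p\<in>UNIV. \<Sum>q\<in>UNIV. - 2 * (L a p q * \<phi> a p q))"
      unfolding sum_subtractf[symmetric]
      by (intro sum.cong refl) (simp add: L_def dG_def lowered_christoffel_def field_simps)
    finally show ?thesis by (simp only: sum_distrib_left)
  qed
  have mM: "m (M i) (M j) = m (P i) (P j) + (\<Sum>k\<in>UNIV. \<Sum>l\<in>UNIV. \<Gamma> j k l * \<phi> i k l) + (\<Sum>k\<in>UNIV. \<Sum>l\<in>UNIV. \<Gamma> i k l * \<phi> j k l)
      + (\<Sum>p\<in>UNIV. \<Sum>q\<in>UNIV. \<Sum>k\<in>UNIV. \<Sum>l\<in>UNIV. \<Gamma> j p q * \<Gamma> i k l * mO p q k l)" for i j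
  proof -
    define W where "W i = (\<chi> \<alpha> \<beta>. \<Sum>t\<in>UNIV. (case t of (k, l) \<Rightarrow> \<Gamma> i k l) * (case t of (k, l) \<Rightarrow> O' k l) $ \<alpha> $ \<beta>)" for i
    have mW: "m A (W i) = (\<Sum>k\<in>UNIV. \<Sum>l\<in>UNIV. \<Gamma> i k l * m A (O' k l))" for A i
      unfolding W_def m_sum unfolding pair prod.case ..
    have "m (M i) (M j) = m (P i) (P j) + m (P i) (W j) + m (P j) (W i) + m (W j) (W i)"
      unfolding M_def W_def[symmetric] m_add m_comm[of "P i + W i"] using m_comm by simp
    also have "m (W j) (W i) = (\<Sum>k\<in>UNIV. \<Sum>l\<in>UNIV. \<Sum>p\<in>UNIV. \<Sum>q\<in>UNIV. \<Gamma> j p q * \<Gamma> i k l * mO p q k l)"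
    proof -
      have "m (W j) (O' k l) = (\<Sum>p\<in>UNIV. \<Sum>q\<in>UNIV. \<Gamma> j p q * mO p q k l)" for k l
        unfolding m_comm[of "W j"] mW mO_def by (intro sum.cong refl) (subst m_comm, rule refl)
      then show ?thesis unfolding mW[of "W j" i] by (simp add: sum_distrib_left mult_ac)
    qed
    also have "\<dots> = (\<Sum>p\<in>UNIV. \<Sum>q\<in>UNIV. \<Sum>k\<in>UNIV. \<Sum>l\<in>UNIV. \<Gamma> j p q * \<Gamma> i k l * mO p q k l)"
      unfolding sum_quadruple by (rule sum.reindex_bij_witness[of _ "\<lambda>(p,q,k,l). (k,l,p,q)" "\<lambda>(k,l,p,q). (p,q,k,l)"]) auto
    finally show ?thesis unfolding mW \<phi>_def by simp
  qed
  \<comment> \<open>Lowering an index with g turns each cross term into the sum found in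
    \<open>cubic\<close>, up to its factor, and the square of \<Gamma> into the quadratic part of
    \<open>curvature_coeff\<close>.\<close>
  have gM: "(\<Sum>i\<in>UNIV. \<Sum>j\<in>UNIV. g i j * m (M i) (M j)) = (\<Sum>i\<in>UNIV. \<Sum>j\<in>UNIV. g i j * m (P i) (P j))
      + 2 * (\<Sum>a\<in>UNIV. \<Sum>p\<in>UNIV. \<Sum>q\<in>UNIV. L a p q * \<phi> a p q)
      + (\<Sum>p\<in>UNIV. \<Sum>q\<in>UNIV. \<Sum>k\<in>UNIV. \<Sum>l\<in>UNIV. (\<Sum>a\<in>UNIV. L a p q * \<Gamma> a k l) * mO p q k l)"
  proof -
    have tr: "(\<Sum>i\<in>UNIV. \<Sum>k\<in>UNIV. \<Sum>l\<in>UNIV. \<Sum>j\<in>UNIV. f i j k l) = (\<Sum>i\<in>UNIV. \<Sum>j\<in>UNIV. \<Sum>k\<in>UNIV. \<Sum>l\<in>UNIV. f i j k l)" for f :: "'n \<Rightarrow> 'n \<Rightarrow> 'n \<Rightarrow> 'n \<Rightarrow> complex"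
      unfolding sum_quadruple by (rule sum.reindex_bij_witness[of _ "\<lambda>(i,j,k,l). (i,k,l,j)" "\<lambda>(i,k,l,j). (i,j,k,l)"]) auto
    have 2: "(\<Sum>i\<in>UNIV. \<Sum>j\<in>UNIV. g i j * (\<Sum>k\<in>UNIV. \<Sum>l\<in>UNIV. \<Gamma> j k l * \<phi> i k l)) = (\<Sum>a\<in>UNIV. \<Sum>p\<in>UNIV. \<Sum>q\<in>UNIV. L a p q * \<phi> a p q)"
    proof -
      have "(\<Sum>i\<in>UNIV. \<Sum>j\<in>UNIV. g i j * (\<Sum>k\<in>UNIV. \<Sum>l\<in>UNIV. \<Gamma> j k l * \<phi> i k l))
        = (\<Sum>i\<in>UNIV. \<Sum>j\<in>UNIV. \<Sum>k\<in>UNIV. \<Sum>l\<in>UNIV. g j i * \<Gamma> j k l * \<phi> i k l)"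
        unfolding sum_distrib_left by (intro sum.cong refl, subst gsym) (rule mult.assoc[symmetric])
      also have "\<dots> = (\<Sum>a\<in>UNIV. \<Sum>p\<in>UNIV. \<Sum>q\<in>UNIV. L a p q * \<phi> a p q)"
        unfolding low[symmetric] sum_distrib_right by (rule tr[symmetric])
      finally show ?thesis .
    qed
    have 3: "(\<Sum>i\<in>UNIV. \<Sum>j\<in>UNIV. g i j * (\<Sum>k\<in>UNIV. \<Sum>l\<in>UNIV. \<Gamma> i k l * \<phi> j k l)) = (\<Sum>a\<in>UNIV. \<Sum>p\<in>UNIV. \<Sum>q\<in>UNIV. L a p q * \<phi> a p q)"
    proof -
      have "(\<Sum>i\<in>UNIV. \<Sum>j\<in>UNIV. g i j * (\<Sum>k\<in>UNIV. \<Sum>l\<in>UNIV. \<Gamma> i k l * \<phi> j k l))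
         = (\<Sum>j\<in>UNIV. \<Sum>i\<in>UNIV. g i j * (\<Sum>k\<in>UNIV. \<Sum>l\<in>UNIV. \<Gamma> i k l * \<phi> j k l))" by (rule sum.swap)
      also have "\<dots> = (\<Sum>i\<in>UNIV. \<Sum>j\<in>UNIV. g i j * (\<Sum>k\<in>UNIV. \<Sum>l\<in>UNIV. \<Gamma> j k l * \<phi> i k l))"
        by (intro sum.cong refl) (subst gsym, rule refl)
      finally show ?thesis unfolding 2 .
    qed
    have 4: "(\<Sum>i\<in>UNIV. \<Sum>j\<in>UNIV. g i j * (\<Sum>p\<in>UNIV. \<Sum>q\<in>UNIV. \<Sum>k\<in>UNIV. \<Sum>l\<in>UNIV. \<Gamma> j p q * \<Gamma> i k l * mO p q k l))
      = (\<Sum>p\<in>UNIV. \<Sum>q\<in>UNIV. \<Sum>k\<in>UNIV. \<Sum>l\<in>UNIV. (\<Sum>a\<in>UNIV. L a p q * \<Gamma> a k l) * mO p q k l)"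
    proof -
      let ?f = "\<lambda>i j (p,q,k,l). g i j * (\<Gamma> j p q * \<Gamma> i k l * mO p q k l)"
      have "(\<Sum>i\<in>UNIV. \<Sum>j\<in>UNIV. g i j * (\<Sum>p\<in>UNIV. \<Sum>q\<in>UNIV. \<Sum>k\<in>UNIV. \<Sum>l\<in>UNIV. \<Gamma> j p q * \<Gamma> i k l * mO p q k l))
        = (\<Sum>i\<in>UNIV. \<Sum>j\<in>UNIV. \<Sum>x\<in>UNIV. ?f i j x)"
        unfolding sum_distrib_left sum_quadruple by (intro sum.cong refl) (simp split: prod.splits)
      also have "\<dots> = (\<Sum>i\<in>UNIV. \<Sum>x\<in>UNIV. \<Sum>j\<in>UNIV. ?f i j x)"
        by (intro sum.cong[OF refl] sum.swap)
      also have "\<dots> = (\<Sum>x\<in>UNIV. \<Sum>i\<in>UNIV. \<Sum>j\<in>UNIV. ?f i j x)" by (rule sum.swap)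
      also have "\<dots> = (\<Sum>(p,q,k,l)\<in>UNIV. (\<Sum>a\<in>UNIV. L a p q * \<Gamma> a k l) * mO p q k l)"
      proof (rule sum.cong[OF refl])
        fix x :: "'n \<times> 'n \<times> 'n \<times> 'n"
        obtain p q k l where x: "x = (p,q,k,l)" by (cases x)
        have "(\<Sum>j\<in>UNIV. g i j * (\<Gamma> j p q * \<Gamma> i k l * mO p q k l)) = L i p q * \<Gamma> i k l * mO p q k l" for i
        proof -
          have "(\<Sum>j\<in>UNIV. g i j * (\<Gamma> j p q * \<Gamma> i k l * mO p q k l)) = (\<Sum>j\<in>UNIV. g j i * \<Gamma> j p q) * (\<Gamma> i k l * mO p q k l)"
            unfolding sum_distrib_right by (rule sum.cong[OF refl]) (subst gsym, simp add: mult_ac)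
          then show ?thesis unfolding low by simp
        qed
        then show "(\<Sum>i\<in>UNIV. \<Sum>j\<in>UNIV. ?f i j x) = (case x of (p,q,k,l) \<Rightarrow> (\<Sum>a\<in>UNIV. L a p q * \<Gamma> a k l) * mO p q k l)"
          by (simp add: x sum_distrib_right)
      qed
      finally show ?thesis unfolding sum_quadruple .
    qed
    show ?thesis unfolding mM distrib_left sum.distrib 2 3 4 by simp
  qed
  define f where "f s = (\<chi> i. \<Sum>\<alpha>\<in>UNIV. E $ s $ \<alpha> * d_dz \<alpha> (?F i) x)" for s
  let ?A = "frame_matrix f"
  have bar: "d_dzbar \<alpha> (?F i) z = cnj (d_dz \<alpha> (?F i) z)" if "z \<in> U" for \<alpha> i z
    by (rule wirtinger_of_real) (rule ck_differentiable[OF ck_vec_nth[OF U F] that])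
  have NO: "(E ** O' p q ** ?E) $ s $ t = f s $ p * cnj (f t $ q)" for p q s t
    by (simp add: matrix_matrix_mult_def O'_def gradient_product_def f_def bar[OF x] sum_distrib_left sum_distrib_right mult_ac)
  have trO: "trace (matrix_inv H ** O' p q) = ?A $ p $ q" for p q
    unfolding trace_frame(1)[OF E(1)] by (simp add: trace_def NO frame_matrix_def)
  \<comment> \<open>In the unitary frame O'_pq is the outer product of the p-th components of f with
    the conjugate q-th ones, so both traces factor into entries of its Gram matrix.\<close>
  have mO: "mO p q k l = ?A $ p $ q * ?A $ k $ l - ?A $ p $ l * ?A $ k $ q" for p q k l
  proof -
    have "trace (matrix_inv H ** O' p q ** matrix_inv H ** O' k l) = (\<Sum>s\<in>UNIV. \<Sum>t\<in>UNIV. (f s $ p * cnj (f t $ q)) * (f t $ k * cnj (f s $ l)))"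
      unfolding trace_frame(2)[OF E(1)] by (simp add: trace_def matrix_matrix_mult_def[of "E ** O' p q ** ?E"] NO)
    also have "\<dots> = ?A $ p $ l * ?A $ k $ q"
      unfolding frame_matrix_def vec_lambda_beta sum_product by (intro sum.cong refl) (simp add: mult_ac)
    finally show ?thesis unfolding mO_def m_def trace_contraction_def trO by simp
  qed
  \<comment> \<open>Harmonicity enters here. Its equation pairs the lower indices of \<Gamma> with
    \<partial>bar and \<partial> in the opposite order, hence the exchange of summations and the
    symmetry of \<Gamma>.\<close>
  have trM: "trace (matrix_inv H ** M i) = 0" for i
  proof -
    have "M i $ \<alpha> $ \<beta> = d_dz \<alpha> (d_dzbar \<beta> (?F i)) x + (\<Sum>j\<in>UNIV. \<Sum>k\<in>UNIV. complex_of_real (christoffel G i j k (F x))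
             * d_dzbar \<beta> (?F j) x * d_dz \<alpha> (?F k) x)" for \<alpha> \<beta>
    proof -
      have "(\<Sum>k\<in>UNIV. \<Sum>l\<in>UNIV. \<Gamma> i k l * O' k l $ \<alpha> $ \<beta>) = (\<Sum>l\<in>UNIV. \<Sum>k\<in>UNIV. \<Gamma> i k l * O' k l $ \<alpha> $ \<beta>)"
        by (rule sum.swap)
      also have "\<dots> = (\<Sum>j\<in>UNIV. \<Sum>k\<in>UNIV. complex_of_real (christoffel G i j k (F x)) * d_dzbar \<beta> (?F j) x * d_dz \<alpha> (?F k) x)"
        by (intro sum.cong refl) (simp add: \<Gamma>_def O'_def gradient_product_def christoffel_symmetric[OF y, of i] mult_ac)
      finally show ?thesis by (simp add: M_def P_def hessian_def pair)
    qed
    then show ?thesis unfolding trace_inv_mult using harmonic[of i] by simp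
  qed
  have hM: "M i $ \<beta> $ \<alpha> = cnj (M i $ \<alpha> $ \<beta>)" for i \<alpha> \<beta>
  proof -
    have "cnj (d_dz \<alpha> (d_dzbar \<beta> (?F i)) x) = d_dzbar \<alpha> (\<lambda>z. cnj (d_dzbar \<beta> (?F i) z)) x"
      by (rule wirtinger_cnj(2)[symmetric]) (rule ck_differentiable[OF ck_wirtinger(2)[OF U cF] x])
    also have "\<dots> = d_dzbar \<alpha> (d_dz \<beta> (?F i)) x"
      by (rule wirtinger_cong(2)[OF U x]) (simp add: bar)
    also have "\<dots> = d_dz \<beta> (d_dzbar \<alpha> (?F i)) x" by (rule wirtinger_commute(1)[OF U cF x, symmetric])
    finally have 1: "P i $ \<beta> $ \<alpha> = cnj (P i $ \<alpha> $ \<beta>)" by (simp add: P_def hessian_def)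
    have "(\<Sum>k\<in>UNIV. \<Sum>l\<in>UNIV. \<Gamma> i k l * O' k l $ \<beta> $ \<alpha>) = (\<Sum>l\<in>UNIV. \<Sum>k\<in>UNIV. \<Gamma> i k l * O' k l $ \<beta> $ \<alpha>)"
      by (rule sum.swap)
    also have "\<dots> = cnj (\<Sum>k\<in>UNIV. \<Sum>l\<in>UNIV. \<Gamma> i k l * O' k l $ \<alpha> $ \<beta>)"
      unfolding cnj_sum by (intro sum.cong refl)
        (simp add: \<Gamma>_def O'_def gradient_product_def bar[OF x] christoffel_symmetric[OF y, of i] mult_ac)
    finally have 2: "(\<Sum>k\<in>UNIV. \<Sum>l\<in>UNIV. \<Gamma> i k l * O' k l $ \<beta> $ \<alpha>) = cnj (\<Sum>k\<in>UNIV. \<Sum>l\<in>UNIV. \<Gamma> i k l * O' k l $ \<alpha> $ \<beta>)" .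
    have "M i $ \<alpha> $ \<beta> = P i $ \<alpha> $ \<beta> + (\<Sum>k\<in>UNIV. \<Sum>l\<in>UNIV. \<Gamma> i k l * O' k l $ \<alpha> $ \<beta>)" for \<alpha> \<beta>
      by (simp add: M_def pair)
    then show ?thesis using 1 2 by simp
  qed
  define N where "N i = E ** M i ** ?E" for i
  have hN: "N i $ t $ s = cnj (N i $ s $ t)" for i s t
  proof -
    have e: "N i $ s $ t = (\<Sum>\<beta>\<in>UNIV. \<Sum>\<alpha>\<in>UNIV. E $ s $ \<alpha> * M i $ \<alpha> $ \<beta> * cnj (E $ t $ \<beta>))" for s t
      by (simp add: N_def matrix_matrix_mult_def sum_distrib_right)
    have "cnj (N i $ s $ t) = (\<Sum>\<beta>\<in>UNIV. \<Sum>\<alpha>\<in>UNIV. cnj (E $ s $ \<alpha>) * M i $ \<beta> $ \<alpha> * E $ t $ \<beta>)"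
      unfolding e cnj_sum by (intro sum.cong refl) (simp add: hM[symmetric])
    also have "\<dots> = (\<Sum>\<alpha>\<in>UNIV. \<Sum>\<beta>\<in>UNIV. cnj (E $ s $ \<alpha>) * M i $ \<beta> $ \<alpha> * E $ t $ \<beta>)" by (rule sum.swap)
    also have "\<dots> = N i $ t $ s" unfolding e by (intro sum.cong refl) (simp add: mult_ac)
    finally show ?thesis by simp
  qed
  define b where "b = (\<Sum>s\<in>UNIV. \<Sum>t\<in>UNIV. Re (metric_form (G ?y) (\<chi> i. N i $ s $ t) (\<chi> i. N i $ s $ t)))"
  have b: "b \<ge> 0" unfolding b_def by (intro sum_nonneg metric_form_positive(2)[OF y])
  \<comment> \<open>M is trace-free, so only the trace of the product remains; since each N_i is
    Hermitian in s, t it is a sum of N_i times conjugate N_j, and contraction with g gives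
    norms.\<close>
  have gMb: "(\<Sum>i\<in>UNIV. \<Sum>j\<in>UNIV. g i j * m (M i) (M j)) = - of_real b"
  proof -
    have mN: "m (M i) (M j) = - (\<Sum>s\<in>UNIV. \<Sum>t\<in>UNIV. N i $ s $ t * cnj (N j $ s $ t))" for i j
      unfolding m_def trace_contraction_def trM trace_frame(2)[OF E(1)] N_def[symmetric] hN[symmetric]
      by (simp add: trace_def matrix_matrix_mult_def)
    have "(\<Sum>i\<in>UNIV. \<Sum>j\<in>UNIV. g i j * m (M i) (M j)) = - (\<Sum>i\<in>UNIV. \<Sum>j\<in>UNIV. \<Sum>s\<in>UNIV. \<Sum>t\<in>UNIV. g i j * N i $ s $ t * cnj (N j $ s $ t))"
      unfolding mN by (simp add: sum_distrib_left sum_negf mult_ac)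
    also have "(\<Sum>i\<in>UNIV. \<Sum>j\<in>UNIV. \<Sum>s\<in>UNIV. \<Sum>t\<in>UNIV. g i j * N i $ s $ t * cnj (N j $ s $ t))
      = (\<Sum>i\<in>UNIV. \<Sum>s\<in>UNIV. \<Sum>j\<in>UNIV. \<Sum>t\<in>UNIV. g i j * N i $ s $ t * cnj (N j $ s $ t))"
      by (intro sum.cong[OF refl] sum.swap)
    also have "\<dots> = (\<Sum>s\<in>UNIV. \<Sum>i\<in>UNIV. \<Sum>j\<in>UNIV. \<Sum>t\<in>UNIV. g i j * N i $ s $ t * cnj (N j $ s $ t))" by (rule sum.swap)
    also have "\<dots> = (\<Sum>s\<in>UNIV. \<Sum>i\<in>UNIV. \<Sum>t\<in>UNIV. \<Sum>j\<in>UNIV. g i j * N i $ s $ t * cnj (N j $ s $ t))"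
      by (intro sum.cong[OF refl] sum.swap)
    also have "\<dots> = (\<Sum>s\<in>UNIV. \<Sum>t\<in>UNIV. \<Sum>i\<in>UNIV. \<Sum>j\<in>UNIV. g i j * N i $ s $ t * cnj (N j $ s $ t))"
      by (intro sum.cong[OF refl] sum.swap)
    also have "\<dots> = (\<Sum>s\<in>UNIV. \<Sum>t\<in>UNIV. metric_form (G ?y) (\<chi> i. N i $ s $ t) (\<chi> i. N i $ s $ t))"
      by (simp add: metric_form_def g_def)
    also have "\<dots> = of_real b"
      unfolding b_def of_real_sum by (intro sum.cong refl metric_form_positive(1)[OF y])
    finally show ?thesis .
  qed
  have "minor_contraction H (\<lambda>\<alpha> \<beta> \<gamma> \<delta>. d_dz \<gamma> (d_dzbar \<delta> (pullback_form G F \<alpha> \<beta>)) x)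
    = (\<Sum>i\<in>UNIV. \<Sum>j\<in>UNIV. triple_operator H (u i j) (?F i) (?F j) x)"
    using pullback_triple[OF assms(1) U F FU x ck_const[of 2 U 1], of H] by (simp add: u_def[abs_def])
  also have "\<dots> = (\<Sum>i\<in>UNIV. \<Sum>j\<in>UNIV. \<Sum>k\<in>UNIV. \<Sum>l\<in>UNIV. dd k l i j * mO i j k l)
      + (\<Sum>i\<in>UNIV. \<Sum>j\<in>UNIV. \<Sum>l\<in>UNIV. dG l i j * (\<phi> l i j - \<phi> j i l - \<phi> i l j)) - (\<Sum>i\<in>UNIV. \<Sum>j\<in>UNIV. g i j * m (P i) (P j))"
    unfolding triple by (simp add: sum.distrib sum_subtractf)
  also have "\<dots> = (\<Sum>p\<in>UNIV. \<Sum>q\<in>UNIV. \<Sum>k\<in>UNIV. \<Sum>l\<in>UNIV. dd k l p q * mO p q k l)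
      + (\<Sum>p\<in>UNIV. \<Sum>q\<in>UNIV. \<Sum>k\<in>UNIV. \<Sum>l\<in>UNIV. (\<Sum>a\<in>UNIV. L a p q * \<Gamma> a k l) * mO p q k l)
      - (\<Sum>i\<in>UNIV. \<Sum>j\<in>UNIV. g i j * m (M i) (M j))"
    unfolding cubic gM by simp
  also have "\<dots> = curvature_quadratic G ?y ?A + of_real b"
  proof -
    have "(\<Sum>p\<in>UNIV. \<Sum>q\<in>UNIV. \<Sum>k\<in>UNIV. \<Sum>l\<in>UNIV. dd k l p q * mO p q k l)
      + (\<Sum>p\<in>UNIV. \<Sum>q\<in>UNIV. \<Sum>k\<in>UNIV. \<Sum>l\<in>UNIV. (\<Sum>a\<in>UNIV. L a p q * \<Gamma> a k l) * mO p q k l)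
      = (\<Sum>p\<in>UNIV. \<Sum>q\<in>UNIV. \<Sum>k\<in>UNIV. \<Sum>l\<in>UNIV. of_real (curvature_coeff G ?y p q k l) * mO p q k l)"
      unfolding sum.distrib[symmetric]
      by (intro sum.cong refl) (simp add: curvature_coeff_def dd_def L_def \<Gamma>_def distrib_right)
    then show ?thesis unfolding gMb by (simp add: curvature_quadratic_def mO)
  qed
  also have "curvature_quadratic G ?y ?A = - curvature_contraction G ?y ?A" by (simp add: curvature_contraction_eq[OF y])
  finally have "minor_contraction H (\<lambda>\<alpha> \<beta> \<gamma> \<delta>. d_dz \<gamma> (d_dzbar \<delta> (pullback_form G F \<alpha> \<beta>)) x) = of_real b - curvature_contraction G ?y ?A"
    by simp
  then show thesis using that[OF b E(2)] by (simp add: f_def[abs_def])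
qed

section \<open>Charts and partitions of unity\<close>

locale topological_atlas =
  fixes X :: "'a topology" and A :: "('a, 'e::euclidean_space) chart set"
  assumes atlas: "topological_manifold X A"
begin

lemma hausdorff: "Hausdorff_space X"
  and charts_cover: "topspace X = (\<Union>c\<in>A. fst c)"
  using atlas by (auto simp: topological_manifold_def)

lemma
  assumes "c \<in> A"
  shows chart_domain_open: "openin X (fst c)" and chart_image_open: "open (chart_image c)"
    and chart_homeomorphic: "homeomorphic_map (subtopology X (fst c)) (top_of_set (chart_image c)) (snd c)"
  using atlas assms by (auto simp: topological_manifold_def)

lemma chart_domain_subset: "c \<in> A \<Longrightarrow> fst c \<subseteq> topspace X"
  by (rule openin_subset[OF chart_domain_open])

lemma chart_inj: "c \<in> A \<Longrightarrow> inj_on (snd c) (fst c)"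
  using chart_homeomorphic[of c] chart_domain_subset[of c]
  by (simp add: homeomorphic_eq_everything_map topspace_subtopology inf.absorb2)

lemma chart_inv_left [simp]: "c \<in> A \<Longrightarrow> p \<in> fst c \<Longrightarrow> chart_inv c (snd c p) = p"
  by (simp add: chart_inv_def chart_inj)

lemma chart_inv_right:
  assumes "c \<in> A" "x \<in> chart_image c"
  shows "snd c (chart_inv c x) = x" "chart_inv c x \<in> fst c"
  using assms f_inv_into_f[of x "snd c" "fst c"] inv_into_into[of x "snd c" "fst c"]
  by (auto simp: chart_inv_def chart_image_def)

lemma chart_image_of_open:
  assumes c: "c \<in> A" and "openin X W" "W \<subseteq> fst c"
  shows "open (snd c ` W)"
proof -
  have "openin (subtopology X (fst c)) W" using assms chart_domain_open[OF c] by (simp add: openin_open_subtopology)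
  then have "openin (top_of_set (chart_image c)) (snd c ` W)"
    using homeomorphic_imp_open_map[OF chart_homeomorphic[OF c]] by (simp add: open_map_def)
  then show ?thesis using chart_image_open[OF c] openin_open_trans by blast
qed

lemma chart_preimage_open:
  assumes c: "c \<in> A" and "open T"
  shows "openin X {p \<in> fst c. snd c p \<in> T}"
proof -
  have "openin (top_of_set (chart_image c)) (chart_image c \<inter> T)" using assms(2) by (simp add: openin_open_Int)
  then have "openin (subtopology X (fst c)) {p \<in> topspace (subtopology X (fst c)). snd c p \<in> chart_image c \<inter> T}"
    by (rule openin_continuous_map_preimage[OF homeomorphic_imp_continuous_map[OF chart_homeomorphic[OF c]]])
  moreover have "{p \<in> topspace (subtopology X (fst c)). snd c p \<in> chart_image c \<inter> T} = {p \<in> fst c. snd c p \<in> T}"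
    using chart_domain_subset[OF c] by (auto simp: chart_image_def)
  ultimately show ?thesis using chart_domain_open[OF c] openin_trans_full by auto
qed

lemma chart_compact_iff:
  assumes c: "c \<in> A" and "W \<subseteq> fst c"
  shows "compactin X W \<longleftrightarrow> compact (snd c ` W)"
proof -
  have t: "topspace (subtopology X (fst c)) = fst c" using chart_domain_subset[OF c] by auto
  have "compactin (subtopology X (fst c)) W \<longleftrightarrow> compactin (top_of_set (chart_image c)) (snd c ` W)"
    using homeomorphic_map_compactness_eq[OF chart_homeomorphic[OF c], of W] assms(2) t by auto
  moreover have "snd c ` W \<subseteq> chart_image c" using assms(2) by (auto simp: chart_image_def)
  ultimately show ?thesis using assms(2) by (simp add: compactin_subtopology)
qed

lemma chart_preimage_compact:
  assumes c: "c \<in> A" and "compact K" "K \<subseteq> chart_image c"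
  shows "compactin X {p \<in> fst c. snd c p \<in> K}"
proof -
  have "snd c ` {p \<in> fst c. snd c p \<in> K} = K" using assms(3) by (auto simp: chart_image_def)
  then show ?thesis using chart_compact_iff[OF c, of "{p \<in> fst c. snd c p \<in> K}"] assms(2) by auto
qed

lemma transition_apply: "c \<in> A \<Longrightarrow> p \<in> fst c \<Longrightarrow> transition c c' (snd c p) = snd c' p"
  by (simp add: transition_def)

end

section \<open>Cutoff functions and partitions of unity\<close>

lemma positive_part_power_derivative:
  "((\<lambda>t::real. (max 0 t) ^ Suc (Suc n)) has_real_derivative real (Suc (Suc n)) * (max 0 t) ^ Suc n) (at t)"
proof -
  consider "t > 0" | "t < 0" | "t = 0" by linarith
  then show ?thesis
  proof cases
    case 1
    have "((\<lambda>t::real. t ^ Suc (Suc n)) has_real_derivative real (Suc (Suc n)) * (max 0 t) ^ Suc n) (at t)"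
      using 1 DERIV_pow[of "Suc (Suc n)" t UNIV] by (simp add: max_def)
    then show ?thesis
      by (rule has_field_derivative_transform_within_open[of _ _ _ "{0<..}"]) (use 1 in \<open>auto simp: max_def\<close>)
  next
    case 2
    have "((\<lambda>t::real. 0) has_real_derivative real (Suc (Suc n)) * (max 0 t) ^ Suc n) (at t)"
      using 2 by (simp add: max_def)
    then show ?thesis
      by (rule has_field_derivative_transform_within_open[of _ _ _ "{..<0}"]) (use 2 in \<open>auto simp: max_def\<close>)
  next
    case 3
    have "((\<lambda>h::real. (max 0 h) ^ Suc n) \<longlongrightarrow> (max 0 0) ^ Suc n) (at 0)"
      by (intro tendsto_intros)
    \<comment> \<open>At the corner the difference quotient is itself a power of the positive part,
      one degree lower, and that is continuous.\<close>
    moreover have "((max 0 (0 + h)) ^ Suc (Suc n) - (max 0 0) ^ Suc (Suc n)) / h = (max 0 h) ^ Suc n" if "h \<noteq> 0" for h :: real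
      using that by (cases "h > 0") (auto simp: max_def)
    ultimately have "((\<lambda>h::real. ((max 0 (0 + h)) ^ Suc (Suc n) - (max 0 0) ^ Suc (Suc n)) / h) \<longlongrightarrow> (max 0 0) ^ Suc n) (at 0)"
      by (subst tendsto_cong[where g="\<lambda>h. (max 0 h) ^ Suc n"]) (auto simp: eventually_at_filter)
    then show ?thesis unfolding 3 DERIV_def by simp
  qed
qed

lemma ck_positive_part_cube: "ck 2 S (\<lambda>t::real. (max 0 t) ^ 3)"
proof (rule ck_subset[of _ UNIV])
  have "ck (Suc (Suc 0)) UNIV (\<lambda>t::real. (max 0 t) ^ Suc (Suc (Suc 0)))"
  proof (rule ck_SucI[OF open_UNIV positive_part_power_derivative[unfolded has_field_derivative_def]])
    fix v :: real
    have "ck (Suc 0) UNIV (\<lambda>x::real. max 0 x ^ Suc (Suc 0))"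
    proof (rule ck_SucI[OF open_UNIV positive_part_power_derivative[unfolded has_field_derivative_def]])
      show "ck 0 UNIV (\<lambda>x::real. real (Suc (Suc 0)) * max 0 x ^ Suc 0 * v)" for v
        by (auto intro!: continuous_intros)
    qed
    then show "ck (Suc 0) UNIV (\<lambda>x::real. real (Suc (Suc (Suc 0))) * max 0 x ^ Suc (Suc 0) * v)"
      by (intro ck_mult ck_const open_UNIV)
  qed
  then show "ck 2 UNIV (\<lambda>t::real. (max 0 t) ^ 3)" by (simp only: numeral_2_eq_2 numeral_3_eq_3)
qed simp

text \<open>Class \<open>C\<^sup>2\<close> is all that the second-order operators below need.\<close>

definition bump :: "'e::euclidean_space \<Rightarrow> real \<Rightarrow> 'e \<Rightarrow> real" where
  "bump a r x = (max 0 (r\<^sup>2 - (x - a) \<bullet> (x - a))) ^ 3"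

lemma ck_bump: "ck 2 S (bump a r)"
proof (rule ck_subset[of _ UNIV])
  have "ck 2 UNIV (\<lambda>x. r\<^sup>2 - (x - a) \<bullet> (x - a))"
    by (intro ck_diff ck_const ck_bilinear[OF _ bounded_bilinear_inner] ck_id open_UNIV)
  from ck_compose[OF open_UNIV open_UNIV _ this ck_positive_part_cube]
  show "ck 2 UNIV (bump a r)" by (simp add: bump_def[abs_def])
qed simp

lemma bump_nonneg: "bump a r x \<ge> 0"
  by (simp add: bump_def)

lemma bump_positive_iff: "r > 0 \<Longrightarrow> bump a r x > 0 \<longleftrightarrow> x \<in> ball a r"
proof -
  assume r: "r > 0"
  have "x \<in> ball a r \<longleftrightarrow> (norm (x - a))\<^sup>2 < r\<^sup>2"
    using r by (simp add: dist_norm norm_minus_commute power2_less_imp_less abs_le_square_iff linorder_not_le[symmetric] abs_of_pos)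
  then show ?thesis by (simp add: bump_def power2_norm_eq_inner max_def)
qed

text \<open>D i may be smaller than the domain of the chart \<open>ch i\<close>; for a map it will
  be the part sent into a single target chart. The weights are bumps on coordinate balls divided by
  their sum, which is positive because finitely many of these balls cover the compact space.\<close>

lemma (in topological_atlas) partition_of_unity:
  assumes cpt: "compact_space X"
    and trans: "\<And>c c'. c \<in> A \<Longrightarrow> c' \<in> A \<Longrightarrow> ck 2 (snd c ` (fst c \<inter> fst c')) (transition c c')"
    and dom: "\<And>p. p \<in> topspace X \<Longrightarrow> \<exists>i\<in>I. ch i \<in> A \<and> p \<in> D i"
    and D: "\<And>i. i \<in> I \<Longrightarrow> openin X (D i)" "\<And>i. i \<in> I \<Longrightarrow> D i \<subseteq> fst (ch i)"
  obtains Q :: "'a set" and \<iota> :: "'a \<Rightarrow> 'i" and K :: "'a \<Rightarrow> 'e set" and \<rho> :: "'a \<Rightarrow> 'a \<Rightarrow> real"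
  where "finite Q" "\<And>q. q \<in> Q \<Longrightarrow> \<iota> q \<in> I \<and> ch (\<iota> q) \<in> A" "\<And>q. q \<in> Q \<Longrightarrow> compact (K q)"
    "\<And>q. q \<in> Q \<Longrightarrow> K q \<subseteq> snd (ch (\<iota> q)) ` D (\<iota> q)"
    "\<And>q p. q \<in> Q \<Longrightarrow> \<rho> q p \<ge> 0"
    "\<And>q p. q \<in> Q \<Longrightarrow> \<rho> q p \<noteq> 0 \<Longrightarrow> p \<in> D (\<iota> q) \<and> snd (ch (\<iota> q)) p \<in> K q"
    "\<And>p. p \<in> topspace X \<Longrightarrow> (\<Sum>q\<in>Q. \<rho> q p) = 1"
    "\<And>q c. q \<in> Q \<Longrightarrow> c \<in> A \<Longrightarrow> ck 2 (chart_image c) (\<lambda>x. \<rho> q (chart_inv c x))"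
proof -
  have "\<forall>q\<in>topspace X. \<exists>i r. i \<in> I \<and> ch i \<in> A \<and> q \<in> D i \<and> r > 0 \<and> cball (snd (ch i) q) r \<subseteq> snd (ch i) ` D i"
  proof
    fix q assume "q \<in> topspace X"
    then obtain i where i: "i \<in> I" "ch i \<in> A" "q \<in> D i" using dom by blast
    have "open (snd (ch i) ` D i)" by (rule chart_image_of_open[OF i(2) D[OF i(1)]])
    then obtain r where "r > 0" "cball (snd (ch i) q) r \<subseteq> snd (ch i) ` D i"
      using i(3) open_contains_cball by blast
    then show "\<exists>i r. i \<in> I \<and> ch i \<in> A \<and> q \<in> D i \<and> r > 0 \<and> cball (snd (ch i) q) r \<subseteq> snd (ch i) ` D i" using i by blast
  qed
  then obtain \<iota> r where \<iota>: "\<And>q. q \<in> topspace X \<Longrightarrow> \<iota> q \<in> I \<and> ch (\<iota> q) \<in> A \<and> q \<in> D (\<iota> q) \<and> r q > 0 \<and>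
      cball (snd (ch (\<iota> q)) q) (r q) \<subseteq> snd (ch (\<iota> q)) ` D (\<iota> q)" by metis
  let ?c = "\<lambda>q. ch (\<iota> q)"
  let ?x = "\<lambda>q. snd (?c q) q"
  define W where "W q = {p \<in> fst (?c q). snd (?c q) p \<in> ball (?x q) (r q)}" for q
  have Wo: "openin X (W q)" if "q \<in> topspace X" for q
    unfolding W_def by (rule chart_preimage_open) (use \<iota>[OF that] in auto)
  have qW: "q \<in> W q" if "q \<in> topspace X" for q
    using \<iota>[OF that] D(2) by (auto simp: W_def)
  have "topspace X \<subseteq> \<Union> (W ` topspace X)" using qW by blast
  then obtain \<F> where F: "finite \<F>" "\<F> \<subseteq> W ` topspace X" "topspace X \<subseteq> \<Union> \<F>"
    using cpt Wo unfolding compact_space_alt by (metis (no_types, lifting) imageE)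
  obtain Q where Q: "finite Q" "Q \<subseteq> topspace X" "\<F> = W ` Q"
    using finite_subset_image[OF F(1,2)] by blast
  define b where "b q p = (if p \<in> fst (?c q) then bump (?x q) (r q) (snd (?c q) p) else 0)" for q p
  have b0: "b q p \<ge> 0" for q p by (simp add: b_def bump_nonneg)
  have bpos: "b q p > 0 \<longleftrightarrow> p \<in> W q" if "q \<in> topspace X" for q p
    using \<iota>[OF that] bump_positive_iff[of "r q"] by (auto simp: b_def W_def)
  define \<sigma> where "\<sigma> p = (\<Sum>q\<in>Q. b q p)" for p
  have \<sigma>: "\<sigma> p > 0" if "p \<in> topspace X" for p
  proof -
    have "p \<in> \<Union> (W ` Q)" using F(3) Q(3) \<open>p \<in> topspace X\<close> by blast
    then obtain q where "q \<in> Q" "p \<in> W q" by blast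
    then have "b q p > 0" using bpos Q(2) by blast
    then show ?thesis unfolding \<sigma>_def using \<open>q \<in> Q\<close> Q(1) b0 by (intro sum_pos2[of Q q]) auto
  qed
  have ckb: "ck 2 (chart_image c) (\<lambda>x. b q (chart_inv c x))" if c: "c \<in> A" and q: "q \<in> topspace X" for c q
  proof (rule ck_local)
    fix x assume x: "x \<in> chart_image c"
    have cq: "?c q \<in> A" using \<iota>[OF q] by blast
    have Dq: "D (\<iota> q) \<subseteq> fst (?c q)" using \<iota>[OF q] D by blast
    let ?K = "{p \<in> fst (?c q). snd (?c q) p \<in> cball (?x q) (r q)}"
    have sub: "cball (?x q) (r q) \<subseteq> chart_image (?c q)"
      using \<iota>[OF q] Dq unfolding chart_image_def by blast
    have "compactin X ?K" by (rule chart_preimage_compact[OF cq compact_cball sub])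
    \<comment> \<open>The Hausdorff property makes the closed coordinate ball closed in the whole
      space, so the bump is zero near every point outside its chart and its extension by zero stays
      regular.\<close>
    then have Kc: "closedin X ?K" by (rule compactin_imp_closedin[OF hausdorff])
    show "\<exists>T. open T \<and> x \<in> T \<and> ck 2 T (\<lambda>x. b q (chart_inv c x))"
    proof (cases "chart_inv c x \<in> fst (?c q)")
      case True
      let ?S = "snd c ` (fst c \<inter> fst (?c q))"
      have o: "open ?S" by (rule chart_image_of_open[OF c]) (use chart_domain_open[OF c] chart_domain_open[OF cq] in auto)
      have "x \<in> ?S" using True chart_inv_right[OF c x] by (metis IntI imageI)
      moreover have "ck 2 ?S (\<lambda>x. b q (chart_inv c x))"
      proof (rule ck_cong[OF o])
        show "ck 2 ?S (\<lambda>x. bump (?x q) (r q) (transition c (?c q) x))"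
          by (rule ck_compose[OF o open_UNIV _ trans[OF c cq] ck_bump]) simp
        fix y assume "y \<in> ?S"
        then obtain p where "p \<in> fst c" "p \<in> fst (?c q)" "y = snd c p" by blast
        then show "bump (?x q) (r q) (transition c (?c q) y) = b q (chart_inv c y)"
          using c by (simp add: b_def transition_apply)
      qed
      ultimately show ?thesis using o by blast
    next
      case False
      let ?S = "snd c ` (fst c - ?K)"
      have o: "open ?S" by (rule chart_image_of_open[OF c openin_diff[OF chart_domain_open[OF c] Kc]]) auto
      have "x \<in> ?S" using False chart_inv_right[OF c x] by (intro image_eqI[of x "snd c" "chart_inv c x"]) auto
      moreover have "ck 2 ?S (\<lambda>x. b q (chart_inv c x))"
      proof (rule ck_cong[OF o ck_const[of 2 ?S "0::real"]])
        fix y assume "y \<in> ?S"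
        then obtain p where p: "p \<in> fst c" "p \<notin> ?K" "y = snd c p" by blast
        have "b q p = 0"
        proof (rule ccontr)
          assume "b q p \<noteq> 0"
          then have "p \<in> W q" using b0[of q p] bpos[OF q, of p] by auto
          then show False using p(2) by (auto simp: W_def)
        qed
        then show "0 = b q (chart_inv c y)" using p c by simp
      qed
      ultimately show ?thesis using o by blast
    qed
  qed
  \<comment> \<open>Written with \<open>inverse\<close> of the sum, so that the closure rules for
    products and reciprocals give the regularity of the weights.\<close>
  define \<rho> where "\<rho> q p = b q p * inverse (\<sigma> p)" for q p
  show thesis
  proof (rule that[of Q \<iota> "\<lambda>q. cball (?x q) (r q)" \<rho>])
    show "finite Q" by fact
    show "\<iota> q \<in> I \<and> ?c q \<in> A" if "q \<in> Q" for q using that Q(2) \<iota> by blast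
    show "compact (cball (?x q) (r q))" for q by simp
    show "cball (?x q) (r q) \<subseteq> snd (?c q) ` D (\<iota> q)" if "q \<in> Q" for q using that Q(2) \<iota> by blast
    show "\<rho> q p \<ge> 0" for q p unfolding \<rho>_def \<sigma>_def by (simp add: b0 sum_nonneg)
    show "(\<Sum>q\<in>Q. \<rho> q p) = 1" if "p \<in> topspace X" for p
      using \<sigma>[OF that] unfolding \<rho>_def sum_distrib_right[symmetric] by (simp add: \<sigma>_def)
    show "p \<in> D (\<iota> q) \<and> snd (?c q) p \<in> cball (?x q) (r q)" if q: "q \<in> Q" and "\<rho> q p \<noteq> 0" for q p
    proof -
      have qX: "q \<in> topspace X" using q Q(2) by blast
      have "b q p > 0" using that b0[of q p] by (auto simp: \<rho>_def)
      then have p: "p \<in> fst (?c q)" "snd (?c q) p \<in> cball (?x q) (r q)"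
        using bpos[OF qX] by (auto simp: W_def)
      then obtain p' where p': "p' \<in> D (\<iota> q)" "snd (?c q) p = snd (?c q) p'" using \<iota>[OF qX] by blast
      moreover have "p' \<in> fst (?c q)" using p'(1) \<iota>[OF qX] D by blast
      ultimately have "p = p'" using chart_inj[of "?c q"] \<iota>[OF qX] p(1) by (auto simp: inj_on_def)
      then show ?thesis using p p' by simp
    qed
    show "ck 2 (chart_image c) (\<lambda>x. \<rho> q (chart_inv c x))" if "q \<in> Q" and c: "c \<in> A" for q c
      unfolding \<rho>_def
    proof (intro ck_mult ck_inverse chart_image_open[OF c] ckb c)
      show "q \<in> topspace X" using that Q(2) by blast
      show "ck 2 (chart_image c) (\<lambda>x. \<sigma> (chart_inv c x))"
        unfolding \<sigma>_def by (intro ck_sum chart_image_open[OF c] ckb c) (use Q(2) in blast)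
      fix x assume "x \<in> chart_image c"
      then have "chart_inv c x \<in> topspace X" using chart_inv_right[OF c] chart_domain_subset[OF c] by blast
      then show "\<sigma> (chart_inv c x) \<noteq> 0" using \<sigma> by fastforce
    qed
  qed
qed

lemma coord_integral_nonneg_zero:
  fixes u :: "complex^'m::finite \<Rightarrow> real"
  assumes u: "continuous_on UNIV u" "compactly_supported u" "\<And>x. u x \<ge> 0" and zero: "coord_integral u = 0"
  shows "u x = 0"
proof -
  let ?v = "\<lambda>y. u (of_coords y)"
  have vi: "?v integrable_on UNIV" by (rule coord_integrable(2)[OF u(1,2)])
  have vc: "continuous_on S ?v" for S
    by (intro continuous_on_compose2[OF u(1)] continuous_on_of_coords continuous_on_id) auto
  obtain a where a: "to_coords x \<in> box (- a) a"
    using bounded_subset_box_symmetric[of "{to_coords x}"] by auto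
  have ic: "?v integrable_on cbox (- a) a" by (rule integrable_continuous[OF vc])
  have "integral (cbox (- a) a) ?v \<le> integral UNIV ?v"
    by (rule integral_subset_le[OF _ ic vi]) (auto simp: u(3))
  moreover have "integral (cbox (- a) a) ?v \<ge> 0" by (rule integral_nonneg[OF ic]) (simp add: u(3))
  ultimately have "integral (cbox (- a) a) ?v = 0" using zero by (simp add: coord_integral_def)
  then have h: "(?v has_integral 0) (cbox (- a) a)" using integrable_integral[OF ic] by simp
  have "?v (to_coords x) = 0"
    by (rule has_integral_0_cbox_imp_0[OF vc _ h]) (use a box_subset_cbox u(3) in auto)
  then show ?thesis by simp
qed

section \<open>Harmonic maps in charts\<close>

lemma ck_pullback_form:
  fixes F :: "complex^'m::finite \<Rightarrow> real^'n::finite"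
  assumes "riemannian_coordinates G V" and U: "open U" and F: "\<And>k. ck k U F" and FU: "F ` U \<subseteq> V"
  shows "ck k U (pullback_form G F \<alpha> \<beta>)"
proof -
  interpret riemannian_coordinates G V by fact
  have 1: "ck k U (\<lambda>z. complex_of_real (G (F z) $ i $ j))" for i j
    by (rule ck_of_real[OF U ck_compose[OF U V FU F entry_ck]])
  have 2: "ck k U (d_dz \<alpha> (\<lambda>z. complex_of_real (F z $ i)))" "ck k U (d_dzbar \<alpha> (\<lambda>z. complex_of_real (F z $ i)))" for i \<alpha> k
    by (rule ck_wirtinger[OF U ck_of_real[OF U ck_vec_nth[OF U F]]])+
  show ?thesis unfolding pullback_form_def
    by (intro ck_sum ck_mult U 1 2)
qed

lemma hessian_cong:
  assumes S: "open S" "x \<in> S" "\<And>y. y \<in> S \<Longrightarrow> u y = v y"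
  shows "d_dz \<gamma> (d_dzbar \<delta> u) x = d_dz \<gamma> (d_dzbar \<delta> v) x"
  by (rule wirtinger_cong(1)[OF S(1,2)]) (rule wirtinger_cong(2)[OF S(1) _ S(3)])

lemma triple_operator_cong:
  assumes S: "open S" "x \<in> S" "\<And>y. y \<in> S \<Longrightarrow> u y = u' y" "\<And>y. y \<in> S \<Longrightarrow> v y = v' y" "\<And>y. y \<in> S \<Longrightarrow> w y = w' y"
  shows "triple_operator H u v w x = triple_operator H u' v' w' x"
proof -
  note c = wirtinger_cong[OF S(1,2)] and hc = hessian_cong[OF S(1,2)]
  have e: "hessian u x = hessian u' x" "hessian v x = hessian v' x" "hessian w x = hessian w' x"
    by (simp_all only: hessian_def hc[OF S(3)] hc[OF S(4)] hc[OF S(5)])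
  have "gradient_product v w x = gradient_product v' w' x" "gradient_product v u x = gradient_product v' u' x"
    "gradient_product u w x = gradient_product u' w' x"
    by (simp_all only: gradient_product_def c(1)[OF S(3)] c(1)[OF S(4)] c(2)[OF S(3)] c(2)[OF S(5)])
  then show ?thesis using S(3)[OF S(2)] by (simp only: triple_operator_def e)
qed

locale harmonic_map =
  fixes X :: "'a topology" and A :: "('a, complex^'m) chart set"
    and h :: "('a, 'm::finite) hermitian_components"
    and Y :: "'b topology" and B :: "('b, real^'n) chart set"
    and g :: "('b, 'n::finite) riemannian_components"
    and f :: "'a \<Rightarrow> 'b"
  assumes hermitian: "hermitian_manifold X A h" and riemannian: "riemannian_manifold Y B g"
    and harmonic: "hermitian_harmonic X A h Y B g f"
begin

sublocale domain: topological_atlas X A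
  using hermitian by unfold_locales (simp add: hermitian_manifold_def complex_manifold_def)

sublocale target: topological_atlas Y B
  using riemannian by unfold_locales (simp add: riemannian_manifold_def smooth_manifold_def)

abbreviation "rep c d \<equiv> local_rep c d f"
abbreviation "ldom c d \<equiv> local_dom c d f"

lemma continuous: "continuous_map X Y f"
  and rep_ck: "c \<in> A \<Longrightarrow> d \<in> B \<Longrightarrow> ck k (ldom c d) (rep c d)"
  using harmonic by (auto simp: hermitian_harmonic_def smooth_map_def smooth_on_def)

lemma charts_around:
  assumes p: "p \<in> topspace X"
  obtains c d where "c \<in> A" "p \<in> fst c" "d \<in> B" "f p \<in> fst d"
proof -
  obtain c where "c \<in> A" "p \<in> fst c" using p unfolding domain.charts_cover by blast
  moreover have "f p \<in> topspace Y" using continuous_map_image_subset_topspace[OF continuous] p by blast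
  then obtain d where "d \<in> B" "f p \<in> fst d" unfolding target.charts_cover by blast
  ultimately show thesis by (rule that)
qed

lemma map_preimage_open:
  assumes "c \<in> A" "d \<in> B"
  shows "openin X {p \<in> fst c. f p \<in> fst d}"
proof -
  have "openin X (fst c \<inter> {p \<in> topspace X. f p \<in> fst d})"
    by (intro openin_Int domain.chart_domain_open assms openin_continuous_map_preimage[OF continuous] target.chart_domain_open)
  moreover have "fst c \<inter> {p \<in> topspace X. f p \<in> fst d} = {p \<in> fst c. f p \<in> fst d}"
    using domain.chart_domain_subset[OF assms(1)] by auto
  ultimately show ?thesis by simp
qed

lemma dom_open: "c \<in> A \<Longrightarrow> d \<in> B \<Longrightarrow> open (ldom c d)"
  unfolding local_dom_def by (rule domain.chart_image_of_open[OF _ map_preimage_open]) auto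

lemma mem_dom: "c \<in> A \<Longrightarrow> p \<in> fst c \<Longrightarrow> snd c p \<in> ldom c d \<longleftrightarrow> f p \<in> fst d"
  using domain.chart_inj[of c] by (auto simp: local_dom_def inj_on_def)

lemma dom_subset: "ldom c d \<subseteq> chart_image c"
  by (auto simp: local_dom_def chart_image_def)

lemma domE:
  assumes "x \<in> ldom c d"
  obtains p where "p \<in> fst c" "f p \<in> fst d" "x = snd c p"
  using assms by (auto simp: local_dom_def)

lemma rep_apply: "c \<in> A \<Longrightarrow> p \<in> fst c \<Longrightarrow> rep c d (snd c p) = snd d (f p)"
  by (simp add: local_rep_def)

lemma rep_image: "c \<in> A \<Longrightarrow> rep c d ` ldom c d \<subseteq> chart_image d"
  by (auto simp: rep_apply chart_image_def elim!: domE)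

lemma coordinates: "d \<in> B \<Longrightarrow> riemannian_coordinates (g d) (chart_image d)"
proof
  assume d: "d \<in> B"
  note m = riemannian[unfolded riemannian_manifold_def riemannian_metric_def]
  show "open (chart_image d)" by (rule target.chart_image_open[OF d])
  show "ck k (chart_image d) (g d)" for k using m d by (auto simp: smooth_on_def)
  show "v \<bullet> (g d y *v v) > 0" if "y \<in> chart_image d" "v \<noteq> 0" for y v using m d that by blast
  show "g d y $ i $ j = g d y $ j $ i" if "y \<in> chart_image d" for y i j
  proof -
    have "transpose (g d y) = g d y" using m d that by blast
    then have "transpose (g d y) $ i $ j = g d y $ i $ j" by simp
    then show ?thesis by (simp add: transpose_def)
  qed
qed

lemma metric_ck: "c \<in> A \<Longrightarrow> ck k (chart_image c) (h c)"
  and metric_positive: "c \<in> A \<Longrightarrow> x \<in> chart_image c \<Longrightarrow> hermitian_positive_definite (h c x)"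
  using hermitian by (auto simp: hermitian_manifold_def hermitian_metric_def smooth_on_def)

lemma metric_invertible: "c \<in> A \<Longrightarrow> x \<in> chart_image c \<Longrightarrow> invertible (h c x)"
  by (rule positive_definite_invertible[OF metric_positive])

lemma transition_holomorphic:
  "c \<in> A \<Longrightarrow> c' \<in> A \<Longrightarrow> holomorphic_map_on (snd c ` (fst c \<inter> fst c')) (transition c c')"
  using hermitian by (simp add: hermitian_manifold_def complex_manifold_def)

lemma metric_transformation:
  assumes c: "c \<in> A" "c' \<in> A" and p: "p \<in> fst c" "p \<in> fst c'"
  defines "J \<equiv> complex_jacobian (transition c c') (snd c p)"
  shows "h c (snd c p) = transpose J ** h c' (snd c' p) ** (\<chi> i j. cnj (J $ i $ j))"
proof -
  have "h c (snd c p) $ \<alpha> $ \<beta> = (transpose J ** h c' (snd c' p) ** (\<chi> i j. cnj (J $ i $ j))) $ \<alpha> $ \<beta>" for \<alpha> \<beta>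
  proof -
    have "h c (snd c p) $ \<alpha> $ \<beta> = (\<Sum>\<gamma>\<in>UNIV. \<Sum>\<delta>\<in>UNIV. h c' (snd c' p) $ \<gamma> $ \<delta> * J $ \<gamma> $ \<alpha> * cnj (J $ \<delta> $ \<beta>))"
      unfolding J_def complex_jacobian_def vec_lambda_beta
      by (rule hermitian[unfolded hermitian_manifold_def hermitian_metric_def, THEN conjunct2, THEN conjunct2, rule_format, OF c IntI[OF p]])
    also have "\<dots> = (\<Sum>\<delta>\<in>UNIV. \<Sum>\<gamma>\<in>UNIV. h c' (snd c' p) $ \<gamma> $ \<delta> * J $ \<gamma> $ \<alpha> * cnj (J $ \<delta> $ \<beta>))" by (rule sum.swap)
    also have "\<dots> = (transpose J ** h c' (snd c' p) ** (\<chi> i j. cnj (J $ i $ j))) $ \<alpha> $ \<beta>"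
      by (simp add: matrix_matrix_mult_def transpose_def sum_distrib_left sum_distrib_right mult_ac)
    finally show ?thesis .
  qed
  then show ?thesis by (simp add: vec_eq_iff)
qed

section \<open>The volume density and independence of the target chart\<close>

definition volume :: "('a, complex^'m) chart \<Rightarrow> complex^'m \<Rightarrow> real" where
  "volume c x = Re (det (h c x))"

lemma volume_positive: "c \<in> A \<Longrightarrow> x \<in> chart_image c \<Longrightarrow> volume c x > 0"
  and det_metric: "c \<in> A \<Longrightarrow> x \<in> chart_image c \<Longrightarrow> det (h c x) = of_real (volume c x)"
  unfolding volume_def by (rule positive_definite_det[OF metric_positive]; assumption)+

lemma volume_continuous: "c \<in> A \<Longrightarrow> continuous_on (chart_image c) (volume c)"
  unfolding volume_def[abs_def]
  by (rule ck_continuous_on[where k=0], intro ck_Re ck_det ck_vec_nth metric_ck domain.chart_image_open)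

lemma volume_transformation:
  assumes c: "c \<in> A" "c' \<in> A" and p: "p \<in> fst c" "p \<in> fst c'"
  shows "volume c (snd c p) = volume c' (snd c' p) * (cmod (det (complex_jacobian (transition c c') (snd c p))))\<^sup>2"
proof -
  let ?J = "complex_jacobian (transition c c') (snd c p)"
  have m: "snd c p \<in> chart_image c" "snd c' p \<in> chart_image c'" using p by (auto simp: chart_image_def)
  have "det (h c (snd c p)) = det ?J * det (h c' (snd c' p)) * cnj (det ?J)"
    by (subst metric_transformation[OF c p]) (simp add: det_mul det_cnj)
  also have "\<dots> = of_real (volume c' (snd c' p) * (cmod (det ?J))\<^sup>2)"
    using complex_norm_square[of "det ?J"] by (simp add: det_metric[OF c(2) m(2)] mult_ac)
  finally show ?thesis unfolding det_metric[OF c(1) m(1)] of_real_eq_iff .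
qed

lemma pullback_form_invariant:
  assumes c: "c \<in> A" and d: "d \<in> B" "d' \<in> B" and x: "x \<in> ldom c d" "x \<in> ldom c d'"
  shows "pullback_form (g d) (rep c d) \<alpha> \<beta> x = pullback_form (g d') (rep c d') \<alpha> \<beta> x"
proof -
  obtain p where p: "p \<in> fst c" "f p \<in> fst d" "x = snd c p" using x(1) by (rule domE)
  have p': "f p \<in> fst d'" using x(2)[unfolded p(3)] mem_dom[OF c p(1)] by blast
  let ?S = "ldom c d \<inter> ldom c d'"
  let ?T = "transition d d'"
  have S: "open ?S" "x \<in> ?S" using x dom_open[OF c d(1)] dom_open[OF c d(2)] by auto
  have T: "rep c d' z = ?T (rep c d z)" if "z \<in> ?S" for z
  proof -
    from that have "z \<in> ldom c d" by blast
    then obtain q where q: "q \<in> fst c" "f q \<in> fst d" "z = snd c q" by (rule domE)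
    show ?thesis unfolding q(3) rep_apply[OF c q(1)] by (rule target.transition_apply[OF d(1) q(2), symmetric])
  qed
  have rd: "rep c d differentiable at x" by (rule ck_differentiable[OF rep_ck[OF c d(1), of "Suc 0"] x(1)])
  have dT: "(\<lambda>y. ?T y $ k) differentiable at (rep c d x)" for k
  proof -
    let ?V = "snd d ` (fst d \<inter> fst d')"
    have V: "open ?V"
      by (rule target.chart_image_of_open[OF d(1)]) (use target.chart_domain_open[OF d(1)] target.chart_domain_open[OF d(2)] in auto)
    have "ck (Suc 0) ?V ?T" using riemannian d unfolding riemannian_manifold_def smooth_manifold_def smooth_on_def by blast
    then have "ck (Suc 0) ?V (\<lambda>y. ?T y $ k)" by (rule ck_vec_nth[OF V])
    moreover have "rep c d x \<in> ?V" unfolding p(3) rep_apply[OF c p(1)] using p(2) p' by blast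
    ultimately show ?thesis by (rule ck_differentiable)
  qed
  define P where "P k i = complex_of_real (partial_deriv i (\<lambda>y. ?T y $ k) (rep c d x))" for k i
  define a where "a i = d_dz \<alpha> (\<lambda>z. complex_of_real (rep c d z $ i)) x" for i
  define b where "b i = d_dzbar \<beta> (\<lambda>z. complex_of_real (rep c d z $ i)) x" for i
  define \<gamma> where "\<gamma> k l = complex_of_real (g d' (rep c d' x) $ k $ l)" for k l
  have a': "d_dz \<alpha> (\<lambda>z. complex_of_real (rep c d' z $ k)) x = (\<Sum>i\<in>UNIV. P k i * a i)" for k
    unfolding a_def P_def wirtinger_chain_real(1)[OF rd dT, symmetric]
    by (rule wirtinger_cong(1)[OF S]) (simp add: T)
  have b': "d_dzbar \<beta> (\<lambda>z. complex_of_real (rep c d' z $ k)) x = (\<Sum>i\<in>UNIV. P k i * b i)" for k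
    unfolding b_def P_def wirtinger_chain_real(2)[OF rd dT, symmetric]
    by (rule wirtinger_cong(2)[OF S]) (simp add: T)
  have G: "complex_of_real (g d (rep c d x) $ i $ j) = (\<Sum>k\<in>UNIV. \<Sum>l\<in>UNIV. \<gamma> k l * P k i * P l j)" for i j
  proof -
    have "g d (snd d (f p)) $ i $ j = (\<Sum>k\<in>UNIV. \<Sum>l\<in>UNIV. g d' (snd d' (f p)) $ k $ l
             * partial_deriv i (\<lambda>y. ?T y $ k) (snd d (f p)) * partial_deriv j (\<lambda>y. ?T y $ l) (snd d (f p)))"
      by (rule riemannian[unfolded riemannian_manifold_def riemannian_metric_def, THEN conjunct2, THEN conjunct2, rule_format, OF d IntI[OF p(2) p']])
    then show ?thesis using p c by (simp add: rep_apply P_def \<gamma>_def)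
  qed
  have "pullback_form (g d) (rep c d) \<alpha> \<beta> x
      = (\<Sum>i\<in>UNIV. \<Sum>j\<in>UNIV. \<Sum>k\<in>UNIV. \<Sum>l\<in>UNIV. \<gamma> k l * (P k i * a i * (P l j * b j)))"
    unfolding pullback_form_def G a_def[symmetric] b_def[symmetric] sum_distrib_right by (simp only: mult_ac)
  also have "\<dots> = (\<Sum>k\<in>UNIV. \<Sum>l\<in>UNIV. \<Sum>i\<in>UNIV. \<Sum>j\<in>UNIV. \<gamma> k l * (P k i * a i * (P l j * b j)))"
    unfolding sum_quadruple by (rule sum.reindex_bij_witness[of _ "\<lambda>(k,l,i,j). (i,j,k,l)" "\<lambda>(i,j,k,l). (k,l,i,j)"]) auto
  also have "\<dots> = pullback_form (g d') (rep c d') \<alpha> \<beta> x"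
    unfolding pullback_form_def a' b' \<gamma>_def[symmetric] sum_product by (simp only: sum_distrib_left)
  finally show ?thesis .
qed

section \<open>The localized integrand and its independence of the charts\<close>

definition twice_differentiable :: "('a \<Rightarrow> real) \<Rightarrow> bool" where
  "twice_differentiable \<rho> \<longleftrightarrow> (\<forall>c\<in>A. ck 2 (chart_image c) (\<lambda>x. \<rho> (chart_inv c x)))"

text \<open>In the chart \<open>c\<close> this is the coefficient of \<open>\<partial>\<partial>bar(\<rho> f\<^sup>* g) \<and> \<omega>\<^sup>m\<^sup>-\<^sup>2\<close> with respect to the volume form, up
  to a constant factor; \<open>f\<^sup>* g\<close> stands for the (1,1)-form \<open>g\<^sub>i\<^sub>j \<partial>f\<^sup>i \<and> \<partial>bar f\<^sup>j\<close>.\<close>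

definition bochner_term :: "('a \<Rightarrow> real) \<Rightarrow> ('a, complex^'m) chart \<Rightarrow> ('b, real^'n) chart \<Rightarrow> complex^'m \<Rightarrow> complex" where
  "bochner_term \<rho> c d x = minor_contraction (h c x)
     (\<lambda>\<alpha> \<beta> \<gamma> \<delta>. d_dz \<gamma> (d_dzbar \<delta> (\<lambda>z. of_real (\<rho> (chart_inv c z)) * pullback_form (g d) (rep c d) \<alpha> \<beta> z)) x)"

lemma weighted_form_ck:
  assumes "c \<in> A" "d \<in> B" "twice_differentiable \<rho>"
  shows "ck 2 (ldom c d) (\<lambda>z. complex_of_real (\<rho> (chart_inv c z)) * pullback_form (g d) (rep c d) \<alpha> \<beta> z)"
proof (intro ck_mult ck_of_real dom_open assms)
  show "ck 2 (ldom c d) (\<lambda>x. \<rho> (chart_inv c x))"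
    by (rule ck_subset[OF _ dom_subset]) (use assms in \<open>auto simp: twice_differentiable_def\<close>)
  show "ck 2 (ldom c d) (pullback_form (g d) (rep c d) \<alpha> \<beta>)"
    by (rule ck_pullback_form[OF coordinates dom_open rep_ck rep_image]) (use assms in auto)
qed

lemma minor_coeff_ck:
  assumes c: "c \<in> A"
  shows "ck 2 (chart_image c) (\<lambda>z. minor_coeff (h c z) \<alpha> \<beta> \<gamma> \<delta>)"
    and "ck 2 (chart_image c) (\<lambda>z. det (h c z) * minor_coeff (h c z) \<alpha> \<beta> \<gamma> \<delta>)"
proof -
  note o = domain.chart_image_open[OF c]
  have e: "ck 2 (chart_image c) (\<lambda>x. h c x $ i $ j)" for i j
    by (intro ck_vec_nth o metric_ck c)
  have "ck 2 (chart_image c) (\<lambda>x. matrix_inv (h c x) $ i $ j)" for i j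
    by (rule ck_matrix_inv[OF o e metric_invertible[OF c]])
  then show *: "ck 2 (chart_image c) (\<lambda>z. minor_coeff (h c z) \<alpha> \<beta> \<gamma> \<delta>)"
    unfolding minor_coeff_def inverse_metric_def by (intro ck_diff ck_mult o)
  show "ck 2 (chart_image c) (\<lambda>z. det (h c z) * minor_coeff (h c z) \<alpha> \<beta> \<gamma> \<delta>)"
    by (intro ck_mult ck_det o e *)
qed

lemma bochner_term_continuous:
  assumes c: "c \<in> A" and d: "d \<in> B" and \<rho>: "twice_differentiable \<rho>"
  shows "continuous_on (ldom c d) (bochner_term \<rho> c d)"
proof -
  have "ck 2 (ldom c d) (\<lambda>z. minor_coeff (h c z) \<alpha> \<beta> \<gamma> \<delta>)" for \<alpha> \<beta> \<gamma> \<delta>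
    by (rule ck_subset[OF minor_coeff_ck(1)[OF c] dom_subset])
  then have "continuous_on (ldom c d) (\<lambda>z. minor_coeff (h c z) \<alpha> \<beta> \<gamma> \<delta>)" for \<alpha> \<beta> \<gamma> \<delta>
    by (rule ck_continuous_on)
  moreover have "continuous_on (ldom c d) (d_dz \<gamma> (d_dzbar \<delta> (\<lambda>z. of_real (\<rho> (chart_inv c z)) * pullback_form (g d) (rep c d) \<alpha> \<beta> z)))" for \<alpha> \<beta> \<gamma> \<delta>
    by (rule ck_continuous_on[where k=0], rule ck_wirtinger(1)[OF dom_open[OF c d]], rule ck_wirtinger(2)[OF dom_open[OF c d]])
      (use weighted_form_ck[OF c d \<rho>] in \<open>simp add: numeral_2_eq_2 del: continuously_differentiable_on.simps\<close>)
  ultimately show ?thesis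
    unfolding bochner_term_def[abs_def] minor_contraction_def by (intro continuous_on_sum continuous_on_mult)
qed

lemma bochner_term_zero:
  assumes c: "c \<in> A" and W: "openin X W" "p \<in> W" and p: "p \<in> fst c" and \<rho>: "\<And>q. q \<in> W \<Longrightarrow> \<rho> q = 0"
  shows "bochner_term \<rho> c d (snd c p) = 0"
proof -
  let ?S = "snd c ` (fst c \<inter> W)"
  have S: "open ?S" "snd c p \<in> ?S"
    using domain.chart_image_of_open[OF c openin_Int[OF domain.chart_domain_open[OF c] W(1)]] W p by auto
  have z: "complex_of_real (\<rho> (chart_inv c z)) * F z = 0" if "z \<in> ?S" for z F
    using that \<rho> c by auto
  have "d_dz \<gamma> (d_dzbar \<delta> (\<lambda>z. complex_of_real (\<rho> (chart_inv c z)) * pullback_form (g d) (rep c d) \<alpha> \<beta> z)) (snd c p) = 0" for \<alpha> \<beta> \<gamma> \<delta>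
  proof -
    have 0: "d_dzbar \<delta> (\<lambda>z. 0) = (\<lambda>z. 0)" by (rule ext) simp
    have "d_dz \<gamma> (d_dzbar \<delta> (\<lambda>z. complex_of_real (\<rho> (chart_inv c z)) * pullback_form (g d) (rep c d) \<alpha> \<beta> z)) (snd c p)
        = d_dz \<gamma> (d_dzbar \<delta> (\<lambda>z. 0)) (snd c p)"
      by (rule hessian_cong[OF S z])
    then show ?thesis by (simp add: 0)
  qed
  then show ?thesis by (simp add: bochner_term_def minor_contraction_def)
qed

lemma bochner_term_target_invariant:
  assumes c: "c \<in> A" and d: "d \<in> B" "d' \<in> B" and x: "x \<in> ldom c d" "x \<in> ldom c d'"
  shows "bochner_term \<rho> c d x = bochner_term \<rho> c d' x"
proof -
  let ?S = "ldom c d \<inter> ldom c d'"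
  have S: "open ?S" "x \<in> ?S" using x dom_open[OF c d(1)] dom_open[OF c d(2)] by auto
  have "d_dz \<gamma> (d_dzbar \<delta> (\<lambda>z. of_real (\<rho> (chart_inv c z)) * pullback_form (g d) (rep c d) \<alpha> \<beta> z)) x
      = d_dz \<gamma> (d_dzbar \<delta> (\<lambda>z. of_real (\<rho> (chart_inv c z)) * pullback_form (g d') (rep c d') \<alpha> \<beta> z)) x" for \<alpha> \<beta> \<gamma> \<delta>
  proof (rule hessian_cong[OF S])
    fix z assume z: "z \<in> ?S"
    show "of_real (\<rho> (chart_inv c z)) * pullback_form (g d) (rep c d) \<alpha> \<beta> z
        = of_real (\<rho> (chart_inv c z)) * pullback_form (g d') (rep c d') \<alpha> \<beta> z"
      using pullback_form_invariant[OF c d IntD1[OF z] IntD2[OF z]] by simp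
  qed
  then show ?thesis unfolding bochner_term_def by simp
qed

text \<open>The coefficients of the form change by Jacobians, whose derivatives would appear if they
  were compared directly. In terms of the triple operator only functions are differentiated, and
  their gradients and complex Hessians pull back together with the metric.\<close>

lemma bochner_term_domain_invariant:
  assumes c: "c \<in> A" "c' \<in> A" and d: "d \<in> B" and p: "p \<in> fst c" "p \<in> fst c'" "f p \<in> fst d" and \<rho>: "twice_differentiable \<rho>"
  shows "bochner_term \<rho> c d (snd c p) = bochner_term \<rho> c' d (snd c' p)"
proof -
  let ?T = "transition c c'"
  let ?W = "fst c' \<inter> {p \<in> fst c. f p \<in> fst d}"
  let ?S = "snd c ` ?W"
  have S: "open ?S"
    by (rule domain.chart_image_of_open[OF c(1) openin_Int[OF domain.chart_domain_open[OF c(2)] map_preimage_open[OF c(1) d]]]) auto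
  have xS: "snd c p \<in> ?S" using p by blast
  have T: "holomorphic_map_on ?S ?T"
    using transition_holomorphic[OF c] unfolding holomorphic_map_on_def by blast
  have TS: "?T ` ?S \<subseteq> ldom c' d"
    using c by (auto simp: domain.transition_apply local_dom_def)
  let ?u = "\<lambda>c i j z. of_real (\<rho> (chart_inv c z)) * complex_of_real (g d (rep c d z) $ i $ j)"
  let ?F = "\<lambda>c i z. complex_of_real (rep c d z $ i)"
  have eq: "chart_inv c z = chart_inv c' (?T z)" "rep c d z = rep c' d (?T z)" if "z \<in> ?S" for z
    using that c by (auto simp: domain.transition_apply rep_apply)
  have rc: "ck 2 (ldom c d) (\<lambda>z. complex_of_real (\<rho> (chart_inv c z)))" if "c \<in> A" for c
    by (rule ck_of_real[OF dom_open[OF that d] ck_subset[OF _ dom_subset]]) (use that \<rho> in \<open>auto simp: twice_differentiable_def\<close>)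
  interpret G: riemannian_coordinates "g d" "chart_image d" by (rule coordinates[OF d])
  note o' = dom_open[OF c(2) d]
  have Fc: "ck 2 (ldom c' d) (?F c' i)" for i
    by (intro ck_of_real ck_vec_nth o' rep_ck c d)
  have uc: "ck 2 (ldom c' d) (?u c' i j)" for i j
    by (intro ck_mult o' rc c ck_of_real ck_compose[OF o' G.V rep_image[OF c(2)] rep_ck[OF c(2) d] G.entry_ck])
  have xd: "snd c p \<in> ldom c d" "snd c' p \<in> ldom c' d" using p by (simp_all add: mem_dom c)
  have Tx: "?T (snd c p) = snd c' p" by (rule domain.transition_apply[OF c(1) p(1)])
  have inv: "invertible (h c (snd c p))" by (rule metric_invertible[OF c(1)]) (use p in \<open>auto simp: chart_image_def\<close>)
  have "bochner_term \<rho> c d (snd c p) = (\<Sum>i\<in>UNIV. \<Sum>j\<in>UNIV. triple_operator (h c (snd c p)) (?u c i j) (?F c i) (?F c j) (snd c p))"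
    unfolding bochner_term_def
    by (rule pullback_triple[OF coordinates[OF d] dom_open[OF c(1) d] rep_ck[OF c(1) d] rep_image[OF c(1)] xd(1) rc[OF c(1)]])
  also have "\<dots> = (\<Sum>i\<in>UNIV. \<Sum>j\<in>UNIV. triple_operator (h c' (snd c' p)) (?u c' i j) (?F c' i) (?F c' j) (snd c' p))"
  proof (intro sum.cong refl)
    fix i j
    have "triple_operator (h c (snd c p)) (?u c i j) (?F c i) (?F c j) (snd c p)
        = triple_operator (h c (snd c p)) (\<lambda>z. ?u c' i j (?T z)) (\<lambda>z. ?F c' i (?T z)) (\<lambda>z. ?F c' j (?T z)) (snd c p)"
      by (rule triple_operator_cong[OF S xS]) (simp_all only: eq)
    also have "\<dots> = triple_operator (h c' (snd c' p)) (?u c' i j) (?F c' i) (?F c' j) (?T (snd c p))"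
      by (rule triple_operator_pullback[OF S o' T TS xS uc Fc Fc inv metric_transformation[OF c p(1,2)]])
    finally show "triple_operator (h c (snd c p)) (?u c i j) (?F c i) (?F c j) (snd c p)
        = triple_operator (h c' (snd c' p)) (?u c' i j) (?F c' i) (?F c' j) (snd c' p)" unfolding Tx .
  qed
  also have "\<dots> = bochner_term \<rho> c' d (snd c' p)"
    unfolding bochner_term_def
    by (rule pullback_triple[OF coordinates[OF d] o' rep_ck[OF c(2) d] rep_image[OF c(2)] xd(2) rc[OF c(2)], symmetric])
  finally show ?thesis .
qed

lemma bochner_term_invariant:
  assumes c: "c \<in> A" "c' \<in> A" and d: "d \<in> B" "d' \<in> B" and p: "p \<in> fst c" "p \<in> fst c'" "f p \<in> fst d" "f p \<in> fst d'"
    and \<rho>: "twice_differentiable \<rho>"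
  shows "bochner_term \<rho> c d (snd c p) = bochner_term \<rho> c' d' (snd c' p)"
proof -
  have "snd c' p \<in> ldom c' d" "snd c' p \<in> ldom c' d'" using p by (simp_all add: mem_dom c)
  from bochner_term_target_invariant[OF c(2) d this] show ?thesis
    using bochner_term_domain_invariant[OF c d(1) p(1-3) \<rho>] by simp
qed

text \<open>Linearity brings the sum of the weights, which is 1, inside the derivatives. A single
  localized term contains derivatives of its weight and obeys no Bochner formula; the sum
  does.\<close>

lemma bochner_term_sum:
  assumes c: "c \<in> A" and d: "d \<in> B" and Q: "finite Q" "\<And>q. q \<in> Q \<Longrightarrow> twice_differentiable (\<rho> q)"
    and one: "\<And>p. p \<in> topspace X \<Longrightarrow> (\<Sum>q\<in>Q. \<rho> q p) = 1" and x: "x \<in> ldom c d"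
  shows "(\<Sum>q\<in>Q. bochner_term (\<rho> q) c d x)
    = minor_contraction (h c x) (\<lambda>\<alpha> \<beta> \<gamma> \<delta>. d_dz \<gamma> (d_dzbar \<delta> (pullback_form (g d) (rep c d) \<alpha> \<beta>)) x)"
proof -
  note S = dom_open[OF c d]
  let ?\<psi> = "\<lambda>q \<alpha> \<beta> z. complex_of_real (\<rho> q (chart_inv c z)) * pullback_form (g d) (rep c d) \<alpha> \<beta> z"
  have ck: "ck (Suc (Suc 0)) (ldom c d) (?\<psi> q \<alpha> \<beta>)" if "q \<in> Q" for q \<alpha> \<beta>
    using weighted_form_ck[OF c d Q(2)[OF that]] by (simp add: numeral_2_eq_2 del: continuously_differentiable_on.simps)
  have sum1: "(\<Sum>q\<in>Q. ?\<psi> q \<alpha> \<beta> z) = pullback_form (g d) (rep c d) \<alpha> \<beta> z" if "z \<in> ldom c d" for z \<alpha> \<beta>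
  proof -
    have "chart_inv c z \<in> topspace X"
      using domain.chart_inv_right(2)[OF c subsetD[OF dom_subset that]] domain.chart_domain_subset[OF c] by blast
    from one[OF this] show ?thesis by (simp add: sum_distrib_right[symmetric] of_real_sum[symmetric] del: of_real_sum)
  qed
  have "(\<Sum>q\<in>Q. d_dz \<gamma> (d_dzbar \<delta> (?\<psi> q \<alpha> \<beta>)) x) = d_dz \<gamma> (d_dzbar \<delta> (pullback_form (g d) (rep c d) \<alpha> \<beta>)) x" for \<alpha> \<beta> \<gamma> \<delta>
  proof -
    have "(\<Sum>q\<in>Q. d_dz \<gamma> (d_dzbar \<delta> (?\<psi> q \<alpha> \<beta>)) x) = d_dz \<gamma> (\<lambda>z. \<Sum>q\<in>Q. d_dzbar \<delta> (?\<psi> q \<alpha> \<beta>) z) x"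
      by (rule wirtinger_sum(1)[symmetric]) (rule ck_differentiable[OF ck_wirtinger(2)[OF S ck] x])
    also have "\<dots> = d_dz \<gamma> (d_dzbar \<delta> (\<lambda>z. \<Sum>q\<in>Q. ?\<psi> q \<alpha> \<beta> z)) x"
      by (rule wirtinger_cong(1)[OF S x], rule wirtinger_sum(2)[symmetric]) (rule ck_differentiable[OF ck])
    also have "\<dots> = d_dz \<gamma> (d_dzbar \<delta> (pullback_form (g d) (rep c d) \<alpha> \<beta>)) x"
      by (rule hessian_cong[OF S x sum1])
    finally show ?thesis .
  qed
  then show ?thesis unfolding bochner_term_def minor_contraction_sum[symmetric] by simp
qed

section \<open>Integrals over charts\<close>

definition chart_integral :: "('a \<Rightarrow> real) \<Rightarrow> ('a, complex^'m) chart \<Rightarrow> real" where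
  "chart_integral u c = coord_integral (extend_zero (chart_image c) (\<lambda>x. u (chart_inv c x) * volume c x))"

definition continuous_in_charts :: "('a \<Rightarrow> real) \<Rightarrow> bool" where
  "continuous_in_charts u \<longleftrightarrow> (\<forall>c\<in>A. continuous_on (chart_image c) (\<lambda>x. u (chart_inv c x)))"

text \<open>The square modulus of the complex Jacobian, produced by the change of variables, is
  exactly the factor relating the two determinants of the metric. The compact set L confines the
  integrand to the overlap of the charts.\<close>

lemma chart_integral_invariant:
  assumes c: "c \<in> A" "c' \<in> A" and u: "continuous_in_charts u"
    and L: "compactin X L" "L \<subseteq> fst c \<inter> fst c'" "\<And>p. p \<notin> L \<Longrightarrow> u p = 0"
  shows "chart_integral u c = chart_integral u c'"
proof -
  let ?T = "transition c c'"
  let ?W = "fst c \<inter> fst c'"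
  let ?S = "snd c ` ?W"
  have W: "openin X ?W" using domain.chart_domain_open c by blast
  have S: "open ?S" by (rule domain.chart_image_of_open[OF c(1) W]) auto
  have TS: "?T ` ?S = snd c' ` ?W"
    unfolding image_image by (rule image_cong) (auto simp: domain.transition_apply c)
  have S': "open (?T ` ?S)" unfolding TS by (rule domain.chart_image_of_open[OF c(2) W]) auto
  have inj: "inj_on ?T ?S"
  proof (rule inj_onI)
    fix a b assume a: "a \<in> ?S" and b: "b \<in> ?S" and ab: "?T a = ?T b"
    obtain p q where "p \<in> ?W" "q \<in> ?W" "a = snd c p" "b = snd c q" using a b by blast
    then show "a = b" using ab domain.chart_inj[OF c(2)] by (auto simp: domain.transition_apply c inj_on_def)
  qed
  let ?v = "\<lambda>c x. u (chart_inv c x) * volume c x"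
  \<comment> \<open>A point of the chart outside the overlap lies outside L, where u vanishes, so
    shrinking the domain of integration changes nothing.\<close>
  have ext: "extend_zero (chart_image b) (?v b) = extend_zero (snd b ` ?W) (?v b)" if b: "b \<in> A" "?W \<subseteq> fst b" for b
  proof
    fix x
    show "extend_zero (chart_image b) (?v b) x = extend_zero (snd b ` ?W) (?v b) x"
    proof (cases "x \<in> chart_image b \<and> chart_inv b x \<notin> L")
      case True
      then show ?thesis using L(3) by (simp add: extend_zero_def)
    next
      case False
      then have "x \<in> chart_image b \<Longrightarrow> x \<in> snd b ` ?W"
        using domain.chart_inv_right(1)[OF b(1), of x] L(2) by (metis image_eqI subsetD)
      moreover have "x \<in> snd b ` ?W \<Longrightarrow> x \<in> chart_image b" using b(2) by (auto simp: chart_image_def)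
      ultimately show ?thesis by (auto simp: extend_zero_def)
    qed
  qed
  have "extend_zero ?S (?v c) = extend_zero ?S (\<lambda>x. ?v c' (?T x) * (cmod (det (complex_jacobian ?T x)))\<^sup>2)"
  proof
    fix x
    show "extend_zero ?S (?v c) x = extend_zero ?S (\<lambda>x. ?v c' (?T x) * (cmod (det (complex_jacobian ?T x)))\<^sup>2) x"
    proof (cases "x \<in> ?S")
      case True
      then obtain p where p: "p \<in> fst c" "p \<in> fst c'" "x = snd c p" by blast
      show ?thesis using True p volume_transformation[OF c p(1,2)]
        by (simp add: extend_zero_def domain.transition_apply c)
    qed (simp add: extend_zero_def)
  qed
  then have "chart_integral u c = coord_integral (extend_zero ?S (\<lambda>x. ?v c' (?T x) * (cmod (det (complex_jacobian ?T x)))\<^sup>2))"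
    unfolding chart_integral_def ext[OF c(1) Int_lower1] by simp
  also have "\<dots> = coord_integral (extend_zero (?T ` ?S) (?v c'))"
  proof (rule coord_integral_change_of_variables[OF S transition_holomorphic[OF c] inj S'])
    have "?T ` ?S \<subseteq> chart_image c'" unfolding TS by (auto simp: chart_image_def)
    then show "continuous_on (?T ` ?S) (?v c')"
      using u c(2) volume_continuous[OF c(2)] unfolding continuous_in_charts_def
      by (intro continuous_on_mult) (auto intro: continuous_on_subset)
    show "compact (snd c' ` L)" using domain.chart_compact_iff[OF c(2), of L] L(1,2) by blast
    show "snd c' ` L \<subseteq> ?T ` ?S" unfolding TS using L(2) by blast
    fix y assume "y \<in> ?T ` ?S - snd c' ` L"
    then obtain p where "p \<in> ?W" "y = snd c' p" "p \<notin> L" unfolding TS by blast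
    then show "?v c' y = 0" using c(2) L(3) by simp
  qed
  also have "\<dots> = chart_integral u c'"
    unfolding chart_integral_def TS ext[OF c(2) Int_lower2] ..
  finally show ?thesis .
qed

end

section \<open>The integral argument\<close>

lemma frame_matrix_hermitian: "frame_matrix f $ j $ i = cnj (frame_matrix f $ i $ j)"
  by (simp add: frame_matrix_def mult.commute)

lemma collinear_change_of_frame:
  fixes E :: "complex^'m::finite^'m" and D :: "'m \<Rightarrow> complex^'n::finite"
  assumes E: "invertible E" and w: "\<And>s. \<exists>c. (\<chi> i. \<Sum>\<alpha>\<in>UNIV. E $ s $ \<alpha> * D \<alpha> $ i) = c *s w"
  shows "\<exists>c. D \<alpha> = c *s w"
proof -
  obtain E' where E': "E' ** E = mat 1" using E by (auto simp: invertible_def)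
  obtain c where c: "\<And>s. (\<chi> i. \<Sum>\<alpha>\<in>UNIV. E $ s $ \<alpha> * D \<alpha> $ i) = c s *s w" using w by metis
  have c': "(\<Sum>\<alpha>\<in>UNIV. E $ s $ \<alpha> * D \<alpha> $ i) = c s * w $ i" for s i
    using c[of s] by (simp add: vec_eq_iff)
  have "D \<alpha> $ i = (\<Sum>s\<in>UNIV. E' $ \<alpha> $ s * c s) * w $ i" for i
  proof -
    have "(\<Sum>s\<in>UNIV. E' $ \<alpha> $ s * c s) * w $ i = (\<Sum>s\<in>UNIV. E' $ \<alpha> $ s * (\<Sum>\<beta>\<in>UNIV. E $ s $ \<beta> * D \<beta> $ i))"
      by (simp only: c' sum_distrib_right mult.assoc)
    also have "\<dots> = (\<Sum>\<beta>\<in>UNIV. (\<Sum>s\<in>UNIV. E' $ \<alpha> $ s * E $ s $ \<beta>) * D \<beta> $ i)"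
      unfolding sum_distrib_left sum_distrib_right by (simp only: mult.assoc) (rule sum.swap)
    also have "\<dots> = (\<Sum>\<beta>\<in>UNIV. (E' ** E) $ \<alpha> $ \<beta> * D \<beta> $ i)" by (simp add: matrix_matrix_mult_def)
    also have "\<dots> = D \<alpha> $ i" by (simp add: E' mat_def if_distrib[of "\<lambda>x. x * _"] cong: if_cong)
    finally show ?thesis by simp
  qed
  then show ?thesis by (intro exI[of _ "\<Sum>s\<in>UNIV. E' $ \<alpha> $ s * c s"]) (simp add: vec_eq_iff)
qed

text \<open>Each weight is supported in one domain chart, on a compact set that f sends into one
  target chart, so that on the support of a weight a single coordinate expression of f is available.
  The assumption m \<ge> 2 is the case in which the condition on \<omega> has content.\<close>

locale partitioned_harmonic_map = harmonic_map X A h Y B g f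
  for X :: "'a topology" and A :: "('a, complex^'m) chart set" and h :: "('a, 'm::finite) hermitian_components"
    and Y :: "'b topology" and B :: "('b, real^'n) chart set" and g :: "('b, 'n::finite) riemannian_components" and f +
  fixes Q :: "'q set" and C :: "'q \<Rightarrow> ('a, complex^'m) chart" and E :: "'q \<Rightarrow> ('b, real^'n) chart"
    and K :: "'q \<Rightarrow> (complex^'m) set" and \<rho> :: "'q \<Rightarrow> 'a \<Rightarrow> real"
  assumes card: "CARD('m) \<ge> 2" and del_delbar: "del_delbar_omega_condition A h"
    and curvature: "\<And>d y. d \<in> B \<Longrightarrow> y \<in> chart_image d \<Longrightarrow> rank_one_curvature TYPE('m) (g d) y"
    and Q: "finite Q" and C: "\<And>q. q \<in> Q \<Longrightarrow> C q \<in> A" and E: "\<And>q. q \<in> Q \<Longrightarrow> E q \<in> B"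
    and K: "\<And>q. q \<in> Q \<Longrightarrow> compact (K q)" "\<And>q. q \<in> Q \<Longrightarrow> K q \<subseteq> local_dom (C q) (E q) f"
    and \<rho>_nonneg: "\<And>q p. q \<in> Q \<Longrightarrow> \<rho> q p \<ge> 0"
    and \<rho>_supp: "\<And>q p. q \<in> Q \<Longrightarrow> \<rho> q p \<noteq> 0 \<Longrightarrow> p \<in> fst (C q) \<and> snd (C q) p \<in> K q"
    and \<rho>_sum: "\<And>p. p \<in> topspace X \<Longrightarrow> (\<Sum>q\<in>Q. \<rho> q p) = 1"
    and \<rho>_ck: "\<And>q. q \<in> Q \<Longrightarrow> twice_differentiable (\<rho> q)"
begin

definition supp :: "'q \<Rightarrow> 'a set" where
  "supp q = {p \<in> fst (C q). snd (C q) p \<in> K q}"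

lemma K_chart: "q \<in> Q \<Longrightarrow> K q \<subseteq> chart_image (C q)"
  by (rule subset_trans[OF K(2) dom_subset])

lemma supp_compact: "q \<in> Q \<Longrightarrow> compactin X (supp q)"
  unfolding supp_def by (rule domain.chart_preimage_compact[OF C K(1) K_chart])

lemma supp_complement: "q \<in> Q \<Longrightarrow> openin X (topspace X - supp q)"
  using compactin_imp_closedin[OF domain.hausdorff supp_compact] by blast

lemma supp_dom: "q \<in> Q \<Longrightarrow> p \<in> supp q \<Longrightarrow> p \<in> fst (C q) \<and> f p \<in> fst (E q)"
  using K(2)[of q] mem_dom[OF C, of q p "E q"] by (auto simp: supp_def)

lemma \<rho>_zero: "q \<in> Q \<Longrightarrow> p \<notin> supp q \<Longrightarrow> \<rho> q p = 0"
  using \<rho>_supp by (auto simp: supp_def)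

lemma bochner_term_off_supp:
  assumes q: "q \<in> Q" and c: "c \<in> A" "p \<in> fst c" and p: "p \<notin> supp q"
  shows "bochner_term (\<rho> q) c d (snd c p) = 0"
proof (rule bochner_term_zero[OF c(1) supp_complement[OF q] _ c(2)])
  show "p \<in> topspace X - supp q" using domain.chart_domain_subset[OF c(1)] c(2) p by blast
  show "\<And>p. p \<in> topspace X - supp q \<Longrightarrow> \<rho> q p = 0" using \<rho>_zero[OF q] by blast
qed

text \<open>The global function whose coordinate expressions are the localized terms. It is computed
  in the charts attached to q and set to zero off the support; invariance of the local expression
  makes it correct in all charts.\<close>

definition \<theta> :: "'q \<Rightarrow> 'a \<Rightarrow> real" where
  "\<theta> q p = (if p \<in> supp q then Re (bochner_term (\<rho> q) (C q) (E q) (snd (C q) p)) else 0)"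

lemma \<theta>_eq:
  assumes q: "q \<in> Q" and c: "c \<in> A" "p \<in> fst c" and d: "d \<in> B" "f p \<in> fst d"
  shows "\<theta> q p = Re (bochner_term (\<rho> q) c d (snd c p))"
proof (cases "p \<in> supp q")
  case True
  note s = supp_dom[OF q True, THEN conjunct1] supp_dom[OF q True, THEN conjunct2]
  have "bochner_term (\<rho> q) (C q) (E q) (snd (C q) p) = bochner_term (\<rho> q) c d (snd c p)"
    by (rule bochner_term_invariant[OF C[OF q] c(1) E[OF q] d(1) s(1) c(2) s(2) d(2) \<rho>_ck[OF q]])
  then show ?thesis using True by (simp add: \<theta>_def)
qed (simp add: \<theta>_def bochner_term_off_supp[OF q c])

lemma \<theta>_continuous: "q \<in> Q \<Longrightarrow> continuous_in_charts (\<theta> q)"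
  unfolding continuous_in_charts_def
proof
  fix c assume q: "q \<in> Q" and c: "c \<in> A"
  have "ck 0 (chart_image c) (\<lambda>x. \<theta> q (chart_inv c x))"
  proof (rule ck_local)
    fix x assume x: "x \<in> chart_image c"
    let ?p = "chart_inv c x"
    have p: "?p \<in> fst c" "snd c ?p = x" using domain.chart_inv_right[OF c x] by auto
    obtain d where d: "d \<in> B" "f ?p \<in> fst d"
      using charts_around[of ?p] domain.chart_domain_subset[OF c] p(1) by blast
    have o: "open (ldom c d)" by (rule dom_open[OF c d(1)])
    have "ck 0 (ldom c d) (\<lambda>x. \<theta> q (chart_inv c x))"
    proof (rule ck_cong[OF o])
      show "ck 0 (ldom c d) (\<lambda>x. Re (bochner_term (\<rho> q) c d x))"
        using bochner_term_continuous[OF c d(1) \<rho>_ck[OF q]] by (simp add: continuous_on_Re)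
      fix y assume "y \<in> ldom c d"
      then obtain p where "p \<in> fst c" "f p \<in> fst d" "y = snd c p" by (rule domE)
      then show "Re (bochner_term (\<rho> q) c d y) = \<theta> q (chart_inv c y)"
        using \<theta>_eq[OF q c _ d(1)] c by simp
    qed
    moreover have "x \<in> ldom c d" using mem_dom[OF c p(1), of d] d(2) unfolding p(2) by blast
    ultimately show "\<exists>T. open T \<and> x \<in> T \<and> ck 0 T (\<lambda>x. \<theta> q (chart_inv c x))" using o by blast
  qed
  then show "continuous_on (chart_image c) (\<lambda>x. \<theta> q (chart_inv c x))" by simp
qed

definition \<Theta> :: "'a \<Rightarrow> real" where
  "\<Theta> p = (\<Sum>q\<in>Q. \<theta> q p)"

text \<open>Here \<Theta> = b - Re R, with b the square norm of the covariant Hessian and R the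
  curvature contraction on the frame. Both contributions are nonnegative, so a zero of \<Theta> puts
  the curvature condition into its equality case.\<close>

lemma \<Theta>_properties:
  assumes c: "c \<in> A" "p \<in> fst c" and d: "d \<in> B" "f p \<in> fst d"
  shows "\<Theta> p \<ge> 0"
    and "\<Theta> p = 0 \<Longrightarrow> \<exists>w. \<forall>\<alpha>. \<exists>k. (\<chi> i. d_dz \<alpha> (\<lambda>z. complex_of_real (rep c d z $ i)) (snd c p)) = k *s w"
proof -
  let ?x = "snd c p"
  let ?D = "\<lambda>\<alpha>. \<chi> i. d_dz \<alpha> (\<lambda>z. complex_of_real (rep c d z $ i)) ?x"
  have x: "?x \<in> ldom c d" using mem_dom[OF c, of d] d(2) by blast
  have y: "rep c d ?x \<in> chart_image d" by (rule subsetD[OF rep_image[OF c(1)] imageI[OF x]])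
  have H: "hermitian_positive_definite (h c ?x)" by (rule metric_positive[OF c(1) subsetD[OF dom_subset x]])
  have harm: "(\<Sum>\<alpha>\<in>UNIV. \<Sum>\<beta>\<in>UNIV. inverse_metric (h c ?x) \<alpha> \<beta> * (d_dz \<alpha> (d_dzbar \<beta> (\<lambda>z. complex_of_real (rep c d z $ i))) ?x +
          (\<Sum>j\<in>UNIV. \<Sum>k\<in>UNIV. complex_of_real (christoffel (g d) i j k (rep c d ?x))
             * d_dzbar \<beta> (\<lambda>z. complex_of_real (rep c d z $ j)) ?x * d_dz \<alpha> (\<lambda>z. complex_of_real (rep c d z $ k)) ?x))) = 0" for i
    using harmonic[unfolded hermitian_harmonic_def Let_def, THEN conjunct2, rule_format, OF c(1) d(1) x] .
  obtain b :: real and M :: "complex^'m^'m" where b: "b \<ge> 0" and M: "invertible M"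
    and eq: "minor_contraction (h c ?x) (\<lambda>\<alpha> \<beta> \<gamma> \<delta>. d_dz \<gamma> (d_dzbar \<delta> (pullback_form (g d) (rep c d) \<alpha> \<beta>)) ?x)
      = of_real b - curvature_contraction (g d) (rep c d ?x) (frame_matrix (\<lambda>s. \<chi> i. \<Sum>\<alpha>\<in>UNIV. M $ s $ \<alpha> * d_dz \<alpha> (\<lambda>z. complex_of_real (rep c d z $ i)) ?x))"
    by (rule bochner_formula[OF coordinates[OF d(1)] dom_open[OF c(1) d(1)] rep_ck[OF c(1) d(1)] rep_image[OF c(1)] x H harm])
  define \<phi> :: "'m \<Rightarrow> complex^'n" where "\<phi> s = (\<chi> i. \<Sum>\<alpha>\<in>UNIV. M $ s $ \<alpha> * d_dz \<alpha> (\<lambda>z. complex_of_real (rep c d z $ i)) ?x)" for s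
  define R where "R = curvature_contraction (g d) (rep c d ?x) (frame_matrix \<phi>)"
  have "(\<Sum>q\<in>Q. bochner_term (\<rho> q) c d ?x) = of_real b - R"
    using bochner_term_sum[where \<rho>=\<rho>, OF c(1) d(1) Q \<rho>_ck \<rho>_sum x] unfolding eq R_def \<phi>_def[abs_def] .
  then have \<Theta>: "\<Theta> p = b - Re R"
    by (simp add: \<Theta>_def \<theta>_eq[OF _ c d] Re_sum[symmetric] del: Re_sum)
  have neg: "Re R \<le> 0" "R = 0 \<Longrightarrow> \<exists>w. \<forall>s. \<exists>k. \<phi> s = k *s w"
    using curvature[OF d(1) y] unfolding rank_one_curvature_def R_def by blast+
  show "\<Theta> p \<ge> 0" using \<Theta> neg(1) b by simp
  assume "\<Theta> p = 0"
  then have "Re R = 0" using \<Theta> neg(1) b by simp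
  moreover have "cnj R = R"
    unfolding R_def riemannian_coordinates.curvature_contraction_eq[OF coordinates[OF d(1)] y]
    using riemannian_coordinates.curvature_quadratic_real[OF coordinates[OF d(1)] y frame_matrix_hermitian] by simp
  ultimately have "R = 0" by (simp add: complex_eq_iff)
  then obtain w where w: "\<And>s. \<exists>k. \<phi> s = k *s w" using neg(2) by blast
  \<comment> \<open>The equality case concerns derivatives along the unitary frame; inverting M
    returns to coordinate directions with the same w.\<close>
  have "\<exists>k. ?D \<alpha> = k *s w" for \<alpha>
    by (rule collinear_change_of_frame[OF M]) (use w in \<open>simp add: \<phi>_def\<close>)
  then show "\<exists>w. \<forall>\<alpha>. \<exists>k. ?D \<alpha> = k *s w" by blast
qed

text \<open>The localized term times det h is the integrand of
  \<open>integral_contraction_zero\<close>, and det h is the volume density. Extending by zero from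
  the local domain or from the whole chart image gives the same function, as the support lies in K
  q.\<close>

lemma \<theta>_integral:
  assumes q: "q \<in> Q"
  shows "chart_integral (\<theta> q) (C q) = 0"
proof -
  note c = C[OF q] and d = E[OF q]
  let ?c = "C q" and ?d = "E q"
  let ?U = "ldom ?c ?d"
  let ?\<psi> = "\<lambda>\<alpha> \<beta> z. complex_of_real (\<rho> q (chart_inv ?c z)) * pullback_form (g ?d) (rep ?c ?d) \<alpha> \<beta> z"
  let ?v = "\<lambda>x. det (h ?c x) * bochner_term (\<rho> q) ?c ?d x"
  note U = dom_open[OF c d]
  have off: "chart_inv ?c x \<notin> supp q" if "x \<in> chart_image ?c - K q" for x
    using that domain.chart_inv_right[OF c, of x] by (simp add: supp_def)
  have div: "(\<Sum>\<gamma>\<in>UNIV. \<Sum>\<delta>\<in>UNIV. d_dz \<gamma> (d_dzbar \<delta> (\<lambda>z. det (h ?c z) * minor_coeff (h ?c z) \<alpha> \<beta> \<gamma> \<delta>)) x) = 0"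
    if "x \<in> ?U" for x \<alpha> \<beta>
    unfolding minor_coeff_def
  proof (rule minors_divergence_free[OF card domain.chart_image_open[OF c] metric_ck[OF c] metric_invertible[OF c]])
    show x: "x \<in> chart_image ?c" by (rule subsetD[OF dom_subset that])
    show "del (2 * (CARD('m) - 2) + 1) (delbar (2 * (CARD('m) - 2)) (wedge_power (fundamental_form (h ?c)) (CARD('m) - 2))) x vs = 0"
      if "length vs = 2 * (CARD('m) - 2) + 2" for vs
      using del_delbar card c x that unfolding del_delbar_omega_condition_def by blast
  qed
  have "coord_integral (extend_zero ?U ?v) = 0"
    unfolding bochner_term_def
  proof (rule integral_contraction_zero[OF U K[OF q] _ div weighted_form_ck[OF c d \<rho>_ck[OF q]]])
    show "ck 2 ?U (\<lambda>z. det (h ?c z) * minor_coeff (h ?c z) \<alpha> \<beta> \<gamma> \<delta>)" for \<alpha> \<beta> \<gamma> \<delta>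
      by (rule ck_subset[OF minor_coeff_ck(2)[OF c] dom_subset])
    show "?\<psi> \<alpha> \<beta> x = 0" if "x \<in> ?U - K q" for x \<alpha> \<beta>
    proof -
      have "x \<in> chart_image ?c - K q" using that by (blast intro: subsetD[OF dom_subset])
      then show ?thesis using \<rho>_zero[OF q off] by simp
    qed
  qed
  moreover have "extend_zero (chart_image ?c) (\<lambda>x. \<theta> q (chart_inv ?c x) * volume ?c x) = (\<lambda>x. Re (extend_zero ?U ?v x))"
  proof
    fix x
    show "extend_zero (chart_image ?c) (\<lambda>x. \<theta> q (chart_inv ?c x) * volume ?c x) x = Re (extend_zero ?U ?v x)"
    proof (cases "x \<in> ?U")
      case True
      then obtain p where p: "p \<in> fst ?c" "f p \<in> fst ?d" "x = snd ?c p" by (rule domE)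
      have "x \<in> chart_image ?c" by (rule subsetD[OF dom_subset True])
      then show ?thesis using True \<theta>_eq[OF q c p(1) d p(2)] c p det_metric[OF c, of x] by (simp add: extend_zero_def mult.commute)
    next
      case False
      then have "x \<notin> K q" using K(2)[OF q] by blast
      then show ?thesis using False off[of x] by (simp add: extend_zero_def \<theta>_def)
    qed
  qed
  moreover have "coord_integral (\<lambda>x. Re (extend_zero ?U ?v x)) = Re (coord_integral (extend_zero ?U ?v))"
  proof -
    have "(\<lambda>y. extend_zero ?U ?v (of_coords y)) integrable_on UNIV"
    proof (rule extend_zero_integrable[OF U K[OF q]])
      have "ck 0 (chart_image ?c) (\<lambda>x. det (h ?c x))"
        by (intro ck_det ck_vec_nth metric_ck[OF c] domain.chart_image_open[OF c])
      then have "continuous_on ?U (\<lambda>x. det (h ?c x))" using continuous_on_subset[OF _ dom_subset] by simp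
      then show "continuous_on ?U ?v" by (intro continuous_on_mult bochner_term_continuous[OF c d \<rho>_ck[OF q]])
      fix x assume x: "x \<in> ?U - K q"
      then have xc: "x \<in> chart_image ?c" by (blast intro: subsetD[OF dom_subset])
      have "bochner_term (\<rho> q) ?c ?d (snd ?c (chart_inv ?c x)) = 0"
        by (rule bochner_term_off_supp[OF q c domain.chart_inv_right(2)[OF c xc] off]) (use x xc in blast)
      then show "?v x = 0" by (simp add: domain.chart_inv_right[OF c xc])
    qed
    from integral_linear[OF this bounded_linear_Re] show ?thesis by (simp add: coord_integral_def o_def)
  qed
  ultimately show ?thesis by (simp add: chart_integral_def)
qed

lemma weight_continuous: "q \<in> Q \<Longrightarrow> continuous_in_charts (\<rho> q)"
  using \<rho>_ck[of q] by (auto simp: continuous_in_charts_def twice_differentiable_def intro: ck_continuous_on)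

lemma continuous_in_charts_mult:
  "continuous_in_charts u \<Longrightarrow> continuous_in_charts v \<Longrightarrow> continuous_in_charts (\<lambda>p. u p * v p)"
  unfolding continuous_in_charts_def by (auto intro: continuous_on_mult)

lemma chart_integral_sum:
  assumes q: "q \<in> Q" and I: "finite I" and u: "\<And>i. i \<in> I \<Longrightarrow> continuous_in_charts (u i)" "\<And>i p. i \<in> I \<Longrightarrow> p \<notin> supp q \<Longrightarrow> u i p = 0"
  shows "chart_integral (\<lambda>p. \<Sum>i\<in>I. u i p) (C q) = (\<Sum>i\<in>I. chart_integral (u i) (C q))"
  unfolding chart_integral_def sum_distrib_right
proof (rule coord_integral_extend_sum[OF I domain.chart_image_open[OF C[OF q]] K(1)[OF q] K_chart[OF q]])
  fix i assume i: "i \<in> I"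
  show "continuous_on (chart_image (C q)) (\<lambda>x. u i (chart_inv (C q) x) * volume (C q) x)"
    using u(1)[OF i] C[OF q] volume_continuous[OF C[OF q]] by (auto simp: continuous_in_charts_def intro: continuous_on_mult)
  fix x assume "x \<in> chart_image (C q) - K q"
  then have "chart_inv (C q) x \<notin> supp q" using domain.chart_inv_right[OF C[OF q], of x] by (simp add: supp_def)
  then show "u i (chart_inv (C q) x) * volume (C q) x = 0" using u(2)[OF i] by simp
qed

text \<open>\<open>\<rho>\<^sub>l \<theta>\<^sub>q\<close> is supported in the overlap of the charts \<open>C l\<close> and \<open>C q\<close>, so it may be integrated in \<open>C q\<close>;
  summing over \<open>l\<close> there leaves \<open>\<theta>\<^sub>q\<close>, whose integral vanishes. No global integral is needed.\<close>

lemma weighted_integrals_zero: "(\<Sum>l\<in>Q. chart_integral (\<lambda>p. \<rho> l p * \<Theta> p) (C l)) = 0"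
proof -
  have cont: "continuous_in_charts (\<lambda>p. \<rho> l p * \<theta> q p)" if "l \<in> Q" "q \<in> Q" for l q
    using that by (intro continuous_in_charts_mult weight_continuous \<theta>_continuous)
  have \<theta>0: "\<theta> q p = 0" if "p \<notin> supp q" for q p using that by (simp add: \<theta>_def)
  have "(\<Sum>l\<in>Q. chart_integral (\<lambda>p. \<rho> l p * \<Theta> p) (C l)) = (\<Sum>l\<in>Q. \<Sum>q\<in>Q. chart_integral (\<lambda>p. \<rho> l p * \<theta> q p) (C l))"
    unfolding \<Theta>_def sum_distrib_left
    by (intro sum.cong refl chart_integral_sum Q cont) (simp_all add: \<rho>_zero)
  also have "\<dots> = (\<Sum>l\<in>Q. \<Sum>q\<in>Q. chart_integral (\<lambda>p. \<rho> l p * \<theta> q p) (C q))"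
  proof (intro sum.cong refl)
    fix l q assume l: "l \<in> Q" and q: "q \<in> Q"
    show "chart_integral (\<lambda>p. \<rho> l p * \<theta> q p) (C l) = chart_integral (\<lambda>p. \<rho> l p * \<theta> q p) (C q)"
    proof (rule chart_integral_invariant[OF C[OF l] C[OF q] cont[OF l q]])
      show "compactin X (supp l \<inter> supp q)"
        by (rule closed_Int_compactin[OF compactin_imp_closedin[OF domain.hausdorff supp_compact[OF l]] supp_compact[OF q]])
      show "supp l \<inter> supp q \<subseteq> fst (C l) \<inter> fst (C q)" by (auto simp: supp_def)
      fix p assume "p \<notin> supp l \<inter> supp q"
      then show "\<rho> l p * \<theta> q p = 0" using \<rho>_zero[OF l] \<theta>0 by auto
    qed
  qed
  also have "\<dots> = (\<Sum>q\<in>Q. \<Sum>l\<in>Q. chart_integral (\<lambda>p. \<rho> l p * \<theta> q p) (C q))" by (rule sum.swap)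
  also have "\<dots> = (\<Sum>q\<in>Q. chart_integral (\<lambda>p. \<Sum>l\<in>Q. \<rho> l p * \<theta> q p) (C q))"
    by (intro sum.cong refl chart_integral_sum[symmetric] Q cont) (simp_all add: \<theta>0)
  also have "\<dots> = (\<Sum>q\<in>Q. chart_integral (\<theta> q) (C q))"
  proof (intro sum.cong refl)
    fix q assume q: "q \<in> Q"
    have "(\<Sum>l\<in>Q. \<rho> l p * \<theta> q p) = \<theta> q p" for p
    proof (cases "p \<in> supp q")
      case True
      then have "p \<in> topspace X" using supp_dom[OF q True] domain.chart_domain_subset[OF C[OF q]] by blast
      then show ?thesis by (simp add: sum_distrib_right[symmetric] \<rho>_sum)
    qed (simp add: \<theta>0)
    then show "chart_integral (\<lambda>p. \<Sum>l\<in>Q. \<rho> l p * \<theta> q p) (C q) = chart_integral (\<theta> q) (C q)" by simp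
  qed
  also have "\<dots> = 0" by (simp add: \<theta>_integral)
  finally show ?thesis .
qed

lemma \<Theta>_continuous: "continuous_in_charts \<Theta>"
  using \<theta>_continuous unfolding continuous_in_charts_def \<Theta>_def[abs_def] by (auto intro: continuous_on_sum)

lemma \<Theta>_nonneg:
  assumes "p \<in> topspace X" shows "\<Theta> p \<ge> 0"
proof -
  from assms obtain c d where "c \<in> A" "p \<in> fst c" "d \<in> B" "f p \<in> fst d" by (rule charts_around)
  then show ?thesis by (rule \<Theta>_properties(1))
qed

text \<open>Every \<rho> l times \<Theta> is nonnegative and the integrals add up to zero, so each
  integral is zero and each continuous integrand vanishes. Summing over l recovers \<Theta>.\<close>

lemma \<Theta>_zero:
  assumes p: "p \<in> topspace X"
  shows "\<Theta> p = 0"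
proof -
  let ?w = "\<lambda>l x. \<rho> l (chart_inv (C l) x) * \<Theta> (chart_inv (C l) x) * volume (C l) x"
  let ?u = "\<lambda>l. extend_zero (chart_image (C l)) (?w l)"
  have pos: "?u l x \<ge> 0" if l: "l \<in> Q" for l x
    using \<rho>_nonneg[OF l] volume_positive[OF C[OF l], of x] \<Theta>_nonneg[of "chart_inv (C l) x"]
      domain.chart_inv_right(2)[OF C[OF l], of x] domain.chart_domain_subset[OF C[OF l]]
    by (auto simp: extend_zero_def intro!: mult_nonneg_nonneg)
  have cont: "continuous_on (chart_image (C l)) (?w l)" if l: "l \<in> Q" for l
    using weight_continuous[OF l] \<Theta>_continuous C[OF l] volume_continuous[OF C[OF l]]
    unfolding continuous_in_charts_def by (intro continuous_on_mult) auto
  have zero: "?w l x = 0" if l: "l \<in> Q" and x: "x \<in> chart_image (C l) - K l" for l x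
    using \<rho>_zero[OF l, of "chart_inv (C l) x"] x domain.chart_inv_right[OF C[OF l], of x] by (simp add: supp_def)
  have contU: "continuous_on UNIV (?u l)" if l: "l \<in> Q" for l
  proof (rule ck_continuous_on[OF extend_zero_ck[OF domain.chart_image_open[OF C[OF l]] K(1)[OF l] K_chart[OF l] _ zero[OF l]]])
    show "ck 0 (chart_image (C l)) (?w l)" using cont[OF l] by simp
  qed
  have cs: "compactly_supported (?u l)" if l: "l \<in> Q" for l
    by (rule extend_zero_supported[OF K(1)[OF l] zero[OF l]])
  have nn: "coord_integral (?u l) \<ge> 0" if l: "l \<in> Q" for l
    unfolding coord_integral_def by (rule integral_nonneg[OF coord_integrable(2)[OF contU[OF l] cs[OF l]]]) (rule pos[OF l])
  have int0: "coord_integral (?u l) = 0" if l: "l \<in> Q" for l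
    using weighted_integrals_zero nn l sum_nonneg_eq_0_iff[OF Q, of "\<lambda>l. coord_integral (?u l)"]
    unfolding chart_integral_def by blast
  have "\<rho> l p * \<Theta> p = 0" if l: "l \<in> Q" for l
  proof (cases "p \<in> fst (C l)")
    case True
    then have x: "snd (C l) p \<in> chart_image (C l)" by (auto simp: chart_image_def)
    have "?u l (snd (C l) p) = 0"
      by (rule coord_integral_nonneg_zero[OF contU[OF l] cs[OF l] pos[OF l] int0[OF l]])
    then show ?thesis using x True volume_positive[OF C[OF l] x] C[OF l] by (simp add: extend_zero_def)
  next
    case False
    then show ?thesis using \<rho>_supp[OF l, of p] by auto
  qed
  then have "(\<Sum>l\<in>Q. \<rho> l p * \<Theta> p) = 0" by (rule sum.neutral[rule_format])
  then show ?thesis by (simp add: sum_distrib_right[symmetric] \<rho>_sum[OF p])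
qed

end

section \<open>The rank bound\<close>

text \<open>The partition is indexed by pairs of a domain chart and a target chart, and D selects
  the part of the domain chart that f sends into the target chart.\<close>

lemma (in harmonic_map) gradients_collinear:
  assumes cpt: "compact_space X" and card: "CARD('m) \<ge> 2" and del_delbar: "del_delbar_omega_condition A h"
    and curvature: "\<And>d y. d \<in> B \<Longrightarrow> y \<in> chart_image d \<Longrightarrow> rank_one_curvature TYPE('m) (g d) y"
    and c: "c \<in> A" "p \<in> fst c" and d: "d \<in> B" "f p \<in> fst d"
  shows "\<exists>w. \<forall>\<alpha>. \<exists>k. (\<chi> i. d_dz \<alpha> (\<lambda>z. complex_of_real (rep c d z $ i)) (snd c p)) = k *s w"
proof -
  let ?D = "\<lambda>i. {p \<in> fst (fst i). f p \<in> fst (snd i)}"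
  have trans: "ck 2 (snd c ` (fst c \<inter> fst c')) (transition c c')" if "c \<in> A" "c' \<in> A" for c c'
    by (rule holomorphic_map_ck[OF domain.chart_image_of_open[OF that(1)] transition_holomorphic[OF that]])
      (use domain.chart_domain_open[OF that(1)] domain.chart_domain_open[OF that(2)] in auto)
  have cover: "\<exists>i\<in>A \<times> B. fst i \<in> A \<and> p \<in> ?D i" if "p \<in> topspace X" for p
  proof -
    from that obtain c d where "c \<in> A" "p \<in> fst c" "d \<in> B" "f p \<in> fst d" by (rule charts_around)
    then show ?thesis by (intro bexI[of _ "(c, d)"]) auto
  qed
  obtain Q :: "'a set" and \<iota> and K :: "'a \<Rightarrow> (complex^'m) set" and \<rho> :: "'a \<Rightarrow> 'a \<Rightarrow> real" where Q: "finite Q" "\<And>q. q \<in> Q \<Longrightarrow> \<iota> q \<in> A \<times> B \<and> fst (\<iota> q) \<in> A"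
    "\<And>q. q \<in> Q \<Longrightarrow> compact (K q)" "\<And>q. q \<in> Q \<Longrightarrow> K q \<subseteq> snd (fst (\<iota> q)) ` ?D (\<iota> q)"
    and \<rho>: "\<And>q p. q \<in> Q \<Longrightarrow> \<rho> q p \<ge> 0"
    "\<And>q p. q \<in> Q \<Longrightarrow> \<rho> q p \<noteq> 0 \<Longrightarrow> p \<in> ?D (\<iota> q) \<and> snd (fst (\<iota> q)) p \<in> K q"
    "\<And>p. p \<in> topspace X \<Longrightarrow> (\<Sum>q\<in>Q. \<rho> q p) = 1"
    "\<And>q c. q \<in> Q \<Longrightarrow> c \<in> A \<Longrightarrow> ck 2 (chart_image c) (\<lambda>x. \<rho> q (chart_inv c x))"
    by (rule domain.partition_of_unity[where I="A \<times> B" and ch=fst and D="?D", OF cpt trans cover])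
      (use map_preimage_open in auto)
  interpret partitioned_harmonic_map X A h Y B g f Q "\<lambda>q. fst (\<iota> q)" "\<lambda>q. snd (\<iota> q)" K \<rho>
  proof
    show "snd (\<iota> q) \<in> B" if "q \<in> Q" for q using Q(2)[OF that] by auto
    show "K q \<subseteq> local_dom (fst (\<iota> q)) (snd (\<iota> q)) f" if "q \<in> Q" for q
      using Q(4)[OF that] by (simp add: local_dom_def)
    show "p \<in> fst (fst (\<iota> q)) \<and> snd (fst (\<iota> q)) p \<in> K q" if "q \<in> Q" "\<rho> q p \<noteq> 0" for q p
      using \<rho>(2)[OF that] by simp
    show "twice_differentiable (\<rho> q)" if "q \<in> Q" for q using \<rho>(4)[OF that] by (simp add: twice_differentiable_def)
  qed (use card del_delbar curvature Q \<rho> in auto)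
  have "p \<in> topspace X" using domain.chart_domain_subset[OF c(1)] c(2) by blast
  then show ?thesis by (rule \<Theta>_properties(2)[OF c d \<Theta>_zero])
qed

lemma rank_le_two_if_gradients_collinear:
  fixes F :: "complex^'m::finite \<Rightarrow> real^'n::finite"
  assumes F: "F differentiable at x"
    and w: "\<And>\<alpha>. \<exists>k. (\<chi> i. d_dz \<alpha> (\<lambda>z. complex_of_real (F z $ i)) x) = k *s w"
  shows "dim (range (frechet_derivative F (at x))) \<le> 2"
proof -
  obtain k where k: "\<And>\<alpha>. (\<chi> i. d_dz \<alpha> (\<lambda>z. complex_of_real (F z $ i)) x) = k \<alpha> *s w" using w by metis
  have dz: "d_dz \<alpha> (\<lambda>z. complex_of_real (F z $ i)) x = k \<alpha> * w $ i" for \<alpha> i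
    using k[of \<alpha>] by (simp add: vec_eq_iff)
  define u1 :: "real^'n" where "u1 = (\<chi> i. Re (w $ i))"
  define u2 :: "real^'n" where "u2 = (\<chi> i. Im (w $ i))"
  have "frechet_derivative F (at x) v \<in> span {u1, u2}" for v
  proof -
    \<comment> \<open>With every \<partial>\<alpha> f equal to k \<alpha> times w, the derivative
      along v is s w plus its conjugate, twice the real part of s w.\<close>
    define s where "s = (\<Sum>\<alpha>\<in>UNIV. k \<alpha> * v $ \<alpha>)"
    have "frechet_derivative F (at x) v $ i = 2 * Re s * Re (w $ i) - 2 * Im s * Im (w $ i)" for i
    proof -
      have Fi: "((\<lambda>z. F z $ i) has_derivative (\<lambda>v. frechet_derivative F (at x) v $ i)) (at x)"
        by (rule bounded_linear.has_derivative[OF bounded_linear_vec_nth differentiable_has_frechet[OF F]])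
      then have Fc: "((\<lambda>z. complex_of_real (F z $ i)) has_derivative (\<lambda>v. complex_of_real (frechet_derivative F (at x) v $ i))) (at x)"
        by (rule bounded_linear.has_derivative[OF bounded_linear_of_real])
      have "complex_of_real (frechet_derivative F (at x) v $ i)
          = (\<Sum>\<alpha>\<in>UNIV. d_dz \<alpha> (\<lambda>z. complex_of_real (F z $ i)) x * v $ \<alpha> + d_dzbar \<alpha> (\<lambda>z. complex_of_real (F z $ i)) x * cnj (v $ \<alpha>))"
        using wirtinger_expansion[of "\<lambda>z. complex_of_real (F z $ i)" x v] Fc frechet_derivative_eqI[OF Fc]
        by (simp add: differentiable_def) blast
      also have "\<dots> = (\<Sum>\<alpha>\<in>UNIV. k \<alpha> * w $ i * v $ \<alpha> + cnj (k \<alpha> * w $ i) * cnj (v $ \<alpha>))"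
        using Fi by (subst wirtinger_of_real) (auto simp: differentiable_def dz)
      also have "\<dots> = s * w $ i + cnj (s * w $ i)"
        by (simp add: s_def sum.distrib sum_distrib_left sum_distrib_right mult_ac)
      finally have "complex_of_real (frechet_derivative F (at x) v $ i) = s * w $ i + cnj (s * w $ i)" .
      from arg_cong[OF this, of Re] show ?thesis by (simp add: algebra_simps)
    qed
    then have "frechet_derivative F (at x) v = (2 * Re s) *\<^sub>R u1 - (2 * Im s) *\<^sub>R u2"
      by (simp add: vec_eq_iff u1_def u2_def)
    then show ?thesis by (simp add: span_diff span_scale span_base)
  qed
  then have "dim (range (frechet_derivative F (at x))) \<le> dim {u1, u2}"
    unfolding dim_span[of "{u1, u2}", symmetric] by (intro dim_subset) auto
  also have "\<dots> \<le> card {u1, u2}" by (rule dim_le_card') simp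
  also have "\<dots> \<le> 2" by (simp add: card_insert_if)
  finally show ?thesis .
qed

lemma (in harmonic_map) rep_differentiable:
  assumes "c \<in> A" "p \<in> fst c" "d \<in> B" "f p \<in> fst d"
  shows "rep c d differentiable at (snd c p)"
  by (rule ck_differentiable[OF rep_ck[OF assms(1,3), of "Suc 0"]]) (use mem_dom[OF assms(1,2), of d] assms(4) in blast)

lemma (in harmonic_map) real_rank_le_two:
  assumes cpt: "compact_space X" and del_delbar: "del_delbar_omega_condition A h"
    and curvature: "\<And>d y. d \<in> B \<Longrightarrow> y \<in> chart_image d \<Longrightarrow> rank_one_curvature TYPE('m) (g d) y"
    and c: "c \<in> A" "p \<in> fst c" and d: "d \<in> B" "f p \<in> fst d"
  shows "real_rank c d f p \<le> 2"
proof (cases "CARD('m) \<ge> 2")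
  case True
  obtain w where "\<And>\<alpha>. \<exists>k. (\<chi> i. d_dz \<alpha> (\<lambda>z. complex_of_real (rep c d z $ i)) (snd c p)) = k *s w"
    using gradients_collinear[OF cpt True del_delbar curvature c d] by blast
  then show ?thesis
    unfolding real_rank_def differential_def by (rule rank_le_two_if_gradients_collinear[OF rep_differentiable[OF c d]])
next
  \<comment> \<open>Now m = 1, and the differential starts from a space of real dimension
    two.\<close>
  case False
  have "linear (differential c d f p)"
    unfolding differential_def
    by (rule has_derivative_linear[OF differentiable_has_frechet[OF rep_differentiable[OF c d]]])
  then have "dim (range (differential c d f p)) \<le> dim (UNIV :: (complex^'m) set)" by (rule dim_image_le)
  also have "\<dots> = CARD('m) * 2" by simp
  finally show ?thesis using False unfolding real_rank_def by simp
qed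

lemma (in harmonic_map) immersion_rank:
  assumes "immersion X A Y B f" and c: "c \<in> A" "p \<in> fst c" and d: "d \<in> B" "f p \<in> fst d"
  shows "real_rank c d f p = 2 * CARD('m)"
proof -
  have inj: "inj (differential c d f p)" using assms unfolding immersion_def by blast
  have "linear (differential c d f p)"
    unfolding differential_def
    by (rule has_derivative_linear[OF differentiable_has_frechet[OF rep_differentiable[OF c d]]])
  then have "dim (range (differential c d f p)) = dim (UNIV :: (complex^'m) set)"
    using inj by (intro dim_image_eq) auto
  then show ?thesis by (simp add: real_rank_def)
qed

theorem theorem1p3:
  fixes X :: "'a topology" and A :: "('a, complex^'m) chart set"
    and h :: "('a, 'm::finite) hermitian_components"
    and Y :: "'b topology" and B :: "('b, real^'n) chart set"
    and g :: "('b, 'n::finite) riemannian_components"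
  assumes "hermitian_manifold X A h" and "compact_space X"
    and "del_delbar_omega_condition A h"
    and "riemannian_manifold Y B g"
  shows "(\<forall>f. hermitian_harmonic X A h Y B g f \<and> strongly_hermitian_negative B g \<longrightarrow>
            (\<forall>c\<in>A. \<forall>d\<in>B. \<forall>p\<in>fst c. f p \<in> fst d \<longrightarrow> real_rank c d f p \<le> 2))
       \<and> (CARD('m) > 1 \<and> (\<exists>\<kappa><0. constant_sectional_curvature B g \<kappa>) \<longrightarrow>
            \<not> (\<exists>f. hermitian_harmonic X A h Y B g f \<and> immersion X A Y B f))"
proof (intro conjI allI impI ballI notI)
  fix f c d p
  assume f: "hermitian_harmonic X A h Y B g f \<and> strongly_hermitian_negative B g"
    and p: "c \<in> A" "d \<in> B" "p \<in> fst c" "f p \<in> fst d"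
  interpret harmonic_map X A h Y B g f by unfold_locales (use assms f in auto)
  have "strongly_hermitian_negative B g" using f by blast
  from real_rank_le_two[OF assms(2,3) strongly_negative_rank_one[OF this] p(1,3,2,4)]
  show "real_rank c d f p \<le> 2" .
next
  assume \<kappa>: "CARD('m) > 1 \<and> (\<exists>\<kappa><0. constant_sectional_curvature B g \<kappa>)"
    and "\<exists>f. hermitian_harmonic X A h Y B g f \<and> immersion X A Y B f"
  then obtain f where f: "hermitian_harmonic X A h Y B g f" "immersion X A Y B f" by blast
  obtain \<kappa> where k: "\<kappa> < 0" "constant_sectional_curvature B g \<kappa>" using \<kappa> by blast
  interpret harmonic_map X A h Y B g f by unfold_locales (use assms f in auto)
  have curv: "rank_one_curvature TYPE('m) (g d) y" if d: "d \<in> B" and y: "y \<in> chart_image d" for d y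
    by (rule riemannian_coordinates.constant_curvature_rank_one[OF coordinates[OF d] y k(1)])
      (use k(2) d y in \<open>unfold constant_sectional_curvature_def, blast\<close>)
  \<comment> \<open>The contradiction is drawn at a single point, where the rank would be 2m and at
    most 2; a manifold is nonempty by definition.\<close>
  have "topspace X \<noteq> {}" using domain.atlas unfolding topological_manifold_def by blast
  then obtain p where p: "p \<in> topspace X" by blast
  then obtain c d where cd: "c \<in> A" "p \<in> fst c" "d \<in> B" "f p \<in> fst d" by (rule charts_around)
  have "2 * CARD('m) \<le> 2"
    using real_rank_le_two[OF assms(2,3) curv cd] immersion_rank[OF f(2) cd] by simp
  then show False using \<kappa> by simp
qed

end
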